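(* Over $\mathbb{Q}$ the following $p$-congruences between higher twists hold. (Quartic twists.) For $a\in\mathbb{Q}^*$ let $E_a$ denote the elliptic curve $Y^2=X^3+aX$ (which has $j$-invariant $1728$). Then for every $a\in\mathbb{Q}^*$: \begin{itemize} \item $E_a$ is symplectically $3$-congruent to $E_{-1/(3a)}$, and also anti-symplectically $3$-congruent to both $E_{-4a}$ and $E_{4/(3a)}$, the latter two curves being $2$-isogenous to the former two ($E_{-4a}$ to $E_a$ and $E_{4/(3a)}$ to $E_{-1/(3a)}$); \item $E_a$ is symplectically $5$-congruent to $E_{5/a}$, and also anti-symplectically $5$-congruent to both $E_{-4a}$ and $E_{-20/a}$, the latter two curves being $2$-isogenous to the former two ($E_{-4a}$ to $E_a$ and $E_{-20/a}$ to $E_{5/a}$). \end{itemize} (Sextic twists.) For $b\in\mathbb{Q}^*$ let $E_b$ denote the elliptic curve $Y^2=X^3+b$ (which has $j$-invariant $0$). Then for every $b\in\mathbb{Q}^*$: \begin{itemize} \item $E_b$ is symplectically $5$-congruent to $E_{4/(5b)}$, and also anti-symplectically $5$-congruent to both $E_{-27b}$ and $E_{-108/(5b)}$, the latter two curves being $3$-isogenous to the former two ($E_{-27b}$ to $E_b$ and $E_{-108/(5b)}$ to $E_{4/(5b)}$); \item $E_b$ is symplectically $7$-congruent to $E_{-28/b}$, and also anti-symplectically $7$-congruent to both $E_{-27b}$ and $E_{756/b}$, the latter two curves being $3$-isogenous to the former two ($E_{-27b}$ to $E_b$ and $E_{756/b}$ to $E_{-28/b}$). \end{itemize}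
   Context: For an elliptic curve $E$ over $\mathbb{Q}$ and a prime $p$, $E[p]$ denotes the $p$-torsion subgroup of $E(\overline{\mathbb{Q}})$ as a $G_{\mathbb{Q}}=\mathrm{Gal}(\overline{\mathbb{Q}}/\mathbb{Q})$-module, and $e_{E,p}$ its Weil pairing. For an isomorphism of $G_{\mathbb{Q}}$-modules $\phi:E[p]\to E'[p]$ there is $d(\phi)\in\mathbb{F}_p^*$ with $e_{E',p}(\phi(P),\phi(Q))=e_{E,p}(P,Q)^{d(\phi)}$ for all $P,Q\in E[p]$; $\phi$ is called symplectic if $d(\phi)$ is a square mod $p$ and anti-symplectic otherwise. $E$ and $E'$ are $p$-congruent if $E[p]\cong E'[p]$ as $G_{\mathbb{Q}}$-modules; they are symplectically (resp. anti-symplectically) $p$-congruent if there is a symplectic (resp. anti-symplectic) such isomorphism. *)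

theory Defs
  imports Complex_Main "HOL-Computational_Algebra.Polynomial" "HOL-Number_Theory.Number_Theory"
begin

text \<open>Short Weierstrass curves y^2 = x^3 + A x + B with A, B rational, viewed inside the
complex numbers.  The algebraic closure of Q is the set of complex algebraic numbers.
A point is None (the point at infinity O) or Some (x, y).\<close>

type_synonym wcurve = "rat \<times> rat"
type_synonym pt = "(complex \<times> complex) option"

definition Qbar :: "complex set" where
  "Qbar = {z. algebraic z}"

definition on_curve :: "wcurve \<Rightarrow> pt \<Rightarrow> bool" where
  "on_curve E P = (case P of None \<Rightarrow> True
     | Some (x, y) \<Rightarrow> y ^ 2 = x ^ 3 + of_rat (fst E) * x + of_rat (snd E))"

definition alg_pt :: "pt \<Rightarrow> bool" where
  "alg_pt P = (case P of None \<Rightarrow> True | Some (x, y) \<Rightarrow> x \<in> Qbar \<and> y \<in> Qbar)"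

definition Epts :: "wcurve \<Rightarrow> pt set" where
  "Epts E = {P. alg_pt P \<and> on_curve E P}"

fun eadd :: "wcurve \<Rightarrow> pt \<Rightarrow> pt \<Rightarrow> pt" where
  "eadd E None Q = Q"
| "eadd E (Some P) None = Some P"
| "eadd E (Some (x1, y1)) (Some (x2, y2)) =
     (if x1 = x2 \<and> y1 = - y2 then None
      else (let l = (if x1 = x2 then (3 * x1 ^ 2 + of_rat (fst E)) / (2 * y1)
                     else (y2 - y1) / (x2 - x1));
                x3 = l ^ 2 - x1 - x2
            in Some (x3, l * (x1 - x3) - y1)))"

fun esmul :: "wcurve \<Rightarrow> nat \<Rightarrow> pt \<Rightarrow> pt" where
  "esmul E 0 P = None"
| "esmul E (Suc n) P = eadd E P (esmul E n P)"

definition tors :: "wcurve \<Rightarrow> nat \<Rightarrow> pt set" where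
  "tors E p = {P \<in> Epts E. esmul E p P = None}"

definition GalQ :: "(complex \<Rightarrow> complex) set" where
  "GalQ = {\<sigma>. bij_betw \<sigma> Qbar Qbar \<and> \<sigma> 1 = 1 \<and>
      (\<forall>x\<in>Qbar. \<forall>y\<in>Qbar. \<sigma> (x + y) = \<sigma> x + \<sigma> y \<and> \<sigma> (x * y) = \<sigma> x * \<sigma> y)}"

definition gal_pt :: "(complex \<Rightarrow> complex) \<Rightarrow> pt \<Rightarrow> pt" where
  "gal_pt \<sigma> P = map_option (\<lambda>(x, y). (\<sigma> x, \<sigma> y)) P"

definition galmod_iso :: "wcurve \<Rightarrow> wcurve \<Rightarrow> nat \<Rightarrow> (pt \<Rightarrow> pt) \<Rightarrow> bool" where
  "galmod_iso E E' p \<phi> =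
     (bij_betw \<phi> (tors E p) (tors E' p) \<and>
      (\<forall>P\<in>tors E p. \<forall>Q\<in>tors E p. \<phi> (eadd E P Q) = eadd E' (\<phi> P) (\<phi> Q)) \<and>
      (\<forall>\<sigma>\<in>GalQ. \<forall>P\<in>tors E p. \<phi> (gal_pt \<sigma> P) = gal_pt \<sigma> (\<phi> P)))"

text \<open>Normalised Miller functions: f_1 = 1, f_(n+1) = f_n * l_(nP,P) / v_((n+1)P), where
l_(T,P) is the (normalised) line through T and P (tangent if T = P, vertical if T = -P) and
v_S = x - x_S is the vertical line through S (v_O = 1).  Then div f_n = n(P) - (nP) - (n-1)(O).\<close>
definition eline :: "wcurve \<Rightarrow> pt \<Rightarrow> pt \<Rightarrow> pt \<Rightarrow> complex" where
  "eline E T P R = (case (T, P, R) of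
     (Some (xt, yt), Some (xp, yp), Some (xr, yr)) \<Rightarrow>
       (if xt = xp \<and> yt = - yp then xr - xp
        else (let l = (if xt = xp then (3 * xt ^ 2 + of_rat (fst E)) / (2 * yt)
                       else (yp - yt) / (xp - xt))
              in yr - yt - l * (xr - xt)))
   | _ \<Rightarrow> 1)"

definition evert :: "pt \<Rightarrow> pt \<Rightarrow> complex" where
  "evert S R = (case (S, R) of (Some (xs, _), Some (xr, _)) \<Rightarrow> xr - xs | _ \<Rightarrow> 1)"

fun miller :: "wcurve \<Rightarrow> nat \<Rightarrow> pt \<Rightarrow> pt \<Rightarrow> complex" where
  "miller E 0 P R = 1"
| "miller E (Suc n) P R =
     (if n = 0 then 1
      else miller E n P R * eline E (esmul E n P) P R / evert (esmul E (Suc n) P) R)"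

text \<open>The Weil pairing e_(E,p) on E[p]: it is 1 on linearly dependent pairs (it is
alternating), and for independent P, Q it is given by Miller's formula
e_p(P,Q) = (-1)^p f_(p,P)(Q) / f_(p,Q)(P).\<close>
definition weil :: "wcurve \<Rightarrow> nat \<Rightarrow> pt \<Rightarrow> pt \<Rightarrow> complex" where
  "weil E p P Q =
     (if P = None \<or> Q = None \<or> (\<exists>k. Q = esmul E k P) then 1
      else (-1) ^ p * miller E p P Q / miller E p Q P)"

definition weil_exp :: "wcurve \<Rightarrow> wcurve \<Rightarrow> nat \<Rightarrow> (pt \<Rightarrow> pt) \<Rightarrow> nat \<Rightarrow> bool" where
  "weil_exp E E' p \<phi> d =
     (\<not> p dvd d \<and> (\<forall>P\<in>tors E p. \<forall>Q\<in>tors E p. weil E' p (\<phi> P) (\<phi> Q) = weil E p P Q ^ d))"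

definition sympl_cong :: "nat \<Rightarrow> wcurve \<Rightarrow> wcurve \<Rightarrow> bool" where
  "sympl_cong p E E' = (\<exists>\<phi> d. galmod_iso E E' p \<phi> \<and> weil_exp E E' p \<phi> d \<and>
                              QuadRes (int p) (int d))"

definition antisympl_cong :: "nat \<Rightarrow> wcurve \<Rightarrow> wcurve \<Rightarrow> bool" where
  "antisympl_cong p E E' = (\<exists>\<phi> d. galmod_iso E E' p \<phi> \<and> weil_exp E E' p \<phi> d \<and>
                              \<not> QuadRes (int p) (int d))"

text \<open>An isogeny E \<rightarrow> E' of degree n defined over Q: a group homomorphism
E(Qbar) \<rightarrow> E'(Qbar) with kernel of size n, given on points outside the kernel by
rational functions over Q in (x, y) (every element of Q(E) has the form (a(x) + y c(x)) / b(x)).\<close>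
definition isogenous :: "nat \<Rightarrow> wcurve \<Rightarrow> wcurve \<Rightarrow> bool" where
  "isogenous n E E' = (\<exists>\<psi>.
     (\<forall>P\<in>Epts E. \<psi> P \<in> Epts E') \<and>
     (\<forall>P\<in>Epts E. \<forall>Q\<in>Epts E. \<psi> (eadd E P Q) = eadd E' (\<psi> P) (\<psi> Q)) \<and>
     card {P\<in>Epts E. \<psi> P = None} = n \<and>
     (\<exists>a1 b1 c1 a2 b2 c2 :: rat poly. \<forall>x y. Some (x, y) \<in> Epts E \<and> \<psi> (Some (x, y)) \<noteq> None \<longrightarrow>
        (let ev = (\<lambda>f. poly (map_poly of_rat f) x) in
          ev b1 \<noteq> 0 \<and> ev b2 \<noteq> 0 \<and>
          \<psi> (Some (x, y)) = Some ((ev a1 + y * ev c1) / ev b1, (ev a2 + y * ev c2) / ev b2))))"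

definition quartic :: "rat \<Rightarrow> wcurve" where "quartic a = (a, 0)"
definition sextic :: "rat \<Rightarrow> wcurve" where "sextic b = (0, b)"

end

theory Submission
  imports Defs
begin

text \<open>A curve of the statement is a twist of y^2 = x^3 + x or y^2 = x^3 + 1 by a fourth or sixth
  root u, so its Galois module is that of the untwisted curve changed by the cocycle
  \<open>\<sigma> u / u\<close> with values in the automorphism group. An endomorphism of norm n (namely 1 + i or the
  square root of -3) multiplies the Weil pairing by n and yields the isogenies and the
  antisymplectic congruences, since n is a nonresidue modulo p. The symplectic ones come from a map M
  on p-torsion that is semilinear over the endomorphism ring: M inverts automorphisms, hence
  turns the cocycle of u into that of 1 / u. It is given by explicit coordinates
  depending on a scalar r, and \<open>M\<^sup>2 = \<plusminus>1\<close> makes it raise the pairing to the power \<open>\<mp>1\<close>.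
  Bilinearity of the pairing, defined by Miller functions, follows from the cocycle
  relation of the functions \<open>line / vertical\<close> and Weil reciprocity.\<close>

section \<open>Lines on a Weierstrass cubic\<close>

text \<open>The pairing is Miller's quotient on independent pairs and 1 by definition on dependent
  ones, so reciprocity gives additivity in Q only while Q, Q' and Q + Q' avoid the multiples of P.
  The possible defect is a cube root of unity; its order excludes it when p is not 3, and computing
  with tangents at flexes does so when p = 3. The shape of M depends on p. If p splits (5 for i, 7
  for cube roots of unity), M interchanges two eigenspaces, each cyclic of order p. If p is inert (3
  and 5 respectively), the p-torsion is a line over the field with p^2 elements, and additivity is
  deduced from compatibility with generators of its unit group. The scalar is r = 1 / (u u') for the
  roots u, u' defining the two twists. M preserves the torsion of the untwisted curve when r^4 is -3
  or 1/5, respectively r^6 is 5/4 or -1/28; this dictates the partners -1/(3a), 5/a, 4/(5b) and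
  -28/b. In coordinates M is a scalar of norm N after conjugation, with determinant -N and square N:
  hence the sign in the exponent.\<close>

lemmas ring_normal = algebra_simps power2_eq_square power3_eq_cube

text \<open>With \<open>x4\<close> chosen to cancel the quadratic term, the curve cubic minus
  \<open>(s*x+c)^2\<close> minus the product of the three linear factors is linear in x. It vanishes
  at both abscissas, or for a tangent has slope zero by the choice of \<open>s\<close>, so it is
  zero; the last two equations are its coefficients.\<close>

lemma line_vieta:
  fixes a b x1 y1 x2 y2 :: complex
  assumes P1: "y1^2 = x1^3 + a*x1 + b" and P2: "y2^2 = x2^3 + a*x2 + b"
    and ne: "\<not> (x1 = x2 \<and> y1 = - y2)"
    and s: "s = (if x1 = x2 then (3*x1^2 + a) / (2*y1) else (y2 - y1) / (x2 - x1))"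
    and c: "c = y1 - s*x1" and x4: "x4 = s^2 - x1 - x2"
  shows "y1 = s*x1 + c" "y2 = s*x2 + c"
    "a = x1*x2 + x1*x4 + x2*x4 + 2*s*c" "b = c^2 - x1*x2*x4"
proof -
  show y1: "y1 = s*x1 + c" using c by simp
  define \<alpha> where "\<alpha> = a - 2*s*c - (x1*x2 + x1*x4 + x2*x4)"
  define \<beta> where "\<beta> = b - c^2 + x1*x2*x4"
  have lin: "\<alpha>*x + \<beta> = (x^3 + a*x + b) - (s*x+c)^2 - (x-x1)*(x-x2)*(x-x4)" for x
    unfolding \<alpha>_def \<beta>_def x4 by (simp add: ring_normal)
  have z1: "\<alpha>*x1 + \<beta> = 0" using lin[of x1] P1 y1 by simp
  have "y2 = s*x2 + c \<and> \<alpha> = 0 \<and> \<beta> = 0"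
  proof (cases "x1 = x2")
    case True
    then have "y1^2 = y2^2" using P1 P2 by simp
    then have yy: "y1 = y2" "y1 \<noteq> 0" using ne True by (auto simp: power2_eq_iff)
    then have t: "a = 2*s*y1 - 3*x1^2" using s True by (simp add: field_simps)
    have "\<alpha> = 0" unfolding \<alpha>_def x4 c t True[symmetric] by (simp add: ring_normal)
    then show ?thesis using z1 yy y1 True by auto
  next
    case False
    then have "s*(x2-x1) = y2 - y1" using s by simp
    then have y2: "y2 = s*x2 + c" unfolding c by (simp add: algebra_simps)
    have "\<alpha>*x2 + \<beta> = 0" using lin[of x2] P2 y2 by simp
    then have "\<alpha>*x2 = \<alpha>*x1" using z1 by (metis add_right_cancel)
    then show ?thesis using False z1 y2 by auto
  qed
  then show "y2 = s*x2 + c" "a = x1*x2 + x1*x4 + x2*x4 + 2*s*c" "b = c^2 - x1*x2*x4"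
    unfolding \<alpha>_def \<beta>_def by (auto simp: algebra_simps)
qed

text \<open>The product of the lines \<open>y = s x + c\<close> and \<open>y = m x + d\<close>, the first through
  \<open>-(A + B)\<close> and the second through \<open>A + B = (x4, y4)\<close>, is divisible by \<open>x - x4\<close> on the curve.\<close>

lemma two_lines_factor:
  fixes a b s c m d x4 y4 :: complex
  assumes c: "c = - y4 - s*x4" and d: "d = y4 - m*x4" and "y4^2 = x4^3 + a*x4 + b"
    and y: "y^2 = x^3 + a*x + b"
  shows "(y - s*x - c)*(y - m*x - d) =
    (x - x4)*(x^2 + (s*m + x4)*x + (a + s*d + m*c + x4*(s*m + x4)) - (s+m)*y)"
proof -
  have b: "b = y4^2 - x4^3 - a*x4" using assms(3) by simp
  have "(y - s*x - c)*(y - m*x - d) =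
    (x - x4)*(x^2 + (s*m + x4)*x + (a + s*d + m*c + x4*(s*m + x4)) - (s+m)*y)
      + (y^2 - (x^3 + a*x + b))"
    unfolding c d b by (simp add: ring_normal)
  then show ?thesis using y by simp
qed

text \<open>The second factor of the product above vanishes where the first line meets the curve
  away from abscissa \<open>x4\<close>. As a polynomial identity this also holds when
  \<open>x1 = x4\<close>, where dividing by \<open>x - x4\<close> would say nothing.\<close>

lemma two_lines_zero:
  fixes a s c m d x1 x2 x4 :: complex
  assumes c: "c = - y4 - s*x4" and d: "d = y4 - m*x4" and s: "x2 = s^2 - x1 - x4"
    and a: "a = x1*x2 + x1*x4 + x2*x4 + 2*s*c"
  shows "x1^2 + (s*m + x4)*x1 + (a + s*d + m*c + x4*(s*m + x4)) - (s+m)*(s*x1 + c) = 0"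
  unfolding a s c d by (simp add: ring_normal)

text \<open>Both triples \<open>(p, q, k)\<close> below describe a function \<open>x\<^sup>2 + p x + q - k y\<close> vanishing at three
  given points, so their difference is the equation of a line through them.\<close>

lemma conic_unique:
  fixes xA xB xC :: complex
  assumes "xA \<noteq> xB" "xA \<noteq> xC" "xB \<noteq> xC"
    and A: "xA^2 + p*xA + q - k*yA = 0" "xA^2 + p'*xA + q' - k'*yA = 0"
    and B: "xB^2 + p*xB + q - k*yB = 0" "xB^2 + p'*xB + q' - k'*yB = 0"
    and C: "xC^2 + p*xC + q - k*yC = 0" "xC^2 + p'*xC + q' - k'*yC = 0"
    and l: "yA = s*xA + c" "yB = s*xB + c" "yC \<noteq> s*xC + c"
  shows "p = p' \<and> q = q' \<and> k = k' \<and> k \<noteq> 0"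
proof -
  define u v w where "u = p - p'" "v = q - q'" "w = k - k'"
  have A': "u*xA + v = w*yA" using A unfolding u_v_w_def by Groebner_Basis.algebra
  have B': "u*xB + v = w*yB" using B unfolding u_v_w_def by Groebner_Basis.algebra
  have C': "u*xC + v = w*yC" using C unfolding u_v_w_def by Groebner_Basis.algebra
  \<comment> \<open>A and B satisfy both equations, so the difference \<open>u*x + v = w*y\<close>
    is \<open>w\<close> times the line through them, and C off that line forces
    \<open>w = 0\<close>.\<close>
  have "(u - w*s)*(xA - xB) = 0" using A' B' l by Groebner_Basis.algebra
  then have u: "u = w*s" using assms(1) by simp
  then have v: "v = w*c" using A' l by (simp add: algebra_simps)
  have "w*(yC - (s*xC + c)) = 0" using C' u v by Groebner_Basis.algebra
  then have "w = 0" using l by simp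
  \<comment> \<open>Otherwise one monic quadratic in x would have the three distinct roots
    \<open>xA\<close>, \<open>xB\<close>, \<open>xC\<close>.\<close>
  moreover have "k \<noteq> 0"
  proof
    assume "k = 0"
    then have "(xA - xB)*(xA + xB + p) = 0" "(xA - xC)*(xA + xC + p) = 0"
      using A B C by Groebner_Basis.algebra+
    then show False using assms(1-3) by (metis add_left_cancel add.commute eq_iff_diff_eq_0 mult_eq_0_iff)
  qed
  ultimately show ?thesis using u v by (auto simp: u_v_w_def)
qed

section \<open>The group of complex points\<close>

text \<open>A curve is carried by a phantom type, so that its points form a type of their own, to
  which the class of abelian groups can apply. Only two curves become instances; all others are
  reached as their twists.\<close>

class curve =
  fixes crv :: "'a itself \<Rightarrow> wcurve"
  assumes nonsingular: "4 * fst (crv TYPE('a)) ^ 3 + 27 * snd (crv TYPE('a)) ^ 2 \<noteq> 0"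

definition ca :: "'c::curve itself \<Rightarrow> complex" where "ca T = of_rat (fst (crv T))"
definition cb :: "'c::curve itself \<Rightarrow> complex" where "cb T = of_rat (snd (crv T))"

lemma nonsingular_complex:
  assumes "x^3 + ca TYPE('c::curve) * x + cb TYPE('c) = 0"
  shows "3*x^2 + ca TYPE('c) \<noteq> 0"
proof
  assume "3*x^2 + ca TYPE('c) = 0"
  then have a: "ca TYPE('c) = -3*x^2" by Groebner_Basis.algebra
  have b: "cb TYPE('c) = 2*x^3" using assms unfolding a by Groebner_Basis.algebra
  have "4*(ca TYPE('c))^3 + 27*(cb TYPE('c))^2 = 0" unfolding a b by (simp add: ring_normal)
  then have "of_rat (4 * fst (crv TYPE('c)) ^ 3 + 27 * snd (crv TYPE('c)) ^ 2) = (0::complex)"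
    unfolding ca_def cb_def by (simp add: of_rat_add of_rat_mult of_rat_power)
  then show False using nonsingular[where 'a='c] by simp
qed

text \<open>All complex points are taken, not just the algebraic ones, so that the limits used for
  the pairing stay on the curve. Algebraicity is the separate predicate \<open>alg\<close>.\<close>

typedef (overloaded) ('c::curve) ept = "{P. on_curve (crv TYPE('c)) P}"
  morphisms raw Ept
  by (rule exI[of _ None]) (simp add: on_curve_def)

definition mk :: "complex \<Rightarrow> complex \<Rightarrow> 'c::curve ept" where "mk x y = Ept (Some (x, y))"
definition px :: "'c::curve ept \<Rightarrow> complex" where "px X = fst (the (raw X))"
definition py :: "'c::curve ept \<Rightarrow> complex" where "py X = snd (the (raw X))"

instantiation ept :: (curve) "{zero,plus,uminus,minus}"
begin
definition "0 = Ept None"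
definition "X + Y = Ept (eadd (crv TYPE('a)) (raw X) (raw Y))"
definition "- X = Ept (map_option (\<lambda>(x, y). (x, - y)) (raw X))"
definition "X - (Y :: 'a ept) = X + - Y"
instance ..
end

lemma raw_0 [simp]: "raw (0 :: 'c::curve ept) = None"
  unfolding zero_ept_def by (subst Ept_inverse) (simp_all add: on_curve_def)

lemma raw_eq_None_iff [simp]: "raw X = None \<longleftrightarrow> X = 0"
  using raw_0 raw_inject by metis

lemma raw_nonzero: "X \<noteq> 0 \<Longrightarrow> raw X = Some (px X, py X)"
  unfolding px_def py_def using raw_eq_None_iff[of X] by (cases "raw X") auto

lemma on_curve_Some [simp]:
  "on_curve (crv TYPE('c::curve)) (Some (x, y)) \<longleftrightarrow> y^2 = x^3 + ca TYPE('c)*x + cb TYPE('c)"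
  by (simp add: on_curve_def ca_def cb_def)

lemma curve_eq:
  assumes "X \<noteq> (0::'c::curve ept)"
  shows "(py X)^2 = (px X)^3 + ca TYPE('c) * px X + cb TYPE('c)"
  using raw[of X] raw_nonzero[OF assms] by simp

lemma raw_mk:
  "y^2 = x^3 + ca TYPE('c)*x + cb TYPE('c) \<Longrightarrow> raw (mk x y :: 'c::curve ept) = Some (x, y)"
  unfolding mk_def by (subst Ept_inverse) simp_all

lemma mk_simps:
  assumes "y^2 = x^3 + ca TYPE('c)*x + cb TYPE('c)"
  shows "(mk x y :: 'c::curve ept) \<noteq> 0" "px (mk x y :: 'c ept) = x" "py (mk x y :: 'c ept) = y"
  using raw_mk[OF assms] by (auto simp: px_def py_def simp flip: raw_eq_None_iff)

lemma mk_px_py: "X \<noteq> 0 \<Longrightarrow> mk (px X) (py X) = X"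
  unfolding mk_def using raw_nonzero by (metis raw_inverse)

lemma ept_eqI: "X \<noteq> 0 \<Longrightarrow> Y \<noteq> 0 \<Longrightarrow> px X = px Y \<Longrightarrow> py X = py Y \<Longrightarrow> X = Y"
  by (metis mk_px_py)

lemma raw_uminus: "raw (- X) = map_option (\<lambda>(x, y). (x, - y)) (raw X)"
  unfolding uminus_ept_def
  by (subst Ept_inverse) (use raw[of X] in \<open>auto simp: on_curve_def split: option.splits\<close>)

lemma uminus_zero_iff [simp]: "- X = 0 \<longleftrightarrow> X = (0::'c::curve ept)"
  unfolding raw_eq_None_iff[symmetric] by (simp add: raw_uminus)

lemma ept_uminus_0: "- (0::'c::curve ept) = 0"
  by simp

lemma raw_uminus_nonzero: "X \<noteq> 0 \<Longrightarrow> raw (- X) = Some (px X, - py X)"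
  by (subst raw_uminus, subst raw_nonzero) auto

lemma px_uminus [simp]: "px (- X) = px X"
proof (cases "X = 0")
  case False
  then show ?thesis by (subst px_def, subst raw_uminus_nonzero) auto
qed (metis ept_uminus_0)

lemma py_uminus: "X \<noteq> 0 \<Longrightarrow> py (- X) = - py X"
  by (subst py_def, subst raw_uminus_nonzero) auto

lemma ept_minus_minus: "- (- X) = (X::'c::curve ept)"
  by (cases "X = 0") (auto intro: ept_eqI simp: py_uminus)

lemma px_eq_iff:
  assumes "X \<noteq> 0" "Y \<noteq> (0::'c::curve ept)"
  shows "px X = px Y \<longleftrightarrow> X = Y \<or> X = - Y"
proof
  assume e: "px X = px Y"
  then have "(py X)^2 = (py Y)^2" using curve_eq assms by metis
  then consider "py X = py Y" | "py X = - py Y" by (auto simp: power2_eq_iff)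
  then show "X = Y \<or> X = - Y"
  proof cases
    case 1 then show ?thesis using ept_eqI assms e by blast
  next
    case 2 then have "X = - Y" using assms e by (intro ept_eqI) (simp_all add: py_uminus)
    then show ?thesis ..
  qed
qed auto

section \<open>Chord and tangent addition: closure, commutativity, cancellation\<close>

definition slp :: "'c::curve ept \<Rightarrow> 'c ept \<Rightarrow> complex" where
  "slp X Y = (if px X = px Y then (3 * px X ^ 2 + ca TYPE('c)) / (2 * py X)
              else (py Y - py X) / (px Y - px X))"

lemma eadd_closed:
  fixes X Y :: "'c::curve ept"
  shows "on_curve (crv TYPE('c)) (eadd (crv TYPE('c)) (raw X) (raw Y))"
proof (cases "X = 0 \<or> Y = 0 \<or> px X = px Y \<and> py X = - py Y")
  case True
  then show ?thesis using raw[of X] raw[of Y] raw_nonzero[of X] raw_nonzero[of Y]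
    by (cases "X = 0"; cases "Y = 0") (auto simp: on_curve_def)
next
  case False
  then have ne: "X \<noteq> 0" "Y \<noteq> 0" "\<not> (px X = px Y \<and> py X = - py Y)" by auto
  define s c x4 where "s = slp X Y" "c = py X - s * px X" "x4 = s^2 - px X - px Y"
  note v = line_vieta[OF curve_eq[OF ne(1)] curve_eq[OF ne(2)] ne(3) s_c_x4_def(1)[unfolded slp_def]
      s_c_x4_def(2,3)]
  have e: "eadd (crv TYPE('c)) (raw X) (raw Y) = Some (x4, s * (px X - x4) - py X)"
    unfolding raw_nonzero[OF ne(1)] raw_nonzero[OF ne(2)] using ne(3)
    by (simp add: s_c_x4_def slp_def ca_def Let_def)
  have "s * (px X - x4) - py X = - (s * x4 + c)" using v(1) by (simp add: algebra_simps)
  then have "(s * (px X - x4) - py X)^2 = (s * x4 + c)^2" by (simp only: power2_minus)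
  also have "\<dots> = s^2 * x4^2 + 2*s*c*x4 + c^2" by (simp add: ring_normal)
  also have "\<dots> = x4^3 + ca TYPE('c) * x4 + cb TYPE('c)"
    unfolding v(3,4) using s_c_x4_def(3) by Groebner_Basis.algebra
  finally show ?thesis unfolding e by simp
qed

lemma raw_add: "raw (X + Y) = eadd (crv TYPE('c)) (raw X) (raw (Y :: 'c::curve ept))"
  unfolding plus_ept_def by (subst Ept_inverse) (auto simp: eadd_closed)

lemma ept_add_0: "0 + X = X" "X + 0 = (X::'c::curve ept)"
  by (simp_all add: raw_add flip: raw_inject) (cases "raw X"; simp)+

lemma ept_add_eq_0_iff:
  fixes X Y :: "'c::curve ept"
  shows "X + Y = 0 \<longleftrightarrow> Y = - X"
proof (cases "X = 0 \<or> Y = 0")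
  case True
  then show ?thesis by (auto simp: ept_add_0)
next
  case False
  then have r: "raw X = Some (px X, py X)" "raw Y = Some (px Y, py Y)"
    using raw_nonzero by blast+
  have "X + Y = 0 \<longleftrightarrow> raw (X + Y) = None" by simp
  also have "\<dots> \<longleftrightarrow> px X = px Y \<and> py X = - py Y"
    unfolding raw_add r by (simp add: Let_def)
  also have "\<dots> \<longleftrightarrow> Y = - X"
    using False ept_eqI[of Y "- X"] by (auto simp: py_uminus)
  finally show ?thesis .
qed

text \<open>The line through X and Y meets the curve a third time in \<open>- (X + Y)\<close>. The
  last two equations, Vieta's relations for the three abscissas, make it possible to eliminate the
  curve coefficients from later identities in favour of a line.\<close>

lemma line:
  fixes X Y :: "'c::curve ept"
  assumes "X \<noteq> 0" "Y \<noteq> 0" "X + Y \<noteq> 0" and s: "s = slp X Y" and c: "c = py X - s * px X"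
  shows "py X = s * px X + c" "py Y = s * px Y + c" "px (X + Y) = s^2 - px X - px Y"
    "py (X + Y) = - (s * px (X + Y) + c)"
    "ca TYPE('c) = px X * px Y + px X * px (X+Y) + px Y * px (X+Y) + 2 * s * c"
    "cb TYPE('c) = c^2 - px X * px Y * px (X+Y)"
proof -
  have ne: "\<not> (px X = px Y \<and> py X = - py Y)"
    using assms(1-3) ept_eqI[of Y "- X"] by (auto simp: py_uminus ept_add_eq_0_iff)
  have e: "raw (X + Y) = Some (s^2 - px X - px Y, s * (px X - (s^2 - px X - px Y)) - py X)"
    unfolding raw_add raw_nonzero[OF assms(1)] raw_nonzero[OF assms(2)] using ne
    by (simp add: s slp_def ca_def Let_def)
  show x: "px (X + Y) = s^2 - px X - px Y" unfolding px_def[of "X+Y"] e by simp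
  note v = line_vieta[OF curve_eq[OF assms(1)] curve_eq[OF assms(2)] ne s[unfolded slp_def] c x]
  show "py X = s * px X + c" "py Y = s * px Y + c"
    "ca TYPE('c) = px X * px Y + px X * px (X+Y) + px Y * px (X+Y) + 2 * s * c"
    "cb TYPE('c) = c^2 - px X * px Y * px (X+Y)" by (fact v)+
  show "py (X + Y) = - (s * px (X + Y) + c)"
    unfolding py_def[of "X+Y"] e by (simp add: x c algebra_simps)
qed

lemma slp_commute:
  assumes "X \<noteq> 0" "Y \<noteq> 0" "X + Y \<noteq> (0::'c::curve ept)"
  shows "slp X Y = slp Y X"
proof (cases "px X = px Y")
  case True
  then have "X = Y" using assms by (metis px_eq_iff ept_add_eq_0_iff ept_minus_minus)
  then show ?thesis by simp
next
  case False
  then show ?thesis using minus_divide_divide[of "py Y - py X" "px Y - px X"] by (simp add: slp_def)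
qed

lemma ept_add_commute: "X + Y = Y + (X::'c::curve ept)"
proof (cases "X = 0 \<or> Y = 0 \<or> X + Y = 0")
  case True
  then show ?thesis by (auto simp: ept_add_0 ept_add_eq_0_iff ept_minus_minus) 
      (metis ept_add_eq_0_iff ept_minus_minus)
next
  case False
  then have n: "X \<noteq> 0" "Y \<noteq> 0" "X + Y \<noteq> 0" "Y + X \<noteq> 0"
    using ept_add_eq_0_iff ept_minus_minus by metis+
  define s where "s = slp X Y"
  have s': "s = slp Y X" using slp_commute n s_def by metis
  note l = line[OF n(1-3) s_def refl] and l' = line[OF n(2,1,4) s' refl]
  have "px (X + Y) = px (Y + X)" using l(3) l'(3) by simp
  moreover have "py (X + Y) = py (Y + X)" using l(2,4) l'(4) calculation by simp
  ultimately show ?thesis using n by (intro ept_eqI)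
qed

text \<open>The line through \<open>X + Y\<close> and \<open>- Y\<close> is the mirror image of the
  line through X and Y, so its third point leads back to X. This cancellation law precedes
  associativity, whose proof uses it.\<close>

lemma ept_add_cancel: "X + Y + - Y = (X::'c::curve ept)"
proof (cases "X = 0 \<or> Y = 0 \<or> X + Y = 0")
  case True
  then show ?thesis
    using ept_add_eq_0_iff[of Y "- Y"] ept_add_eq_0_iff[of X Y]
    by (auto simp: ept_add_0 ept_minus_minus ept_uminus_0)
next
  case False
  then have n: "X \<noteq> 0" "Y \<noteq> 0" "X + Y \<noteq> 0" by auto
  define s c Z where "s = slp X Y" "c = py X - s * px X" "Z = X + Y"
  note l = line[OF n s_c_Z_def(1,2), folded s_c_Z_def(3)]
  have nZ: "Z \<noteq> 0" "- Y \<noteq> 0" using n s_c_Z_def by auto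
  have x1: "px X = s^2 - px Y - px Z" using l(3) by simp
  have F': "3 * px Y ^2 + ca TYPE('c) = 2 * s * py Y" if "px Z = px Y"
    unfolding l(2,5) x1 that by (simp add: ring_normal)
  \<comment> \<open>If Z = Y, this point lies on the line and on its mirror image, hence has
    ordinate 0; together with \<open>F'\<close> it would be a singular point.\<close>
  have "Z \<noteq> Y"
  proof
    assume ZY: "Z = Y"
    then have "py Y = - py Y" using l(2,4) by argo
    then have "py Y = 0" by simp
    then show False using F' ZY nonsingular_complex[of "px Y", where 'c='c] curve_eq[OF n(2)] by simp
  qed
  then have nW: "Z + - Y \<noteq> 0" by (metis ept_add_eq_0_iff ept_minus_minus)
  have "slp Z (- Y) = - s"
  proof (cases "px Z = px Y")
    case True
    then have "Z = - Y" using \<open>Z \<noteq> Y\<close> px_eq_iff nZ n by metis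
    moreover then have "py Y \<noteq> 0" using \<open>Z \<noteq> Y\<close> n py_uminus[of Y]
      by (metis ept_eqI minus_equation_iff nZ(1) px_uminus add.inverse_neutral)
    ultimately show ?thesis using F'[OF True] n by (simp add: slp_def py_uminus field_simps)
  next
    case False
    have "py (- Y) - py Z = - s * (px (- Y) - px Z)"
      using l(2,4) n by (simp add: py_uminus algebra_simps)
    then show ?thesis using False by (simp add: slp_def)
  qed
  note l' = line[OF nZ nW this[symmetric] refl]
  have "px (Z + - Y) = px X" unfolding l'(3) x1 by simp
  moreover have "py (Z + - Y) = py X" using l'(4) l(1,4) calculation by (simp add: algebra_simps)
  ultimately show ?thesis unfolding s_c_Z_def(3)[symmetric] using nW n by (intro ept_eqI)
qed

text \<open>A function of two coordinates and not of a point, so that it can also be evaluated at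
  the mirror image \<open>(x, - y)\<close>.\<close>

definition chord :: "'c::curve ept \<Rightarrow> 'c ept \<Rightarrow> complex \<Rightarrow> complex \<Rightarrow> complex" where
  "chord A B x y = y - py A - slp A B * (x - px A)"

lemma chord_commute:
  assumes "A \<noteq> 0" "B \<noteq> 0" "A + B \<noteq> (0::'c::curve ept)"
  shows "chord A B x y = chord B A x y"
  using line(1,2)[OF assms refl refl] slp_commute[OF assms] by (simp add: chord_def algebra_simps)

text \<open>The two lines used to form \<open>A + B + C\<close>, divided by the vertical line at
  \<open>A + B\<close>, give a function with zeros A, B, C and \<open>- (A + B + C)\<close> and a
  fourfold pole at infinity, hence of the shape \<open>x^2 + p*x + q - k*y\<close>. Its norm down to
  x has root sum \<open>k^2 - 2*p\<close>, which is the abscissa formula.\<close>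

lemma conic_through_sum:
  fixes A B C :: "'c::curve ept"
  assumes n: "A \<noteq> 0" "B \<noteq> 0" "C \<noteq> 0" "A + B \<noteq> 0" "A + B + C \<noteq> 0"
  obtains p q k where
    "px A^2 + p * px A + q - k * py A = 0" "px B^2 + p * px B + q - k * py B = 0"
    "px C^2 + p * px C + q - k * py C = 0"
    "px (A+B+C) = k^2 - 2*p - px A - px B - px C"
    "px (A+B+C)^2 + p * px (A+B+C) + q + k * py (A+B+C) = 0"
    "\<And>x y. y^2 = x^3 + ca TYPE('c) * x + cb TYPE('c) \<Longrightarrow>
       chord A B x y * chord (A+B) C x y = (x - px (A+B)) * (x^2 + p*x + q - k*y)"
proof -
  define s c where "s = slp A B" "c = py A - s * px A"
  define m d where "m = slp (A+B) C" "d = py (A+B) - m * px (A+B)"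
  note l = line[OF n(1,2,4) s_c_def] and l' = line[OF n(4,3,5) m_d_def]
  define x4 y4 where "x4 = px (A+B)" "y4 = py (A+B)"
  note l = l[folded x4_y4_def] and l' = l'[folded x4_y4_def]
  have c: "c = - y4 - s * x4" and d: "d = y4 - m * x4" using l(4) by (simp_all add: m_d_def x4_y4_def)
  define p q k where "p = s*m + x4" "q = ca TYPE('c) + s*d + m*c + x4*(s*m + x4)" "k = s + m"
  define q' where "q' = ca TYPE('c) + m*c + s*d + x4*(m*s + x4)"
  have q': "q' = q" unfolding q'_def p_q_k_def by (simp add: algebra_simps)
  have A: "px A^2 + p * px A + q - k * py A = 0"
    unfolding p_q_k_def l(1) by (rule two_lines_zero[OF c d _ l(5)]) (simp add: l(3))
  have B: "px B^2 + p * px B + q - k * py B = 0"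
    unfolding p_q_k_def l(2)
  proof (rule two_lines_zero[OF c d])
    show "px A = s^2 - px B - x4" using l(3) by simp
    show "ca TYPE('c) = px B * px A + px B * x4 + px A * x4 + 2*s*c"
      unfolding l(5) by (simp add: mult.commute add_ac)
  qed
  \<comment> \<open>For the points on the second line the two lines exchange roles;
    \<open>A + B\<close> is then replaced by its negative, which changes the sign of
    \<open>y4\<close>.\<close>
  have pk: "p = m*s + x4" "k = m + s" "c = - y4 - s*x4" "d = - (- y4) - m*x4"
    using c d by (simp_all add: p_q_k_def algebra_simps)
  have C: "px C^2 + p * px C + q - k * py C = 0"
    unfolding q'[symmetric] pk(1,2) q'_def l'(2)
  proof (rule two_lines_zero[OF pk(4,3)])
    show "px (A+B+C) = m^2 - px C - x4" using l'(3) by simp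
    show "ca TYPE('c) = px C * px (A+B+C) + px C * x4 + px (A+B+C) * x4 + 2*m*d"
      unfolding l'(5) by (simp add: mult.commute add_ac)
  qed
  have D: "px (A+B+C)^2 + p * px (A+B+C) + q + k * py (A+B+C) = 0"
  proof -
    have "px (A+B+C)^2 + p * px (A+B+C) + q - k * (m * px (A+B+C) + d) = 0"
      unfolding q'[symmetric] pk(1,2) q'_def
    proof (rule two_lines_zero[OF pk(4,3)])
      show "px C = m^2 - px (A+B+C) - x4" using l'(3) by simp
      show "ca TYPE('c) = px (A+B+C) * px C + px (A+B+C) * x4 + px C * x4 + 2*m*d"
        unfolding l'(5) by (simp add: mult.commute add_ac)
    qed
    then show ?thesis unfolding l'(4) by Groebner_Basis.algebra
  qed
  have S: "px (A+B+C) = k^2 - 2*p - px A - px B - px C"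
    using l(3) l'(3) unfolding p_q_k_def by Groebner_Basis.algebra
  have y4: "y4^2 = x4^3 + ca TYPE('c) * x4 + cb TYPE('c)" using curve_eq[OF n(4)] x4_y4_def by simp
  have P: "chord A B x y * chord (A+B) C x y = (x - px (A+B)) * (x^2 + p*x + q - k*y)"
    if "y^2 = x^3 + ca TYPE('c) * x + cb TYPE('c)" for x y
  proof -
    have "chord A B x y = y - s*x - c" "chord (A+B) C x y = y - m*x - d"
      by (simp_all add: chord_def s_c_def m_d_def algebra_simps)
    then show ?thesis using two_lines_factor[OF c d y4 that] by (simp add: p_q_k_def x4_y4_def)
  qed
  show thesis using that[OF A B C S D P] .
qed

text \<open>Both bracketings produce a function \<open>x^2 + p*x + q - k*y\<close> through A, B, C.
  There is only one such function, so the fourth zeros agree, which is associativity, and so do the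
  two products of lines, which is the cocycle relation of the Miller factors.\<close>

lemma generic_assoc:
  fixes A B C :: "'c::curve ept"
  assumes n: "A \<noteq> 0" "B \<noteq> 0" "C \<noteq> 0" and d: "px A \<noteq> px B" "px A \<noteq> px C" "px B \<noteq> px C"
    and z: "A + B + C \<noteq> 0" "A + (B + C) \<noteq> 0"
  shows "A + B + C = A + (B + C)"
    "y^2 = x^3 + ca TYPE('c) * x + cb TYPE('c) \<Longrightarrow>
      chord A B x y * chord (A+B) C x y * (x - px (B+C)) = chord B C x y * chord A (B+C) x y * (x - px (A+B))"
proof -
  have AB: "A + B \<noteq> 0" and BC: "B + C \<noteq> 0" using d by (auto simp: ept_add_eq_0_iff)
  have z': "B + C + A \<noteq> 0" using z(2) ept_add_commute by metis
  obtain p q k where h: "px A^2 + p * px A + q - k * py A = 0" "px B^2 + p * px B + q - k * py B = 0"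
    "px C^2 + p * px C + q - k * py C = 0"
    "px (A+B+C) = k^2 - 2*p - px A - px B - px C"
    "px (A+B+C)^2 + p * px (A+B+C) + q + k * py (A+B+C) = 0"
    "\<And>x y. y^2 = x^3 + ca TYPE('c) * x + cb TYPE('c) \<Longrightarrow>
       chord A B x y * chord (A+B) C x y = (x - px (A+B)) * (x^2 + p*x + q - k*y)"
    using conic_through_sum[OF n AB z(1)] by metis
  obtain p' q' k' where h': "px B^2 + p' * px B + q' - k' * py B = 0" "px C^2 + p' * px C + q' - k' * py C = 0"
    "px A^2 + p' * px A + q' - k' * py A = 0"
    "px (B+C+A) = k'^2 - 2*p' - px B - px C - px A"
    "px (B+C+A)^2 + p' * px (B+C+A) + q' + k' * py (B+C+A) = 0"
    "\<And>x y. y^2 = x^3 + ca TYPE('c) * x + cb TYPE('c) \<Longrightarrow>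
       chord B C x y * chord (B+C) A x y = (x - px (B+C)) * (x^2 + p'*x + q' - k'*y)"
    using conic_through_sum[OF n(2,3,1) BC z'] by metis
  define s c where "s = slp A B" "c = py A - s * px A"
  note l = line[OF n(1,2) AB s_c_def]
  \<comment> \<open>On the line of A and B the only further point of the curve is
    \<open>- (A + B)\<close>, and C differs from it because \<open>A + B + C\<close> is not
    0.\<close>
  have "py C \<noteq> s * px C + c"
  proof
    assume yC: "py C = s * px C + c"
    have "(px C - px A) * (px C - px B) * (px C - px (A+B)) =
        (px C^3 + ca TYPE('c) * px C + cb TYPE('c)) - (s * px C + c)^2"
      unfolding l(5,6) l(3) by (simp add: ring_normal)
    then have "(px C - px A) * (px C - px B) * (px C - px (A+B)) = 0"
      using curve_eq[OF n(3)] yC by simp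
    then have x: "px C = px (A+B)" using d by simp
    then have "C = - (A + B)" using n AB yC l(4) by (intro ept_eqI) (auto simp: py_uminus)
    then show False using z(1) ept_add_eq_0_iff by blast
  qed
  from conic_unique[OF d h(1) h'(3) h(2) h'(1) h(3) h'(2) l(1,2) this]
  have e: "p' = p" "q' = q" "k' = k" "k \<noteq> 0" by auto
  have x: "px (A+B+C) = px (B+C+A)" using h(4) h'(4) e by simp
  have "k * py (A+B+C) = k * py (B+C+A)" using h(5) h'(5) unfolding e x by (metis add_left_cancel)
  then have "A + B + C = B + C + A" using e x z(1) z' by (intro ept_eqI) auto
  then show "A + B + C = A + (B + C)" using ept_add_commute by metis
  show "chord A B x y * chord (A+B) C x y * (x - px (B+C)) = chord B C x y * chord A (B+C) x y * (x - px (A+B))"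
    if "y^2 = x^3 + ca TYPE('c) * x + cb TYPE('c)"
    using h(6)[OF that] h'(6)[OF that] chord_commute[OF n(1) BC z(2)] unfolding e by simp
qed

section \<open>Points in general position and full associativity\<close>

lemma ex_point: "\<exists>X::'c::curve ept. X \<noteq> 0 \<and> px X = x"
  using mk_simps(1,2)[of "csqrt (x^3 + ca TYPE('c)*x + cb TYPE('c))" x] by (metis power2_csqrt)

lemma infinite_ept: "infinite (UNIV :: 'c::curve ept set)"
proof
  assume "finite (UNIV :: 'c ept set)"
  then have "finite (px ` (UNIV :: 'c ept set))" by simp
  moreover have "px ` (UNIV :: 'c ept set) = UNIV"
    using ex_point[where 'c='c] by (auto simp: image_iff) metis
  ultimately show False using infinite_UNIV_char_0[where 'a=complex] by simp
qed

lemma finite_px_in: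
  assumes "finite S" shows "finite {X::'c::curve ept. X = 0 \<or> px X \<in> S}"
proof -
  have "{X::'c ept. X \<noteq> 0 \<and> px X = x} \<subseteq> (let Z = SOME Z. Z \<noteq> 0 \<and> px Z = x in {Z, - Z})" for x
  proof -
    obtain Z :: "'c ept" where "Z \<noteq> 0 \<and> px Z = x" using ex_point by blast
    from someI[of "\<lambda>Z::'c ept. Z \<noteq> 0 \<and> px Z = x", OF this] show ?thesis
      by (auto simp: Let_def) (metis px_eq_iff)
  qed
  then have "finite {X::'c ept. X \<noteq> 0 \<and> px X = x}" for x
    by (rule finite_subset) (simp add: Let_def)
  then have "finite (insert 0 (\<Union>x\<in>S. {X::'c ept. X \<noteq> 0 \<and> px X = x}))" using assms by simp
  then show ?thesis by (rule rev_finite_subset) auto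
qed

text \<open>The duplication formula makes the abscissa of V a root of \<open>P\<close>, whose
  leading coefficient is 9 - 8 = 1; the exceptions are V = 0 and the points with ordinate 0. A point
  in general position can thus be required not to be a half of Z.\<close>

lemma finite_halves: "finite {V::'c::curve ept. V + V = Z}"
proof -
  define a b z where "a = ca TYPE('c)" "b = cb TYPE('c)" "z = px Z"
  define P where "P = [:a, 0, 3:]^2 - [:4:] * [:b, a, 0, 1:] * [:z, 2:]"
  have "Polynomial.coeff P 4 = 1" unfolding P_def by (simp add: numeral_eq_Suc power2_eq_square)
  then have P: "finite {x. poly P x = 0}" by (intro poly_roots_finite) auto
  have Y: "finite {x. poly [:b, a, 0, 1:] x = 0}" by (intro poly_roots_finite) simp
  have "{V::'c ept. V + V = Z} \<subseteq> {V. V = 0 \<or> px V \<in> {x. poly P x = 0} \<union> {x. poly [:b, a, 0, 1:] x = 0}}"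
  proof
    fix V :: "'c ept" assume V: "V \<in> {V. V + V = Z}"
    show "V \<in> {V. V = 0 \<or> px V \<in> {x. poly P x = 0} \<union> {x. poly [:b, a, 0, 1:] x = 0}}"
    proof (cases "V = 0 \<or> py V = 0")
      case True
      then show ?thesis using curve_eq[of V]
        by (cases "V = 0") (auto simp: a_b_z_def power3_eq_cube algebra_simps)
    next
      case False
      then have n: "V \<noteq> 0" by simp
      have n2: "V + V \<noteq> 0"
      proof
        assume "V + V = 0"
        then have "py V = - py V" using py_uminus[OF n] ept_add_eq_0_iff by metis
        then show False using False by simp
      qed
      define s where "s = slp V V"
      have "2 * s * py V = 3 * px V^2 + a" using False by (simp add: s_def slp_def a_b_z_def)
      moreover have "z = s^2 - px V - px V" using line(3)[OF n n n2 s_def refl] V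
        by (simp add: a_b_z_def)
      moreover have "py V ^2 = px V^3 + a * px V + b" using curve_eq n a_b_z_def by blast
      ultimately have "(a + 3*px V^2)^2 - 4 * (b + a*px V + px V^3) * (z + 2*px V) = 0"
        by Groebner_Basis.algebra
      then have "poly P (px V) = 0" unfolding P_def
        by (simp add: algebra_simps power2_eq_square power3_eq_cube)
      then show ?thesis by simp
    qed
  qed
  then show ?thesis using finite_px_in[of "{x. poly P x = 0} \<union> {x. poly [:b, a, 0, 1:] x = 0}"] P Y
    by (auto intro: finite_subset)
qed

lemma eventually_cofinite_neq: "\<forall>\<^sub>F x in cofinite. x \<noteq> z"
  by (simp add: eventually_cofinite)

lemma eventually_cofinite_inj:
  assumes "inj f" "\<forall>\<^sub>F x in cofinite. P x" shows "\<forall>\<^sub>F x in cofinite. P (f x)"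
  using finite_vimageI[OF assms(2)[unfolded eventually_cofinite] assms(1)]
  by (simp add: eventually_cofinite vimage_def)

lemma eventually_halves: "\<forall>\<^sub>F V in cofinite. V + V \<noteq> (Z::'c::curve ept)"
  using finite_halves[of Z] by (simp add: eventually_cofinite)

lemma ept_cofinite_ex: "\<forall>\<^sub>F x in cofinite. P x \<Longrightarrow> \<exists>x::'c::curve ept. P x"
  using infinite_ept[where 'c='c] by (rule contrapos_np) (simp add: eventually_cofinite)

lemma inj_ept_add: "inj ((+) (C::'c::curve ept))"
  by (rule injI) (metis ept_add_cancel ept_add_commute)

lemma inj_ept_uminus: "inj (uminus :: 'c::curve ept \<Rightarrow> 'c ept)"
  by (rule injI) (metis ept_minus_minus)

lemma ept_minus_add: "- A + - B = - (A + (B::'c::curve ept))"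
proof (cases "A = 0 \<or> B = 0 \<or> A + B = 0")
  case True
  then show ?thesis
    using ept_add_eq_0_iff[of A B] ept_add_eq_0_iff[of "- A" "- B"]
    by (auto simp: ept_add_0 ept_uminus_0)
next
  case False
  then have n: "A \<noteq> 0" "B \<noteq> 0" "A + B \<noteq> 0" by auto
  have n': "- A \<noteq> 0" "- B \<noteq> 0" "- A + - B \<noteq> 0" using n by (auto simp: ept_add_eq_0_iff ept_minus_minus)
  define s where "s = slp A B"
  have s': "- s = slp (- A) (- B)" using n by (simp add: slp_def s_def py_uminus) (simp add: minus_divide_left)
  note l = line[OF n s_def refl] and l' = line[OF n' s' refl]
  have "px (- A + - B) = px (A + B)" using l(3) l'(3) by simp
  moreover have "py (- A + - B) = - py (A + B)" using l(4) l'(4) calculation n by (simp add: py_uminus)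
  ultimately show ?thesis using n n' by (intro ept_eqI) (simp_all add: py_uminus)
qed

lemma eventually_assoc_distinct:
  fixes X Y :: "'c::curve ept"
  assumes "X \<noteq> 0" "Y \<noteq> 0" "X \<noteq> Y" "X \<noteq> - Y"
  shows "\<forall>\<^sub>F D in cofinite. X + Y + D = X + (Y + D)"
proof -
  have "\<forall>\<^sub>F D in cofinite. D \<noteq> 0 \<and> D \<noteq> X \<and> D \<noteq> - X \<and> D \<noteq> Y \<and> D \<noteq> - Y \<and> D \<noteq> - (X + Y) \<and> D \<noteq> - X + - Y"
    by (intro eventually_conj eventually_cofinite_neq)
  then show ?thesis
  proof (rule eventually_mono)
    fix D assume D: "D \<noteq> 0 \<and> D \<noteq> X \<and> D \<noteq> - X \<and> D \<noteq> Y \<and> D \<noteq> - Y \<and> D \<noteq> - (X + Y) \<and> D \<noteq> - X + - Y"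
    have "X + (Y + D) \<noteq> 0"
      using D ept_add_eq_0_iff ept_add_cancel ept_add_commute by metis
    moreover have "X + Y + D \<noteq> 0" using D ept_add_eq_0_iff by metis
    moreover have "px X \<noteq> px Y" "px X \<noteq> px D" "px Y \<noteq> px D"
      using D assms px_eq_iff ept_minus_minus by metis+
    ultimately show "X + Y + D = X + (Y + D)" using generic_assoc(1) D assms by metis
  qed
qed

text \<open>The tangent case \<open>X = Y\<close> is reduced to secants by writing \<open>Y = (X - V) + V\<close>.\<close>

lemma eventually_assoc:
  fixes X Y :: "'c::curve ept"
  shows "\<forall>\<^sub>F D in cofinite. X + Y + D = X + (Y + D)"
proof -
  consider "X = 0 \<or> Y = 0" | "X = - Y" | "X = Y" "X \<noteq> 0" "X \<noteq> - X"
    | "X \<noteq> 0" "Y \<noteq> 0" "X \<noteq> Y" "X \<noteq> - Y" by blast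
  then show ?thesis
  proof cases
    case 1
    then show ?thesis by (auto simp: ept_add_0)
  next
    case 2
    have "X + Y + D = X + (Y + D)" for D
      using 2 ept_add_cancel[of D Y] ept_add_commute[of D Y] ept_add_commute[of _ X]
        ept_add_eq_0_iff[of Y X] by (metis ept_add_0(1))
    then show ?thesis by simp
  next
    case 3
    \<comment> \<open>V is going to be chosen such that X, V and W = X - V, and later
      \<open>X + W\<close> and V, are never equal or opposite; each condition excludes finitely many
      V.\<close>
    have i: "inj (\<lambda>V. X + - V)"
      by (rule injI) (metis inj_ept_add inj_ept_uminus injD)
    have "\<forall>\<^sub>F V in cofinite. V \<noteq> 0 \<and> V \<noteq> X \<and> V \<noteq> - X \<and> V \<noteq> X + X \<and> V + V \<noteq> X
        \<and> (X + - V) + (X + - V) \<noteq> 0"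
      using eventually_cofinite_inj[OF i eventually_halves[of 0]]
      by (intro eventually_conj eventually_cofinite_neq eventually_halves) auto
    then obtain V where V: "V \<noteq> 0" "V \<noteq> X" "V \<noteq> - X" "V \<noteq> X + X" "V + V \<noteq> X"
        "(X + - V) + (X + - V) \<noteq> 0"
      using ept_cofinite_ex by blast
    define W where "W = X + - V"
    have WV: "W + V = X" unfolding W_def using ept_add_cancel[of X "- V"] by (simp add: ept_minus_minus)
    have W: "W \<noteq> 0" "X \<noteq> W" "X \<noteq> - W" "W \<noteq> V" "W \<noteq> - V"
    proof -
      show "W \<noteq> 0" using WV V(2) by (auto simp: ept_add_0)
      show "X \<noteq> W" using WV V(1) by (metis ept_add_0(2) inj_ept_add injD)
      show "X \<noteq> - W" using WV V(4) by (metis ept_add_cancel ept_add_commute ept_minus_minus)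
      show "W \<noteq> V" using WV V(5) by auto
      show "W \<noteq> - V" using WV 3 ept_add_eq_0_iff ept_minus_minus by metis
    qed
    have XW: "X + W \<noteq> 0" "X + W \<noteq> V" "X + W \<noteq> - V"
    proof -
      show "X + W \<noteq> 0" using W by (metis ept_add_eq_0_iff ept_minus_minus)
      show "X + W \<noteq> V"
      proof
        assume "X + W = V"
        then have "V + - W = V + W" using ept_add_cancel[of X W] WV ept_add_commute by metis
        then have "- W = W" using inj_ept_add injD by metis
        then show False using V(6) W_def ept_add_eq_0_iff by metis
      qed
      show "X + W \<noteq> - V"
      proof
        assume "X + W = - V"
        then have "X = - V + - W" using ept_add_cancel[of X W] by simp
        then have "X = - X" using ept_minus_add[of V W] WV ept_add_commute by metis
        then show False using 3 by simp
      qed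
    qed
    have XX: "X + W + V = X + X"
    proof -
      have "px X \<noteq> px W" "px X \<noteq> px V" "px W \<noteq> px V" using px_eq_iff 3(2) W V ept_minus_minus by metis+
      moreover have "X + W + V \<noteq> 0" using XW(3) ept_add_eq_0_iff ept_minus_minus by metis
      moreover have "X + (W + V) \<noteq> 0" using WV 3 ept_add_eq_0_iff by metis
      ultimately show ?thesis using generic_assoc(1)[of X W V] 3 W V WV by simp
    qed
    have "\<forall>\<^sub>F D in cofinite. X + W + V + D = X + W + (V + D) \<and> X + W + (V + D) = X + (W + (V + D))
        \<and> W + V + D = W + (V + D)"
      by (intro eventually_conj eventually_assoc_distinct
        eventually_cofinite_inj[OF inj_ept_add eventually_assoc_distinct]) (use 3 W V XW in auto)
    then show ?thesis unfolding 3(1)[symmetric] by (rule eventually_mono) (simp add: XX WV)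
  next
    case 4
    then show ?thesis by (rule eventually_assoc_distinct)
  qed
qed

text \<open>The five bracketings of A, B, C, D form a pentagon. For generic D four of its edges are
  instances of \<open>eventually_assoc\<close>, the fifth is the claim with D added, and D
  cancels.\<close>

lemma ept_add_assoc: "A + B + C = A + (B + (C::'c::curve ept))"
proof -
  have "\<forall>\<^sub>F D in cofinite. A + B + C + D = A + B + (C + D) \<and> A + B + (C + D) = A + (B + (C + D))
      \<and> B + C + D = B + (C + D) \<and> A + (B + C) + D = A + (B + C + D)"
    by (intro eventually_conj eventually_assoc eventually_cofinite_inj[OF inj_ept_add eventually_assoc])
  from ept_cofinite_ex[OF this] obtain D where "A + B + C + D = A + (B + C) + D" by metis
  then show ?thesis using ept_add_cancel by metis
qed

instance ept :: (curve) ab_group_add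
proof
  fix a b c :: "'a ept"
  show "a + b + c = a + (b + c)" by (rule ept_add_assoc)
  show "a + b = b + a" by (rule ept_add_commute)
  show "0 + a = a" by (rule ept_add_0)
  show "- a + a = 0" using ept_add_eq_0_iff ept_add_commute by metis
  show "a - b = a + - b" by (rule minus_ept_def)
qed

section \<open>Miller functions and their cocycle relation\<close>

text \<open>The normalised function with divisor (A) + (B) - (A + B) - (O), one factor of Miller's
  recursion. When \<open>A + B = 0\<close> only the vertical line remains.\<close>

definition gxy :: "'c::curve ept \<Rightarrow> 'c ept \<Rightarrow> complex \<Rightarrow> complex \<Rightarrow> complex" where
  "gxy A B x y = (if A = 0 \<or> B = 0 then 1 else if A + B = 0 then x - px A
                  else chord A B x y / (x - px (A + B)))"

definition gf :: "'c::curve ept \<Rightarrow> 'c ept \<Rightarrow> 'c ept \<Rightarrow> complex" where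
  "gf A B R = gxy A B (px R) (py R)"

text \<open>R is neither A nor \<open>- A\<close>, so the vertical line at A does not vanish at R.
  For A = 0 nothing is required, because the point at infinity has no vertical line.\<close>

definition off :: "'c::curve ept \<Rightarrow> 'c ept \<Rightarrow> bool" where
  "off A R \<longleftrightarrow> A = 0 \<or> px R \<noteq> px A"

lemma off_iff: "R \<noteq> 0 \<Longrightarrow> off A R \<longleftrightarrow> A \<noteq> R \<and> A \<noteq> - R"
  by (cases "A = 0") (auto simp: off_def px_eq_iff)

lemma gf_commute: "gf A B R = gf B A R"
proof (cases "A = 0 \<or> B = 0 \<or> A + B = 0")
  case True
  have "px B = px A" if "A + B = 0"
  proof -
    have "B = - A" using that by (simp add: add_eq_0_iff)
    then show ?thesis by simp
  qed
  then show ?thesis using True by (auto simp: gf_def gxy_def add.commute)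
next
  case False
  then show ?thesis using chord_commute[of A B] by (simp add: gf_def gxy_def add.commute)
qed

text \<open>This is the norm of the line from the curve down to the x-line. It trades a value at the
  mirror image of a point for a value at the point itself.\<close>

lemma line_norm:
  fixes A B :: "'c::curve ept"
  assumes "A \<noteq> 0" "B \<noteq> 0" "A + B \<noteq> 0" and y: "y^2 = x^3 + ca TYPE('c) * x + cb TYPE('c)"
  shows "chord A B x y * chord A B x (- y) = - ((x - px A) * (x - px B) * (x - px (A + B)))"
proof -
  define s c where "s = slp A B" "c = py A - s * px A"
  note l = line[OF assms(1-3) s_c_def]
  have "chord A B x y * chord A B x (- y) = (s*x + c)^2 - y^2"
    by (simp add: chord_def s_c_def ring_normal)
  also have "\<dots> = - ((x - px A) * (x - px B) * (x - px (A + B)))"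
    unfolding y l(5,6) using l(3) by Groebner_Basis.algebra
  finally show ?thesis .
qed

lemma chord_nonzero:
  assumes "A \<noteq> 0" "B \<noteq> 0" "A + B \<noteq> 0" "R \<noteq> 0" "off A R" "off B R" "off (A + B) R"
  shows "chord A B (px R) (py R) \<noteq> 0" "chord A B (px R) (- py R) \<noteq> 0"
  using line_norm[OF assms(1-3) curve_eq[OF assms(4)]] assms by (auto simp: off_def)

lemma gf_nonzero:
  assumes "R \<noteq> 0" "off A R" "off B R" "off (A + B) R"
  shows "gf A B R \<noteq> 0"
  using chord_nonzero[of A B R] assms by (auto simp: gf_def gxy_def off_def)

text \<open>Both products have divisor (A) + (B) + (C) - (A + B + C) - 2(O): the factors form a
  2-cocycle on the group with values in functions, stated here at one point R.\<close>

definition coc :: "'c::curve ept \<Rightarrow> 'c ept \<Rightarrow> 'c ept \<Rightarrow> 'c ept \<Rightarrow> bool" where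
  "coc A B C R \<longleftrightarrow> gf A B R * gf (A + B) C R = gf B C R * gf A (B + C) R"

lemma coc_generic:
  assumes n: "A \<noteq> 0" "B \<noteq> 0" "C \<noteq> 0" and d: "px A \<noteq> px B" "px A \<noteq> px C" "px B \<noteq> px C"
    and z: "A + B + C \<noteq> 0" and R: "R \<noteq> 0" "off (A + B) R" "off (B + C) R" "off (A + B + C) R"
  shows "coc A B C R"
proof -
  have AB: "A + B \<noteq> 0" and BC: "B + C \<noteq> 0" using d by (auto simp: ept_add_eq_0_iff)
  have z': "A + (B + C) \<noteq> 0" using z by (simp add: add.assoc)
  have "chord A B (px R) (py R) * chord (A+B) C (px R) (py R) * (px R - px (B+C)) =
      chord B C (px R) (py R) * chord A (B+C) (px R) (py R) * (px R - px (A+B))"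
    by (rule generic_assoc(2)[OF n d z z' curve_eq[OF R(1)]])
  then show ?thesis using n AB BC z z' R
    by (simp add: coc_def gf_def gxy_def off_def add.assoc divide_simps mult.assoc)
qed

lemma eventually_off: "R \<noteq> 0 \<Longrightarrow> \<forall>\<^sub>F D in cofinite. off D R"
  by (simp add: off_iff) (intro eventually_conj eventually_cofinite_neq)

lemma eventually_off_add: "R \<noteq> 0 \<Longrightarrow> \<forall>\<^sub>F D in cofinite. off (Z + D) R"
  using eventually_cofinite_inj[OF inj_ept_add[of Z] eventually_off] .

lemma eventually_coc_distinct:
  assumes XY: "X \<noteq> 0" "Y \<noteq> 0" "X \<noteq> Y" "X \<noteq> - Y" and R: "R \<noteq> 0" "off (X + Y) R"
  shows "\<forall>\<^sub>F D in cofinite. coc X Y D R"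
proof -
  have "\<forall>\<^sub>F D in cofinite. D \<noteq> 0 \<and> D \<noteq> X \<and> D \<noteq> - X \<and> D \<noteq> Y \<and> D \<noteq> - Y \<and> D \<noteq> - (X + Y)
      \<and> off (Y + D) R \<and> off (X + Y + D) R"
    by (intro eventually_conj eventually_cofinite_neq eventually_off_add R)
  then show ?thesis
  proof (rule eventually_mono)
    fix D assume D: "D \<noteq> 0 \<and> D \<noteq> X \<and> D \<noteq> - X \<and> D \<noteq> Y \<and> D \<noteq> - Y \<and> D \<noteq> - (X + Y)
      \<and> off (Y + D) R \<and> off (X + Y + D) R"
    have "px X \<noteq> px Y" "px X \<noteq> px D" "px Y \<noteq> px D"
      using D XY px_eq_iff minus_minus by metis+
    moreover have "X + Y + D \<noteq> 0" using D by (simp only: add_eq_0_iff) simp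
    ultimately show "coc X Y D R" using D XY R by (intro coc_generic) auto
  qed
qed

text \<open>The line through \<open>- X\<close> and D and the line through X and
  \<open>- X + D\<close> are mirror images, so their product is, up to sign, the norm of one line,
  and the vertical lines at D and \<open>- X + D\<close> cancel.\<close>

lemma eventually_coc_opposite:
  assumes R: "R \<noteq> 0"
  shows "\<forall>\<^sub>F D in cofinite. coc X (- X) D R"
proof (cases "X = 0")
  case True
  then show ?thesis by (simp add: coc_def gf_def gxy_def)
next
  case False
  have "\<forall>\<^sub>F D in cofinite. D \<noteq> 0 \<and> D \<noteq> X \<and> D \<noteq> X + X \<and> off D R \<and> off (- X + D) R"
    by (intro eventually_conj eventually_cofinite_neq eventually_off_add eventually_off R)
  then show ?thesis
  proof (rule eventually_mono)
    fix D assume D: "D \<noteq> 0 \<and> D \<noteq> X \<and> D \<noteq> X + X \<and> off D R \<and> off (- X + D) R"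
    define Y where "Y = - X"
    have n: "Y \<noteq> 0" "D \<noteq> 0" "Y + D \<noteq> 0" "X + (Y + D) \<noteq> 0"
      using D False by (auto simp: Y_def add_eq_0_iff)
    define s c where "s = slp Y D" "c = py Y - s * px Y"
    note l = line[OF n(1-3) s_c_def]
    have "Y + D \<noteq> X" "Y + D \<noteq> - X" using D False by (auto simp: Y_def algebra_simps)
    then have x: "px X \<noteq> px (Y + D)" using px_eq_iff[of X "Y + D"] False n by (metis minus_minus)
    have "- py X = s * px X + c" using l(1) False by (simp add: Y_def py_uminus)
    then have yX: "py X = - (s * px X + c)" by Groebner_Basis.algebra
    then have "py (Y + D) - py X = - s * (px (Y + D) - px X)"
      using l(4) by (simp add: algebra_simps)
    then have s': "slp X (Y + D) = - s" using x by (simp add: slp_def)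
    have "chord Y D (px R) (py R) * chord X (Y + D) (px R) (py R) = - (chord Y D (px R) (py R) * chord Y D (px R) (- py R))"
      unfolding chord_def s' s_c_def(1)[symmetric] yX l(1) by (simp add: Y_def ring_normal)
    also have "\<dots> = (px R - px X) * (px R - px D) * (px R - px (Y + D))"
      unfolding line_norm[OF n(1-3) curve_eq[OF R]] by (simp add: Y_def)
    finally have e: "chord Y D (px R) (py R) * chord X (Y + D) (px R) (py R) =
      (px R - px X) * (px R - px D) * (px R - px (Y + D))" .
    have XYD: "X + (Y + D) = D" by (simp add: Y_def)
    have o: "px R - px D \<noteq> 0" "px R - px (Y + D) \<noteq> 0" using D n by (auto simp: off_def Y_def)
    have "gf Y D R * gf X (Y + D) R = (chord Y D (px R) (py R) * chord X (Y + D) (px R) (py R))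
        / ((px R - px (Y + D)) * (px R - px D))"
      unfolding gf_def gxy_def XYD using n(1-3) False by simp
    also have "\<dots> = px R - px X" unfolding e using o by simp
    also have "\<dots> = gf X Y R * gf (X + Y) D R" using False by (simp add: gf_def gxy_def Y_def)
    finally show "coc X (- X) D R" by (simp add: coc_def Y_def)
  qed
qed

text \<open>Pentagon argument: four cocycle relations give the fifth after cancelling the nonzero
  value of \<open>gf W V\<close>.\<close>

lemma coc_chain:
  assumes "coc X W V R" "coc (X + W) V D R" "coc X W (V + D) R" "coc W V D R" "gf W V R \<noteq> 0"
  shows "coc X (W + V) D R"
proof -
  have "gf W V R * (gf X (W+V) R * gf (X+(W+V)) D R) = gf W V R * (gf (W+V) D R * gf X (W+V+D) R)"
    using assms(1-4) unfolding coc_def by (simp only: add.assoc) Groebner_Basis.algebra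
  then show ?thesis using assms(5) by (simp add: coc_def add.assoc)
qed

text \<open>When X = Y, the tangent is avoided by writing Y = W + V with a generic V and chaining
  relations between distinct points.\<close>

lemma eventually_coc:
  assumes R: "R \<noteq> 0" "off X R" "off Y R" "off (X + Y) R"
  shows "\<forall>\<^sub>F D in cofinite. coc X Y D R"
proof -
  consider "X = 0 \<or> Y = 0" | "Y = - X" | "X = Y" "X \<noteq> 0" "X + X \<noteq> 0"
    | "X \<noteq> 0" "Y \<noteq> 0" "X \<noteq> Y" "X \<noteq> - Y" by (metis add_eq_0_iff minus_minus)
  then show ?thesis
  proof cases
    case 1
    then show ?thesis by (auto simp: coc_def gf_def gxy_def)
  next
    case 2
    then show ?thesis using eventually_coc_opposite[OF R(1)] by simp
  next
    case 3
    have i: "inj (\<lambda>V. X + - V)" "inj (\<lambda>V. X + X + - V)" by (auto intro: injI)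
    have "\<forall>\<^sub>F V in cofinite. V \<noteq> 0 \<and> V \<noteq> X \<and> V \<noteq> - X \<and> V \<noteq> X + X \<and> V + V \<noteq> X \<and> V + V \<noteq> X + X
        \<and> off V R \<and> off (X + - V) R \<and> off (X + X + - V) R"
      using eventually_cofinite_inj[OF i(1) eventually_off[OF R(1)]]
        eventually_cofinite_inj[OF i(2) eventually_off[OF R(1)]]
      by (intro eventually_conj eventually_cofinite_neq eventually_halves eventually_off R) auto
    from ept_cofinite_ex[OF this]
    obtain V where V: "V \<noteq> 0" "V \<noteq> X" "V \<noteq> - X" "V \<noteq> X + X" "V + V \<noteq> X" "V + V \<noteq> X + X"
        "off V R" "off (X + - V) R" "off (X + X + - V) R" by blast
    define W where "W = X + - V"
    have WV: "W + V = X" by (simp add: W_def)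
    have W: "W \<noteq> 0" "X \<noteq> W" "X \<noteq> - W" "W \<noteq> V" "W \<noteq> - V"
      using V 3 by (auto simp: W_def algebra_simps)
    have XW: "X + W \<noteq> 0" "X + W \<noteq> V" "X + W \<noteq> - V" "off (X + W) R"
      using V 3 by (auto simp: W_def algebra_simps)
    have "px X \<noteq> px W" "px X \<noteq> px V" "px W \<noteq> px V"
      using px_eq_iff 3(2) W V minus_minus by metis+
    then have c1: "coc X W V R"
      using coc_generic[of X W V R] 3 W V WV XW R by (simp add: add.assoc)
    have g: "gf W V R \<noteq> 0" using gf_nonzero[of R W V] V R WV by (simp add: W_def)
    have "\<forall>\<^sub>F D in cofinite. coc (X + W) V D R \<and> coc X W (V + D) R \<and> coc W V D R"
      by (intro eventually_conj eventually_coc_distinct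
        eventually_cofinite_inj[OF inj_ept_add eventually_coc_distinct])
        (use 3 W V XW R WV in \<open>auto simp: add.assoc\<close>)
    then show ?thesis unfolding 3(1)[symmetric]
      by (rule eventually_mono) (use coc_chain[OF c1 _ _ _ g] WV in auto)
  next
    case 4
    then show ?thesis by (intro eventually_coc_distinct R)
  qed
qed

text \<open>The pentagon with a generic fourth point D: the four relations containing D are known,
  and the common factor at D is nonzero and cancels. No genericity of X, Y, Z is left, only
  conditions at R.\<close>

lemma gf_cocycle:
  assumes R: "R \<noteq> 0" "off X R" "off Y R" "off Z R" "off (X + Y) R" "off (Y + Z) R" "off (X + Y + Z) R"
  shows "gf X Y R * gf (X + Y) Z R = gf Y Z R * gf X (Y + Z) R"
proof -
  have "\<forall>\<^sub>F D in cofinite. coc Y Z D R \<and> coc X (Y + Z) D R \<and> coc (X + Y) Z D R \<and> coc X Y (Z + D) R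
      \<and> off D R \<and> off (X + Y + Z + D) R"
    by (intro eventually_conj eventually_coc eventually_off eventually_off_add
        eventually_cofinite_inj[OF inj_ept_add eventually_coc] R)
      (use R in \<open>auto simp: add.assoc\<close>)
  from ept_cofinite_ex[OF this]
  obtain D where D: "coc Y Z D R" "coc X (Y + Z) D R" "coc (X + Y) Z D R" "coc X Y (Z + D) R"
    "off D R" "off (X + Y + Z + D) R" by blast
  have "gf (X + (Y + Z)) D R * (gf X Y R * gf (X + Y) Z R) =
      gf (X + (Y + Z)) D R * (gf Y Z R * gf X (Y + Z) R)"
    using D(1-4) unfolding coc_def by (simp only: add.assoc) Groebner_Basis.algebra
  moreover have "gf (X + (Y + Z)) D R \<noteq> 0"
    using gf_nonzero[of R "X + (Y + Z)" D] D R by (simp add: add.assoc)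
  ultimately show ?thesis by simp
qed

section \<open>Multiples and torsion\<close>

primrec nm :: "nat \<Rightarrow> 'a::ab_group_add \<Rightarrow> 'a" where
  "nm 0 X = 0"
| "nm (Suc n) X = X + nm n X"

lemma nm_1 [simp]: "nm (Suc 0) X = X" by simp

lemma nm_add: "nm (m + n) X = nm m X + nm n X"
  by (induction m) (simp_all add: add.assoc)

lemma nm_mult: "nm (m * n) X = nm m (nm n X)"
  by (induction m) (simp_all add: nm_add)

lemma nm_plus: "nm n (X + Y) = nm n X + nm n Y"
  by (induction n) (simp_all add: algebra_simps)

lemma nm_0_right [simp]: "nm n 0 = 0"
  by (induction n) simp_all

lemma nm_uminus: "nm n (- X) = - nm n X"
  by (induction n) simp_all

lemma nm_mod: "nm p X = 0 \<Longrightarrow> nm (n mod p) X = nm n X"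
  using nm_add[of "n mod p" "n div p * p" X] by (simp add: nm_mult)

definition tor :: "nat \<Rightarrow> 'a::ab_group_add set" where "tor p = {X. nm p X = 0}"

lemma tor_0 [simp]: "0 \<in> tor p"
  and tor_plus: "X \<in> tor p \<Longrightarrow> Y \<in> tor p \<Longrightarrow> X + Y \<in> tor p"
  and tor_uminus: "X \<in> tor p \<Longrightarrow> - X \<in> tor p"
  and tor_nm: "X \<in> tor p \<Longrightarrow> nm k X \<in> tor p"
  by (auto simp: tor_def nm_plus nm_uminus) (metis mult.commute nm_0_right nm_mult)

text \<open>Natural multiples match the dependence test in \<open>weil\<close>; for P of finite
  order they form the cyclic subgroup of P.\<close>

definition mults :: "'a::ab_group_add \<Rightarrow> 'a set" where "mults P = range (\<lambda>k. nm k P)"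

lemma mults_0 [simp]: "0 \<in> mults P" and mults_self [simp]: "P \<in> mults P"
  unfolding mults_def by (metis nm.simps(1) rangeI) (metis nm_1 rangeI)

lemma mults_plus: "X \<in> mults P \<Longrightarrow> Y \<in> mults P \<Longrightarrow> X + Y \<in> mults P"
  unfolding mults_def by (auto simp flip: nm_add)

lemma mults_nm [simp]: "nm k P \<in> mults P"
  by (simp add: mults_def)

lemma mults_uminus:
  assumes "P \<in> tor p" "p > 0" "X \<in> mults P" shows "- X \<in> mults P"
proof -
  obtain k where k: "X = nm k P" using assms(3) by (auto simp: mults_def)
  have "nm (k * (p - 1)) P + nm k P = nm (k * p) P"
    unfolding nm_add[symmetric] using assms(2) by (cases p) (simp_all add: add.commute)
  also have "\<dots> = 0" using assms(1) by (simp add: nm_mult tor_def)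
  finally have "- X = nm (k * (p - 1)) P" unfolding k by (metis eq_neg_iff_add_eq_0)
  then show ?thesis by simp
qed

lemma mults_invert:
  assumes "prime p" "P \<in> tor p" "nm k P \<noteq> 0"
  obtains m where "nm m (nm k P) = P"
proof -
  have "\<not> p dvd k" using assms(2,3) by (auto simp: tor_def mult.commute[of p] nm_mult elim: dvdE)
  then have "coprime k p" using prime_imp_coprime[OF assms(1)] coprime_commute by blast
  then obtain m where "[k * m = Suc 0] (mod p)" using cong_solve_coprime_nat[of k p] by blast
  then have "nm (m * k) P = nm (Suc 0) P"
    using nm_mod[of p P "m * k"] nm_mod[of p P "Suc 0"] assms(2)
    by (simp add: tor_def cong_def mult.commute)
  then show thesis using that by (simp add: nm_mult)
qed

text \<open>For prime p the coefficient of a nonzero multiple of Q is invertible modulo p, so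
  dependence of nonzero points is symmetric. \<open>weil\<close> tests it in one direction
  only.\<close>

lemma mults_sym:
  assumes "prime p" "P \<in> tor p" "Q \<in> tor p" "P \<noteq> 0" "P \<in> mults Q"
  shows "Q \<in> mults P"
proof -
  obtain k where "P = nm k Q" using assms by (auto simp: mults_def)
  then show ?thesis using mults_invert[OF assms(1,3), of k] assms(4) by (metis mults_nm)
qed

lemma nm_nonzero:
  assumes "prime p" "P \<in> tor p" "P \<noteq> 0" "0 < k" "k < p"
  shows "nm k P \<noteq> 0"
proof
  assume z: "nm k P = 0"
  have "coprime k p" using assms by (metis coprime_commute prime_imp_coprime nat_dvd_not_less)
  then obtain m where "[k * m = Suc 0] (mod p)" using cong_solve_coprime_nat[of k p] by blast
  then have "nm (m * k) P = nm (Suc 0) P"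
    using nm_mod[of p P "m * k"] nm_mod[of p P "Suc 0"] assms(2)
    by (simp add: tor_def cong_def mult.commute)
  then show False using z assms(3) by (simp add: nm_mult)
qed

lemma off_mults:
  fixes P Q :: "'c::curve ept"
  assumes "P \<in> tor p" "p > 0" "Q \<notin> mults P" "X \<in> mults P"
  shows "off X Q"
proof -
  have "Q \<noteq> 0" using assms(3) by auto
  then show ?thesis using assms mults_uminus[of P p X] by (auto simp: off_iff)
qed

section \<open>The Weil pairing is bilinear\<close>

text \<open>Miller's function in coordinates, so that limits along the curve can be taken. As in
  \<open>miller\<close> the values for n = 0 and n = 1 are both 1.\<close>

primrec mxy :: "nat \<Rightarrow> 'c::curve ept \<Rightarrow> complex \<Rightarrow> complex \<Rightarrow> complex" where
  "mxy 0 P x y = 1"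
| "mxy (Suc n) P x y = (if n = 0 then 1 else mxy n P x y * gxy (nm n P) P x y)"

definition mf :: "nat \<Rightarrow> 'c::curve ept \<Rightarrow> 'c ept \<Rightarrow> complex" where
  "mf n P R = mxy n P (px R) (py R)"

lemma mf_1 [simp]: "mf (Suc 0) P R = 1"
  and mf_Suc: "n > 0 \<Longrightarrow> mf (Suc n) P R = mf n P R * gf (nm n P) P R"
  by (simp_all add: mf_def gf_def)

lemma esmul_raw: "esmul (crv TYPE('c)) n (raw X) = raw (nm n (X::'c::curve ept))"
  by (induction n) (simp_all add: raw_add)

lemma eline_evert_raw:
  fixes A P R :: "'c::curve ept"
  assumes "A \<noteq> 0" "P \<noteq> 0" "R \<noteq> 0"
  shows "eline (crv TYPE('c)) (raw A) (raw P) (raw R) / evert (raw (P + A)) (raw R) = gf A P R"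
proof -
  have r: "raw A = Some (px A, py A)" "raw P = Some (px P, py P)" "raw R = Some (px R, py R)"
    using assms raw_nonzero by blast+
  show ?thesis
  proof (cases "A + P = 0")
    case True
    then have "A = - P" by (simp add: eq_neg_iff_add_eq_0)
    then have "px A = px P" "py A = - py P" using assms py_uminus by auto
    then show ?thesis using True assms unfolding r
      by (simp add: eline_def evert_def gf_def gxy_def add.commute[of P])
  next
    case False
    then have "\<not> (px A = px P \<and> py A = - py P)"
      using ept_eqI[of A "- P"] assms py_uminus[of P] by (auto simp: eq_neg_iff_add_eq_0)
    moreover have "raw (P + A) = Some (px (A + P), py (A + P))"
      using False raw_nonzero[of "A + P"] by (simp add: add.commute)
    ultimately show ?thesis using False assms unfolding r
      by (simp add: eline_def evert_def gf_def gxy_def chord_def slp_def ca_def Let_def)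
  qed
qed

text \<open>The multiples below n have to be nonzero: at a zero multiple \<open>gf\<close> has the
  value 1, whereas the quotient in \<open>miller\<close> still contains a vertical line.\<close>

lemma miller_raw:
  fixes P R :: "'c::curve ept"
  assumes "R \<noteq> 0" "P \<noteq> 0" "\<And>k. 0 < k \<Longrightarrow> k < n \<Longrightarrow> nm k P \<noteq> 0"
  shows "miller (crv TYPE('c)) n (raw P) (raw R) = mf n P R"
  using assms(3)
proof (induction n)
  case (Suc n)
  show ?case
  proof (cases "n = 0")
    case False
    then have "nm n P \<noteq> 0" using Suc.prems by simp
    then show ?thesis using False Suc.IH Suc.prems eline_evert_raw[of "nm n P" P R] assms(1,2)
      by (simp add: mf_Suc esmul_raw raw_add[symmetric]) (metis times_divide_eq_right)
  qed (simp add: mf_def)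
qed (simp add: mf_def)

text \<open>With F the curve cubic, the two sides are, up to the same factor, the values of F minus
  the square of either line at the abscissa where the two lines cross, and there the lines agree.
  Expanding in elementary symmetric functions also covers parallel lines.\<close>

lemma line_product_symmetric:
  fixes s c m d x1 x2 x3 z1 z2 z3 :: complex
  assumes "x3 = s^2 - x1 - x2" "z3 = m^2 - z1 - z2"
    "a = x1*x2 + x1*x3 + x2*x3 + 2*s*c" "b = c^2 - x1*x2*x3"
    "a = z1*z2 + z1*z3 + z2*z3 + 2*m*d" "b = d^2 - z1*z2*z3"
  shows "((m-s)*z1 + (d-c))*((m-s)*z2 + (d-c))*((m-s)*z3 + (d-c)) =
    ((m-s)*x1 + (d-c))*((m-s)*x2 + (d-c))*((m-s)*x3 + (d-c))"
proof -
  have cubic: "(u*x1 + v)*(u*x2 + v)*(u*x3 + v) =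
     u^3*(x1*x2*x3) + u^2*v*(x1*x2 + x1*x3 + x2*x3) + u*v^2*(x1+x2+x3) + v^3"
    for u v x1 x2 x3 :: complex by (simp add: ring_normal)
  have X: "x1+x2+x3 = s^2" "x1*x2 + x1*x3 + x2*x3 = a - 2*s*c" "x1*x2*x3 = c^2 - b"
    using assms(1,3,4) by simp_all
  have Z: "z1+z2+z3 = m^2" "z1*z2 + z1*z3 + z2*z3 = a - 2*m*d" "z1*z2*z3 = d^2 - b"
    using assms(2,5,6) by simp_all
  show ?thesis unfolding cubic X Z by (simp add: ring_normal)
qed

text \<open>Weil reciprocity for two lines. At a point of one line the other takes the value of the
  difference of the two lines, up to sign; the three points of each line account for the
  sign.\<close>

lemma chord_reciprocity:
  fixes A B C D :: "'c::curve ept"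
  assumes n: "A \<noteq> 0" "B \<noteq> 0" "A + B \<noteq> 0" "C \<noteq> 0" "D \<noteq> 0" "C + D \<noteq> 0"
  shows "chord A B (px C) (py C) * chord A B (px D) (py D) * chord A B (px (C+D)) (- py (C+D)) =
    - (chord C D (px A) (py A) * chord C D (px B) (py B) * chord C D (px (A+B)) (- py (A+B)))"
proof -
  define s c where "s = slp A B" "c = py A - s * px A"
  define m d where "m = slp C D" "d = py C - m * px C"
  note l = line[OF n(1-3) s_c_def] and l' = line[OF n(4-6) m_d_def]
  have L: "chord A B x y = y - s*x - c" "chord C D x y = y - m*x - d" for x y
    by (simp_all add: chord_def s_c_def m_d_def algebra_simps)
  have 1: "m*x + d - s*x - c = (m-s)*x + (d-c)" "s*x + c - m*x - d = - ((m-s)*x + (d-c))" for x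
    by (simp_all add: algebra_simps)
  show ?thesis
    unfolding L l(1,2,4) l'(1,2,4) minus_minus 1
    using line_product_symmetric[OF l(3) l'(3) l(5,6) l'(5,6)]
    by (simp only: mult_minus_left mult_minus_right minus_minus)
qed

text \<open>Weil reciprocity for two Miller factors. Both have a simple pole at infinity, which is
  the source of the sign. The lines have to be evaluated at \<open>A + B\<close> and
  \<open>C + D\<close>, not at their negatives as in \<open>chord_reciprocity\<close>;
  \<open>line_norm\<close> makes the change.\<close>

lemma gf_reciprocity:
  fixes A B C D :: "'c::curve ept"
  assumes n: "A \<noteq> 0" "B \<noteq> 0" "A + B \<noteq> 0" "C \<noteq> 0" "D \<noteq> 0" "C + D \<noteq> 0"
    and x: "px C \<noteq> px (A+B)" "px D \<noteq> px (A+B)" "px (C+D) \<noteq> px (A+B)"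
      "px A \<noteq> px (C+D)" "px B \<noteq> px (C+D)"
  shows "gf A B C * gf A B D * gf C D (A+B) = - (gf C D A * gf C D B * gf A B (C+D))"
proof -
  let ?l = "\<lambda>R. chord A B (px R) (py R)" and ?m = "\<lambda>R. chord C D (px R) (py R)"
  define u where "u = chord A B (px (C+D)) (- py (C+D))"
  define v where "v = chord C D (px (A+B)) (- py (A+B))"
  have 1: "?l C * ?l D * u = - (?m A * ?m B * v)" unfolding u_def v_def by (rule chord_reciprocity[OF n])
  have 2: "?l (C+D) * u = - ((px (C+D) - px A) * (px (C+D) - px B) * (px (C+D) - px (A+B)))"
    unfolding u_def by (rule line_norm[OF n(1-3) curve_eq[OF n(6)]])
  have 3: "?m (A+B) * v = - ((px (A+B) - px C) * (px (A+B) - px D) * (px (A+B) - px (C+D)))"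
    unfolding v_def by (rule line_norm[OF n(4-6) curve_eq[OF n(3)]])
  have uv: "u \<noteq> 0" "v \<noteq> 0" using 2 3 x by auto
  define P Q where "P = (px (A+B) - px C) * (px (A+B) - px D) * (px (A+B) - px (C+D))"
    and "Q = (px (C+D) - px A) * (px (C+D) - px B) * (px (C+D) - px (A+B))"
  have PQ: "P \<noteq> 0" "Q \<noteq> 0" using x by (auto simp: P_def Q_def)
  have P': "P = (px C - px (A+B)) * (px D - px (A+B)) * (px (A+B) - px (C+D))"
    and Q': "Q = (px A - px (C+D)) * (px B - px (C+D)) * (px (C+D) - px (A+B))"
    by (simp_all add: P_def Q_def algebra_simps)
  have "u * v * (?l C * ?l D * ?m (A+B) * Q) = u * v * (- (?m A * ?m B * ?l (C+D)) * P)"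
    using 1 2 3 unfolding P_def[symmetric] Q_def[symmetric] by Groebner_Basis.algebra
  then have "?l C * ?l D * ?m (A+B) * Q = - (?m A * ?m B * ?l (C+D)) * P"
    using uv mult_left_cancel[of "u * v"] by (metis no_zero_divisors)
  then have e: "?l C * ?l D * ?m (A+B) / P = - (?m A * ?m B * ?l (C+D)) / Q"
    by (simp only: frac_eq_eq[OF PQ])
  have "gf A B C * gf A B D * gf C D (A+B) = ?l C * ?l D * ?m (A+B) / P"
    unfolding P' using n by (simp add: gf_def gxy_def)
  moreover have "gf C D A * gf C D B * gf A B (C+D) = (?m A * ?m B * ?l (C+D)) / Q"
    unfolding Q' using n by (simp add: gf_def gxy_def)
  ultimately show ?thesis using e by simp
qed

text \<open>Here one factor is a vertical line with a double pole at infinity, and the sign of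
  \<open>gf_reciprocity\<close> disappears.\<close>

lemma gf_reciprocity_vertical:
  fixes A C D :: "'c::curve ept"
  assumes n: "A \<noteq> 0" "C \<noteq> 0" "D \<noteq> 0" "C + D \<noteq> 0" and x: "px A \<noteq> px (C+D)"
  shows "gf (- A) A C * gf (- A) A D = gf C D (- A) * gf C D A * gf (- A) A (C+D)"
proof -
  define t where "t = px A - px (C+D)"
  have t: "t \<noteq> 0" using x by (simp add: t_def)
  have "chord C D (px A) (py A) * chord C D (px A) (- py A) = - ((px A - px C) * (px A - px D) * t)"
    unfolding t_def by (rule line_norm[OF n(2-4) curve_eq[OF n(1)]])
  then have "gf C D (- A) * gf C D A = - ((px A - px C) * (px A - px D) * t) / (t * t)"
    using n by (simp add: gf_def gxy_def py_uminus t_def mult.commute)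
  moreover have "gf (- A) A R = px R - px A" for R using n by (simp add: gf_def gxy_def)
  ultimately show ?thesis using t by (simp add: t_def[symmetric] divide_simps)
    (simp add: t_def ring_normal)
qed

section \<open>Miller functions as functions of their base point\<close>

lemma gf_four_half:
  assumes R: "R \<noteq> 0" "\<And>Z. Z \<in> tor p \<Longrightarrow> off Z R" and T: "a \<in> tor p" "b \<in> tor p" "c \<in> tor p" "d \<in> tor p"
  shows "gf a b R * gf c d R * gf (a+b) (c+d) R = gf b c R * gf (b+c) d R * gf a (b+c+d) R"
proof -
  have "gf a b R * gf (a+b) (c+d) R = gf b (c+d) R * gf a (b+(c+d)) R"
    by (intro gf_cocycle R tor_plus T)
  moreover have "gf b c R * gf (b+c) d R = gf c d R * gf b (c+d) R"
    by (intro gf_cocycle R tor_plus T)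
  ultimately show ?thesis unfolding add.assoc by Groebner_Basis.algebra
qed

text \<open>The form given by \<open>gf_four_half\<close> is symmetric in b and c because
  \<open>gf\<close> is commutative.\<close>

lemma gf_four:
  assumes R: "R \<noteq> 0" "\<And>Z. Z \<in> tor p \<Longrightarrow> off Z R" and T: "a \<in> tor p" "b \<in> tor p" "c \<in> tor p" "d \<in> tor p"
  shows "gf a b R * gf c d R * gf (a+b) (c+d) R = gf a c R * gf b d R * gf (a+c) (b+d) R"
proof -
  have "gf a b R * gf c d R * gf (a+b) (c+d) R = gf b c R * gf (b+c) d R * gf a (b+c+d) R"
    by (rule gf_four_half[OF assms])
  also have "\<dots> = gf c b R * gf (c+b) d R * gf a (c+b+d) R"
    by (simp only: gf_commute[of c b] add.commute[of c b])
  also have "\<dots> = gf a c R * gf b d R * gf (a+c) (b+d) R"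
    by (rule gf_four_half[OF R T(1,3,2,4), symmetric])
  finally show ?thesis .
qed

text \<open>Both sides have divisor n(A) + n(B) - (nA + nB) - (2n - 1)(O). The induction step is the
  exchange law for the four points nA, nB, A, B.\<close>

lemma mf_power:
  assumes R: "R \<noteq> 0" "\<And>Z. Z \<in> tor p \<Longrightarrow> off Z R" and T: "A \<in> tor p" "B \<in> tor p" and "n > 0"
  shows "mf n (A+B) R * gf A B R ^ n = mf n A R * mf n B R * gf (nm n A) (nm n B) R"
  using \<open>n > 0\<close>
proof (induction n)
  case (Suc n)
  show ?case
  proof (cases "n = 0")
    case False
    have "mf (Suc n) (A+B) R * gf A B R ^ Suc n =
        (mf n (A+B) R * gf A B R ^ n) * gf A B R * gf (nm n A + nm n B) (A + B) R"
      using False by (simp add: mf_Suc nm_plus)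
    also have "\<dots> = mf n A R * mf n B R * (gf (nm n A) (nm n B) R * gf A B R * gf (nm n A + nm n B) (A + B) R)"
      using Suc False by simp
    also have "\<dots> = mf n A R * mf n B R * (gf (nm n A) A R * gf (nm n B) B R * gf (nm n A + A) (nm n B + B) R)"
      by (subst gf_four[OF R]) (use T tor_nm in auto)
    also have "\<dots> = mf (Suc n) A R * mf (Suc n) B R * gf (nm (Suc n) A) (nm (Suc n) B) R"
      using False by (simp add: mf_Suc add.commute)
    finally show ?thesis .
  qed simp
qed simp

lemma mf_tor_generic:
  fixes A B R :: "'c::curve ept"
  assumes "R \<notin> tor p" "A \<in> tor p" "B \<in> tor p" "p > 0"
  shows "mf p (A+B) R * gf A B R ^ p = mf p A R * mf p B R"
proof -
  have R: "R \<noteq> 0" using assms(1) by auto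
  have "off Z R" if "Z \<in> tor p" for Z using that assms(1) tor_uminus[OF that] R
    by (auto simp: off_iff)
  from mf_power[OF R this assms(2-4)] show ?thesis using assms(2,3) by (simp add: tor_def gf_def gxy_def)
qed

section \<open>Evaluation at torsion points by continuity\<close>

lemma tendsto_gxy:
  assumes "(f \<longlongrightarrow> x) F" "(h \<longlongrightarrow> y) F" "A + B = 0 \<or> x \<noteq> px (A + B)"
  shows "((\<lambda>k. gxy A B (f k) (h k)) \<longlongrightarrow> gxy A B x y) F"
  unfolding gxy_def chord_def using assms
  by (auto intro!: tendsto_intros split: if_splits)

lemma tendsto_mxy:
  assumes "(f \<longlongrightarrow> x) F" "(h \<longlongrightarrow> y) F" "\<And>k. nm k A = 0 \<or> x \<noteq> px (nm k A)"
  shows "((\<lambda>k. mxy n A (f k) (h k)) \<longlongrightarrow> mxy n A x y) F"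
proof (induction n)
  case (Suc n)
  have "((\<lambda>k. gxy (nm n A) A (f k) (h k)) \<longlongrightarrow> gxy (nm n A) A x y) F"
    using assms(3)[of "Suc n"] by (intro tendsto_gxy assms) (simp add: add.commute)
  then show ?case using Suc by (auto intro!: tendsto_intros)
qed simp

text \<open>Of the two ordinates y the one nearer to y0 = \<open>py P\<close> is taken; then
  \<open>|y - y0|^2\<close> is at most \<open>|y - y0| * |y + y0| = |y^2 - y0^2|\<close>.\<close>

lemma ex_point_near:
  fixes P :: "'c::curve ept"
  assumes "P \<noteq> 0"
  shows "\<exists>X::'c ept. X \<noteq> 0 \<and> px X = x \<and>
    norm (py X - py P)^2 \<le> norm ((x^3 + ca TYPE('c) * x + cb TYPE('c)) - (py P)^2)"
proof -
  obtain X :: "'c ept" where X: "X \<noteq> 0" "px X = x" using ex_point by blast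
  define Y where "Y = (if norm (py X - py P) \<le> norm (py X + py P) then X else - X)"
  have Y: "Y \<noteq> 0" "px Y = x" using X by (auto simp: Y_def)
  have "norm (py Y - py P) \<le> norm (py Y + py P)"
    using X by (auto simp: Y_def py_uminus norm_minus_commute)
      (metis add.commute dual_order.trans linear minus_add_distrib norm_minus_cancel uminus_add_conv_diff)
  then have "norm (py Y - py P)^2 \<le> norm (py Y - py P) * norm (py Y + py P)"
    unfolding power2_eq_square by (intro mult_left_mono) auto
  also have "\<dots> = norm ((py Y)^2 - (py P)^2)"
    unfolding norm_mult[symmetric] by (simp add: ring_normal)
  finally show ?thesis using Y curve_eq[OF Y(1)] by auto
qed

lemma approach:
  fixes P :: "'c::curve ept"
  assumes "P \<noteq> 0" "finite S"
  obtains R :: "nat \<Rightarrow> 'c ept" where "\<And>k. R k \<noteq> 0" "(\<lambda>k. px (R k)) \<longlonglongrightarrow> px P"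
    "(\<lambda>k. py (R k)) \<longlonglongrightarrow> py P" "\<forall>\<^sub>F k in sequentially. R k \<notin> S"
proof -
  define xs where "xs k = px P + inverse (of_nat (Suc k))" for k
  define e where "e k = norm ((xs k^3 + ca TYPE('c) * xs k + cb TYPE('c)) - (py P)^2)" for k
  have xs: "xs \<longlonglongrightarrow> px P" unfolding xs_def
    using tendsto_add[OF tendsto_const LIMSEQ_inverse_real_of_nat[THEN tendsto_of_real, where 'a=complex]]
    by (simp add: of_real_inverse)
  have "e \<longlonglongrightarrow> norm ((px P^3 + ca TYPE('c) * px P + cb TYPE('c)) - (py P)^2)"
    unfolding e_def by (intro tendsto_intros xs)
  then have e0: "e \<longlonglongrightarrow> 0" using curve_eq[OF assms(1)] by simp
  have "\<forall>k. \<exists>X::'c ept. X \<noteq> 0 \<and> px X = xs k \<and> norm (py X - py P)^2 \<le> e k"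
    using ex_point_near[OF assms(1)] unfolding e_def by blast
  from choice[OF this] obtain R :: "nat \<Rightarrow> 'c ept" where R: "\<And>k. R k \<noteq> 0" "\<And>k. px (R k) = xs k"
      "\<And>k. norm (py (R k) - py P)^2 \<le> e k" by blast
  have "(\<lambda>k. norm (py (R k) - py P)^2) \<longlonglongrightarrow> 0"
    by (rule tendsto_sandwich[OF _ _ tendsto_const e0]) (use R(3) in auto)
  then have "(\<lambda>k. sqrt (norm (py (R k) - py P)^2)) \<longlonglongrightarrow> sqrt 0"
    by (intro tendsto_intros)
  then have y: "(\<lambda>k. py (R k)) \<longlonglongrightarrow> py P"
    by (simp add: tendsto_norm_zero_iff LIM_zero_iff)
  have "inj xs" unfolding xs_def by (auto intro!: injI simp: of_nat_eq_iff simp del: of_nat_Suc)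
  then have "inj R" using R(2) by (metis injD injI)
  then have "finite (R -` S)" using assms(2) by (rule finite_vimageI[rotated])
  then have "\<forall>\<^sub>F k in sequentially. R k \<notin> S"
    using eventually_cofinite[of "\<lambda>k. R k \<notin> S"] by (simp add: vimage_def cofinite_eq_sequentially)
  then show thesis using that[OF R(1) _ y] xs R(2) by simp
qed

text \<open>The cocycle derivation passes through combinations of A and B that may equal P or
  \<open>- P\<close>, where single factors degenerate although both sides of the identity are
  regular at P. The identity is therefore proved at points outside the torsion and carried to P by
  continuity.\<close>

lemma mf_tor:
  fixes A B P :: "'c::curve ept"
  assumes f: "finite (tor p :: 'c ept set)" and T: "A \<in> tor p" "B \<in> tor p" "p > 0"
    and P: "P \<notin> mults A" "P \<notin> mults B" "P \<notin> mults (A + B)"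
  shows "mf p (A+B) P * gf A B P ^ p = mf p A P * mf p B P"
proof -
  have P0: "P \<noteq> 0" using P(1) by auto
  have AB: "A + B \<in> tor p" by (intro tor_plus T)
  have x: "nm k Z = 0 \<or> px P \<noteq> px (nm k Z)" if "P \<notin> mults Z" "Z \<in> tor p" for k Z
    using off_mults[OF that(2) T(3) that(1) mults_nm] by (simp add: off_def)
  obtain R :: "nat \<Rightarrow> 'c ept" where R: "\<And>k. R k \<noteq> 0" "(\<lambda>k. px (R k)) \<longlonglongrightarrow> px P"
    "(\<lambda>k. py (R k)) \<longlonglongrightarrow> py P" "\<forall>\<^sub>F k in sequentially. R k \<notin> tor p"
    using approach[OF P0 f] by metis
  have 1: "(\<lambda>k. mf p (A+B) (R k) * gf A B (R k) ^ p) \<longlonglongrightarrow> mf p (A+B) P * gf A B P ^ p"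
    unfolding mf_def gf_def
    by (intro tendsto_intros tendsto_mxy tendsto_gxy R x[OF P(3) AB]) (use x[OF P(3) AB, of 1] in simp)
  have 2: "(\<lambda>k. mf p A (R k) * mf p B (R k)) \<longlonglongrightarrow> mf p A P * mf p B P"
    unfolding mf_def by (intro tendsto_intros tendsto_mxy R x P T)
  have "\<forall>\<^sub>F k in sequentially. mf p (A+B) (R k) * gf A B (R k) ^ p = mf p A (R k) * mf p B (R k)"
    using R(4) by (rule eventually_mono) (rule mf_tor_generic[OF _ T])
  from Lim_transform_eventually[OF 1 this] 2 show ?thesis using LIMSEQ_unique by blast
qed

lemma mult_step:
  fixes mC mD gA e G M u v w g t :: complex
  assumes "mC*mD*gA = e*G*M" "u*v*w = - (gA*g*t)"
  shows "gA*((mC*u)*(mD*v)*w) = gA*((-1*e)*(g*G)*(M*t))"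
  using assms by Groebner_Basis.algebra

lemma mult_step':
  fixes mC mD gA e G M u v g t :: complex
  assumes "mC*mD*gA = e*G*M" "u*v = gA*g*t"
  shows "gA*((mC*u)*(mD*v)) = gA*((-1*(-1*e))*(g*G)*(M*t))"
  using assms by Groebner_Basis.algebra

text \<open>Weil reciprocity is applied at every factor of Miller's recursion. The quantity carried
  along contains the extra value of \<open>gf C D\<close> at the current multiple of P, which
  reciprocity trades for the value at the next multiple.\<close>

lemma mf_add:
  fixes P C D :: "'c::curve ept"
  assumes p: "prime p" and P: "P \<in> tor p" "P \<noteq> 0"
    and o: "C \<notin> mults P" "D \<notin> mults P" "C + D \<notin> mults P"
  shows "mf p P C * mf p P D = (-1)^p * gf C D P ^ p * mf p P (C + D)"
proof -
  have p0: "p > 0" "p \<ge> 2" using p prime_gt_0_nat prime_ge_2_nat by auto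
  have n: "C \<noteq> 0" "D \<noteq> 0" "C + D \<noteq> 0" using o by auto
  have off: "off X C" "off X D" "off X (C + D)" if "X \<in> mults P" for X
    using off_mults[OF P(1) p0(1)] o that by blast+
  have x: "px X \<noteq> px C" "px X \<noteq> px D" "px X \<noteq> px (C + D)" if "X \<in> mults P" "X \<noteq> 0" for X
    using off[OF that(1)] that(2) by (auto simp: off_def)
  have g0: "gf C D X \<noteq> 0" if "X \<in> mults P" "X \<noteq> 0" for X
    using x[OF that] that n by (intro gf_nonzero) (auto simp: off_def)
  have st: "mf (Suc n) P C * mf (Suc n) P D * gf C D (nm (Suc n) P) =
      (-1)^n * gf C D P ^ Suc n * mf (Suc n) P (C + D)" if "Suc n < p" for n
    using that
  proof (induction n)
    case (Suc n)
    define A where "A = nm (Suc n) P"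
    have A: "A \<noteq> 0" "A + P \<noteq> 0" "A \<in> mults P" "A + P \<in> mults P"
      using nm_nonzero[OF p P, of "Suc n"] nm_nonzero[OF p P, of "Suc (Suc n)"] Suc.prems
      by (auto simp: A_def add.commute[of _ P] simp del: nm.simps) 
       (metis add.commute mults_nm nm.simps(2))+
    have IH: "mf (Suc n) P C * mf (Suc n) P D * gf C D A = (-1)^n * gf C D P ^ Suc n * mf (Suc n) P (C + D)"
      using Suc by (simp add: A_def)
    have r: "gf A P C * gf A P D * gf C D (A+P) = - (gf C D A * gf C D P * gf A P (C+D))"
      using gf_reciprocity[of A P C D] A P n x[OF A(4,2)] x[OF A(3,1)] x[OF mults_self P(2)] by metis
    have "gf C D A * (mf (Suc (Suc n)) P C * mf (Suc (Suc n)) P D * gf C D (A + P)) =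
       gf C D A * ((-1)^Suc n * gf C D P ^ Suc (Suc n) * mf (Suc (Suc n)) P (C + D))"
      unfolding mf_Suc[OF zero_less_Suc] A_def[symmetric] power_Suc[of _ "Suc n"] power_Suc[of "-1" n]
      by (rule mult_step[OF IH r])
    then have "mf (Suc (Suc n)) P C * mf (Suc (Suc n)) P D * gf C D (A + P) =
       (-1)^Suc n * gf C D P ^ Suc (Suc n) * mf (Suc (Suc n)) P (C + D)"
      using g0[OF A(3,1)] mult_left_cancel by blast
    then show ?case by (simp only: A_def nm.simps(2)[of "Suc n"] add.commute)
  qed simp
  \<comment> \<open>The last step adds P to \<open>- P\<close>, the (p - 1)-fold multiple: a
    vertical line, without sign. The p - 2 earlier signs give \<open>(-1)^p\<close>.\<close>
  obtain n where n1: "p = Suc (Suc n)" using p0 by (metis One_nat_def Suc_1 Suc_le_D Suc_le_mono)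
  define A where "A = nm (Suc n) P"
  have "A + P = 0" using P(1) n1 by (simp add: A_def tor_def add.commute)
  then have A: "A = - P" by (simp add: eq_neg_iff_add_eq_0)
  have Am: "A \<in> mults P" "A \<noteq> 0" unfolding A_def by (rule mults_nm) (use A P A_def in simp)
  have IH: "mf (Suc n) P C * mf (Suc n) P D * gf C D A = (-1)^n * gf C D P ^ Suc n * mf (Suc n) P (C + D)"
    using st[of n] n1 by (simp add: A_def)
  have r: "gf A P C * gf A P D = gf C D A * gf C D P * gf A P (C + D)"
    using gf_reciprocity_vertical[of P C D] A P n x[OF mults_self P(2)] by metis
  have "gf C D A * (mf p P C * mf p P D) = gf C D A * ((-1)^p * gf C D P ^ p * mf p P (C + D))"
    unfolding n1 mf_Suc[OF zero_less_Suc] A_def[symmetric] power_Suc[of _ "Suc n"] power_Suc[of "-1" n]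
    by (rule mult_step'[OF IH r])
  then show ?thesis using g0[OF Am] mult_left_cancel by blast
qed

section \<open>The Weil pairing on the point type: antisymmetry and additivity off a line\<close>

definition wp :: "nat \<Rightarrow> 'c::curve ept \<Rightarrow> 'c ept \<Rightarrow> complex" where
  "wp p P Q = weil (crv TYPE('c)) p (raw P) (raw Q)"

lemma wp_dependent: "P = 0 \<or> Q \<in> mults P \<Longrightarrow> wp p P Q = 1"
  by (auto simp: wp_def weil_def esmul_raw mults_def)

lemma mf_nonzero:
  fixes P Q :: "'c::curve ept"
  assumes "P \<in> tor p" "p > 0" "Q \<notin> mults P"
  shows "mf n P Q \<noteq> 0"
proof (induction n)
  case (Suc n)
  have "Q \<noteq> 0" using assms(3) by auto
  then have "gf (nm n P) P Q \<noteq> 0"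
    by (intro gf_nonzero off_mults[OF assms] mults_plus) simp_all
  then show ?case using Suc by (cases "n = 0") (simp_all add: mf_Suc)
qed (simp add: mf_def)

lemma wp_independent:
  fixes P Q :: "'c::curve ept"
  assumes p: "prime p" and T: "P \<in> tor p" "Q \<in> tor p" and n: "P \<noteq> 0" "Q \<notin> mults P"
  shows "wp p P Q = (-1)^p * mf p P Q / mf p Q P"
proof -
  have Q: "Q \<noteq> 0" using n by auto
  have "\<not> (\<exists>k. raw Q = esmul (crv TYPE('c)) k (raw P))"
    using n(2) by (auto simp: esmul_raw raw_inject mults_def)
  then show ?thesis using n Q miller_raw[OF Q n(1) nm_nonzero[OF p T(1) n(1)]]
      miller_raw[OF n(1) Q nm_nonzero[OF p T(2) Q]]
    by (simp add: wp_def weil_def)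
qed

text \<open>Reciprocity in the numerator and the cocycle relation in the denominator produce the
  same power of \<open>gf Q Q' P\<close>, which cancels; the sign \<open>(-1)^p\<close> left over is
  the one in Miller's formula.\<close>

lemma wp_add_off:
  fixes P Q Q' :: "'c::curve ept"
  assumes p: "prime p" "finite (tor p :: 'c ept set)" and T: "P \<in> tor p" "Q \<in> tor p" "Q' \<in> tor p"
    and n: "P \<noteq> 0" "Q \<notin> mults P" "Q' \<notin> mults P" "Q + Q' \<notin> mults P"
  shows "wp p P (Q + Q') = wp p P Q * wp p P Q'"
proof -
  have p0: "p > 0" using p prime_gt_0_nat by blast
  have T': "Q + Q' \<in> tor p" by (intro tor_plus T)
  have m: "P \<notin> mults Q" "P \<notin> mults Q'" "P \<notin> mults (Q + Q')"
    using mults_sym[OF p(1)] T T' n by blast+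
  have nz: "mf p Q P \<noteq> 0" "mf p Q' P \<noteq> 0" "mf p (Q + Q') P \<noteq> 0"
    using mf_nonzero m T T' p0 by blast+
  have "gf Q Q' P \<noteq> 0"
  proof (rule gf_nonzero[OF n(1)])
    show "off Q P" "off Q' P" "off (Q + Q') P"
      using off_mults[OF _ p0] m T T' mults_self by blast+
  qed
  moreover have "mf p (Q + Q') P * gf Q Q' P ^ p = mf p Q P * mf p Q' P"
    by (rule mf_tor[OF p(2) T(2,3) p0 m])
  moreover have "mf p P Q * mf p P Q' = (-1)^p * gf Q Q' P ^ p * mf p P (Q + Q')"
    by (rule mf_add[OF p(1) T(1) n])
  moreover have "((-1)^p * (-1)^p :: complex) = 1" by (simp flip: power_mult_distrib)
  ultimately show ?thesis
    unfolding wp_independent[OF p(1) T(1,2) n(1,2)] wp_independent[OF p(1) T(1,3) n(1,3)]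
      wp_independent[OF p(1) T(1) T' n(1,4)] using nz
    by (simp add: field_simps)
qed

lemma wp_nonzero:
  assumes "prime p" "P \<in> tor p" "Q \<in> tor p" shows "wp p P Q \<noteq> 0"
proof (cases "P = 0 \<or> Q \<in> mults P")
  case False
  then have "P \<notin> mults Q" using mults_sym assms by blast
  then have "mf p P Q \<noteq> 0" "mf p Q P \<noteq> 0" using mf_nonzero False assms prime_gt_0_nat by blast+
  then show ?thesis using False wp_independent[OF assms] by auto
qed (simp add: wp_dependent)

lemma wp_antisym:
  assumes "prime p" "P \<in> tor p" "Q \<in> tor p" shows "wp p Q P = 1 / wp p P Q"
proof (cases "P = 0 \<or> Q = 0 \<or> Q \<in> mults P")
  case True
  then have "Q = 0 \<or> P \<in> mults Q" using mults_sym assms by (metis mults_0)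
  moreover have "P = 0 \<or> Q \<in> mults P" using True by auto
  ultimately show ?thesis by (simp add: wp_dependent)
next
  case False
  then have "P \<notin> mults Q" using mults_sym assms by blast
  then have "mf p P Q \<noteq> 0" "mf p Q P \<noteq> 0" using mf_nonzero False assms prime_gt_0_nat by blast+
  moreover have "wp p P Q = (-1)^p * mf p P Q / mf p Q P" "wp p Q P = (-1)^p * mf p Q P / mf p P Q"
    using False wp_independent[OF assms] wp_independent[OF assms(1,3,2)] \<open>P \<notin> mults Q\<close> by auto
  moreover have "((-1)^p * (-1)^p :: complex) = 1" by (simp flip: power_mult_distrib)
  ultimately have "wp p Q P * wp p P Q = 1" by simp
  then show ?thesis by (rule eq_divide_imp[OF wp_nonzero[OF assms]])
qed

text \<open>What is known of the pairing so far, on an abstract group: additivity only where all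
  three arguments avoid the multiples of P. The passage to full bilinearity for p other than 3 uses
  nothing else about curves.\<close>

locale off_line_additive =
  fixes p :: nat and B :: "'a::ab_group_add \<Rightarrow> 'a \<Rightarrow> complex"
  assumes p: "prime p" "odd p"
    and dep: "P = 0 \<or> Q \<in> mults P \<Longrightarrow> B P Q = 1"
    and nz: "P \<in> tor p \<Longrightarrow> Q \<in> tor p \<Longrightarrow> B P Q \<noteq> 0"
    and anti: "P \<in> tor p \<Longrightarrow> Q \<in> tor p \<Longrightarrow> B Q P = 1 / B P Q"
    and add: "P \<in> tor p \<Longrightarrow> Q \<in> tor p \<Longrightarrow> Q' \<in> tor p \<Longrightarrow> P \<noteq> 0 \<Longrightarrow> Q \<notin> mults P \<Longrightarrow>
      Q' \<notin> mults P \<Longrightarrow> Q + Q' \<notin> mults P \<Longrightarrow> B P (Q + Q') = B P Q * B P Q'"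
begin

lemma mults_shift:
  assumes "P \<in> tor p" "X \<in> mults P" shows "Q + X \<in> mults P \<longleftrightarrow> Q \<in> mults P"
proof -
  have "- X \<in> mults P" using mults_uminus assms p prime_gt_0_nat by blast
  then show ?thesis using mults_plus[of "Q + X" P "- X"] mults_plus[of Q P X] assms by auto
qed

lemma mults_uminus_iff: "P \<in> tor p \<Longrightarrow> - Q \<in> mults P \<longleftrightarrow> Q \<in> mults P"
  using mults_uminus[of P p] p prime_gt_0_nat by (metis minus_minus)

lemma mults_cancel:
  assumes "P \<in> tor p" "Q \<in> tor p" "\<not> p dvd k" shows "nm k Q \<in> mults P \<longleftrightarrow> Q \<in> mults P"
proof
  assume k: "nm k Q \<in> mults P"
  obtain j where j: "nm k Q = nm j P" using k by (auto simp: mults_def)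
  have "coprime k p" using prime_imp_coprime[OF p(1) assms(3)] coprime_commute by blast
  then obtain m where "[k * m = Suc 0] (mod p)" using cong_solve_coprime_nat[of k p] by blast
  then have "nm (m * k) Q = nm (Suc 0) Q"
    using nm_mod[of p Q "m * k"] nm_mod[of p Q "Suc 0"] assms(2)
    by (simp add: tor_def cong_def mult.commute)
  then have "Q = nm (m * j) P" by (simp add: nm_mult j)
  then show "Q \<in> mults P" by simp
next
  assume "Q \<in> mults P" then show "nm k Q \<in> mults P" by (auto simp: mults_def simp flip: nm_mult)
qed

lemma double_off: "P \<in> tor p \<Longrightarrow> Q \<in> tor p \<Longrightarrow> Q + Q \<in> mults P \<longleftrightarrow> Q \<in> mults P"
proof -
  assume "P \<in> tor p" "Q \<in> tor p"
  moreover have "\<not> p dvd 2" using p by (metis dvd_refl prime_ge_2_nat two_is_prime_nat primes_dvd_imp_eq)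
  ultimately show ?thesis using mults_cancel[of P Q 2] by (simp add: numeral_2_eq_2)
qed

text \<open>The point \<open>- Q\<close> is reached through Q = 2Q + (-Q); the double stays off the
  multiples of P because p is odd.\<close>

lemma uminus_off:
  assumes "P \<in> tor p" "Q \<in> tor p" "Q \<notin> mults P" shows "B P (- Q) = 1 / B P Q"
proof -
  have "B P Q = B P (Q + Q) * B P (- Q)" if "P \<noteq> 0"
    using add[of P "Q + Q" "- Q"] assms that by (auto simp: double_off mults_uminus_iff tor_plus tor_uminus)
  moreover have "B P (Q + Q) = B P Q * B P Q" if "P \<noteq> 0"
    using add[of P Q Q] assms that by (auto simp: double_off)
  ultimately show ?thesis using nz[OF assms(1,2)] by (cases "P = 0") (auto simp: dep field_simps)
qed

definition bilinear_on_tor :: bool where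
  "bilinear_on_tor \<longleftrightarrow> (\<forall>P\<in>tor p. \<forall>Q\<in>tor p. \<forall>Q'\<in>tor p. B P (Q + Q') = B P Q * B P Q')"

text \<open>If adding P does not change the value, an argument off the multiples of P can be moved
  within its coset, and the cases excluded by \<open>add\<close> reduce to permitted ones or to
  \<open>uminus_off\<close>. Kept apart because p = 3 obtains the invariance in another way.\<close>

lemma bilinear_if_shift_invariant:
  assumes inv: "\<And>P Q. P \<in> tor p \<Longrightarrow> Q \<in> tor p \<Longrightarrow> Q \<notin> mults P \<Longrightarrow> B P (Q + P) = B P Q"
  shows "bilinear_on_tor"
  unfolding bilinear_on_tor_def
proof (intro ballI)
  fix P Q Q' :: 'a assume T: "P \<in> tor p" "Q \<in> tor p" "Q' \<in> tor p"
  have inv': "B P (X + nm k P) = B P X" if "X \<in> tor p" "X \<notin> mults P" for k X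
  proof (induction k)
    case (Suc k)
    have "B P (X + nm k P + P) = B P (X + nm k P)"
      using inv[of P "X + nm k P"] that T by (auto simp: tor_plus tor_nm mults_shift)
    then show ?case using Suc by (simp add: algebra_simps)
  qed simp
  show "B P (Q + Q') = B P Q * B P Q'"
  proof (cases "P = 0 \<or> Q \<in> mults P \<or> Q' \<in> mults P")
    case True
    then consider "P = 0" | k where "Q = nm k P" | k where "Q' = nm k P" by (auto simp: mults_def)
    then show ?thesis
    proof cases
      case 2
      then show ?thesis using inv'[of Q' k] T mults_shift[of P Q Q'] dep[of P Q] dep[of P "Q + Q'"] dep[of P Q']
        by (cases "Q' \<in> mults P") (auto simp: add.commute)
    next
      case 3
      then show ?thesis using inv'[of Q k] T mults_shift[of P Q' Q] dep[of P Q] dep[of P "Q + Q'"] dep[of P Q']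
        by (cases "Q \<in> mults P") (auto simp: add.commute)
    qed (simp add: dep)
  next
    case False
    show ?thesis
    proof (cases "Q + Q' \<in> mults P")
      case True
      then obtain k where "Q + Q' = nm k P" by (auto simp: mults_def)
      then have "Q' = - Q + nm k P" by (simp add: algebra_simps)
      then have "B P Q' = B P (- Q)" using inv'[of "- Q" k] T False by (auto simp: tor_uminus mults_uminus_iff)
      then show ?thesis using uminus_off[of P Q] T False dep True nz by auto
    next
      case o: False
      then show ?thesis using add T False by blast
    qed
  qed
qed

text \<open>Splitting the argument \<open>Q + Q' + P\<close> in two ways compares the ratios at Q
  and at Q'. If \<open>Q + Q'\<close> is a multiple of P, the comparison goes through 2Q; this needs
  3Q off the multiples of P, hence p different from 3.\<close>

lemma shift_ratio:
  assumes "p \<noteq> 3" and T: "P \<in> tor p" "Q \<in> tor p" "Q' \<in> tor p" and o: "P \<noteq> 0" "Q \<notin> mults P" "Q' \<notin> mults P"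
  shows "B P (Q + P) * B P Q' = B P Q * B P (Q' + P)"
proof -
  have 1: "B P (X + P) * B P Y = B P X * B P (Y + P)"
    if "X \<in> tor p" "Y \<in> tor p" "X \<notin> mults P" "Y \<notin> mults P" "X + Y \<notin> mults P" for X Y
  proof -
    have "B P (X + P) * B P Y = B P (X + P + Y)"
      using add[of P "X + P" Y] that T o mults_shift[of P P X] mults_shift[of P P "X + Y"]
        tor_plus[of P p X]
      by (simp add: algebra_simps)
    moreover have "B P X * B P (Y + P) = B P (X + (Y + P))"
      using add[of P X "Y + P"] that T o mults_shift[of P P Y] mults_shift[of P P "X + Y"]
        tor_plus[of P p Y]
      by (simp add: algebra_simps)
    ultimately show ?thesis by (simp add: algebra_simps)
  qed
  show ?thesis
  proof (cases "Q + Q' \<in> mults P")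
    case True
    define R where "R = Q + Q"
    have "\<not> p dvd 3" using p assms(1) primes_dvd_imp_eq[of p 3] by auto
    then have "Q + R \<notin> mults P" using mults_cancel[of P Q 3] T o
      by (simp add: R_def numeral_3_eq_3)
    moreover have "R \<notin> mults P" "R \<in> tor p" using double_off T o tor_plus by (auto simp: R_def)
    moreover have "Q' + R \<notin> mults P"
      using mults_shift[OF T(1) True, of Q] o by (simp add: R_def algebra_simps)
    ultimately have "B P (Q + P) * B P R = B P Q * B P (R + P)" "B P (Q' + P) * B P R = B P Q' * B P (R + P)"
      using 1 T o by auto
    then have "B P R * (B P (Q + P) * B P Q') = B P R * (B P Q * B P (Q' + P))"
      by Groebner_Basis.algebra
    moreover have "B P R \<noteq> 0" using nz T \<open>R \<in> tor p\<close> by blast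
    ultimately show ?thesis by simp
  next
    case False
    then show ?thesis using 1 T o by blast
  qed
qed

text \<open>The defect \<open>c P\<close> of invariance under \<open>Q \<mapsto> Q + P\<close> satisfies \<open>c P c Q c (P + Q) = 1\<close>,
  so it is constant and its cube and its \<open>p\<close>-th power are \<open>1\<close>.\<close>

definition c :: "'a \<Rightarrow> complex" where
  "c P = (let Q = (SOME Q. Q \<in> tor p \<and> Q \<notin> mults P) in B P (Q + P) / B P Q)"

lemma c_eq:
  assumes "p \<noteq> 3" "P \<in> tor p" "Q \<in> tor p" "P \<noteq> 0" "Q \<notin> mults P"
  shows "B P (Q + P) = c P * B P Q"
proof -
  define R where "R = (SOME Q. Q \<in> tor p \<and> Q \<notin> mults P)"
  have R: "R \<in> tor p" "R \<notin> mults P" using someI[of "\<lambda>Q. Q \<in> tor p \<and> Q \<notin> mults P" Q] assms by (auto simp: R_def)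
  have "c P = B P (R + P) / B P R" unfolding c_def R_def Let_def ..
  then have "c P * B P R = B P (R + P)" using nz[OF assms(2) R(1)] by simp
  then have "B P R * B P (Q + P) = B P R * (c P * B P Q)"
    using shift_ratio[OF assms(1,2,3) R(1) assms(4,5) R(2)] by (metis mult.assoc mult.commute)
  then show ?thesis using nz[OF assms(2) R(1)] by simp
qed

lemma c_power:
  assumes "p \<noteq> 3" "P \<in> tor p" "Q \<in> tor p" "P \<noteq> 0" "Q \<notin> mults P"
  shows "c P ^ p = 1"
proof -
  have "B P (Q + nm k P) = c P ^ k * B P Q" for k
  proof (induction k)
    case (Suc k)
    have "B P (Q + nm k P + P) = c P * B P (Q + nm k P)"
      using c_eq[of P "Q + nm k P"] assms by (auto simp: tor_plus tor_nm mults_shift)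
    then show ?case using Suc by (simp add: algebra_simps)
  qed simp
  from this[of p] show ?thesis using assms nz[of P Q] by (simp add: tor_def)
qed

lemma independent:
  assumes T: "P \<in> tor p" "Q \<in> tor p" and o: "P \<noteq> 0" "Q \<notin> mults P"
  shows "Q \<noteq> 0" "P \<notin> mults Q" "P + Q \<in> tor p" "P + Q \<noteq> 0" "P + Q \<notin> mults P" "P \<notin> mults (P + Q)"
    "P + Q \<notin> mults Q" "Q \<notin> mults (P + Q)"
proof -
  show Q0: "Q \<noteq> 0" using o by auto
  show PQ: "P \<notin> mults Q" using mults_sym[OF p(1)] T o by blast
  show T': "P + Q \<in> tor p" using T tor_plus by blast
  show 1: "P + Q \<notin> mults P" using mults_shift[OF T(1) mults_self, of Q] o by (simp add: add.commute)
  show 2: "P + Q \<notin> mults Q" using mults_shift[OF T(2) mults_self, of P] PQ by simp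
  show "P + Q \<noteq> 0" using 1 by auto
  show "P \<notin> mults (P + Q)" "Q \<notin> mults (P + Q)" using mults_sym[OF p(1)] T T' o Q0 1 2 by blast+
qed

text \<open>In the triangle P, Q, S = P + Q the value at (P, S) is \<open>c P\<close> times that at
  (P, Q). Writing P as S - Q and using antisymmetry expresses its inverse by \<open>c S\<close>,
  \<open>c Q\<close> and the same value.\<close>

lemma c_product:
  assumes "p \<noteq> 3" and T: "P \<in> tor p" "Q \<in> tor p" and o: "P \<noteq> 0" "Q \<notin> mults P"
  shows "c P * c Q * c (P + Q) = 1"
proof -
  note i = independent[OF T o]
  define S where "S = P + Q"
  note i = i[folded S_def]
  have "B P S = c P * B P Q" using c_eq[OF assms(1) T o] by (simp add: S_def add.commute)
  moreover have "B Q S = c Q * B Q P" using c_eq[OF assms(1) T(2,1) i(1,2)] by (simp add: S_def)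
  moreover have "B S P = c S * B S (- Q)"
    using c_eq[OF assms(1) i(3) tor_uminus[OF T(2)] i(4)] mults_uminus_iff[OF i(3)] i(8)
    by (simp add: S_def algebra_simps)
  moreover have "B S (- Q) = 1 / B S Q" using uminus_off[OF i(3) T(2) i(8)] .
  moreover have "B S Q = 1 / B Q S" "B S P = 1 / B P S" "B Q P = 1 / B P Q"
    using anti T i(3) by blast+
  moreover have "B P Q \<noteq> 0" "B P S \<noteq> 0" "B Q S \<noteq> 0" using nz T i(3) by blast+
  ultimately have "B P Q * (B Q S * (c P * c S)) = 1" "B P Q * B Q S = c Q" by (auto simp: field_simps)
  then show ?thesis unfolding S_def[symmetric] by (metis mult.assoc mult.commute)
qed

lemma c_trivial:
  assumes "p \<noteq> 3" and T: "P \<in> tor p" "Q \<in> tor p" and o: "P \<noteq> 0" "Q \<notin> mults P"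
  shows "c P = 1"
proof -
  \<comment> \<open>The product relations for (X, Y) and (X, X + Y) share two factors; the remaining
    ones are c at Y and at Y + 2X.\<close>
  have step: "c (Y + (X + X)) = c Y" if "X \<in> tor p" "Y \<in> tor p" "X \<noteq> 0" "Y \<notin> mults X" for X Y
  proof -
    note i = independent[OF that]
    have "c X * c Y * c (X + Y) = 1" "c X * c (X + Y) * c (X + (X + Y)) = 1"
      using c_product[OF assms(1)] that i by blast+
    then have "c X * c (X + Y) \<noteq> 0" "c X * c (X + Y) * c Y = c X * c (X + Y) * c (X + (X + Y))"
      by (auto simp: mult_ac)
    then show ?thesis by (simp add: algebra_simps)
  qed
  \<comment> \<open>As p is odd, adding 2X exactly (p + 1)/2 times amounts to adding X.\<close>
  have shift: "c (Y + X) = c Y" if XY: "X \<in> tor p" "Y \<in> tor p" "X \<noteq> 0" "Y \<notin> mults X" for X Y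
  proof -
    have k: "c (Y + nm (2*k) X) = c Y" for k
    proof (induction k)
      case (Suc k)
      have "Y + nm (2*k) X \<notin> mults X" using XY by (subst mults_shift) simp_all
      moreover have "Y + nm (2*k) X \<in> tor p" using XY tor_plus tor_nm by blast
      ultimately have "c (Y + nm (2*k) X + (X + X)) = c (Y + nm (2*k) X)" using step XY by blast
      then show ?case using Suc by (simp add: algebra_simps)
    qed simp
    obtain m where m: "p = 2*m + 1" using p(2) by (metis oddE)
    have "nm (2*(m+1)) X = nm (p + 1) X" using m by simp
    also have "\<dots> = X" using XY by (simp add: tor_def)
    finally show ?thesis using k[of "m+1"] by simp
  qed
  note i = independent[OF T o]
  have "c (P + Q) = c Q" "c (P + Q) = c P"
    using shift[OF T o] shift[OF T(2,1) i(1,2)] by (simp_all add: add.commute)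
  then have c3: "c P * c P * c P = 1" using c_product[OF assms] by simp
  have cp: "c P ^ p = 1" by (rule c_power[OF assms])
  have "c P ^ (3 * (p div 3) + p mod 3) = 1" using cp by simp
  then have "c P ^ (p mod 3) = 1" unfolding power_add power_mult using c3 by (simp add: power3_eq_cube)
  moreover have "p mod 3 \<noteq> 0" using p assms(1) primes_dvd_imp_eq[of 3 p] by (auto simp: mod_eq_0_iff_dvd)
  then have "p mod 3 = 1 \<or> p mod 3 = 2" by linarith
  ultimately show ?thesis using c3 by (auto simp: power2_eq_square)
qed

lemma bilinear: "p \<noteq> 3 \<Longrightarrow> bilinear_on_tor"
proof (rule bilinear_if_shift_invariant)
  fix P Q :: 'a assume *: "p \<noteq> 3" "P \<in> tor p" "Q \<in> tor p" "Q \<notin> mults P"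
  show "B P (Q + P) = B P Q"
  proof (cases "P = 0")
    case False
    then show ?thesis using c_eq[OF *(1-3) False *(4)] c_trivial[OF *(1-3) False *(4)] by simp
  qed simp
qed

end

lemma wp_off_line_additive:
  assumes "prime p" "odd p" "finite (tor p :: 'c::curve ept set)"
  shows "off_line_additive p (wp p :: 'c ept \<Rightarrow> 'c ept \<Rightarrow> complex)"
proof
  show "prime p" "odd p" by fact+
qed (use wp_dependent wp_nonzero[OF assms(1)] wp_antisym[OF assms(1)] wp_add_off[OF assms(1,3)] in \<open>blast+\<close>)

section \<open>Twists\<close>

definition scl :: "complex \<Rightarrow> pt \<Rightarrow> pt" where
  "scl u P = map_option (\<lambda>(x, y). (u^2 * x, u^3 * y)) P"

definition twist :: "complex \<Rightarrow> wcurve \<Rightarrow> wcurve \<Rightarrow> bool" where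
  "twist u E E' \<longleftrightarrow> u \<noteq> 0 \<and> of_rat (fst E') = u^4 * (of_rat (fst E) :: complex)
     \<and> of_rat (snd E') = u^6 * (of_rat (snd E) :: complex)"

lemma scl_simps [simp]: "scl u None = None" "scl u (Some (x, y)) = Some (u^2 * x, u^3 * y)"
  by (simp_all add: scl_def)

lemma scl_None_iff [simp]: "scl u P = None \<longleftrightarrow> P = None"
  by (simp add: scl_def)

lemma scl_scl: "scl u (scl v P) = scl (u * v) P"
  by (cases P) (auto simp: power_mult_distrib)

lemma scl_1 [simp]: "scl 1 P = P"
  by (cases P) auto

lemma inj_scl: "u \<noteq> 0 \<Longrightarrow> scl u P = scl u Q \<longleftrightarrow> P = Q"
  by (cases P; cases Q) auto

lemma twist_inverse: "twist u E E' \<Longrightarrow> twist (inverse u) E' E"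
  by (auto simp: twist_def field_simps)

lemma scl_inverse: "u \<noteq> 0 \<Longrightarrow> scl (inverse u) (scl u P) = P" "u \<noteq> 0 \<Longrightarrow> scl u (scl (inverse u) P) = P"
  by (simp_all add: scl_scl)

lemma on_curve_scl:
  assumes "twist u E E'" shows "on_curve E' (scl u P) \<longleftrightarrow> on_curve E P"
proof (cases P)
  case (Some xy)
  obtain x y where xy: "xy = (x, y)" by fastforce
  have "(u^3*y)^2 = u^6 * y^2"
    "(u^2*x)^3 + of_rat (fst E') * (u^2*x) + of_rat (snd E') = u^6 * (x^3 + of_rat (fst E) * x + of_rat (snd E))"
    using assms by (simp_all add: twist_def algebra_simps flip: power_mult power_add)
  then show ?thesis using assms by (simp add: on_curve_def Some xy twist_def)
qed (simp add: on_curve_def)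

lemma eadd_scl:
  assumes t: "twist u E E'" shows "eadd E' (scl u P) (scl u Q) = scl u (eadd E P Q)"
proof (cases "P = None \<or> Q = None")
  case True
  then show ?thesis by (cases P; cases Q) auto
next
  case False
  then obtain x1 y1 x2 y2 where PQ: "P = Some (x1, y1)" "Q = Some (x2, y2)" by (cases P; cases Q) auto
  have u: "u \<noteq> 0" and A: "of_rat (fst E') = u^4 * (of_rat (fst E) :: complex)" using t by (auto simp: twist_def)
  have l: "(3 * (u^2*x1)^2 + of_rat (fst E')) / (2 * (u^3*y1)) = u * ((3 * x1^2 + of_rat (fst E)) / (2*y1))"
    "(u^3*y2 - u^3*y1) / (u^2*x2 - u^2*x1) = u * ((y2 - y1) / (x2 - x1))"
  proof -
    have "3 * (u^2*x1)^2 + of_rat (fst E') = u^3 * (u * (3 * x1^2 + of_rat (fst E)))"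
      unfolding A by (simp add: algebra_simps power2_eq_square power3_eq_cube power4_eq_xxxx)
    then show "(3 * (u^2*x1)^2 + of_rat (fst E')) / (2 * (u^3*y1)) = u * ((3 * x1^2 + of_rat (fst E)) / (2*y1))"
      using u by (simp add: mult.left_commute[of 2])
    have "u^3*y2 - u^3*y1 = u^2 * (u * (y2 - y1))" "u^2*x2 - u^2*x1 = u^2*(x2 - x1)"
      by (simp_all add: algebra_simps power2_eq_square power3_eq_cube)
    then show "(u^3*y2 - u^3*y1) / (u^2*x2 - u^2*x1) = u * ((y2 - y1) / (x2 - x1))"
      using u by simp
  qed
  have "- (u^3 * y2) = u^3 * (- y2)" by simp
  then have eq: "u^2*x1 = u^2*x2 \<longleftrightarrow> x1 = x2" "u^3*y1 = - (u^3*y2) \<longleftrightarrow> y1 = - y2"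
    using u by (simp, metis mult_left_cancel power_not_zero)
  have fin: "Some ((u*s)^2 - u^2*x1 - u^2*x2, u*s*(u^2*x1 - ((u*s)^2 - u^2*x1 - u^2*x2)) - u^3*y1) =
      scl u (Some (s^2 - x1 - x2, s*(x1 - (s^2 - x1 - x2)) - y1))" for s
    by (simp add: algebra_simps power2_eq_square power3_eq_cube)
  show ?thesis
  proof (cases "x1 = x2 \<and> y1 = - y2")
    case True
    then show ?thesis unfolding PQ by simp
  next
    case False
    then have ne: "\<not> (u^2*x1 = u^2*x2 \<and> u^3*y1 = - (u^3*y2))" unfolding eq .
    define s where "s = (if x1 = x2 then (3 * x1^2 + of_rat (fst E)) / (2*y1) else (y2 - y1) / (x2 - x1))"
    have s: "(if u^2*x1 = u^2*x2 then (3 * (u^2*x1)^2 + of_rat (fst E')) / (2 * (u^3*y1))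
        else (u^3*y2 - u^3*y1) / (u^2*x2 - u^2*x1)) = u * s"
      unfolding l eq s_def by simp
    show ?thesis
      unfolding PQ scl_simps(2) eadd.simps(3) if_not_P[OF ne] if_not_P[OF False] Let_def s s_def[symmetric] fin
      by simp
  qed
qed

lemma esmul_scl: "twist u E E' \<Longrightarrow> esmul E' n (scl u P) = scl u (esmul E n P)"
  by (induction n) (simp_all add: eadd_scl)

text \<open>Under scaling a non-vertical line has weight 3 and a vertical line weight 2, so an
  ordinary factor is multiplied by u and a factor with \<open>A + P = 0\<close> by u^2.\<close>

lemma eline_evert_scl:
  fixes A P R :: "'c::curve ept"
  assumes t: "twist u (crv TYPE('c)) E'" and n: "A \<noteq> 0" "P \<noteq> 0" "R \<noteq> 0"
  shows "eline E' (scl u (raw A)) (scl u (raw P)) (scl u (raw R)) / evert (scl u (raw (P + A))) (scl u (raw R))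
    = (if A + P = 0 then u^2 else u) * gf A P R"
proof -
  have u: "u \<noteq> 0" and fE: "of_rat (fst E') = u^4 * ca TYPE('c)" using t by (auto simp: twist_def ca_def)
  have r: "raw A = Some (px A, py A)" "raw P = Some (px P, py P)" "raw R = Some (px R, py R)"
    using n raw_nonzero by blast+
  show ?thesis
  proof (cases "A + P = 0")
    case True
    then have "A = - P" by (simp add: eq_neg_iff_add_eq_0)
    then have "px A = px P" "py A = - py P" using n py_uminus by auto
    then show ?thesis using True n unfolding r
      by (simp add: eline_def evert_def gf_def gxy_def add.commute[of P] algebra_simps)
  next
    case False
    have "\<not> (px A = px P \<and> py A = - py P)"
      using ept_eqI[of A "- P"] n py_uminus[of P] False by (auto simp: eq_neg_iff_add_eq_0)
    moreover have "- (u^3 * py P) = u^3 * (- py P)" by simp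
    ultimately have ne: "\<not> (u^2 * px A = u^2 * px P \<and> u^3 * py A = - (u^3 * py P))"
      using u by (metis mult_left_cancel power_not_zero)
    have rs: "raw (P + A) = Some (px (A + P), py (A + P))"
      using False raw_nonzero[of "A + P"] by (simp add: add.commute)
    have s: "(if u^2 * px A = u^2 * px P then (3 * (u^2 * px A)^2 + of_rat (fst E')) / (2 * (u^3 * py A))
        else (u^3 * py P - u^3 * py A) / (u^2 * px P - u^2 * px A)) = u * slp A P"
    proof -
      have 1: "3 * (u^2 * px A)^2 + of_rat (fst E') = u^3 * (u * (3 * px A^2 + ca TYPE('c)))"
        unfolding fE by (simp add: algebra_simps power2_eq_square power3_eq_cube power4_eq_xxxx)
      have 2: "2 * (u^3 * py A) = u^3 * (2 * py A)" by simp
      have 3: "u^3 * py P - u^3 * py A = u^2 * (u * (py P - py A))" "u^2 * px P - u^2 * px A = u^2 * (px P - px A)"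
        by (simp_all add: algebra_simps power2_eq_square power3_eq_cube)
      show ?thesis unfolding 1 2 3 slp_def using u by (simp del: mult_cancel_left)
    qed
    have "eline E' (scl u (raw A)) (scl u (raw P)) (scl u (raw R)) =
        u^3 * py R - u^3 * py A - (u * slp A P) * (u^2 * px R - u^2 * px A)"
      unfolding eline_def r scl_simps by (simp only: prod.case option.case if_not_P[OF ne] s Let_def)
    also have "\<dots> = u^3 * chord A P (px R) (py R)"
      by (simp add: chord_def algebra_simps power2_eq_square power3_eq_cube)
    finally have e: "eline E' (scl u (raw A)) (scl u (raw P)) (scl u (raw R)) = u^2 * (u * chord A P (px R) (py R))"
      by (simp add: power2_eq_square power3_eq_cube)
    have "evert (scl u (raw (P + A))) (scl u (raw R)) = u^2 * (px R - px (A + P))"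
      unfolding r rs by (simp add: evert_def algebra_simps)
    then show ?thesis unfolding e using False n u by (simp add: gf_def gxy_def)
  qed
qed

text \<open>For points of order p the total weight at p is p in both Miller values, so it cancels in
  the Weil quotient.\<close>

lemma miller_scl:
  fixes P R :: "'c::curve ept"
  assumes t: "twist u (crv TYPE('c)) E'" and n: "R \<noteq> 0" "P \<noteq> 0" "\<And>k. 0 < k \<Longrightarrow> k < Suc m \<Longrightarrow> nm k P \<noteq> 0"
  shows "miller E' (Suc m) (scl u (raw P)) (scl u (raw R)) =
    (if nm (Suc m) P = 0 then u^(Suc m) else u^m) * mf (Suc m) P R"
  using n(3)
proof (induction m)
  case (Suc m)
  have nz: "nm (Suc m) P \<noteq> 0" using Suc.prems by (simp del: nm.simps)
  have es: "esmul E' k (scl u (raw P)) = scl u (raw (nm k P))" for k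
    using esmul_scl[OF t] by (simp add: esmul_raw)
  have "miller E' (Suc (Suc m)) (scl u (raw P)) (scl u (raw R)) =
     miller E' (Suc m) (scl u (raw P)) (scl u (raw R)) *
      (eline E' (scl u (raw (nm (Suc m) P))) (scl u (raw P)) (scl u (raw R)) /
       evert (scl u (raw (P + nm (Suc m) P))) (scl u (raw R)))"
    unfolding miller.simps(2)[of _ "Suc m"] es by simp
  also have "\<dots> = u^m * mf (Suc m) P R * ((if nm (Suc m) P + P = 0 then u^2 else u) * gf (nm (Suc m) P) P R)"
    unfolding eline_evert_scl[OF t nz n(2,1)] using Suc.IH Suc.prems nz by (simp del: nm.simps)
  also have "\<dots> = (if nm (Suc (Suc m)) P = 0 then u^(Suc (Suc m)) else u^(Suc m)) * mf (Suc (Suc m)) P R"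
    by (simp add: mf_Suc power2_eq_square add.commute[of P] del: nm.simps)
      (simp add: add.commute add.left_commute)
  finally show ?case .
qed (use n in \<open>simp add: mf_def\<close>)

lemma weil_scl:
  fixes P Q :: "'c::curve ept"
  assumes t: "twist u (crv TYPE('c)) E'" and p: "prime p" and T: "P \<in> tor p" "Q \<in> tor p"
  shows "weil E' p (scl u (raw P)) (scl u (raw Q)) = wp p P Q"
proof -
  have u: "u \<noteq> 0" using t by (simp add: twist_def)
  obtain m where m: "p = Suc m" using p prime_gt_0_nat by (metis gr0_conv_Suc)
  have ex: "(\<exists>k. scl u (raw Q) = esmul E' k (scl u (raw P))) \<longleftrightarrow> Q \<in> mults P"
    unfolding esmul_scl[OF t] esmul_raw inj_scl[OF u] raw_inject by (auto simp: mults_def)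
  show ?thesis
  proof (cases "P = 0 \<or> Q = 0 \<or> Q \<in> mults P")
    case True
    then have "P = 0 \<or> Q \<in> mults P" by auto
    then show ?thesis unfolding weil_def ex using True by (auto simp: wp_dependent)
  next
    case False
    have 1: "miller E' p (scl u (raw P)) (scl u (raw Q)) = u^p * mf p P Q"
      using miller_scl[OF t, of Q P m] False nm_nonzero[OF p T(1)] T(1) m by (simp add: tor_def del: nm.simps)
    have 2: "miller E' p (scl u (raw Q)) (scl u (raw P)) = u^p * mf p Q P"
      using miller_scl[OF t, of P Q m] False nm_nonzero[OF p T(2)] T(2) m by (simp add: tor_def del: nm.simps)
    show ?thesis unfolding weil_def ex 1 2 using False u wp_independent[OF p T] by simp
  qed
qed

section \<open>Modules over the endomorphism ring\<close>

definition zs :: "int \<Rightarrow> 'a::ab_group_add \<Rightarrow> 'a" where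
  "zs k X = nm (nat k) X - nm (nat (- k)) X"

lemma zs_diff_nat: "zs (int a - int b) X = nm a X - nm b X"
proof (cases "a \<le> b")
  case True
  then have "nm b X = nm a X + nm (b - a) X" by (simp flip: nm_add)
  then show ?thesis using True by (simp add: zs_def nat_diff_distrib')
next
  case False
  then have "nm a X = nm b X + nm (a - b) X" by (simp flip: nm_add)
  then show ?thesis using False by (simp add: zs_def nat_diff_distrib')
qed

lemma zs_cases: obtains a b where "k = int a - int b"
  by (metis int_diff_cases)

lemma zs_int [simp]: "zs (int n) X = nm n X" by (simp add: zs_def)
lemma zs_0 [simp]: "zs 0 X = 0" by (simp add: zs_def)
lemma zs_1 [simp]: "zs 1 X = X" by (simp add: zs_def)
lemma zs_m1 [simp]: "zs (-1) X = - X" by (simp add: zs_def)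

lemma zs_add: "zs (k + l) X = zs k X + zs l X"
proof -
  obtain a b c d where kl: "k = int a - int b" "l = int c - int d" by (metis zs_cases)
  have "k + l = int (a + c) - int (b + d)" unfolding kl by simp
  then show ?thesis unfolding kl by (simp only: zs_diff_nat nm_add) simp
qed

lemma zs_uminus: "zs (- k) X = - zs k X"
  using zs_add[of k "-k" X] by (simp add: minus_unique)

lemma zs_diff: "zs (k - l) X = zs k X - zs l X"
  using zs_add[of k "-l" X] by (simp add: zs_uminus)

lemma zs_plus: "zs k (X + Y) = zs k X + zs k Y"
  by (simp add: zs_def nm_plus)

lemma zs_0_right [simp]: "zs k 0 = 0"
  by (simp add: zs_def)

lemma zs_minus_right: "zs k (- X) = - zs k X"
  by (simp add: zs_def nm_uminus)

lemma zs_minus: "zs k (X - Y) = zs k X - zs k Y"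
  using zs_plus[of k X "- Y"] by (simp add: zs_minus_right)

lemma zs_mult: "zs (k * l) X = zs k (zs l X)"
proof (induction k rule: int_induct[where k=0])
  case (step1 i)
  then show ?case by (simp add: distrib_right zs_add)
next
  case (step2 i)
  then show ?case by (simp add: left_diff_distrib zs_diff)
qed simp

lemma zs_numeral [simp]: "zs (numeral n) X = nm (numeral n) X"
  by (simp add: zs_def)

lemma zs_tor: "X \<in> tor p \<Longrightarrow> zs k X \<in> tor p"
  by (simp add: zs_def diff_conv_add_uminus tor_plus tor_uminus tor_nm del: add_uminus_conv_diff)

lemma zs_mod:
  assumes "X \<in> tor p" "int p dvd k - l" shows "zs k X = zs l X"
proof -
  obtain m where "k - l = m * int p" using assms(2) by (metis dvd_def mult.commute)
  then have "zs (k - l) X = 0" using assms(1) by (simp add: zs_mult tor_def)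
  then show ?thesis by (simp add: zs_diff)
qed

lemma zs_hom:
  assumes "\<And>X Y. X \<in> tor p \<Longrightarrow> Y \<in> tor p \<Longrightarrow> f (X + Y) = f X + f Y" "X \<in> tor p"
  shows "f (zs k X) = zs k (f X)"
proof -
  have 0: "f 0 = 0" using assms(1)[of 0 0] by simp
  have n: "f (nm n X) = nm n (f X)" for n by (induction n) (simp_all add: 0 assms tor_nm)
  have "f (Y - Z) = f Y - f Z" if "Y \<in> tor p" "Z \<in> tor p" for Y Z
    using assms(1)[of "Y - Z" Z] tor_plus[of Y p "- Z"] tor_uminus[OF that(2)] that
    by (simp add: algebra_simps)
  then show ?thesis by (simp add: zs_def n tor_nm assms(2))
qed

text \<open>An action of the ring Z[t] with t^2 = \<beta> t - 1, in which m + n t has norm m^2 +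
  \<beta> m n + n^2. The values used are \<beta> = 0 for i and \<beta> = -1 for a cube root of
  unity.\<close>

locale cm =
  fixes \<tau> :: "'a::ab_group_add \<Rightarrow> 'a" and \<beta> :: int
  assumes \<tau>_add: "\<tau> (X + Y) = \<tau> X + \<tau> Y"
    and \<tau>_sq: "\<tau> (\<tau> X) = - X + zs \<beta> (\<tau> X)"
begin

lemma \<tau>_zs: "\<tau> (zs k X) = zs k (\<tau> X)"
proof -
  have 0: "\<tau> 0 = 0" using \<tau>_add[of 0 0] by simp
  have n: "\<tau> (nm n X) = nm n (\<tau> X)" for n by (induction n) (simp_all add: 0 \<tau>_add)
  have "\<tau> (Y - Z) = \<tau> Y - \<tau> Z" for Y Z using \<tau>_add[of "Y - Z" Z] by simp
  then show ?thesis by (simp add: zs_def n)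
qed

lemma \<tau>_tor: "X \<in> tor p \<Longrightarrow> \<tau> X \<in> tor p"
  using \<tau>_zs[of "int p" X] \<tau>_add[of 0 0] by (simp add: tor_def)

definition L :: "int \<Rightarrow> int \<Rightarrow> 'a \<Rightarrow> 'a" where "L m n X = zs m X + zs n (\<tau> X)"

lemma L_add: "L m n X + L m' n' X = L (m + m') (n + n') X"
  by (simp add: L_def zs_add)

lemma L_zs: "zs k (L m n X) = L (k * m) (k * n) X"
  by (simp add: L_def zs_plus zs_mult)

lemma L_uminus: "- L m n X = L (- m) (- n) X"
  by (simp add: L_def zs_uminus)

lemma L_\<tau>: "\<tau> (L m n X) = L (- n) (m + \<beta> * n) X"
  by (simp add: L_def \<tau>_add \<tau>_zs \<tau>_sq zs_plus zs_minus_right zs_minus zs_uminus zs_add mult.commute[of \<beta>] zs_mult)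

lemma L_L: "L m n (L m' n' X) = L (m * m' - n * n') (m * n' + n * m' + \<beta> * n * n') X"
  by (simp add: L_def[of m n] L_zs L_\<tau> L_add algebra_simps)

lemma L_1_0 [simp]: "L 1 0 X = X" and L_0_1: "L 0 1 X = \<tau> X" and L_0_0 [simp]: "L 0 0 X = 0"
  by (simp_all add: L_def)

lemma L_tor: "X \<in> tor p \<Longrightarrow> L m n X \<in> tor p"
  by (simp add: L_def tor_plus zs_tor \<tau>_tor)

lemma L_mod:
  assumes "X \<in> tor p" "int p dvd m - m'" "int p dvd n - n'" shows "L m n X = L m' n' X"
  using zs_mod[of X p m m'] zs_mod[of "\<tau> X" p n n'] \<tau>_tor assms by (simp add: L_def)

end

lemma powi_mult_swap: "((z::complex) powi a) powi b = (z powi b) powi a"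
  unfolding power_int_mult[symmetric] by (simp add: mult.commute)

text \<open>The p-torsion is taken to be a cyclic module over the endomorphism ring. A generator
  \<open>X\<^sub>0\<close> gives coordinates (m, n), which need not be unique, and takes the place
  of a basis over the field with p elements.\<close>

locale cm_pairing = cm \<tau> \<beta> for \<tau> :: "'a::ab_group_add \<Rightarrow> 'a" and \<beta> +
  fixes p :: nat and B :: "'a \<Rightarrow> 'a \<Rightarrow> complex" and X\<^sub>0 :: 'a
  assumes nz: "P \<in> tor p \<Longrightarrow> Q \<in> tor p \<Longrightarrow> B P Q \<noteq> 0"
    and alt: "B P P = 1"
    and anti: "P \<in> tor p \<Longrightarrow> Q \<in> tor p \<Longrightarrow> B Q P = 1 / B P Q"
    and add: "P \<in> tor p \<Longrightarrow> Q \<in> tor p \<Longrightarrow> Q' \<in> tor p \<Longrightarrow> B P (Q + Q') = B P Q * B P Q'"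
    and X0: "X\<^sub>0 \<in> tor p"
    and gen: "P \<in> tor p \<Longrightarrow> \<exists>m n. P = L m n X\<^sub>0"
begin

lemma add_left:
  assumes "P \<in> tor p" "P' \<in> tor p" "Q \<in> tor p" shows "B (P + P') Q = B P Q * B P' Q"
  using anti[of Q "P + P'"] anti[of Q P] anti[of Q P'] add assms tor_plus[OF assms(1,2)] by auto

lemma B_0: assumes "P \<in> tor p" shows "B P 0 = 1"
  using add[OF assms tor_0 tor_0] nz[OF assms tor_0] by simp

lemma B_zs: assumes "P \<in> tor p" "Q \<in> tor p" shows "B P (zs k Q) = B P Q powi k"
proof (induction k rule: int_induct[where k=0])
  case (step1 i)
  then show ?case using add[OF assms(1) zs_tor[OF assms(2), of i] assms(2)] nz[OF assms]
    by (simp add: zs_add power_int_add_1)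
next
  case (step2 i)
  have "B P (zs i Q) = B P (zs (i - 1) Q) * B P Q"
    using add[OF assms(1) zs_tor[OF assms(2), of "i - 1"] assms(2)] by (simp add: zs_diff)
  then show ?case using step2 nz[OF assms] by (simp add: power_int_diff field_simps)
qed (simp add: B_0 assms)

lemma B_zs_left: assumes "P \<in> tor p" "Q \<in> tor p" shows "B (zs k P) Q = B P Q powi k"
  using anti[OF assms(2) zs_tor[OF assms(1)]] anti[OF assms(2,1)] B_zs[OF assms(2,1)]
  by (simp add: power_int_divide_distrib)

definition \<zeta> :: complex where "\<zeta> = B X\<^sub>0 (\<tau> X\<^sub>0)"

text \<open>An alternating bilinear form in two coordinates is the determinant, here as an exponent
  of \<zeta>.\<close>

lemma B_L: "B (L m n X\<^sub>0) (L m' n' X\<^sub>0) = \<zeta> powi (m * n' - n * m')"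
proof -
  note t = X0 \<tau>_tor[OF X0]
  have z: "\<zeta> \<noteq> 0" using nz t by (simp add: \<zeta>_def)
  have "B (\<tau> X\<^sub>0) X\<^sub>0 = 1 / \<zeta>" using anti[OF t] by (simp add: \<zeta>_def)
  then show ?thesis unfolding L_def using t z
    by (simp add: add add_left tor_plus zs_tor B_zs B_zs_left alt \<zeta>_def[symmetric]
      power_int_diff power_int_mult power_int_divide_distrib powi_mult_swap[of \<zeta> n])
qed

lemma B_root: assumes "P \<in> tor p" "Q \<in> tor p" shows "B P Q ^ p = 1"
  using B_zs[OF assms, of "int p"] assms B_0 by (simp add: tor_def)

text \<open>Multiplication by a + b t has its norm as determinant in the coordinates of
  \<open>B_L\<close>.\<close>

lemma B_linear:
  assumes "P \<in> tor p" "Q \<in> tor p"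
  shows "B (L a b P) (L a b Q) = B P Q powi (a^2 + \<beta>*a*b + b^2)"
proof -
  obtain m n m' n' where P: "P = L m n X\<^sub>0" and Q: "Q = L m' n' X\<^sub>0" using gen assms by metis
  have "(a * m - b * n) * (a * n' + b * m' + \<beta> * b * n') - (a * n + b * m + \<beta> * b * n) * (a * m' - b * n') =
    (m * n' - n * m') * (a^2 + \<beta>*a*b + b^2)" by (simp add: algebra_simps power2_eq_square)
  then show ?thesis unfolding P Q L_L B_L by (simp add: power_int_mult)
qed

text \<open>M is conjugation followed by multiplication with some a + b t of norm \<open>N\<close>;
  its determinant is \<open>- N\<close> and its square is multiplication by \<open>N\<close>.
  Knowing the square on one generator therefore determines the effect on the pairing.\<close>

lemma B_semilinear:
  assumes add_M: "\<And>P Q. P \<in> tor p \<Longrightarrow> Q \<in> tor p \<Longrightarrow> M (P + Q) = M P + M Q"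
    and M_tor: "\<And>P. P \<in> tor p \<Longrightarrow> M P \<in> tor p"
    and M_\<tau>: "\<And>P. P \<in> tor p \<Longrightarrow> M (\<tau> P) = zs \<beta> (M P) - \<tau> (M P)"
    and M_M: "M (M X\<^sub>0) = zs \<epsilon> X\<^sub>0" and PQ: "P \<in> tor p" "Q \<in> tor p"
  shows "B (M P) (M Q) = B P Q powi (- \<epsilon>)"
proof -
  obtain a b where ab: "M X\<^sub>0 = L a b X\<^sub>0" using gen M_tor X0 by metis
  have M_zs: "M (zs k P) = zs k (M P)" if "P \<in> tor p" for k P by (rule zs_hom[OF add_M that])
  have M_L: "M (L m n X\<^sub>0) = L (m*a + n*(\<beta>*a + b)) (m*b - n*a) X\<^sub>0" for m n
  proof -
    have "M (L m n X\<^sub>0) = zs m (M X\<^sub>0) + zs n (zs \<beta> (M X\<^sub>0) + - \<tau> (M X\<^sub>0))"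
      using X0 \<tau>_tor[OF X0] by (simp add: L_def add_M zs_tor M_zs M_\<tau>)
    also have "\<dots> = L (m*a + n*(\<beta>*a + b)) (m*b - n*a) X\<^sub>0"
      unfolding ab L_\<tau> L_zs L_uminus L_add by (simp add: algebra_simps)
    finally show ?thesis .
  qed
  define N where "N = a^2 + \<beta>*a*b + b^2"
  have "L N 0 X\<^sub>0 = zs \<epsilon> X\<^sub>0"
    using M_M unfolding ab M_L by (simp add: N_def power2_eq_square algebra_simps)
  \<comment> \<open>Pairing with the image of the generator under \<tau> replaces a congruence
    between \<open>N\<close> and \<epsilon> by the equality of two powers of \<zeta>.\<close>
  then have "B (L N 0 X\<^sub>0) (L 0 1 X\<^sub>0) = B (L \<epsilon> 0 X\<^sub>0) (L 0 1 X\<^sub>0)" by (simp add: L_def)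
  then have z: "\<zeta> powi N = \<zeta> powi \<epsilon>" unfolding B_L by simp
  obtain m n m' n' where P: "P = L m n X\<^sub>0" and Q: "Q = L m' n' X\<^sub>0" using gen PQ by metis
  have "(m*a + n*(\<beta>*a + b)) * (m'*b - n'*a) - (m*b - n*a) * (m'*a + n'*(\<beta>*a + b)) =
    N * (- (m * n' - n * m'))" by (simp add: N_def algebra_simps power2_eq_square)
  then have "B (M P) (M Q) = (\<zeta> powi N) powi (- (m * n' - n * m'))"
    unfolding P Q M_L B_L by (simp only: power_int_mult)
  also have "\<dots> = B P Q powi (- \<epsilon>)" unfolding z P Q B_L
    unfolding power_int_mult[symmetric] by (simp add: algebra_simps)
  finally show ?thesis .
qed

end

section \<open>Algebraic numbers\<close>

interpretation Qv: vector_space "\<lambda>(q::rat) (z::complex). of_rat q * z"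
  by unfold_locales (simp_all add: algebra_simps of_rat_add of_rat_mult)

text \<open>If the powers up to \<open>card S\<close> are distinct, they are too many to be
  independent, and a linear relation is a polynomial with root z. Repetitions need their own case
  because dependence is a property of sets.\<close>

lemma algebraic_if_powers_in_span:
  assumes "finite S" "\<And>k. z ^ k \<in> Qv.span S"
  shows "algebraic (z::complex)"
proof (cases "inj_on (\<lambda>k. z ^ k) {..card S}")
  case False
  then obtain i j where ij: "i < j" "z ^ i = z ^ j"
    unfolding inj_on_def by (metis linorder_neqE_nat)
  define P :: "complex poly" where "P = Polynomial.monom 1 j - Polynomial.monom 1 i"
  have "Polynomial.coeff P j = 1" using ij by (simp add: P_def)
  then have "P \<noteq> 0" by auto
  moreover have "poly P z = 0" using ij by (simp add: P_def poly_monom)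
  moreover have "Polynomial.coeff P n \<in> \<rat>" for n by (simp add: P_def)
  ultimately show ?thesis by (intro algebraicI') auto
next
  case True
  define A where "A = (\<lambda>k. z ^ k) ` {..card S}"
  have A: "finite A" "card A = Suc (card S)" "A \<subseteq> Qv.span S"
    using assms True by (auto simp: A_def card_image)
  have "Qv.dependent A"
    using Qv.independent_span_bound[OF assms(1) _ A(3)] A(2) by auto
  then obtain c v where c: "v \<in> A" "c v \<noteq> 0" "(\<Sum>v\<in>A. of_rat (c v) * v) = 0"
    using Qv.dependent_finite[OF A(1)] by auto
  obtain k where k: "k \<le> card S" "v = z ^ k" using c(1) by (auto simp: A_def)
  define P :: "complex poly" where "P = (\<Sum>k\<le>card S. Polynomial.monom (of_rat (c (z ^ k))) k)"
  have co: "Polynomial.coeff P n = (if n \<le> card S then of_rat (c (z ^ n)) else 0)" for n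
    unfolding P_def Polynomial.coeff_sum by (simp add: coeff_monom if_distrib sum.delta)
  have "P \<noteq> 0" using co[of k] k c(2) by auto
  moreover have "poly P z = (\<Sum>k\<le>card S. of_rat (c (z ^ k)) * z ^ k)"
    unfolding P_def by (simp add: poly_sum poly_monom)
  moreover have "\<dots> = 0" using c(3) unfolding A_def sum.reindex[OF True] by simp
  moreover have "Polynomial.coeff P n \<in> \<rat>" for n by (simp add: co)
  ultimately show ?thesis by (intro algebraicI') auto
qed

lemma span_mult_closed:
  assumes "\<And>s. s \<in> S \<Longrightarrow> x * s \<in> Qv.span S" "v \<in> Qv.span S"
  shows "x * v \<in> Qv.span S"
  using assms(2)
proof (induction rule: Qv.span_induct_alt)
  case base
  then show ?case using Qv.span_zero by simp
next
  case (step c s y)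
  have "x * (of_rat c * s + y) = of_rat c * (x * s) + x * y" by (simp add: algebra_simps)
  then show ?case using Qv.span_add[OF Qv.span_scale[OF assms(1)[OF step(1)]] step(2)] by simp
qed

lemma algebraic_power_reduces:
  assumes "algebraic (x::complex)"
  obtains n c where "x ^ n = (\<Sum>i<n. of_rat (c i :: rat) * x ^ i)"
proof -
  obtain P where P: "\<And>i. Polynomial.coeff P i \<in> \<rat>" "P \<noteq> 0" "poly P x = 0"
    using assms by (auto simp: algebraic_altdef)
  define n where "n = degree P"
  define l where "l = Polynomial.lead_coeff P"
  have l: "l \<noteq> 0" "l \<in> \<rat>" using P by (auto simp: l_def)
  have "\<forall>i. \<exists>q::rat. - Polynomial.coeff P i / l = of_rat q"
  proof
    fix i
    have "- Polynomial.coeff P i / l \<in> \<rat>" using P(1) l by auto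
    then obtain q where "- Polynomial.coeff P i / l = of_rat q" by (rule Rats_cases)
    then show "\<exists>q::rat. - Polynomial.coeff P i / l = of_rat q" by blast
  qed
  then obtain c :: "nat \<Rightarrow> rat" where c: "\<And>i. - Polynomial.coeff P i / l = of_rat (c i)" by metis
  have "0 = (\<Sum>i<n. Polynomial.coeff P i * x ^ i) + l * x ^ n"
    using P(3) unfolding poly_altdef n_def l_def by (simp add: lessThan_Suc_atMost[symmetric])
  then have "l * x ^ n = - (\<Sum>i<n. Polynomial.coeff P i * x ^ i)" by (simp add: eq_neg_iff_add_eq_0 add.commute)
  then have "x ^ n = - (\<Sum>i<n. Polynomial.coeff P i * x ^ i) / l" using l(1) by (metis mult.commute nonzero_eq_divide_eq)
  also have "\<dots> = (\<Sum>i<n. (- Polynomial.coeff P i / l) * x ^ i)"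
    by (simp add: sum_negf sum_divide_distrib)
  finally show thesis using that unfolding c by blast
qed

text \<open>The span of the products \<open>x^i * y^j\<close> below the two degrees is
  finite-dimensional and stable under multiplication by x and by y, hence contains all powers of the
  sum and of the product.\<close>

lemma algebraic_add_mult:
  fixes x y :: complex
  assumes "algebraic x" "algebraic y"
  shows "algebraic (x + y)" "algebraic (x * y)"
proof -
  obtain m c where m: "x ^ m = (\<Sum>i<m. of_rat (c i :: rat) * x ^ i)" using algebraic_power_reduces[OF assms(1)] .
  obtain n d where n: "y ^ n = (\<Sum>i<n. of_rat (d i :: rat) * y ^ i)" using algebraic_power_reduces[OF assms(2)] .
  define S where "S = (\<lambda>(i, j). x ^ i * y ^ j) ` ({..<m} \<times> {..<n})"
  have S: "finite S" by (simp add: S_def)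
  have mem: "x ^ i * y ^ j \<in> Qv.span S" if "i < m" "j < n" for i j
    using that by (intro Qv.span_base) (auto simp: S_def)
  have X: "x * v \<in> Qv.span S" if "v \<in> Qv.span S" for v
  proof (rule span_mult_closed[OF _ that])
    fix s assume "s \<in> S"
    then obtain i j where ij: "i < m" "j < n" "s = x ^ i * y ^ j" by (auto simp: S_def)
    show "x * s \<in> Qv.span S"
    proof (cases "Suc i < m")
      case True
      then show ?thesis using mem[of "Suc i" j] ij by (simp add: mult_ac)
    next
      case False
      then have "Suc i = m" using ij by simp
      then have "x * s = x ^ m * y ^ j" using ij by (auto simp: mult_ac)
      also have "\<dots> = (\<Sum>i<m. of_rat (c i) * (x ^ i * y ^ j))" unfolding m by (simp add: sum_distrib_right mult.assoc)
      also have "\<dots> \<in> Qv.span S" using ij mem by (intro Qv.span_sum Qv.span_scale) auto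
      finally show ?thesis .
    qed
  qed
  have Y: "y * v \<in> Qv.span S" if "v \<in> Qv.span S" for v
  proof (rule span_mult_closed[OF _ that])
    fix s assume "s \<in> S"
    then obtain i j where ij: "i < m" "j < n" "s = x ^ i * y ^ j" by (auto simp: S_def)
    show "y * s \<in> Qv.span S"
    proof (cases "Suc j < n")
      case True
      then show ?thesis using mem[of i "Suc j"] ij by (simp add: mult_ac)
    next
      case False
      then have "Suc j = n" using ij by simp
      then have "y * s = x ^ i * y ^ n" using ij by (auto simp: mult_ac)
      also have "\<dots> = (\<Sum>j<n. of_rat (d j) * (x ^ i * y ^ j))" unfolding n by (simp add: sum_distrib_left mult.left_commute)
      also have "\<dots> \<in> Qv.span S" using ij mem by (intro Qv.span_sum Qv.span_scale) auto
      finally show ?thesis .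
    qed
  qed
  have 1: "1 \<in> Qv.span S"
  proof (cases "m = 0 \<or> n = 0")
    case True
    \<comment> \<open>A relation of degree 0 would equate \<open>x ^ 0\<close> or
      \<open>y ^ 0\<close> with an empty sum.\<close>
    then have "(1::complex) = 0" using m n by auto
    then show ?thesis by simp
  next
    case False
    then show ?thesis using mem[of 0 0] by simp
  qed
  have "(x + y) ^ k \<in> Qv.span S" for k
    by (induction k) (auto simp: 1 distrib_right intro!: Qv.span_add X Y)
  then show "algebraic (x + y)" by (rule algebraic_if_powers_in_span[OF S])
  have "(x * y) ^ k \<in> Qv.span S" for k
    by (induction k) (auto simp: 1 mult.assoc intro!: X Y)
  then show "algebraic (x * y)" by (rule algebraic_if_powers_in_span[OF S])
qed

lemma Qbar_add: "x \<in> Qbar \<Longrightarrow> y \<in> Qbar \<Longrightarrow> x + y \<in> Qbar"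
  and Qbar_mult: "x \<in> Qbar \<Longrightarrow> y \<in> Qbar \<Longrightarrow> x * y \<in> Qbar"
  and Qbar_uminus: "x \<in> Qbar \<Longrightarrow> - x \<in> Qbar"
  and Qbar_inverse: "x \<in> Qbar \<Longrightarrow> inverse x \<in> Qbar"
  by (auto simp: Qbar_def algebraic_add_mult)

lemma Qbar_diff: "x \<in> Qbar \<Longrightarrow> y \<in> Qbar \<Longrightarrow> x - y \<in> Qbar"
  using Qbar_add[of x "- y"] Qbar_uminus by simp

lemma Qbar_divide: "x \<in> Qbar \<Longrightarrow> y \<in> Qbar \<Longrightarrow> x / y \<in> Qbar"
  unfolding divide_inverse by (intro Qbar_mult Qbar_inverse)

lemma Qbar_rat: "of_rat q \<in> Qbar"
  unfolding Qbar_def mem_Collect_eq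
proof (rule algebraicI')
  show "poly [:- of_rat q, 1:] (of_rat q) = (0::complex)" by simp
  show "Polynomial.coeff [:- of_rat q, 1::complex:] i \<in> \<rat>" for i
    by (cases i) (auto simp: coeff_pCons split: nat.splits)
qed simp

lemma Qbar_0: "0 \<in> Qbar" and Qbar_1: "1 \<in> Qbar" and Qbar_numeral: "numeral n \<in> Qbar"
  using Qbar_rat[of 0] Qbar_rat[of 1] Qbar_rat[of "numeral n"] by simp_all

lemma Qbar_power: "x \<in> Qbar \<Longrightarrow> x ^ n \<in> Qbar"
  by (induction n) (auto intro: Qbar_1 Qbar_mult)

lemma Qbar_root: "x ^ n \<in> Qbar \<Longrightarrow> n > 0 \<Longrightarrow> x \<in> Qbar"
proof -
  assume "x ^ n \<in> Qbar" "n > 0"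
  then show "x \<in> Qbar" unfolding Qbar_def
    using algebraic_root[of "x ^ n" "Polynomial.monom 1 n" x] by (simp add: poly_monom degree_monom_eq)
qed

lemmas Qbar_intros = Qbar_add Qbar_mult Qbar_uminus Qbar_inverse Qbar_diff Qbar_divide Qbar_rat
  Qbar_0 Qbar_1 Qbar_numeral Qbar_power

section \<open>Galois action\<close>

lemma
  assumes "\<sigma> \<in> GalQ"
  shows gal_Qbar: "x \<in> Qbar \<Longrightarrow> \<sigma> x \<in> Qbar"
    and gal_inj: "x \<in> Qbar \<Longrightarrow> y \<in> Qbar \<Longrightarrow> \<sigma> x = \<sigma> y \<longleftrightarrow> x = y"
    and gal_1: "\<sigma> 1 = 1"
    and gal_add: "x \<in> Qbar \<Longrightarrow> y \<in> Qbar \<Longrightarrow> \<sigma> (x + y) = \<sigma> x + \<sigma> y"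
    and gal_mult: "x \<in> Qbar \<Longrightarrow> y \<in> Qbar \<Longrightarrow> \<sigma> (x * y) = \<sigma> x * \<sigma> y"
  using assms by (auto simp: GalQ_def bij_betw_def inj_on_def)

context
  fixes \<sigma> assumes \<sigma>: "\<sigma> \<in> GalQ"
begin

lemma gal_0: "\<sigma> 0 = 0"
  using gal_add[OF \<sigma> Qbar_0 Qbar_0] by simp

lemma gal_uminus: "x \<in> Qbar \<Longrightarrow> \<sigma> (- x) = - \<sigma> x"
  using gal_add[OF \<sigma>, of x "- x"] Qbar_uminus gal_0 by (simp add: eq_neg_iff_add_eq_0 add.commute)

lemma gal_diff: "x \<in> Qbar \<Longrightarrow> y \<in> Qbar \<Longrightarrow> \<sigma> (x - y) = \<sigma> x - \<sigma> y"
  using gal_add[OF \<sigma>, of x "- y"] Qbar_uminus gal_uminus by simp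

lemma gal_inverse: "x \<in> Qbar \<Longrightarrow> \<sigma> (inverse x) = inverse (\<sigma> x)"
proof (cases "x = 0")
  case False
  assume "x \<in> Qbar"
  then have "\<sigma> x * \<sigma> (inverse x) = 1" using False gal_mult[OF \<sigma>, of x "inverse x"] Qbar_inverse gal_1[OF \<sigma>] by simp
  then show ?thesis by (simp add: inverse_unique)
qed (simp add: gal_0)

lemma gal_divide: "x \<in> Qbar \<Longrightarrow> y \<in> Qbar \<Longrightarrow> \<sigma> (x / y) = \<sigma> x / \<sigma> y"
  unfolding divide_inverse using gal_mult[OF \<sigma>] gal_inverse Qbar_inverse by simp

lemma gal_power: "x \<in> Qbar \<Longrightarrow> \<sigma> (x ^ n) = \<sigma> x ^ n"
  by (induction n) (simp_all add: gal_1[OF \<sigma>] gal_mult[OF \<sigma>] Qbar_power)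

lemma gal_nat: "\<sigma> (of_nat n) = of_nat n"
proof (induction n)
  case (Suc n)
  have "of_nat n \<in> Qbar" using Qbar_rat[of "of_nat n"] by simp
  then show ?case using Suc gal_add[OF \<sigma> Qbar_1] gal_1[OF \<sigma>] by simp
qed (simp add: gal_0)

lemma gal_numeral: "\<sigma> (numeral n) = numeral n"
  using gal_nat[of "numeral n"] by simp

lemma gal_rat: "\<sigma> (of_rat q) = of_rat q"
proof -
  obtain a b where q: "quotient_of q = (a, b)" by fastforce
  have i: "\<sigma> (of_int k) = of_int k" for k
  proof (cases k rule: int_cases2)
    case (nonneg n) then show ?thesis by (simp add: gal_nat)
  next
    case (nonpos n)
    have "of_nat n \<in> Qbar" using Qbar_rat[of "of_nat n"] by simp
    then show ?thesis using nonpos by (simp add: gal_nat gal_uminus)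
  qed
  have Q: "of_int k \<in> Qbar" for k using Qbar_rat[of "of_int k"] by simp
  have "(of_rat q :: complex) = of_int a / of_int b"
    using quotient_of_div[OF q] by (simp add: of_rat_divide)
  then show ?thesis by (simp add: gal_divide i Q)
qed

lemmas gal_simps = gal_add[OF \<sigma>] gal_mult[OF \<sigma>] gal_1[OF \<sigma>] gal_0 gal_uminus gal_diff gal_inverse
  gal_divide gal_power gal_numeral gal_rat

end

lemma alg_pt_simps [simp]: "alg_pt None" "alg_pt (Some (x, y)) \<longleftrightarrow> x \<in> Qbar \<and> y \<in> Qbar"
  by (simp_all add: alg_pt_def)

lemma gal_pt_simps [simp]: "gal_pt \<sigma> None = None" "gal_pt \<sigma> (Some (x, y)) = Some (\<sigma> x, \<sigma> y)"
  by (simp_all add: gal_pt_def)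

lemma alg_pt_eadd:
  assumes "alg_pt P" "alg_pt Q" shows "alg_pt (eadd E P Q)"
proof (cases "P = None \<or> Q = None")
  case True
  then show ?thesis using assms by (cases P; cases Q) auto
next
  case False
  then obtain x1 y1 x2 y2 where PQ: "P = Some (x1, y1)" "Q = Some (x2, y2)" by (cases P; cases Q) auto
  define s where "s = (if x1 = x2 then (3 * x1^2 + of_rat (fst E)) / (2*y1) else (y2 - y1) / (x2 - x1))"
  have q: "x1 \<in> Qbar" "y1 \<in> Qbar" "x2 \<in> Qbar" "y2 \<in> Qbar" using assms PQ by auto
  then have "s \<in> Qbar" unfolding s_def by (auto intro!: Qbar_intros)
  then show ?thesis unfolding PQ eadd.simps(3) s_def[symmetric] Let_def
    using q by (auto intro!: Qbar_intros)
qed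

lemma gal_pt_eadd:
  assumes \<sigma>: "\<sigma> \<in> GalQ" and "alg_pt P" "alg_pt Q"
  shows "gal_pt \<sigma> (eadd E P Q) = eadd E (gal_pt \<sigma> P) (gal_pt \<sigma> Q)"
proof (cases "P = None \<or> Q = None")
  case True
  then show ?thesis by (cases P; cases Q) auto
next
  case False
  then obtain x1 y1 x2 y2 where PQ: "P = Some (x1, y1)" "Q = Some (x2, y2)" by (cases P; cases Q) auto
  define s where "s = (if x1 = x2 then (3 * x1^2 + of_rat (fst E)) / (2*y1) else (y2 - y1) / (x2 - x1))"
  have q: "x1 \<in> Qbar" "y1 \<in> Qbar" "x2 \<in> Qbar" "y2 \<in> Qbar" using assms PQ by auto
  then have sq: "s \<in> Qbar" unfolding s_def by (auto intro!: Qbar_intros)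
  have eq: "\<sigma> x1 = \<sigma> x2 \<longleftrightarrow> x1 = x2" "\<sigma> y1 = - \<sigma> y2 \<longleftrightarrow> y1 = - y2"
    using gal_inj[OF \<sigma>] q Qbar_uminus gal_uminus[OF \<sigma>] by metis+
  have s': "(if x1 = x2 then (3 * (\<sigma> x1)^2 + of_rat (fst E)) / (2*\<sigma> y1) else (\<sigma> y2 - \<sigma> y1) / (\<sigma> x2 - \<sigma> x1)) = \<sigma> s"
    unfolding s_def using q by (auto simp: gal_simps[OF \<sigma>] Qbar_intros)
  show ?thesis unfolding PQ gal_pt_simps eadd.simps(3) s_def[symmetric] eq unfolding s' Let_def
    using q sq by (simp add: gal_simps[OF \<sigma>] Qbar_intros)
qed

lemma on_curve_gal:
  assumes \<sigma>: "\<sigma> \<in> GalQ" and "alg_pt P" "on_curve E P"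
  shows "on_curve E (gal_pt \<sigma> P)"
proof (cases P)
  case (Some xy)
  then obtain x y where P: "P = Some (x, y)" by (cases xy) auto
  have q: "x \<in> Qbar" "y \<in> Qbar" using assms P by auto
  have "\<sigma> (y^2) = \<sigma> (x^3 + of_rat (fst E) * x + of_rat (snd E))" using assms(3) P by (simp add: on_curve_def)
  then show ?thesis using q by (simp add: P on_curve_def gal_simps[OF \<sigma>] Qbar_intros)
qed (simp add: on_curve_def)

lemma alg_pt_gal: "\<sigma> \<in> GalQ \<Longrightarrow> alg_pt P \<Longrightarrow> alg_pt (gal_pt \<sigma> P)"
  using gal_Qbar by (cases P) (auto simp: gal_pt_def)

lemma alg_pt_scl: "u \<in> Qbar \<Longrightarrow> alg_pt P \<Longrightarrow> alg_pt (scl u P)"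
  by (cases P) (auto intro!: Qbar_intros)

definition alg :: "'c::curve ept \<Rightarrow> bool" where "alg X \<longleftrightarrow> alg_pt (raw X)"

text \<open>Meaningful for \<open>alg\<close> points only, since an element of \<open>GalQ\<close>
  is unconstrained outside \<open>Qbar\<close>.\<close>

definition gal :: "(complex \<Rightarrow> complex) \<Rightarrow> 'c::curve ept \<Rightarrow> 'c ept" where
  "gal \<sigma> X = Ept (gal_pt \<sigma> (raw X))"

lemma alg_0 [simp]: "alg 0" by (simp add: alg_def)

lemma alg_iff: "X \<noteq> 0 \<Longrightarrow> alg X \<longleftrightarrow> px X \<in> Qbar \<and> py X \<in> Qbar"
  using raw_nonzero[of X] by (simp add: alg_def)

lemma alg_add: "alg X \<Longrightarrow> alg Y \<Longrightarrow> alg (X + Y)"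
  by (simp add: alg_def raw_add alg_pt_eadd)

lemma alg_uminus: "alg X \<Longrightarrow> alg (- X)"
  by (cases "X = 0") (auto simp: alg_iff py_uminus Qbar_uminus)

lemma alg_nm: "alg X \<Longrightarrow> alg (nm n X)"
  by (induction n) (auto simp: alg_add)

lemma alg_zs: "alg X \<Longrightarrow> alg (zs n X)"
  unfolding zs_def diff_conv_add_uminus by (intro alg_add alg_uminus alg_nm)

context
  fixes \<sigma> assumes \<sigma>: "\<sigma> \<in> GalQ"
begin

lemma raw_gal: "alg X \<Longrightarrow> raw (gal \<sigma> X) = gal_pt \<sigma> (raw X)"
  unfolding gal_def by (rule Ept_inverse) (use raw[of X] on_curve_gal[OF \<sigma>] in \<open>simp add: alg_def\<close>)

lemma gal_ept_0 [simp]: "gal \<sigma> 0 = 0"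
  using raw_gal[of 0] by simp

lemma gal_ept_add: "alg X \<Longrightarrow> alg Y \<Longrightarrow> gal \<sigma> (X + Y) = gal \<sigma> X + gal \<sigma> Y"
  unfolding raw_inject[symmetric] by (simp add: raw_gal alg_add raw_add gal_pt_eadd[OF \<sigma>] flip: alg_def)

lemma gal_ept_uminus: "alg X \<Longrightarrow> gal \<sigma> (- X) = - gal \<sigma> X"
  using gal_ept_add[of X "- X"] by (simp add: alg_uminus eq_neg_iff_add_eq_0 add.commute)

lemma gal_ept_nm: "alg X \<Longrightarrow> gal \<sigma> (nm n X) = nm n (gal \<sigma> X)"
  by (induction n) (simp_all add: gal_ept_add alg_nm)

lemma gal_ept_zs: "alg X \<Longrightarrow> gal \<sigma> (zs n X) = zs n (gal \<sigma> X)"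
  unfolding zs_def diff_conv_add_uminus by (simp only: gal_ept_add gal_ept_uminus gal_ept_nm alg_uminus alg_nm)

lemma gal_tor: "alg X \<Longrightarrow> X \<in> tor p \<Longrightarrow> gal \<sigma> X \<in> tor p"
  using gal_ept_nm[of X p] by (simp add: tor_def)

lemma gal_coords:
  assumes "X \<noteq> 0" "alg X"
  shows "gal \<sigma> X \<noteq> 0" "px (gal \<sigma> X) = \<sigma> (px X)" "py (gal \<sigma> X) = \<sigma> (py X)"
  using raw_gal[OF assms(2)] raw_nonzero[OF assms(1)]
  by (auto simp: px_def[of "gal \<sigma> X"] py_def[of "gal \<sigma> X"] simp flip: raw_eq_None_iff)

end

lemma twist_trans: "twist u E E' \<Longrightarrow> twist v E' E'' \<Longrightarrow> twist (u * v) E E''"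
  by (auto simp: twist_def power_mult_distrib)

lemma twist_gal:
  assumes "\<sigma> \<in> GalQ" "u \<in> Qbar" "twist u E E'" shows "twist (\<sigma> u) E E'"
proof -
  have "\<sigma> u \<noteq> 0" using assms gal_inj[OF assms(1,2) Qbar_0] gal_0[OF assms(1)] by (auto simp: twist_def)
  moreover have "\<sigma> (of_rat (fst E')) = \<sigma> (u^4 * of_rat (fst E))" "\<sigma> (of_rat (snd E')) = \<sigma> (u^6 * of_rat (snd E))"
    using assms(3) by (auto simp: twist_def)
  ultimately show ?thesis using assms(2) by (simp add: twist_def gal_simps[OF assms(1)] Qbar_intros)
qed

text \<open>Automorphisms are named by the scalar u that sends (x, y) to (u^2 x, u^3 y), so that
  they compose as complex numbers multiply and Galois acts on them through
  \<open>\<sigma> u\<close>.\<close>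

definition autom :: "'c::curve itself \<Rightarrow> complex \<Rightarrow> bool" where
  "autom T u \<longleftrightarrow> twist u (crv T) (crv T)"

definition sc :: "complex \<Rightarrow> 'c::curve ept \<Rightarrow> 'c ept" where
  "sc u X = Ept (scl u (raw X))"

lemma autom_iff: "autom TYPE('c::curve) u \<longleftrightarrow> u \<noteq> 0 \<and> u^4 * ca TYPE('c) = ca TYPE('c) \<and> u^6 * cb TYPE('c) = cb TYPE('c)"
  by (auto simp: autom_def twist_def ca_def cb_def)

lemma autom_1: "autom TYPE('c::curve) 1" by (simp add: autom_iff)

lemma autom_mult: "autom TYPE('c::curve) u \<Longrightarrow> autom TYPE('c) v \<Longrightarrow> autom TYPE('c) (u * v)"
  by (simp add: autom_def twist_trans)

lemma autom_inverse: "autom TYPE('c::curve) u \<Longrightarrow> autom TYPE('c) (inverse u)"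
  by (simp add: autom_def twist_inverse)

lemma autom_Qbar: "autom TYPE('c::curve) u \<Longrightarrow> u \<in> Qbar"
proof -
  assume a: "autom TYPE('c) u"
  have "ca TYPE('c) \<noteq> 0 \<or> cb TYPE('c) \<noteq> 0"
    using nonsingular[where 'a='c] by (auto simp: ca_def cb_def)
  then have "u^4 = 1 \<or> u^6 = 1" using a by (auto simp: autom_iff)
  then show ?thesis using Qbar_root[of u 4] Qbar_root[of u 6] Qbar_1 by auto
qed

context
  fixes u assumes u: "autom TYPE('c::curve) u"
begin

lemma raw_sc: "raw (sc u X :: 'c ept) = scl u (raw X)"
  unfolding sc_def using u raw[of X] by (intro Ept_inverse) (simp add: autom_def on_curve_scl)

lemma sc_0 [simp]: "sc u (0::'c ept) = 0"
  using raw_sc[of 0] by simp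

lemma sc_add: "sc u (X + Y :: 'c ept) = sc u X + sc u Y"
  unfolding raw_inject[symmetric] using u by (simp add: raw_sc raw_add autom_def eadd_scl)

lemma sc_coords:
  assumes "X \<noteq> (0::'c ept)"
  shows "sc u X \<noteq> 0" "px (sc u X) = u^2 * px X" "py (sc u X) = u^3 * py X"
  using raw_sc[of X] raw_nonzero[OF assms] raw_eq_None_iff[of "sc u X"]
  by (auto simp: px_def[of "sc u X"] py_def[of "sc u X"])

lemma sc_uminus: "sc u (- X :: 'c ept) = - sc u X"
  using sc_add[of X "- X"] by (simp add: eq_neg_iff_add_eq_0 add.commute)

lemma sc_nm: "sc u (nm n X :: 'c ept) = nm n (sc u X)"
  by (induction n) (simp_all add: sc_add)

lemma sc_zs: "sc u (zs n X :: 'c ept) = zs n (sc u X)"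
  unfolding zs_def diff_conv_add_uminus sc_add sc_uminus sc_nm ..

lemma sc_tor: "X \<in> tor p \<Longrightarrow> sc u (X :: 'c ept) \<in> tor p"
  by (simp add: tor_def sc_nm[symmetric])

lemma alg_sc: "alg X \<Longrightarrow> alg (sc u (X :: 'c ept))"
  using autom_Qbar[OF u] by (simp add: alg_def raw_sc alg_pt_scl)

end

lemma sc_sc:
  assumes "autom TYPE('c::curve) u" "autom TYPE('c) v"
  shows "sc u (sc v (X :: 'c ept)) = sc (u * v) X"
  unfolding raw_inject[symmetric] by (simp add: raw_sc assms autom_mult scl_scl)

lemma sc_1 [simp]: "sc 1 X = X"
  unfolding raw_inject[symmetric] by (simp add: raw_sc autom_1)

lemma sc_inverse:
  assumes "autom TYPE('c::curve) u" shows "sc u (sc (inverse u) (X :: 'c ept)) = X"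
proof -
  have "u * inverse u = 1" using assms by (simp add: autom_iff)
  then show ?thesis using sc_sc[OF assms autom_inverse[OF assms], of X] by simp
qed

lemma sc_m1 [simp]: "sc (- 1) (X::'c::curve ept) = - X"
proof (cases "X = 0")
  case False
  have "autom TYPE('c) (- 1)" by (simp add: autom_iff)
  from sc_coords[OF this False] show ?thesis using False by (intro ept_eqI) (auto simp: py_uminus)
qed (simp add: autom_iff)

lemma gal_sc:
  assumes "\<sigma> \<in> GalQ" "autom TYPE('c::curve) u" "alg (X :: 'c ept)"
  shows "gal \<sigma> (sc u X) = sc (\<sigma> u) (gal \<sigma> X)"
proof (cases "X = 0")
  case False
  have q: "u \<in> Qbar" using autom_Qbar assms by blast
  have a: "autom TYPE('c) (\<sigma> u)" using twist_gal assms q by (auto simp: autom_def)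
  note g = gal_coords[OF assms(1) False assms(3)]
  note s = sc_coords[OF assms(2) False] and s' = sc_coords[OF a g(1)]
  note gs = gal_coords[OF assms(1) s(1) alg_sc[OF assms(2,3)]]
  have xq: "px X \<in> Qbar" "py X \<in> Qbar" using alg_iff False assms by auto
  show ?thesis using gs(1) s'(1)
    by (rule ept_eqI) (simp_all add: gs s' s g gal_simps[OF assms(1)] Qbar_intros q xq)
next
  case True
  have "autom TYPE('c) (\<sigma> u)" using twist_gal[OF assms(1) autom_Qbar[OF assms(2)]] assms(2) by (auto simp: autom_def)
  then show ?thesis using True assms by simp
qed

section \<open>From endomorphisms of torsion to congruences\<close>

definition ator :: "nat \<Rightarrow> 'c::curve ept set" where "ator p = {X \<in> tor p. alg X}"

lemma tors_eq:
  assumes t: "twist u (crv TYPE('c::curve)) E" and u: "u \<in> Qbar"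
  shows "tors E p = (\<lambda>X::'c ept. scl u (raw X)) ` ator p"
proof -
  have u0: "u \<noteq> 0" using t by (simp add: twist_def)
  show ?thesis
  proof (intro equalityI subsetI)
    fix P assume P: "P \<in> tors E p"
    have on: "on_curve (crv TYPE('c)) (scl (inverse u) P)"
      using P on_curve_scl[OF twist_inverse[OF t]] by (simp add: tors_def Epts_def)
    define X :: "'c ept" where "X = Ept (scl (inverse u) P)"
    have r: "raw X = scl (inverse u) P" unfolding X_def by (rule Ept_inverse) (use on in simp)
    have PX: "P = scl u (raw X)" using r scl_inverse(2)[OF u0] by simp
    have "alg X" using P u by (auto simp: alg_def r tors_def Epts_def intro!: alg_pt_scl Qbar_inverse)
    moreover have "esmul E p (scl u (raw X)) = None" using P by (simp add: tors_def PX)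
    then have "X \<in> tor p" by (simp add: esmul_scl[OF t] esmul_raw tor_def)
    ultimately show "P \<in> (\<lambda>X::'c ept. scl u (raw X)) ` ator p" using PX by (auto simp: ator_def)
  next
    fix P assume "P \<in> (\<lambda>X::'c ept. scl u (raw X)) ` ator p"
    then obtain X :: "'c ept" where X: "P = scl u (raw X)" "X \<in> tor p" "alg X" by (auto simp: ator_def)
    then show "P \<in> tors E p" using on_curve_scl[OF t, of "raw X"] raw[of X] esmul_scl[OF t, of p "raw X"]
        alg_pt_scl[OF u] by (simp add: tors_def Epts_def alg_def esmul_raw tor_def)
  qed
qed

text \<open>Both u and \<open>\<sigma> u\<close> carry the base curve to the same E, since both
  curves are defined over the rationals; their ratio is the cocycle of the twist.\<close>

lemma autom_ratio:
  assumes "twist u (crv TYPE('c::curve)) E" "u \<in> Qbar" "\<sigma> \<in> GalQ"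
  shows "autom TYPE('c) (\<sigma> u / u)"
  using twist_trans[OF twist_gal[OF assms(3,2,1)] twist_inverse[OF assms(1)]]
  by (simp add: autom_def divide_inverse)

text \<open>Transported to the base curve, the Galois action on the twist is the original action
  followed by the cocycle.\<close>

lemma gal_pt_scl_raw:
  fixes X :: "'c::curve ept"
  assumes t: "twist u (crv TYPE('c)) E" and u: "u \<in> Qbar" and \<sigma>: "\<sigma> \<in> GalQ" and X: "alg X"
  shows "gal_pt \<sigma> (scl u (raw X)) = scl u (raw (sc (\<sigma> u / u) (gal \<sigma> X)))"
proof -
  have u0: "u \<noteq> 0" using t by (simp add: twist_def)
  have "gal_pt \<sigma> (scl u (raw X)) = scl (\<sigma> u) (gal_pt \<sigma> (raw X))"
  proof (cases "X = 0")
    case False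
    then show ?thesis using raw_nonzero[OF False] alg_iff[OF False] X u
      by (simp add: gal_simps[OF \<sigma>] Qbar_intros)
  qed simp
  also have "\<dots> = scl u (scl (\<sigma> u / u) (gal_pt \<sigma> (raw X)))" using u0 by (simp add: scl_scl)
  finally show ?thesis by (simp add: raw_sc[OF autom_ratio[OF t u \<sigma>]] raw_gal[OF \<sigma> X])
qed

text \<open>The exponent is kept, so that congruences compose by multiplying exponents and the
  symplectic type is read off only at the end.\<close>

definition weil_congruent :: "nat \<Rightarrow> wcurve \<Rightarrow> wcurve \<Rightarrow> nat \<Rightarrow> bool" where
  "weil_congruent p E E' d \<longleftrightarrow> (\<exists>\<phi>. galmod_iso E E' p \<phi> \<and> weil_exp E E' p \<phi> d)"

text \<open>Conjugation by the two scalings turns a map of the base torsion that intertwines the two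
  twisted Galois actions into an isomorphism of Galois modules; the scalings do not affect the
  pairing.\<close>

lemma congruence_from_torsion_map:
  fixes M :: "'c::curve ept \<Rightarrow> 'c ept"
  assumes t: "twist u (crv TYPE('c)) E" "twist u' (crv TYPE('c)) E'" and q: "u \<in> Qbar" "u' \<in> Qbar"
    and p: "prime p" and bij: "bij_betw M (ator p) (ator p)"
    and add: "\<And>X Y. X \<in> ator p \<Longrightarrow> Y \<in> ator p \<Longrightarrow> M (X + Y) = M X + M Y"
    and gal: "\<And>\<sigma> X. \<sigma> \<in> GalQ \<Longrightarrow> X \<in> ator p \<Longrightarrow>
      M (sc (\<sigma> u / u) (gal \<sigma> X)) = sc (\<sigma> u' / u') (gal \<sigma> (M X))"
    and w: "\<And>X Y. X \<in> ator p \<Longrightarrow> Y \<in> ator p \<Longrightarrow> wp p (M X) (M Y) = wp p X Y ^ d"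
    and d: "\<not> p dvd d"
  shows "weil_congruent p E E' d"
proof -
  have u0: "u \<noteq> 0" "u' \<noteq> 0" using t by (auto simp: twist_def)
  define \<phi> where "\<phi> P = scl u' (raw (M (Ept (scl (inverse u) P))))" for P
  have \<phi>: "\<phi> (scl u (raw X)) = scl u' (raw (M X))" for X
    by (simp add: \<phi>_def scl_inverse(1)[OF u0(1)] raw_inverse)
  note T = tors_eq[OF t(1) q(1)] and T' = tors_eq[OF t(2) q(2)]
  have M: "M X \<in> ator p" if "X \<in> ator p" for X using bij that by (auto simp: bij_betw_def)
  have inj: "inj_on \<phi> (tors E p)"
    unfolding T using bij by (auto simp: inj_on_def \<phi> inj_scl[OF u0(2)] raw_inject bij_betw_def)
  have "\<phi> ` tors E p = (\<lambda>X. scl u' (raw X)) ` (M ` ator p)"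
    unfolding T image_image \<phi> ..
  then have img: "\<phi> ` tors E p = tors E' p" using bij by (simp add: T' bij_betw_def)
  have hom: "\<phi> (eadd E P Q) = eadd E' (\<phi> P) (\<phi> Q)" if PQ: "P \<in> tors E p" "Q \<in> tors E p" for P Q
  proof -
    obtain X Y :: "'c ept" where XY: "X \<in> ator p" "Y \<in> ator p" "P = scl u (raw X)" "Q = scl u (raw Y)"
      using PQ unfolding T by auto
    then show ?thesis by (simp add: eadd_scl[OF t(1)] \<phi> add raw_add[symmetric])
      (simp add: raw_add eadd_scl[OF t(2)])
  qed
  have eq: "\<phi> (gal_pt \<sigma> P) = gal_pt \<sigma> (\<phi> P)" if g: "\<sigma> \<in> GalQ" and P: "P \<in> tors E p" for \<sigma> P
  proof -
    obtain X :: "'c ept" where X: "X \<in> ator p" "P = scl u (raw X)" using P unfolding T by auto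
    have a: "alg X" "alg (M X)" using X M by (auto simp: ator_def)
    show ?thesis unfolding X(2) \<phi> gal_pt_scl_raw[OF t(1) q(1) g a(1)]
        gal_pt_scl_raw[OF t(2) q(2) g a(2)] gal[OF g X(1)] ..
  qed
  have we: "weil E' p (\<phi> P) (\<phi> Q) = weil E p P Q ^ d" if PQ: "P \<in> tors E p" "Q \<in> tors E p" for P Q
  proof -
    obtain X Y :: "'c ept" where XY: "X \<in> ator p" "Y \<in> ator p" "P = scl u (raw X)" "Q = scl u (raw Y)"
      using PQ unfolding T by auto
    have "X \<in> tor p" "Y \<in> tor p" "M X \<in> tor p" "M Y \<in> tor p" using XY M by (auto simp: ator_def)
    then show ?thesis unfolding XY(3,4) \<phi> by (simp add: weil_scl[OF t(1) p] weil_scl[OF t(2) p] w XY(1,2))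
  qed
  show ?thesis unfolding weil_congruent_def galmod_iso_def weil_exp_def bij_betw_def
    using inj img hom eq we d by blast
qed

lemma weil_congruent_trans:
  assumes "weil_congruent p E E' d" "weil_congruent p E' E'' d'" "prime p"
  shows "weil_congruent p E E'' (d * d')"
proof -
  obtain f where f: "galmod_iso E E' p f" "weil_exp E E' p f d" using assms by (auto simp: weil_congruent_def)
  obtain g where g: "galmod_iso E' E'' p g" "weil_exp E' E'' p g d'" using assms by (auto simp: weil_congruent_def)
  have m: "f P \<in> tors E' p" if "P \<in> tors E p" for P using f that by (auto simp: galmod_iso_def bij_betw_def)
  have "galmod_iso E E'' p (g \<circ> f)"
    using f(1) g(1) m bij_betw_trans[of f "tors E p" "tors E' p" g "tors E'' p"]
    by (auto simp: galmod_iso_def)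
  moreover have "weil_exp E E'' p (g \<circ> f) (d * d')"
    using f(2) g(2) m assms(3) by (simp add: weil_exp_def prime_dvd_mult_iff power_mult)
  ultimately show ?thesis by (auto simp: weil_congruent_def)
qed

text \<open>Write z and z' for the cocycles of u and u'. Galois multiplies r by
  \<open>inverse (z * z')\<close>, which \<open>M_r\<close> turns into an automorphism, and
  \<open>M_sc\<close> moves z across M as its inverse; together they give the equivariance required
  between the two twists. Bijectivity holds because the square is a sign at each point.\<close>

lemma semilinear_congruence:
  fixes M :: "complex \<Rightarrow> 'c::curve ept \<Rightarrow> 'c ept"
  assumes t: "twist u (crv TYPE('c)) E" "twist u' (crv TYPE('c)) E'" and q: "u \<in> Qbar" "u' \<in> Qbar"
    and p: "prime p" and r: "r = 1 / (u * u')"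
    and tor: "\<And>X. X \<in> tor p \<Longrightarrow> M r X \<in> tor p"
    and al: "\<And>X. X \<in> tor p \<Longrightarrow> alg X \<Longrightarrow> alg (M r X)"
    and add: "\<And>X Y. X \<in> tor p \<Longrightarrow> Y \<in> tor p \<Longrightarrow> M r (X + Y) = M r X + M r Y"
    and sq: "\<And>X. X \<in> tor p \<Longrightarrow> M r (M r X) = X \<or> M r (M r X) = - X"
    and M_sc: "\<And>\<zeta> X. autom TYPE('c) \<zeta> \<Longrightarrow> X \<in> tor p \<Longrightarrow> M r (sc \<zeta> X) = sc (inverse \<zeta>) (M r X)"
    and M_r: "\<And>\<zeta> X. autom TYPE('c) \<zeta> \<Longrightarrow> X \<in> tor p \<Longrightarrow> M (\<zeta> * r) X = sc \<zeta> (M r X)"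
    and M_gal: "\<And>\<sigma> X. \<sigma> \<in> GalQ \<Longrightarrow> X \<in> tor p \<Longrightarrow> alg X \<Longrightarrow> gal \<sigma> (M r X) = M (\<sigma> r) (gal \<sigma> X)"
    and w: "\<And>X Y. X \<in> tor p \<Longrightarrow> Y \<in> tor p \<Longrightarrow> wp p (M r X) (M r Y) = wp p X Y ^ d"
    and d: "\<not> p dvd d"
  shows "weil_congruent p E E' d"
proof (rule congruence_from_torsion_map[OF t q p, where M="M r"])
  have u0: "u \<noteq> 0" "u' \<noteq> 0" using t by (auto simp: twist_def)
  have 0: "M r 0 = 0" using add[of 0 0] by simp
  have neg: "M r (- X) = - M r X" if "X \<in> tor p" for X
    using add[of X "- X"] that tor_uminus[OF that] by (simp add: 0 eq_neg_iff_add_eq_0 add.commute)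
  have at: "M r X \<in> ator p" if "X \<in> ator p" for X using that tor al by (auto simp: ator_def)
  show "bij_betw (M r) (ator p) (ator p)"
    unfolding bij_betw_def
  proof
    show "inj_on (M r) (ator p)"
    proof (rule inj_onI)
      fix X Y assume XY: "X \<in> ator p" "Y \<in> ator p" "M r X = M r Y"
      define Z where "Z = X + - Y"
      have Z: "Z \<in> tor p" using XY by (auto simp: ator_def Z_def simp del: add_uminus_conv_diff intro!: tor_plus tor_uminus)
      have "M r Z = 0" unfolding Z_def using XY add[of X "- Y"] neg[of Y] tor_uminus[of Y p] by (simp add: ator_def)
      then have "Z = 0" using sq[OF Z] 0 by auto
      then show "X = Y" by (simp add: Z_def)
    qed
    show "M r ` ator p = ator p"
    proof
      show "M r ` ator p \<subseteq> ator p" using at by auto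
      show "ator p \<subseteq> M r ` ator p"
      proof
        fix X :: "'c ept" assume X: "X \<in> ator p"
        have "X \<in> tor p" using X by (simp add: ator_def)
        have "- M r X \<in> ator p" using at[OF X] by (simp add: ator_def tor_uminus alg_uminus)
        moreover have "M r (- M r X) = - M r (M r X)" using neg at[OF X] by (simp add: ator_def)
        ultimately show "X \<in> M r ` ator p"
          using sq[OF \<open>X \<in> tor p\<close>] at[OF X] by (metis imageI minus_minus)
      qed
    qed
  qed
  show "M r (sc (\<sigma> u / u) (gal \<sigma> X)) = sc (\<sigma> u' / u') (gal \<sigma> (M r X))"
    if \<sigma>: "\<sigma> \<in> GalQ" and X: "X \<in> ator p" for \<sigma> X
  proof -
    define z z' where "z = \<sigma> u / u" and "z' = \<sigma> u' / u'"
    have a: "autom TYPE('c) z" "autom TYPE('c) z'" unfolding z_def z'_def by (rule autom_ratio[OF t(1) q(1) \<sigma>], rule autom_ratio[OF t(2) q(2) \<sigma>])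
    have X': "X \<in> tor p" "alg X" using X by (auto simp: ator_def)
    have Y: "gal \<sigma> X \<in> tor p" using gal_tor[OF \<sigma>] X' by blast
    have su: "\<sigma> u = z * u" "\<sigma> u' = z' * u'" using u0 by (auto simp: z_def z'_def)
    have z0: "z \<noteq> 0" "z' \<noteq> 0" using a by (auto simp: autom_iff)
    have "\<sigma> r = 1 / (\<sigma> u * \<sigma> u')" unfolding r using q by (simp add: gal_simps[OF \<sigma>] Qbar_intros)
    also have "\<dots> = inverse (z * z') * r" unfolding su r by (simp add: field_simps)
    finally have "gal \<sigma> (M r X) = sc (inverse (z * z')) (M r (gal \<sigma> X))"
      using M_gal[OF \<sigma> X'] M_r[OF autom_inverse[OF autom_mult[OF a]] Y] by simp
    then have "sc z' (gal \<sigma> (M r X)) = sc (inverse z) (M r (gal \<sigma> X))"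
      using z0 sc_sc[OF a(2) autom_inverse[OF autom_mult[OF a]], of "M r (gal \<sigma> X)"]
      by (simp only:) (simp add: field_simps)
    also have "\<dots> = M r (sc z (gal \<sigma> X))" using M_sc[OF a(1) Y] by simp
    finally show ?thesis by (simp add: z_def z'_def)
  qed
qed (use add w d in \<open>auto simp: ator_def\<close>)

text \<open>As N commutes with automorphisms, the cocycles of u and u' have to differ by the factor
  by which Galois changes N itself, which is the content of \<open>N_gal\<close>. \<open>N'\<close>
  is an inverse up to d, and d is prime to p.\<close>

lemma linear_congruence:
  fixes N N' :: "'c::curve ept \<Rightarrow> 'c ept"
  assumes t: "twist u (crv TYPE('c)) E" "twist u' (crv TYPE('c)) E'" and q: "u \<in> Qbar" "u' \<in> Qbar"
    and p: "prime p"
    and add: "\<And>X Y. N (X + Y) = N X + N Y"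
    and al: "\<And>X. alg X \<Longrightarrow> alg (N X)" "\<And>X. alg X \<Longrightarrow> alg (N' X)"
    and NN: "\<And>X. N (N' X) = nm d X" "\<And>X. N' (N X) = nm d X" and N'0: "N' 0 = 0"
    and N'tor: "\<And>X. X \<in> tor p \<Longrightarrow> N' X \<in> tor p"
    and N_sc: "\<And>\<zeta> X. autom TYPE('c) \<zeta> \<Longrightarrow> N (sc \<zeta> X) = sc \<zeta> (N X)"
    and N_gal: "\<And>\<sigma> X. \<sigma> \<in> GalQ \<Longrightarrow> alg X \<Longrightarrow> sc (\<sigma> (u'/u) / (u'/u)) (gal \<sigma> (N X)) = N (gal \<sigma> X)"
    and w: "\<And>X Y. X \<in> tor p \<Longrightarrow> Y \<in> tor p \<Longrightarrow> wp p (N X) (N Y) = wp p X Y ^ d"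
    and d: "\<not> p dvd d"
  shows "weil_congruent p E E' d"
proof (rule congruence_from_torsion_map[OF t q p, where M=N])
  have u0: "u \<noteq> 0" "u' \<noteq> 0" using t by (auto simp: twist_def)
  have 0: "N 0 = 0" using add[of 0 0] by simp
  have neg: "N (- X) = - N X" for X using add[of X "- X"] by (simp add: 0 eq_neg_iff_add_eq_0 add.commute)
  have nm: "N (nm k X) = nm k (N X)" for k X by (induction k) (simp_all add: 0 add)
  have at: "N X \<in> ator p" if "X \<in> ator p" for X using that al nm[of p X, symmetric] by (auto simp: ator_def tor_def 0)
  have "coprime d p" using prime_imp_coprime[OF p d] coprime_commute by blast
  then obtain k where k: "[d * k = Suc 0] (mod p)" using cong_solve_coprime_nat[of d p] by blast
  have dk: "nm d (nm k X) = X" if "X \<in> tor p" for X :: "'c ept"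
    using nm_mod[of p X "d * k"] nm_mod[of p X "Suc 0"] that k
    by (simp add: tor_def cong_def nm_mult[symmetric])
  show "bij_betw N (ator p) (ator p)"
    unfolding bij_betw_def
  proof
    show "inj_on N (ator p)"
    proof (rule inj_onI)
      fix X Y assume XY: "X \<in> ator p" "Y \<in> ator p" "N X = N Y"
      define Z where "Z = X + - Y"
      have Z: "Z \<in> tor p" using XY by (auto simp: ator_def Z_def simp del: add_uminus_conv_diff intro!: tor_plus tor_uminus)
      have "N Z = 0" unfolding Z_def using XY add[of X "- Y"] neg[of Y] by simp
      then have "nm d Z = 0" using NN(2)[of Z] N'0 by simp
      then have "nm k (nm d Z) = 0" by simp
      then have "Z = 0" using dk[OF Z] by (simp add: nm_mult[symmetric] mult.commute)
      then show "X = Y" by (simp add: Z_def)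
    qed
    show "N ` ator p = ator p"
    proof
      show "N ` ator p \<subseteq> ator p" using at by auto
      show "ator p \<subseteq> N ` ator p"
      proof
        fix X :: "'c ept" assume X: "X \<in> ator p"
        have "N' (nm k X) \<in> ator p" using X al N'tor by (auto simp: ator_def tor_nm alg_nm)
        moreover have "N (N' (nm k X)) = X" using NN(1) dk X by (simp add: ator_def)
        ultimately show "X \<in> N ` ator p" by (metis imageI)
      qed
    qed
  qed
  show "N (sc (\<sigma> u / u) (gal \<sigma> X)) = sc (\<sigma> u' / u') (gal \<sigma> (N X))"
    if \<sigma>: "\<sigma> \<in> GalQ" and X: "X \<in> ator p" for \<sigma> X
  proof -
    define z z' where "z = \<sigma> u / u" and "z' = \<sigma> u' / u'"
    have a: "autom TYPE('c) z" "autom TYPE('c) z'" unfolding z_def z'_def by (rule autom_ratio[OF t(1) q(1) \<sigma>], rule autom_ratio[OF t(2) q(2) \<sigma>])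
    have X': "alg X" using X by (auto simp: ator_def)
    have "\<sigma> (u'/u) / (u'/u) = inverse z * z'" using q by (simp add: gal_simps[OF \<sigma>] z_def z'_def field_simps)
    then have "N (gal \<sigma> X) = sc (inverse z) (sc z' (gal \<sigma> (N X)))"
      using N_gal[OF \<sigma> X'] by (simp add: sc_sc autom_inverse a)
    then have "N (sc z (gal \<sigma> X)) = sc z (sc (inverse z) (sc z' (gal \<sigma> (N X))))" using N_sc[OF a(1)] by simp
    also have "\<dots> = sc z' (gal \<sigma> (N X))" by (rule sc_inverse[OF a(1)])
    finally show ?thesis by (simp add: z_def z'_def)
  qed
qed (use add w d in \<open>auto simp: ator_def\<close>)

lemma double_coords:
  fixes X :: "'c::curve ept"
  assumes "X \<noteq> 0" "py X \<noteq> 0" and s: "s = (3 * px X^2 + ca TYPE('c)) / (2 * py X)"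
  shows "X + X \<noteq> 0" "px (X + X) = s^2 - 2 * px X" "py (X + X) = s * (px X - px (X + X)) - py X"
proof -
  show n: "X + X \<noteq> 0"
  proof
    assume "X + X = 0"
    then have "py X = - py X" using py_uminus[OF assms(1)] by (metis add_eq_0_iff)
    then show False using assms(2) by simp
  qed
  have "s = slp X X" by (simp add: s slp_def)
  note l = line[OF assms(1,1) n this refl]
  show "px (X + X) = s^2 - 2 * px X" using l(3) by simp
  show "py (X + X) = s * (px X - px (X + X)) - py X" using l(4) by (simp add: algebra_simps)
qed

lemma py_eq_0_iff_double: "X \<noteq> 0 \<Longrightarrow> py X = 0 \<longleftrightarrow> X + X = (0::'c::curve ept)"
proof
  assume X: "X \<noteq> 0" "py X = 0"
  then have "- X = X" by (intro ept_eqI) (auto simp: py_uminus)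
  then show "X + X = 0" by (metis add.right_inverse)
qed (use double_coords(1) in blast)

text \<open>Coordinates with respect to the generator can be reduced modulo p, so at most p^2 points
  occur.\<close>

lemma (in cm) finite_tor:
  assumes "X\<^sub>0 \<in> tor p" "p > 0" "\<And>P. P \<in> tor p \<Longrightarrow> \<exists>m n. P = L m n X\<^sub>0"
  shows "finite (tor p :: 'a set)"
proof (rule finite_subset)
  show "(tor p :: 'a set) \<subseteq> (\<lambda>(m, n). L m n X\<^sub>0) ` ({0..<int p} \<times> {0..<int p})"
  proof
    fix P :: 'a assume "P \<in> tor p"
    then obtain m n where "P = L m n X\<^sub>0" using assms(3) by blast
    also have "\<dots> = L (m mod int p) (n mod int p) X\<^sub>0" by (rule L_mod[OF assms(1)]) (simp_all add: mod_0_imp_dvd minus_mod_eq_div_mult)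
    finally show "P \<in> (\<lambda>(m, n). L m n X\<^sub>0) ` ({0..<int p} \<times> {0..<int p})" using assms(2) by auto
  qed
qed simp

lemma (in cm) cm_pairing_wp:
  fixes p :: nat and X\<^sub>0 :: 'a
  assumes "off_line_additive p B" "off_line_additive.bilinear_on_tor p B"
    and "X\<^sub>0 \<in> tor p" "\<And>P. P \<in> tor p \<Longrightarrow> \<exists>m n. P = L m n X\<^sub>0"
  shows "cm_pairing \<tau> \<beta> p B X\<^sub>0"
proof -
  interpret o: off_line_additive p B by fact
  show ?thesis
  proof unfold_locales
    show "B P P = 1" for P by (simp add: o.dep)
    show "P \<in> tor p \<Longrightarrow> Q \<in> tor p \<Longrightarrow> B P Q \<noteq> 0" for P Q by (rule o.nz)
    show "P \<in> tor p \<Longrightarrow> Q \<in> tor p \<Longrightarrow> B Q P = 1 / B P Q" for P Q by (rule o.anti)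
    show "P \<in> tor p \<Longrightarrow> Q \<in> tor p \<Longrightarrow> Q' \<in> tor p \<Longrightarrow> B P (Q + Q') = B P Q * B P Q'" for P Q Q'
      using assms(2) by (simp add: o.bilinear_on_tor_def)
  qed (use assms in auto)
qed

text \<open>The formulas are asked for in the coordinates \<open>u^2 * px X\<close> and
  \<open>u^3 * py X\<close> of the twist, where the powers of u combine into rational
  coefficients.\<close>

lemma isogenous_from_map:
  fixes N :: "'c::curve ept \<Rightarrow> 'c ept"
  assumes t: "twist u (crv TYPE('c)) E" "twist u' (crv TYPE('c)) E'" and q: "u \<in> Qbar" "u' \<in> Qbar"
    and add: "\<And>X Y. N (X + Y) = N X + N Y" and al: "\<And>X. alg X \<Longrightarrow> alg (N X)"
    and ker: "card {X. alg X \<and> N X = 0} = n"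
    and fm: "\<And>X. X \<noteq> 0 \<Longrightarrow> N X \<noteq> 0 \<Longrightarrow>
      poly (map_poly of_rat b1) (u^2 * px X) \<noteq> 0 \<and> poly (map_poly of_rat b2) (u^2 * px X) \<noteq> 0 \<and>
      u'^2 * px (N X) = (poly (map_poly of_rat a1) (u^2 * px X)
        + u^3 * py X * poly (map_poly of_rat c1) (u^2 * px X)) / poly (map_poly of_rat b1) (u^2 * px X) \<and>
      u'^3 * py (N X) = (poly (map_poly of_rat a2) (u^2 * px X)
        + u^3 * py X * poly (map_poly of_rat c2) (u^2 * px X)) / poly (map_poly of_rat b2) (u^2 * px X)"
  shows "isogenous n E E'"
proof -
  have u0: "u \<noteq> 0" "u' \<noteq> 0" using t by (auto simp: twist_def)
  define \<psi> where "\<psi> P = scl u' (raw (N (Ept (scl (inverse u) P))))" for P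
  have \<psi>: "\<psi> (scl u (raw X)) = scl u' (raw (N X))" for X
    by (simp add: \<psi>_def scl_inverse(1)[OF u0(1)] raw_inverse)
  have Ep: "Epts E = (\<lambda>X::'c ept. scl u (raw X)) ` {X. alg X}"
  proof (intro equalityI subsetI)
    fix P assume P: "P \<in> Epts E"
    have on: "on_curve (crv TYPE('c)) (scl (inverse u) P)"
      using P on_curve_scl[OF twist_inverse[OF t(1)]] by (simp add: Epts_def)
    define X :: "'c ept" where "X = Ept (scl (inverse u) P)"
    have r: "raw X = scl (inverse u) P" unfolding X_def by (rule Ept_inverse) (use on in simp)
    have "P = scl u (raw X)" using r scl_inverse(2)[OF u0(1)] by simp
    moreover have "alg X" using P q by (auto simp: alg_def r Epts_def intro!: alg_pt_scl Qbar_inverse)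
    ultimately show "P \<in> (\<lambda>X::'c ept. scl u (raw X)) ` {X. alg X}" by auto
  next
    fix P assume "P \<in> (\<lambda>X::'c ept. scl u (raw X)) ` {X. alg X}"
    then obtain X :: "'c ept" where "P = scl u (raw X)" "alg X" by auto
    then show "P \<in> Epts E" using on_curve_scl[OF t(1), of "raw X"] raw[of X] alg_pt_scl[OF q(1)]
      by (simp add: Epts_def alg_def)
  qed
  have "\<forall>P\<in>Epts E. \<psi> P \<in> Epts E'"
  proof
    fix P assume "P \<in> Epts E"
    then obtain X :: "'c ept" where X: "P = scl u (raw X)" "alg X" unfolding Ep by auto
    then show "\<psi> P \<in> Epts E'" using on_curve_scl[OF t(2), of "raw (N X)"] raw[of "N X"]
        alg_pt_scl[OF q(2)] al[of X] by (simp add: \<psi> Epts_def alg_def)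
  qed
  moreover have "\<forall>P\<in>Epts E. \<forall>Q\<in>Epts E. \<psi> (eadd E P Q) = eadd E' (\<psi> P) (\<psi> Q)"
  proof (intro ballI)
    fix P Q assume PQ: "P \<in> Epts E" "Q \<in> Epts E"
    obtain X Y :: "'c ept" where XY: "P = scl u (raw X)" "Q = scl u (raw Y)" using PQ unfolding Ep by auto
    show "\<psi> (eadd E P Q) = eadd E' (\<psi> P) (\<psi> Q)"
      unfolding XY \<psi> eadd_scl[OF t(1)] eadd_scl[OF t(2)] raw_add[symmetric] add ..
  qed
  moreover have "{P\<in>Epts E. \<psi> P = None} = (\<lambda>X::'c ept. scl u (raw X)) ` {X. alg X \<and> N X = 0}"
    unfolding Ep by (auto simp: \<psi>)
  moreover have "inj_on (\<lambda>X::'c ept. scl u (raw X)) {X. alg X \<and> N X = 0}"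
    by (auto simp: inj_on_def inj_scl[OF u0(1)] raw_inject)
  ultimately have 1: "(\<forall>P\<in>Epts E. \<psi> P \<in> Epts E') \<and>
    (\<forall>P\<in>Epts E. \<forall>Q\<in>Epts E. \<psi> (eadd E P Q) = eadd E' (\<psi> P) (\<psi> Q)) \<and> card {P\<in>Epts E. \<psi> P = None} = n"
    using ker by (simp add: card_image)
  have "\<forall>x y. Some (x, y) \<in> Epts E \<and> \<psi> (Some (x, y)) \<noteq> None \<longrightarrow>
        (let ev = (\<lambda>f. poly (map_poly of_rat f) x) in
          ev b1 \<noteq> 0 \<and> ev b2 \<noteq> 0 \<and>
          \<psi> (Some (x, y)) = Some ((ev a1 + y * ev c1) / ev b1, (ev a2 + y * ev c2) / ev b2))"
  proof (intro allI impI, elim conjE)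
    fix x y assume xy: "Some (x, y) \<in> Epts E" "\<psi> (Some (x, y)) \<noteq> None"
    obtain X :: "'c ept" where X: "Some (x, y) = scl u (raw X)" using xy(1) unfolding Ep by auto
    have X0: "X \<noteq> 0" using X by auto
    have NX: "N X \<noteq> 0" using xy(2) unfolding X \<psi> by auto
    have x: "x = u^2 * px X" "y = u^3 * py X" using X raw_nonzero[OF X0] by auto
    have "\<psi> (Some (x, y)) = Some (u'^2 * px (N X), u'^3 * py (N X))"
      unfolding X \<psi> raw_nonzero[OF NX] by simp
    then show "let ev = (\<lambda>f. poly (map_poly of_rat f) x) in
          ev b1 \<noteq> 0 \<and> ev b2 \<noteq> 0 \<and>
          \<psi> (Some (x, y)) = Some ((ev a1 + y * ev c1) / ev b1, (ev a2 + y * ev c2) / ev b2)"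
      using fm[OF X0 NX] unfolding x Let_def by simp
  qed
  then show ?thesis unfolding isogenous_def using 1 by blast
qed

section \<open>Curves with complex multiplication by \<open>i\<close>\<close>

datatype quar = Quar

instantiation quar :: curve
begin
definition "crv (T :: quar itself) = (1, 0)"
instance by standard (simp add: crv_quar_def)
end

lemma quar_coeffs [simp]: "ca TYPE(quar) = 1" "cb TYPE(quar) = 0"
  by (simp_all add: ca_def cb_def crv_quar_def)

lemma autom_quar: "autom TYPE(quar) u \<longleftrightarrow> u^4 = 1"
  by (auto simp: autom_iff)

lemma quar_eq: "X \<noteq> (0::quar ept) \<Longrightarrow> (py X)^2 = (px X)^3 + px X"
  using curve_eq[of X] by simp

text \<open>Multiplication by j on y^2 = x^3 + x, sending (x, y) to (-x, j y) for either square root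
  j of -1; the scalar is \<open>- j\<close> because its cube has to be j.\<close>

definition ti :: "complex \<Rightarrow> quar ept \<Rightarrow> quar ept" where "ti j = sc (- j)"

context
  fixes j :: complex assumes j: "j^2 = -1"
begin

lemma autom_j: "autom TYPE(quar) (- j)"
proof -
  have "(- j)^4 = (j^2)^2" by (simp flip: power_mult)
  then show ?thesis using j by (simp add: autom_quar)
qed

lemma ti_coords:
  assumes "X \<noteq> 0" shows "ti j X \<noteq> 0" "px (ti j X) = - px X" "py (ti j X) = j * py X"
proof -
  have "(- j)^3 = j * (- (j^2))" by (simp add: power3_eq_cube power2_eq_square)
  then have "(- j)^3 = j" using j by simp
  then show "ti j X \<noteq> 0" "px (ti j X) = - px X" "py (ti j X) = j * py X"
    using sc_coords[OF autom_j assms] j by (simp_all add: ti_def)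
qed

lemma ti_cm: "cm (ti j) 0"
proof
  show "ti j (X + Y) = ti j X + ti j Y" for X Y by (simp add: ti_def sc_add[OF autom_j])
  have "- j * - j = -1" using j by (simp add: power2_eq_square)
  then show "ti j (ti j X) = - X + zs 0 (ti j X)" for X
    using sc_sc[OF autom_j autom_j, of X] by (simp add: ti_def)
qed

lemma ti_alg: "alg X \<Longrightarrow> alg (ti j X)"
  by (simp add: ti_def alg_sc[OF autom_j])

lemma one_plus_ti_coords:
  assumes X: "X \<noteq> 0" "px X \<noteq> 0"
  shows "X + ti j X \<noteq> 0" "px (X + ti j X) = - j * (px X^2 + 1) / (2 * px X)"
    "py (X + ti j X) = (1 + j) * py X * (1 - px X^2) / (4 * px X^2)"
proof -
  define x y where "x = px X" and "y = py X"
  note c = ti_coords[OF X(1)]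
  have x0: "x \<noteq> 0" using X by (simp add: x_def)
  have ne: "px X \<noteq> px (ti j X)" using X c by simp
  have n: "X + ti j X \<noteq> 0"
  proof
    assume "X + ti j X = 0"
    then have "ti j X = - X" by (simp add: add_eq_0_iff)
    then show False using ne by simp
  qed
  then show "X + ti j X \<noteq> 0" .
  define s where "s = slp X (ti j X)"
  note l = line[OF X(1) c(1) n s_def refl]
  have s: "s = (1 - j) * y / (2 * x)" using ne x0 c by (simp add: s_def slp_def x_def y_def field_simps)
  have y2: "y^2 = x^3 + x" using quar_eq[OF X(1)] by (simp add: x_def y_def)
  have j2: "(1 - j)^2 = -2*j" using j by (simp add: power2_eq_square algebra_simps)
  have "px (X + ti j X) = s^2" using l(3) c by simp
  also have "\<dots> = (1 - j)^2 * y^2 / (2*x)^2" unfolding s by (simp add: power_mult_distrib power_divide)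
  also have "\<dots> = - j * (x^2 + 1) / (2 * x)" unfolding j2 y2 using x0
    by (simp add: field_simps power2_eq_square power3_eq_cube)
  finally show px: "px (X + ti j X) = - j * (px X^2 + 1) / (2 * px X)" by (simp add: x_def)
  have "py (X + ti j X) = s * (x - px (X + ti j X)) - y" using l(1,4) by (simp add: x_def y_def algebra_simps)
  also have "\<dots> = (1 + j) * y * (1 - x^2) / (4 * x^2)"
    unfolding px s x_def[symmetric] using x0 j by (simp add: field_simps) Groebner_Basis.algebra
  finally show "py (X + ti j X) = (1 + j) * py X * (1 - px X^2) / (4 * px X^2)" by (simp add: x_def y_def)
qed

end

text \<open>The square of the abscissa separates the orbits of the four automorphisms.\<close>

lemma quar_same_square:
  assumes "X \<noteq> 0" "Y \<noteq> 0" "px X ^ 2 = px Y ^ 2"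
  shows "Y = X \<or> Y = - X \<or> Y = ti \<i> X \<or> Y = - ti \<i> X"
proof -
  note c = ti_coords[OF power2_i assms(1)]
  have "px Y = px X \<or> px Y = px (ti \<i> X)" using assms(3) c(2) by (auto simp: power2_eq_iff)
  then show ?thesis using px_eq_iff[OF assms(2,1)] px_eq_iff[OF assms(2) c(1)] by auto
qed

interpretation qi: cm "ti \<i>" 0 by (rule ti_cm) simp

lemma ti_minus_i: "ti (- \<i>) X = - ti \<i> X"
proof -
  have "autom TYPE(quar) (- 1)" by (simp add: autom_quar)
  from sc_sc[OF this autom_j[OF power2_i], of X] show ?thesis by (simp add: ti_def)
qed

lemma gal_i: "\<sigma> \<in> GalQ \<Longrightarrow> \<sigma> \<i> = \<i> \<or> \<sigma> \<i> = - \<i>"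
proof -
  assume \<sigma>: "\<sigma> \<in> GalQ"
  have "\<i> \<in> Qbar" by (auto simp: Qbar_def)
  then have "\<sigma> \<i> ^ 2 = -1" using gal_power[OF \<sigma>, of \<i> 2] gal_uminus[OF \<sigma>, of 1] gal_1[OF \<sigma>] Qbar_1 by simp
  then have "\<sigma> \<i> ^ 2 = \<i> ^ 2" by simp
  then show ?thesis by (simp only: power2_eq_iff)
qed

lemma i_Qbar: "\<i> \<in> Qbar" by (auto simp: Qbar_def)

lemma twist_quartic:
  assumes "u^4 = of_rat a" "a \<noteq> 0" shows "twist u (crv TYPE(quar)) (quartic a)" "u \<in> Qbar"
proof -
  have "u \<noteq> 0" using assms by auto
  then show "twist u (crv TYPE(quar)) (quartic a)" using assms by (simp add: twist_def crv_quar_def quartic_def)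
  show "u \<in> Qbar" by (rule Qbar_root[of u 4]) (simp_all add: assms Qbar_rat)
qed

lemma ex_fourth_root: "\<exists>u::complex. u^4 = z"
proof
  show "(csqrt (csqrt z))^4 = z" using power_mult[of "csqrt (csqrt z)" 2 2] by simp
qed

lemma one_plus_i_power: "(1 + \<i>)^2 = 2 * \<i>" "(1 + \<i>)^3 = -2 + 2 * \<i>" "(1 + \<i>)^4 = -4"
  by (simp_all add: power2_eq_square power3_eq_cube power4_eq_xxxx algebra_simps)

text \<open>The endomorphism 1 + i has kernel O and (0, 0). Scaling the target by
  \<open>u' = (1 + i) u\<close> makes it rational, and (1 + i)^4 = -4 gives the curve. In twisted
  coordinates it sends x to (x^2 + a)/x and y to y (x^2 - a)/x^2.\<close>

lemma isogenous_quartic: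
  assumes "a \<noteq> 0" shows "isogenous 2 (quartic a) (quartic (-4 * a))"
proof -
  obtain u where u: "u^4 = (of_rat a :: complex)" using ex_fourth_root by blast
  define u' where "u' = (1 + \<i>) * u"
  have u': "u'^4 = of_rat (-4 * a)" by (simp add: u'_def power_mult_distrib u one_plus_i_power of_rat_mult of_rat_minus)
  have u0: "u \<noteq> 0" using u assms by auto
  show ?thesis
  proof (rule isogenous_from_map[OF twist_quartic(1)[OF u assms] twist_quartic(1)[OF u'] twist_quartic(2)[OF u assms] twist_quartic(2)[OF u'],
        where N="\<lambda>X. X + ti \<i> X" and ?a1.0="[:a, 0, 1:]" and ?b1.0="[:0, 1:]" and ?c1.0=0
          and ?a2.0=0 and ?b2.0="[:0, 0, 1:]" and ?c2.0="[:- a, 0, 1:]"])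
    show "-4 * a \<noteq> 0" "-4 * a \<noteq> 0" using assms by auto
    show "X + Y + ti \<i> (X + Y) = X + ti \<i> X + (Y + ti \<i> Y)" for X Y by (simp add: qi.\<tau>_add)
    show "alg X \<Longrightarrow> alg (X + ti \<i> X)" for X by (intro alg_add ti_alg) auto
    define O2 :: "quar ept" where "O2 = mk 0 0"
    have O2: "O2 \<noteq> 0" "px O2 = 0" "py O2 = 0" using mk_simps[of 0 0, where 'c=quar] by (auto simp: O2_def)
    have "X + ti \<i> X = 0 \<longleftrightarrow> X = 0 \<or> X = O2" for X
    proof (cases "X = 0")
      case True
      then show ?thesis using qi.\<tau>_zs[of 0 0] by simp
    next
      case False
      note c = ti_coords[OF power2_i False]
      show ?thesis
      proof (cases "px X = 0")
        case True
        then have "(py X)^2 = 0" using quar_eq[OF False] by simp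
        then have X: "X = O2" using O2 True False by (intro ept_eqI) auto
        moreover have "ti \<i> X = - X" using c True False O2 X by (intro ept_eqI) (auto simp: py_uminus)
        ultimately show ?thesis by simp
      next
        case n: False
        then show ?thesis using one_plus_ti_coords(1)[OF power2_i False n] False O2 by auto
      qed
    qed
    moreover have "alg O2" using O2 by (simp add: alg_iff Qbar_0)
    ultimately have "{X. alg X \<and> X + ti \<i> X = 0} = {0, O2}" by auto
    then show "card {X. alg X \<and> X + ti \<i> X = 0} = 2" using O2(1) by simp
    fix X :: "quar ept" assume X: "X \<noteq> 0" "X + ti \<i> X \<noteq> 0"
    have x0: "px X \<noteq> 0"
    proof
      assume x: "px X = 0"
      then have "(py X)^2 = 0" using quar_eq[OF X(1)] by simp
      then have "ti \<i> X = - X" using ti_coords[OF power2_i X(1)] X x by (intro ept_eqI) (auto simp: py_uminus)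
      then show False using X by simp
    qed
    define x y where "x = px X" and "y = py X"
    have c: "px (X + ti \<i> X) = - \<i> * (x^2 + 1) / (2 * x)"
      "py (X + ti \<i> X) = (1 + \<i>) * y * (1 - x^2) / (4 * x^2)"
      using one_plus_ti_coords[OF power2_i X(1) x0] by (auto simp: x_def y_def)
    have x0: "x \<noteq> 0" using x0 by (simp add: x_def)
    have 1: "u'^2 * px (X + ti \<i> X) = (u^4 + (u^2*x)^2) / (u^2*x)"
    proof -
      have "u'^2 * px (X + ti \<i> X) = u^2 * ((2 * \<i>) * (- \<i> * (x^2 + 1) / (2 * x)))"
        unfolding c u'_def power_mult_distrib one_plus_i_power by simp
      also have "(2 * \<i>) * (- \<i> * (x^2 + 1) / (2 * x)) = (x^2 + 1) / x" using x0 by (simp add: field_simps)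
      also have "u^2 * ((x^2 + 1) / x) = (u^4 + (u^2*x)^2) / (u^2*x)"
        using u0 x0 by (simp add: field_simps power2_eq_square power4_eq_xxxx)
      finally show ?thesis .
    qed
    have 2: "u'^3 * py (X + ti \<i> X) = u^3*y * ((u^2*x)^2 - u^4) / (u^2*x)^2"
    proof -
      have "u'^3 * py (X + ti \<i> X) = u^3 * y * (((-2 + 2*\<i>) * (1 + \<i>)) * (1 - x^2) / (4 * x^2))"
        unfolding c u'_def power_mult_distrib one_plus_i_power by simp
      also have "(-2 + 2*\<i>) * (1 + \<i>) = -4" by (simp add: algebra_simps)
      also have "u^3 * y * (-4 * (1 - x^2) / (4 * x^2)) = u^3*y * ((u^2*x)^2 - u^4) / (u^2*x)^2"
        using u0 x0 by (simp add: field_simps power2_eq_square power4_eq_xxxx)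
      finally show ?thesis .
    qed
    have ev: "poly (map_poly of_rat [:0, 1:]) z = z" "poly (map_poly of_rat [:0, 0, 1:]) z = z^2"
      "poly (map_poly of_rat [:a, 0, 1:]) z = u^4 + z^2" "poly (map_poly of_rat [:- a, 0, 1:]) z = z^2 - u^4"
      for z :: complex by (simp_all add: map_poly_pCons u of_rat_minus power2_eq_square)
    show "poly (map_poly of_rat [:0, 1:]) (u^2 * px X) \<noteq> 0 \<and> poly (map_poly of_rat [:0, 0, 1:]) (u^2 * px X) \<noteq> 0 \<and>
      u'^2 * px (X + ti \<i> X) = (poly (map_poly of_rat [:a, 0, 1:]) (u^2 * px X)
        + u^3 * py X * poly (map_poly of_rat 0) (u^2 * px X)) / poly (map_poly of_rat [:0, 1:]) (u^2 * px X) \<and>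
      u'^3 * py (X + ti \<i> X) = (poly (map_poly of_rat 0) (u^2 * px X)
        + u^3 * py X * poly (map_poly of_rat [:- a, 0, 1:]) (u^2 * px X)) / poly (map_poly of_rat [:0, 0, 1:]) (u^2 * px X)"
      unfolding ev 1 2 using u0 x0 by (simp add: x_def y_def)
  qed
qed

text \<open>The exponent is the norm of 1 + i, and 1 - i serves as inverse up to 2.\<close>

lemma two_isogeny_congruence:
  assumes a: "a \<noteq> 0" and p: "prime p" "odd p" and P: "cm_pairing (ti \<i>) 0 p (wp p) X\<^sub>0"
  shows "weil_congruent p (quartic a) (quartic (-4 * a)) 2"
proof -
  interpret P: cm_pairing "ti \<i>" 0 p "wp p" X\<^sub>0 by fact
  obtain u where u: "u^4 = (of_rat a :: complex)" using ex_fourth_root by blast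
  define u' where "u' = (1 + \<i>) * u"
  have u': "u'^4 = of_rat (-4 * a)" by (simp add: u'_def power_mult_distrib u one_plus_i_power of_rat_mult of_rat_minus)
  have u0: "u \<noteq> 0" using u a by auto
  have a': "-4 * a \<noteq> 0" using a by simp
  have NL: "X + ti \<i> X = qi.L 1 1 X" "X + - ti \<i> X = qi.L 1 (-1) X" for X by (simp_all add: qi.L_def)
  show ?thesis
  proof (rule linear_congruence[OF twist_quartic(1)[OF u a] twist_quartic(1)[OF u' a'] twist_quartic(2)[OF u a] twist_quartic(2)[OF u' a'] p(1),
        where N="\<lambda>X. X + ti \<i> X" and N'="\<lambda>X. X + - ti \<i> X"])
    show "X + Y + ti \<i> (X + Y) = X + ti \<i> X + (Y + ti \<i> Y)" for X Y by (simp add: qi.\<tau>_add)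
    show "alg X \<Longrightarrow> alg (X + ti \<i> X)" for X by (intro alg_add ti_alg) auto
    show "alg X \<Longrightarrow> alg (X + - ti \<i> X)" for X by (intro alg_add alg_uminus ti_alg) auto
    show "X + - ti \<i> X + ti \<i> (X + - ti \<i> X) = nm 2 X" for X
      unfolding NL qi.L_L by (simp add: qi.L_def)
    show "X + ti \<i> X + - ti \<i> (X + ti \<i> X) = nm 2 X" for X
      unfolding NL qi.L_L by (simp add: qi.L_def)
    show "0 + - ti \<i> 0 = 0" using qi.\<tau>_zs[of 0 0] by simp
    show "X \<in> tor p \<Longrightarrow> X + - ti \<i> X \<in> tor p" for X unfolding NL by (rule qi.L_tor)
    show "sc \<zeta> X + ti \<i> (sc \<zeta> X) = sc \<zeta> (X + ti \<i> X)" if "autom TYPE(quar) \<zeta>" for \<zeta> X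
      using that autom_j[OF power2_i] by (simp add: sc_add ti_def sc_sc mult.commute)
    show "\<not> p dvd 2" using p primes_dvd_imp_eq[of p 2] by auto
    show "wp p (X + ti \<i> X) (Y + ti \<i> Y) = wp p X Y ^ 2" if "X \<in> tor p" "Y \<in> tor p" for X Y
      unfolding NL using P.B_linear[OF that, of 1 1] by simp
    fix \<sigma> and X :: "quar ept" assume \<sigma>: "\<sigma> \<in> GalQ" and X: "alg X"
    have uu: "u' / u = 1 + \<i>" using u0 by (simp add: u'_def)
    have g: "gal \<sigma> (X + ti \<i> X) = gal \<sigma> X + ti (\<sigma> \<i>) (gal \<sigma> X)"
      using X gal_sc[OF \<sigma> autom_j[OF power2_i] X] gal_uminus[OF \<sigma> i_Qbar]
      by (simp add: gal_ept_add[OF \<sigma>] ti_alg) (simp add: ti_def)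
    have s: "\<sigma> (1 + \<i>) = 1 + \<sigma> \<i>" using gal_add[OF \<sigma> Qbar_1 i_Qbar] gal_1[OF \<sigma>] by simp
    show "sc (\<sigma> (u' / u) / (u' / u)) (gal \<sigma> (X + ti \<i> X)) = gal \<sigma> X + ti \<i> (gal \<sigma> X)"
    proof (cases "\<sigma> \<i> = \<i>")
      case True
      have "1 + \<i> \<noteq> 0" by (simp add: complex_eq_iff)
      then show ?thesis unfolding g uu s True by simp
    next
      case False
      then have m: "\<sigma> \<i> = - \<i>" using gal_i[OF \<sigma>] by blast
      \<comment> \<open>Galois elements that move i multiply 1 + i by -i. The scalar -i acts as
        \<open>ti \<i>\<close>, which carries the endomorphism 1 - i back to 1 + i.\<close>
      have "1 + - \<i> = - \<i> * (1 + \<i>)" by (simp add: algebra_simps)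
      moreover have "1 + \<i> \<noteq> 0" by (simp add: complex_eq_iff)
      ultimately have r: "(1 + - \<i>) / (1 + \<i>) = - \<i>" by (simp del: add_uminus_conv_diff)
      show ?thesis unfolding g uu s m r ti_minus_i ti_def[symmetric]
        by (simp add: qi.\<tau>_sq qi.\<tau>_add qi.\<tau>_zs[of "-1", simplified] del: add_uminus_conv_diff) 
    qed
  qed
qed

section \<open>The 3-torsion of quartic twists\<close>

text \<open>Here \<open>l1\<close>, \<open>l2\<close>, \<open>l3\<close> are the tangent slopes at
  three flexes of y^2 = x^3 + x lying on one line of slope s: a flex has m^2 = 3x for its tangent
  slope m, so each flex on the line gives a root m of the same quartic.\<close>

lemma collinear_flexes:
  fixes l1 l2 l3 s c :: complex
  assumes d: "l1 \<noteq> l2" "l1 \<noteq> l3" "l2 \<noteq> l3"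
    and f1: "l1^4 - 2*s*l1^3 - 6*c*l1 + 3 = 0" and f2: "l2^4 - 2*s*l2^3 - 6*c*l2 + 3 = 0"
    and f3: "l3^4 - 2*s*l3^3 - 6*c*l3 + 3 = 0"
    and S: "l1^2 + l2^2 + l3^2 = 3*s^2" and T: "l1^2*l2^2 + l1^2*l3^2 + l2^2*l3^2 = 9*(1 - 2*s*c)"
    and U: "l1^2*l2^2*l3^2 = 27*c^2"
  shows "(s - l3)*(s - l2) = (s - l1)^2"
proof -
  have "(l1 - l2) * ((l1^2+l2^2)*(l1+l2) - 2*s*(l1^2+l1*l2+l2^2) - 6*c) = 0" using f1 f2 by Groebner_Basis.algebra
  then have g12: "(l1^2+l2^2)*(l1+l2) - 2*s*(l1^2+l1*l2+l2^2) - 6*c = 0" using d by simp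
  have "(l1 - l3) * ((l1^2+l3^2)*(l1+l3) - 2*s*(l1^2+l1*l3+l3^2) - 6*c) = 0" using f1 f3 by Groebner_Basis.algebra
  then have g13: "(l1^2+l3^2)*(l1+l3) - 2*s*(l1^2+l1*l3+l3^2) - 6*c = 0" using d by simp
  have "(l2 - l3) * (l1^2+l2^2+l3^2+l1*l2+l1*l3+l2*l3 - 2*s*(l1+l2+l3)) = 0"
    using g12 g13 by Groebner_Basis.algebra
  then have h: "l1^2+l2^2+l3^2+l1*l2+l1*l3+l2*l3 - 2*s*(l1+l2+l3) = 0" using d by simp
  define e1 e2 e3 where "e1 = l1+l2+l3" and "e2 = l1*l2+l1*l3+l2*l3" and "e3 = l1*l2*l3"
  have e2: "e2 = 2*s*e1 - 3*s^2" using h S unfolding e1_def e2_def by Groebner_Basis.algebra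
  have "e1^2 - 2*e2 = 3*s^2" using S unfolding e1_def e2_def by Groebner_Basis.algebra
  then have "(e1 - s)*(e1 - 3*s) = 0" unfolding e2 by Groebner_Basis.algebra
  \<comment> \<open>In the first case the differences of s with the three slopes have sum 0 and
    second symmetric function 0, which is the claim. The second case forces \<open>s*e3 = 3\<close>
    and \<open>s*c = 1\<close>, against \<open>(s*e3)^2 = 27*(s*c)^2\<close>.\<close>
  then consider "e1 = 3*s" | "e1 = s" by auto
  then show ?thesis
  proof cases
    case 1
    have "l3 = 3*s - l1 - l2" using 1 unfolding e1_def by Groebner_Basis.algebra
    moreover have "l1*l2+l1*l3+l2*l3 = 3*s^2" using e2 1 by (simp add: e2_def power2_eq_square)
    ultimately show ?thesis by Groebner_Basis.algebra
  next
    case 2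
    have e2': "e2 = - (s^2)" using e2 2 by (simp add: power2_eq_square)
    have l3: "l3 = s - l1 - l2" using 2 by (auto simp: e1_def)
    have q: "l1*l2+l1*(s-l1-l2)+l2*(s-l1-l2) = - (s^2)" using e2' by (simp add: e2_def l3)
    have e3: "e3 = 6*c + s^3" using g12 q unfolding e3_def l3 by Groebner_Basis.algebra
    have r1: "l1^3 - s*l1^2 - s^2*l1 - e3 = 0" using q unfolding e3_def l3 by Groebner_Basis.algebra
    have se3: "s*e3 = 3" using f1 r1 e3 by Groebner_Basis.algebra
    have "e2^2 - 2*e1*e3 = 9*(1 - 2*s*c)" using T unfolding e1_def e2_def e3_def by Groebner_Basis.algebra
    then have t: "s^4 - 6 = 9*(1 - 2*(s*c))" unfolding e2' 2 using se3 by Groebner_Basis.algebra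
    have t': "6*(s*c) + s^4 = 3" using se3 unfolding e3
      by (simp add: algebra_simps power3_eq_cube power4_eq_xxxx)
    have "12 * (s*c) = 12" using t t' by Groebner_Basis.algebra
    then have sc: "s*c = 1" by simp
    have "e3^2 = 27*c^2" using U unfolding e3_def by (simp add: power_mult_distrib)
    then have "(s*e3)^2 = 27*(s*c)^2" by (simp add: power_mult_distrib)
    then have False unfolding se3 sc by simp
    then show ?thesis ..
  qed
qed

lemma tor3:
  fixes P :: "'c::curve ept"
  assumes "P \<in> tor 3" "P \<noteq> 0"
  shows "P + P = - P" "py P \<noteq> 0" "slp P P ^ 2 = 3 * px P" "2 * slp P P * py P = 3 * px P^2 + ca TYPE('c)"
proof -
  have "P + P + P = 0" using assms(1) by (simp add: tor_def numeral_3_eq_3 add.assoc)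
  then show P: "P + P = - P" by (simp add: eq_neg_iff_add_eq_0)
  show y: "py P \<noteq> 0" using P assms(2) py_eq_0_iff_double[of P] by auto
  have s: "slp P P = (3 * px P^2 + ca TYPE('c)) / (2 * py P)" by (simp add: slp_def)
  show "slp P P ^ 2 = 3 * px P" using double_coords(2)[OF assms(2) y s] unfolding P by simp
  show "2 * slp P P * py P = 3 * px P^2 + ca TYPE('c)" unfolding s using y by simp
qed

text \<open>A 3-torsion point is a flex: the vertical line of the second factor cancels the
  denominator of the first, and the tangent remains.\<close>

lemma mf3:
  fixes P R :: "'c::curve ept"
  assumes "P \<in> tor 3" "P \<noteq> 0" "R \<noteq> 0" "px R \<noteq> px P"
  shows "mf 3 P R = chord P P (px R) (py R)"
proof -
  have "mf 3 P R = gf P P R * gf (P + P) P R" by (simp add: numeral_3_eq_3 mf_Suc)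
  also have "\<dots> = chord P P (px R) (py R)"
    unfolding gf_def gxy_def tor3(1)[OF assms(1,2)] using assms by simp
  finally show ?thesis .
qed

text \<open>For p = 3 the defect of shift invariance cannot be excluded by its order, so it is
  computed. The Miller values are tangents evaluated at points of the line through Q and P or at
  their mirror images, and their quotients reduce to the relation between the three slopes in
  \<open>collinear_flexes\<close>.\<close>

lemma wp3_shift:
  fixes P Q :: "quar ept"
  assumes T: "P \<in> tor 3" "Q \<in> tor 3" and o: "Q \<notin> mults P"
  shows "wp 3 P (Q + P) = wp 3 P Q"
proof (cases "P = 0")
  case False
  define S where "S = Q + P"
  interpret o: off_line_additive 3 "\<lambda>_ _ :: quar ept. 1" by unfold_locales auto
  note i = o.independent[OF T False o]
  have S: "S \<in> tor 3" "S \<noteq> 0" "S \<notin> mults P" "P \<notin> mults S" "S \<notin> mults Q"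
    using i by (auto simp: S_def add.commute)
  have Q0: "Q \<noteq> 0" and PQ: "P \<notin> mults Q" using i by auto
  have x: "px Q \<noteq> px P" "px S \<noteq> px P" "px S \<noteq> px Q"
    using off_mults[OF T(1) _ o mults_self] off_mults[OF T(1) _ S(3) mults_self]
      off_mults[OF T(2) _ S(5) mults_self] False Q0 by (auto simp: off_def)
  define s c where "s = slp Q P" "c = py Q - s * px Q"
  note l = line[OF Q0 False S(2)[unfolded S_def] s_c_def, folded S_def]
  define l1 l2 l3 where "l1 = slp P P" and "l2 = slp Q Q" and "l3 = slp S S"
  note tP = tor3(3,4)[OF T(1) False, folded l1_def] and tQ = tor3(3,4)[OF T(2) Q0, folded l2_def]
    and tS = tor3(3,4)[OF S(1,2), folded l3_def]
  have quartic: "m^4 - 2*s*m^3 - 6*c*m + 3 = 0" if "m^2 = 3 * z" "2*m*(s*z+c) = 3*z^2 + 1" for m z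
    using that by Groebner_Basis.algebra
  have q1: "l1^4 - 2*s*l1^3 - 6*c*l1 + 3 = 0" using quartic[OF tP(1)] tP(2) l(2) by simp
  have q2: "l2^4 - 2*s*l2^3 - 6*c*l2 + 3 = 0" using quartic[OF tQ(1)] tQ(2) l(1) by simp
  \<comment> \<open>The third point on the line is \<open>- S\<close>, whose tangent has slope
    \<open>- l3\<close>.\<close>
  have q3: "(-l3)^4 - 2*s*(-l3)^3 - 6*c*(-l3) + 3 = 0"
    using quartic[of "-l3" "px S"] tS l(4) by (simp add: algebra_simps)
  have sum: "px P + px Q + px S = s^2" using l(3) by simp
  have key: "(s - - l3)*(s - l2) = (s - l1)^2"
  proof (rule collinear_flexes[OF _ _ _ q1 q2 q3])
    show "l1 \<noteq> l2" "l1 \<noteq> - l3" "l2 \<noteq> - l3" using tP(1) tQ(1) tS(1) x by auto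
    show "l1^2 + l2^2 + (- l3)^2 = 3*s^2" unfolding tP(1) tQ(1) power2_minus tS(1) sum[symmetric] by simp
    show "l1^2*l2^2 + l1^2*(-l3)^2 + l2^2*(-l3)^2 = 9*(1 - 2*s*c)"
      unfolding tP(1) tQ(1) power2_minus tS(1) using l(5) unfolding quar_coeffs by Groebner_Basis.algebra
    show "l1^2*l2^2*(-l3)^2 = 27*c^2"
      unfolding tP(1) tQ(1) power2_minus tS(1) using l(6) unfolding quar_coeffs by Groebner_Basis.algebra
  qed
  have A: "mf 3 P Q = (s - l1)*(px Q - px P)"
    unfolding mf3[OF T(1) False Q0 x(1)] chord_def l1_def[symmetric] l(1,2) by (simp add: algebra_simps)
  have B: "mf 3 Q P = (s - l2)*(px P - px Q)"
    unfolding mf3[OF T(2) Q0 False x(1)[symmetric]] chord_def l2_def[symmetric] l(1,2) by (simp add: algebra_simps)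
  have PP: "P + P \<noteq> 0" "px (P + P) = px P" "S + S \<noteq> 0" "px (S + S) = px S"
    using tor3(1)[OF T(1) False] tor3(1)[OF S(1,2)] False S(2) by auto
  have C: "mf 3 P S * ((s - l1)*(px S - px P)) = - ((px S - px P)^3)"
  proof -
    have "chord P P (px S) (- py S) = (s - l1)*(px S - px P)"
      unfolding chord_def l1_def[symmetric] l(2,4) by (simp add: algebra_simps)
    then show ?thesis using line_norm[OF False False PP(1) curve_eq[OF S(2)]]
      unfolding mf3[OF T(1) False S(2) x(2)] PP by (simp add: power3_eq_cube mult.assoc)
  qed
  have D: "mf 3 S P * ((s + l3)*(px P - px S)) = (px P - px S)^3"
  proof -
    have "chord S S (px P) (- py P) = - ((s + l3)*(px P - px S))"
      unfolding chord_def l3_def[symmetric] l(2,4) by (simp add: algebra_simps)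
    then show ?thesis using line_norm[OF S(2) S(2) PP(3) curve_eq[OF False]]
      unfolding mf3[OF S(1,2) False x(2)[symmetric]] PP by (simp add: power3_eq_cube mult.assoc)
  qed
  have nz: "s - l1 \<noteq> 0" "s + l3 \<noteq> 0" using C D x by auto
  then have nz2: "s - l2 \<noteq> 0" using key by auto
  have "mf 3 P S * (s - l1) * (px S - px P) = - ((px S - px P)^2) * (px S - px P)"
    using C by (simp add: power2_eq_square power3_eq_cube mult.assoc)
  moreover have "px S - px P \<noteq> 0" using x by simp
  ultimately have C': "mf 3 P S * (s - l1) = - ((px S - px P)^2)" using mult_right_cancel by blast
  have "mf 3 S P * (s + l3) * (px P - px S) = (px P - px S)^2 * (px P - px S)"
    using D by (simp add: power2_eq_square power3_eq_cube mult.assoc)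
  then have D': "mf 3 S P * (s + l3) = (px P - px S)^2" using x by simp
  have sq: "(px S - px P)^2 = (px P - px S)^2" by (simp add: power2_commute)
  have nzD: "mf 3 S P \<noteq> 0" using D' x by auto
  have "(s - l1) * (s + l3) * (mf 3 P S * ((s - l2)*(px P - px Q))) =
      (s - l1) * (s + l3) * (((s - l1)*(px Q - px P)) * mf 3 S P)"
    using C' D' key sq by Groebner_Basis.algebra
  then have "mf 3 P S * mf 3 Q P = mf 3 P Q * mf 3 S P" unfolding A B using nz by simp
  moreover have "mf 3 Q P \<noteq> 0" unfolding B using nz2 x by simp
  ultimately have "mf 3 P S / mf 3 S P = mf 3 P Q / mf 3 Q P" using nzD by (simp add: frac_eq_eq)
  moreover have p3: "prime (3::nat)" by simp
  ultimately show ?thesis unfolding S_def[symmetric] wp_independent[OF p3 T False o] wp_independent[OF p3 T(1) S(1) False S(3)]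
    by simp
qed simp

text \<open>The quartic is the 3-division polynomial of y^2 = x^3 + x.\<close>

lemma tor3_quar_iff:
  fixes X :: "quar ept"
  assumes "X \<noteq> 0" shows "X \<in> tor 3 \<longleftrightarrow> 3 * px X^4 + 6 * px X^2 - 1 = 0"
proof
  assume T: "X \<in> tor 3"
  show "3 * px X^4 + 6 * px X^2 - 1 = 0"
    using tor3(3,4)[OF T assms] quar_eq[OF assms] unfolding quar_coeffs by Groebner_Basis.algebra
next
  assume t: "3 * px X^4 + 6 * px X^2 - 1 = 0"
  have y: "py X \<noteq> 0"
  proof
    assume "py X = 0"
    then have "px X * (px X^2 + 1) = 0" using quar_eq[OF assms] by (simp add: ring_normal)
    then consider "px X = 0" | "px X^2 = -1" by (auto simp: eq_neg_iff_add_eq_0)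
    then show False
    proof cases
      case 2
      then have "px X^4 = 1" using power_mult[of "px X" 2 2] by simp
      then show False using t 2 by simp
    qed (use t in simp)
  qed
  define s where "s = (3 * px X^2 + ca TYPE(quar)) / (2 * py X)"
  note d = double_coords[OF assms y s_def]
  have "2 * py X * s = 3 * px X^2 + 1" using y by (simp add: s_def)
  then have "4 * py X^2 * s^2 = 4 * py X^2 * (3 * px X)" using t quar_eq[OF assms] by Groebner_Basis.algebra
  then have "s^2 = 3 * px X" using y by simp
  then have "px (X + X) = px X" using d(2) by simp
  then have "X + X = X \<or> X + X = - X" using px_eq_iff[OF d(1) assms] by simp
  then have "X + X + X = 0" using assms by auto
  then show "X \<in> tor 3" by (simp add: tor_def numeral_3_eq_3 add.assoc)
qed

text \<open>The squared abscissas of 3-torsion points are the roots of 3t^2 + 6t - 1, with product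
  -1/3; the endomorphism 1 + i interchanges them.\<close>

lemma tor3_square_inverse:
  fixes X :: "quar ept"
  assumes "X \<noteq> 0" "X \<in> tor 3"
  shows "px X \<noteq> 0" "X + ti \<i> X \<noteq> 0" "px (X + ti \<i> X)^2 = -1 / (3 * px X^2)"
proof -
  have t: "3 * px X^4 + 6 * px X^2 - 1 = 0" using assms tor3_quar_iff by blast
  show x: "px X \<noteq> 0" using t by auto
  show "X + ti \<i> X \<noteq> 0" using one_plus_ti_coords(1)[OF power2_i assms(1) x] .
  have c: "3 * (px X^2 + 1)^2 = 4" using t by Groebner_Basis.algebra
  have "px (X + ti \<i> X)^2 = - ((px X^2 + 1)^2 / (4 * px X^2))"
    unfolding one_plus_ti_coords(2)[OF power2_i assms(1) x] by (simp add: power_divide power_mult_distrib)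
  then have "4 * (px X^2 * px (X + ti \<i> X)^2) = - ((px X^2 + 1)^2)" using x by (simp add: field_simps)
  then have "4 * (3 * (px X^2 * px (X + ti \<i> X)^2)) = 4 * (-1)" using c by Groebner_Basis.algebra
  then have "3 * (px X^2 * px (X + ti \<i> X)^2) = -1" by simp
  then show "px (X + ti \<i> X)^2 = -1 / (3 * px X^2)" using x by (simp add: field_simps)
qed

text \<open>The squared abscissas of X and of (1 + i) X are the two roots, and over each root lies
  one orbit of the four automorphisms; so the unit multiples of X and of (1 + i) X are all the
  nonzero points.\<close>

lemma tor3_quar_generated:
  fixes X Y :: "quar ept"
  assumes X: "X \<noteq> 0" "X \<in> tor 3" and Y: "Y \<in> tor 3"
  shows "\<exists>m n. Y = qi.L m n X"
proof (cases "Y = 0")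
  case True
  then show ?thesis by (metis qi.L_0_0)
next
  case False
  define Z where "Z = X + ti \<i> X"
  note z = tor3_square_inverse[OF X, folded Z_def]
  define t u where "t = px X^2" and "u = px Y^2"
  have t: "3*t^2 + 6*t - 1 = 0" "t \<noteq> 0" using X tor3_quar_iff[OF X(1)] z(1) by (auto simp: t_def simp flip: power_mult)
  have u: "3*u^2 + 6*u - 1 = 0" using Y tor3_quar_iff[OF False] by (simp add: u_def flip: power_mult)
  have "(u - t) * (3*t*u + 1) = 0" using t(1) u by Groebner_Basis.algebra
  then consider "u = t" | "3*t*u + 1 = 0" by auto
  then have "u = t \<or> u = px Z^2"
  proof cases
    case 2
    then have "3 * t * u = -1" by (simp add: eq_neg_iff_add_eq_0)
    then have "u = -1 / (3 * t)" using t(2) by (simp add: field_simps)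
    then show ?thesis using z(3) by (simp add: t_def)
  qed simp
  then have "(\<exists>e. Y = zs e X \<or> Y = zs e (ti \<i> X)) \<or> (\<exists>e. Y = zs e Z \<or> Y = zs e (ti \<i> Z))"
    using quar_same_square[OF X(1) False] quar_same_square[OF z(2) False] zs_1 zs_m1
    unfolding t_def u_def by metis
  moreover have "Z = qi.L 1 1 X" by (simp add: Z_def qi.L_def)
  moreover have "zs e X = qi.L e 0 X" "zs e (ti \<i> X) = qi.L 0 e X" for e by (simp_all add: qi.L_def)
  ultimately show ?thesis unfolding qi.\<tau>_zs[symmetric] qi.L_zs qi.L_\<tau> by (metis qi.L_zs qi.L_\<tau> qi.\<tau>_zs)
qed

lemma ex_tor3_quar: "\<exists>X::quar ept. X \<noteq> 0 \<and> X \<in> tor 3"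
proof -
  define w where "w = csqrt 3"
  have w: "w^2 = 3" by (simp add: w_def del: csqrt_of_real_nonneg)
  define x where "x = csqrt (-1 + 2 / w)"
  obtain X :: "quar ept" where X: "X \<noteq> 0" "px X = x" using ex_point by blast
  have x2: "x^2 = -1 + 2 / w" by (simp add: x_def)
  have "x^4 = (x^2)^2" by (simp flip: power_mult)
  then have "3 * x^4 + 6 * x^2 - 1 = 3 * (x^2 + 1)^2 - 4" by (simp add: power2_eq_square algebra_simps)
  also have "\<dots> = 0" unfolding x2 using w by (simp add: power_divide)
  finally show ?thesis using X tor3_quar_iff[OF X(1)] by auto
qed

lemma pairing3_quar:
  assumes X: "X \<noteq> 0" "X \<in> tor 3" shows "cm_pairing (ti \<i>) 0 3 (wp 3) X"
proof -
  have g: "\<exists>m n. P = qi.L m n X" if "P \<in> tor 3" for P by (rule tor3_quar_generated[OF X that])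
  have f: "finite (tor 3 :: quar ept set)" by (rule qi.finite_tor[OF X(2) _ g]) simp_all
  have o: "off_line_additive 3 (wp 3 :: quar ept \<Rightarrow> _)" by (rule wp_off_line_additive) (simp_all add: f)
  show ?thesis
    by (rule qi.cm_pairing_wp[OF o off_line_additive.bilinear_if_shift_invariant[OF o wp3_shift] X(2) g])
qed

text \<open>With r^4 = -3 the squared abscissa of the image is -1/(3 x^2), the other root of 3t^2 +
  6t - 1. The image is thus a unit multiple of (1 + i) X, the unit depending on X.\<close>

definition M3 :: "complex \<Rightarrow> quar ept \<Rightarrow> quar ept" where
  "M3 r X = (if X = 0 then 0 else mk (r^2 / (3 * px X)) (r^3 * py X / (3 * px X)))"

lemma M3_coords:
  assumes r: "r^4 = -3" and X: "X \<noteq> 0" "X \<in> tor 3"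
  shows "M3 r X \<noteq> 0" "px (M3 r X) = r^2 / (3 * px X)" "py (M3 r X) = r^3 * py X / (3 * px X)" "M3 r X \<in> tor 3"
proof -
  have t: "3 * px X^4 + 6 * px X^2 - 1 = 0" using X tor3_quar_iff by blast
  have x: "px X \<noteq> 0" using t by auto
  have r0: "r \<noteq> 0" using r by auto
  have "3 * px X * (r^3 * py X)^2 - ((r^2)^3 + r^2 * (3 * px X)^2) = 0"
    using r t quar_eq[OF X(1)] by Groebner_Basis.algebra
  then have "(r^3 * py X / (3 * px X))^2 = (r^2 / (3 * px X))^3 + r^2 / (3 * px X)"
    using x by (simp add: field_simps power2_eq_square power3_eq_cube)
  then have on: "(r^3 * py X / (3 * px X))^2 = (r^2 / (3 * px X))^3 + ca TYPE(quar) * (r^2 / (3 * px X)) + cb TYPE(quar)"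
    by simp
  have M: "M3 r X = mk (r^2 / (3 * px X)) (r^3 * py X / (3 * px X))" using X by (simp add: M3_def)
  show n: "M3 r X \<noteq> 0" and c: "px (M3 r X) = r^2 / (3 * px X)" "py (M3 r X) = r^3 * py X / (3 * px X)"
    unfolding M using mk_simps[OF on] by auto
  have "(r^2)^4 + 18 * (r^2)^2 * px X^2 - 27 * px X^4 = 0" using r t by Groebner_Basis.algebra
  then have "3 * px (M3 r X)^4 + 6 * px (M3 r X)^2 - 1 = 0"
    unfolding c using x by (simp add: field_simps power2_eq_square power4_eq_xxxx)
  then show "M3 r X \<in> tor 3" using tor3_quar_iff[OF n] by blast
qed

lemma M3_0 [simp]: "M3 r 0 = 0" by (simp add: M3_def)

context
  fixes r :: complex assumes r: "r^4 = -3"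
begin

lemma M3_tor: "X \<in> tor 3 \<Longrightarrow> M3 r X \<in> tor 3"
  using M3_coords(4)[OF r] by (cases "X = 0") auto

lemma M3_sc:
  assumes "autom TYPE(quar) z" "X \<in> tor 3" shows "M3 r (sc z X) = sc (inverse z) (M3 r X)"
proof (cases "X = 0")
  case False
  have z4: "z^4 = 1" "z \<noteq> 0" using assms(1) by (auto simp: autom_quar)
  note s = sc_coords[OF assms(1) False]
  note m = M3_coords[OF r False assms(2)]
  note s' = sc_coords[OF autom_inverse[OF assms(1)] m(1)]
  note m' = M3_coords[OF r s(1) sc_tor[OF assms]]
  have x: "px X \<noteq> 0" using tor3_square_inverse(1)[OF False assms(2)] .
  have "z^4 * z^2 = z^2" using z4 by simp
  have zz: "z^3 * z^3 = z^2" using z4(1) by Groebner_Basis.algebra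
  show ?thesis using m'(1) s'(1)
  proof (rule ept_eqI)
    show "px (M3 r (sc z X)) = px (sc (inverse z) (M3 r X))"
      unfolding m' s' m s using z4(2) x by (simp add: field_simps)
    show "py (M3 r (sc z X)) = py (sc (inverse z) (M3 r X))"
      unfolding m' s' m s using z4(2) x zz by (simp add: field_simps)
  qed
qed (use assms autom_inverse[OF assms(1)] in simp)

lemma M3_ti: "X \<in> tor 3 \<Longrightarrow> M3 r (ti \<i> X) = - ti \<i> (M3 r X)"
  using M3_sc[OF autom_j[OF power2_i]] by (simp add: ti_def ti_minus_i[unfolded ti_def, symmetric])

text \<open>This compatibility with 1 + i, which generates the units of Z[i]/3, is the input from
  which \<open>M3_L\<close> obtains the additivity of M.\<close>

lemma M3_one_plus_i:
  assumes "X \<in> tor 3" shows "M3 r (X + ti \<i> X) = M3 r X + ti (- \<i>) (M3 r X)"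
proof (cases "X = 0")
  case True
  then show ?thesis using qi.\<tau>_zs[of 0 0] by (simp add: ti_minus_i)
next
  case False
  have i: "(- \<i>)^2 = -1" by simp
  have t: "3 * px X^4 + 6 * px X^2 - 1 = 0" using False assms tor3_quar_iff by blast
  define x y where "x = px X" and "y = py X"
  have t: "3 * x^4 + 6 * x^2 - 1 = 0" using t by (simp add: x_def)
  have x0: "x \<noteq> 0" using t by auto
  have r0: "r \<noteq> 0" using r by auto
  note m = M3_coords[OF r False assms, folded x_def y_def]
  note N = one_plus_ti_coords[OF power2_i False, folded x_def y_def, OF x0]
  have NT: "X + ti \<i> X \<in> tor 3" using assms qi.\<tau>_tor tor_plus by blast
  note mN = M3_coords[OF r N(1) NT]
  have mx: "px (M3 r X) \<noteq> 0" using m x0 r0 by simp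
  note Nm = one_plus_ti_coords[OF i m(1) mx]
  have x1: "x^2 + 1 \<noteq> 0"
  proof
    assume "x^2 + 1 = 0"
    then have "4 = (0::complex)" using t by Groebner_Basis.algebra
    then show False by simp
  qed
  have mx2: "px (M3 r X)^2 = -1 / (3 * x^2)"
  proof -
    have "px (M3 r X)^2 = r^4 / (3 * x)^2" unfolding m by (simp add: power_divide flip: power_mult)
    then show ?thesis unfolding r by (simp add: power_mult_distrib)
  qed
  have rx: "r^2 = 3 * x * px (M3 r X)" using x0 by (simp add: m)
  have ii: "\<i> * \<i> = -1" by simp
  \<comment> \<open>Both equations restate the division polynomial, in the shapes needed for the
    ordinate and for the abscissa.\<close>
  have t1: "(1 - x^2) * 12 = (3*x^2 + 1) * (6 * (x^2 + 1))" using t by Groebner_Basis.algebra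
  have t2: "-4 * x^2 = (x^2 + 1) * (3*x^2 - 1)" using t by Groebner_Basis.algebra
  define w where "w = px (M3 r X)"
  have w: "w \<noteq> 0" "w^2 = -1 / (3 * x^2)" using mx mx2 by (auto simp: w_def)
  show ?thesis using mN(1) Nm(1)
  proof (rule ept_eqI)
    have "px (M3 r (X + ti \<i> X)) = 3*x*w / (3 * (- \<i> * (x^2 + 1) / (2 * x)))"
      unfolding mN(2) N(2) rx w_def[symmetric] ..
    also have "\<dots> = \<i> * (2 * x^2 * w) / (x^2 + 1)" using x0 x1 by (simp add: divide_simps power2_eq_square)
    also have "\<dots> = \<i> * (w^2 + 1) / (2 * w)"
    proof -
      have "2 * x^2 * w / (x^2 + 1) = (w^2 + 1) / (2 * w)"
      proof (subst frac_eq_eq)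
        have "(3 * x^2) * (4 * x^2 * w^2) = -4 * x^2" "(3 * x^2) * ((w^2 + 1) * (x^2 + 1)) = (x^2+1)*(3*x^2-1)"
          unfolding w(2) using x0 by (simp_all add: field_simps)
        then have "(3 * x^2) * (4 * x^2 * w^2) = (3 * x^2) * ((w^2 + 1) * (x^2 + 1))" by (simp only: t2)
        moreover have "3 * x^2 \<noteq> 0" using x0 by simp
        ultimately have "4 * x^2 * w^2 = (w^2 + 1) * (x^2 + 1)" using mult_left_cancel by blast
        then show "2 * x^2 * w * (2 * w) = (w^2 + 1) * (x^2 + 1)" by (simp add: power2_eq_square mult_ac)
      qed (use x1 w in auto)
      then show ?thesis by (simp only: times_divide_eq_right[symmetric])
    qed
    finally show "px (M3 r (X + ti \<i> X)) = px (M3 r X + ti (- \<i>) (M3 r X))"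
      unfolding Nm(2) w_def by simp
    have "py (M3 r (X + ti \<i> X)) = r^3 * ((1 + \<i>) * y * (1 - x^2) / (4 * x^2)) / (3 * (- \<i> * (x^2 + 1) / (2 * x)))"
      unfolding mN(3) N(2,3) ..
    also have "\<dots> = (r^3 * y * (\<i> - 1) / x) * ((1 - x^2) / (6 * (x^2 + 1)))"
    proof -
      have "R * ((1 + \<i>) * y * k / (4 * x^2)) / (3 * (- \<i> * v / (2 * x))) = (R * y * (\<i> - 1) / x) * (k / (6 * v))"
        if "v \<noteq> 0" for R k v
        using x0 that by (simp add: divide_simps power2_eq_square) (simp add: algebra_simps)
      from this[OF x1] show ?thesis .
    qed
    also have "(1 - x^2) / (6 * (x^2 + 1)) = (3*x^2 + 1) / 12" using x1 t1 by (subst frac_eq_eq) auto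
    also have "(r^3 * y * (\<i> - 1) / x) * ((3*x^2 + 1) / 12) = (1 + - \<i>) * (r^3 * y / (3 * x)) * (1 - w^2) / (4 * w^2)"
      unfolding w(2) using x0 by (simp add: divide_simps) (simp add: algebra_simps)
    finally show "py (M3 r (X + ti \<i> X)) = py (M3 r X + ti (- \<i>) (M3 r X))"
      unfolding Nm(3) m(3) w_def[symmetric] .
  qed
qed

text \<open>The nine residue classes modulo 3 are 0, the powers of i and their multiples by 1 + i,
  so the rules for i and for 1 + i reach all of them.\<close>

lemma M3_L:
  assumes X: "X \<noteq> 0" "X \<in> tor 3" shows "M3 r (qi.L m n X) = qi.L m (- n) (M3 r X)"
proof -
  note T = X(2) M3_tor[OF X(2)]
  let ?C = "\<lambda>m n. M3 r (qi.L m n X) = qi.L m (- n) (M3 r X)"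
  have 1: "?C 1 0" by simp
  have \<tau>: "?C (- n) m" if "?C m n" for m n
    using M3_ti[OF qi.L_tor[OF T(1), of m n]] that by (simp add: qi.L_\<tau> qi.L_uminus)
  have N: "?C (m - n) (m + n)" if "?C m n" for m n
  proof -
    have "qi.L m n X + ti \<i> (qi.L m n X) = qi.L (m - n) (m + n) X"
      unfolding qi.L_\<tau> qi.L_add by (simp add: add.commute)
    moreover have "qi.L m (- n) (M3 r X) + ti (- \<i>) (qi.L m (- n) (M3 r X)) = qi.L (m - n) (- (m + n)) (M3 r X)"
      unfolding ti_minus_i qi.L_\<tau> qi.L_uminus qi.L_add
      by (rule arg_cong2[where f="\<lambda>a b. qi.L a b (M3 r X)"]) simp_all
    ultimately show ?thesis using M3_one_plus_i[OF qi.L_tor[OF T(1), of m n]] that by simp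
  qed
  note c1 = 1 \<tau>[OF 1] \<tau>[OF \<tau>[OF 1]] \<tau>[OF \<tau>[OF \<tau>[OF 1]]]
  note c2 = N[OF c1(1)] N[OF c1(2)] N[OF c1(3)] N[OF c1(4)]
  have C0: "?C 0 0" by simp
  have mod: "?C m n" if "?C m' n'" "3 dvd m - m'" "3 dvd n - n'" for m n m' n'
  proof -
    have "3 dvd - n - - n'" using that(3) by (metis dvd_minus_iff minus_diff_eq minus_diff_minus)
    then show ?thesis using that qi.L_mod[OF T(1), of m m' n n'] qi.L_mod[OF T(2), of m m' "- n" "- n'"] by simp
  qed
  have base: "?C m' n'" if "m' \<in> {0, 1, -1}" "n' \<in> {0, 1, -1}" for m' n'
    using that C0 c1 c2 by auto
  have r3: "\<exists>k'\<in>{0, 1, -1}. 3 dvd k - k'" for k :: int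
  proof -
    have "3 dvd k - 0 \<or> 3 dvd k - 1 \<or> 3 dvd k - (-1)" by presburger
    then show ?thesis by blast
  qed
  show ?thesis using r3[of m] r3[of n] base mod by blast
qed

lemma M3_add:
  assumes "X \<in> tor 3" "Y \<in> tor 3" shows "M3 r (X + Y) = M3 r X + M3 r Y"
proof (cases "X = 0")
  case False
  obtain m n where Y: "Y = qi.L m n X" using tor3_quar_generated[OF False assms] by blast
  have "X + Y = qi.L (1 + m) n X" unfolding Y using qi.L_add[of 1 0 X m n] by simp
  then show ?thesis unfolding Y M3_L[OF False assms(1)] using qi.L_add[of 1 0 "M3 r X" m "-n"]
    by (simp add: M3_L[OF False assms(1)])
qed simp

lemma M3_M3: assumes "X \<in> tor 3" shows "M3 r (M3 r X) = - X"
proof (cases "X = 0")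
  case False
  note m = M3_coords[OF r False assms]
  note m' = M3_coords[OF r m(1,4)]
  have x: "px X \<noteq> 0" using tor3_square_inverse(1)[OF False assms] .
  have r0: "r \<noteq> 0" using r by auto
  have r': "r^3 * r^3 = -3 * r^2" using r by Groebner_Basis.algebra
  show ?thesis
  proof (rule ept_eqI)
    show "px (M3 r (M3 r X)) = px (- X)" unfolding m' m using x r0 by (simp add: field_simps)
    show "py (M3 r (M3 r X)) = py (- X)" unfolding m' m py_uminus[OF False] using x r0 r'
      by (simp add: field_simps)
  qed (use m' False in auto)
qed simp

end

text \<open>As \<open>u * u'\<close> has fourth power -1/3, r has fourth power -3. Since the square
  of M is -1, the pairing is preserved exactly.\<close>

lemma quartic_3_congruence:
  assumes a: "a \<noteq> 0" shows "weil_congruent 3 (quartic a) (quartic (-1 / (3 * a))) 1"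
proof -
  obtain u where u: "u^4 = (of_rat a :: complex)" using ex_fourth_root by blast
  obtain u' where u': "u'^4 = (of_rat (-1 / (3 * a)) :: complex)" using ex_fourth_root by blast
  have a': "-1 / (3 * a) \<noteq> 0" using a by simp
  have u0: "u \<noteq> 0" "u' \<noteq> 0" using u u' a by auto
  define r where "r = 1 / (u * u')"
  have r: "r^4 = -3" unfolding r_def power_divide power_mult_distrib u u' using a
    by (simp add: of_rat_divide of_rat_mult of_rat_minus)
  have rQ: "r \<in> Qbar" unfolding r_def
    by (intro Qbar_intros twist_quartic(2)[OF u a] twist_quartic(2)[OF u' a'])
  obtain X\<^sub>0 :: "quar ept" where X0: "X\<^sub>0 \<noteq> 0" "X\<^sub>0 \<in> tor 3" using ex_tor3_quar by blast
  interpret P: cm_pairing "ti \<i>" 0 3 "wp 3" X\<^sub>0 by (rule pairing3_quar[OF X0])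
  show ?thesis
  proof (rule semilinear_congruence[OF twist_quartic(1)[OF u a] twist_quartic(1)[OF u' a']
        twist_quartic(2)[OF u a] twist_quartic(2)[OF u' a'] _ r_def, where M=M3])
    show "prime (3::nat)" "\<not> (3::nat) dvd 1" by simp_all
    fix X :: "quar ept" assume X: "X \<in> tor 3"
    show "M3 r X \<in> tor 3" by (rule M3_tor[OF r X])
    show "alg (M3 r X)" if "alg X"
    proof (cases "X = 0")
      case False
      then show ?thesis using that M3_coords[OF r False X] rQ by (auto simp: alg_iff intro!: Qbar_intros)
    qed simp
    show "M3 r (M3 r X) = X \<or> M3 r (M3 r X) = - X" using M3_M3[OF r X] by simp
    show "M3 r (sc z X) = sc (inverse z) (M3 r X)" if "autom TYPE(quar) z" for z by (rule M3_sc[OF r that X])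
    show "M3 (z * r) X = sc z (M3 r X)" if z: "autom TYPE(quar) z" for z
    proof (cases "X = 0")
      case False
      have zr: "(z * r)^4 = -3" using z r by (simp add: power_mult_distrib autom_quar)
      note m = M3_coords[OF r False X] and m' = M3_coords[OF zr False X]
      note s = sc_coords[OF z m(1)]
      show ?thesis using m'(1) s(1) by (rule ept_eqI) (simp_all add: m' s m power_mult_distrib)
    qed (simp add: z)
    show "gal \<sigma> (M3 r X) = M3 (\<sigma> r) (gal \<sigma> X)" if \<sigma>: "\<sigma> \<in> GalQ" and al: "alg X" for \<sigma>
    proof (cases "X = 0")
      case False
      have sr: "(\<sigma> r)^4 = -3" using gal_power[OF \<sigma> rQ, of 4] r gal_uminus[OF \<sigma> Qbar_numeral] gal_numeral[OF \<sigma>] by simp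
      note g = gal_coords[OF \<sigma> False al]
      note m = M3_coords[OF r False X] and m' = M3_coords[OF sr g(1) gal_tor[OF \<sigma> al X]]
      have xq: "px X \<in> Qbar" "py X \<in> Qbar" using al False by (auto simp: alg_iff)
      have "alg (M3 r X)" using m rQ xq by (auto simp: alg_iff intro!: Qbar_intros)
      note gm = gal_coords[OF \<sigma> m(1) this]
      show ?thesis using gm(1) m'(1)
        by (rule ept_eqI) (simp_all add: gm m m' g gal_simps[OF \<sigma>] Qbar_intros xq rQ)
    qed (simp add: \<sigma>)
    fix Y :: "quar ept" assume Y: "Y \<in> tor 3"
    show "M3 r (X + Y) = M3 r X + M3 r Y" by (rule M3_add[OF r X Y])
    have "wp 3 (M3 r X) (M3 r Y) = wp 3 X Y powi (- (-1))"
      by (rule P.B_semilinear[OF M3_add[OF r] M3_tor[OF r] _ _ X Y])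
        (simp_all add: M3_ti[OF r] M3_M3[OF r] X0)
    then show "wp 3 (M3 r X) (M3 r Y) = wp 3 X Y ^ 1" by simp
  qed
qed

section \<open>The 5-torsion of quartic twists\<close>

text \<open>The kernel of 2 + j, of norm 5, where j acts as -2. As 5 = (2 + i)(2 - i), the 5-torsion
  is the direct sum of the kernels for j = i and j = -i.\<close>

definition E5 :: "complex \<Rightarrow> quar ept set" where "E5 j = {X. X + X = - ti j X}"

text \<open>Maps the kernel of 2 + j to that of 2 - j. The factor 2 + j in the ordinate puts the
  image on the curve when 5 r^4 = 1, and since (2 + j)(2 - j) = 5, the maps for j and -j are inverse
  to each other.\<close>

definition F5 :: "complex \<Rightarrow> complex \<Rightarrow> quar ept \<Rightarrow> quar ept" where
  "F5 r j X = (if X = 0 then 0 else mk (r^2 / px X) (r^3 * (2 + j) * py X / px X))"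

text \<open>Multiplication by j - 2: modulo 5 it is -4 = 1 on the kernel of 2 + j and 0 on that of 2
  - j, hence the projection.\<close>

definition pr5 :: "complex \<Rightarrow> quar ept \<Rightarrow> quar ept" where "pr5 j R = ti j R + - (R + R)"

definition M5 :: "complex \<Rightarrow> quar ept \<Rightarrow> quar ept" where
  "M5 r R = F5 r \<i> (pr5 \<i> R) + F5 r (- \<i>) (pr5 (- \<i>) R)"

lemma ti_0: "j^2 = -1 \<Longrightarrow> ti j 0 = 0"
  by (simp add: ti_def autom_j)

lemma F5_0 [simp]: "F5 r j 0 = 0" by (simp add: F5_def)

context
  fixes j :: complex assumes j: "j^2 = -1"
begin

interpretation q: cm "ti j" 0 by (rule ti_cm[OF j])

lemma E5_0 [simp]: "0 \<in> E5 j" by (simp add: E5_def ti_0[OF j])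

text \<open>The condition is a factor over Q(i) of the 5-division polynomial, found by equating the
  duplication formula with \<open>- ti j X\<close>.\<close>

lemma E5_iff:
  assumes X: "X \<noteq> 0" shows "X \<in> E5 j \<longleftrightarrow> 5 * px X^2 = -1 - 2*j"
proof -
  define x y where "x = px X" and "y = py X"
  have y2: "y^2 = x^3 + x" using quar_eq[OF X] by (simp add: x_def y_def)
  note c = ti_coords[OF j X]
  have cm: "px (- ti j X) = - x" "py (- ti j X) = - (j * y)" "- ti j X \<noteq> 0"
    using c py_uminus[OF c(1)] by (simp_all add: x_def y_def)
  show ?thesis
  proof
    assume "X \<in> E5 j"
    then have e: "X + X = - ti j X" by (simp add: E5_def)
    have y0: "y \<noteq> 0" using py_eq_0_iff_double[OF X] e cm(3) by (auto simp: y_def)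
    define s where "s = (3 * px X^2 + ca TYPE(quar)) / (2 * py X)"
    note d = double_coords[OF X y0[unfolded y_def] s_def, folded x_def y_def]
    have s: "2 * y * s = 3 * x^2 + 1" using y0 by (simp add: s_def x_def y_def)
    have x0: "x \<noteq> 0" using y2 y0 by auto
    have "- (j * y) = s * (x - (- x)) - y" using d(3) unfolding e cm .
    then have "x * (5 * x^2 - (-1 - 2*j)) = 0" using s y2 j by Groebner_Basis.algebra
    then have "5 * x^2 - (-1 - 2*j) = 0" using x0 by simp
    then show "5 * px X^2 = -1 - 2*j" by (simp add: x_def)
  next
    assume "5 * px X^2 = -1 - 2*j"
    then have t: "5 * x^2 = -1 - 2*j" by (simp add: x_def)
    have "5 * (5*x^4 + 2*x^2 + 1) = 0" using t j by Groebner_Basis.algebra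
    then have q: "5*x^4 + 2*x^2 + 1 = 0" by (simp only: mult_eq_0_iff) simp
    have "5 * (x^2*(2+j) + j) = 0" using t j by Groebner_Basis.algebra
    then have k: "x^2*(2+j) + j = 0" by (simp only: mult_eq_0_iff) simp
    have x0: "x \<noteq> 0" using q by auto
    have y0: "y \<noteq> 0"
    proof
      assume "y = 0"
      then have "x * (x^2 + 1) = 0" using y2 by (simp add: ring_normal)
      then have "x^2 + 1 = 0" using x0 by simp
      then have "4 = (0::complex)" using q by Groebner_Basis.algebra
      then show False by simp
    qed
    define s where "s = (3 * px X^2 + ca TYPE(quar)) / (2 * py X)"
    note d = double_coords[OF X y0[unfolded y_def] s_def, folded x_def y_def]
    have s: "2 * y * s = 3 * x^2 + 1" using y0 by (simp add: s_def x_def y_def)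
    have "(4 * y^2) * s^2 = (4 * y^2) * x" using s y2 q by Groebner_Basis.algebra
    then have "s^2 = x" using y0 by simp
    then have 1: "px (X + X) = - x" using d(2) by simp
    have "y * (2 * s * x - y) = y * (- (j * y))" using s y2 k by Groebner_Basis.algebra
    then have "2 * s * x - y = - (j * y)" using mult_left_cancel[OF y0] by blast
    moreover have "py (X + X) = s * (x - (- x)) - y" using d(3) unfolding 1 .
    ultimately have "py (X + X) = - (j * y)" by (simp add: mult_ac)
    then have "X + X = - ti j X" using 1 cm d(1) by (intro ept_eqI) auto
    then show "X \<in> E5 j" by (simp add: E5_def)
  qed
qed

lemma E5_px: "X \<noteq> 0 \<Longrightarrow> X \<in> E5 j \<Longrightarrow> px X \<noteq> 0"
proof
  assume "X \<noteq> 0" "X \<in> E5 j" "px X = 0"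
  then have "-1 - 2*j = 0" using E5_iff by auto
  then have "5 = (0::complex)" using j by Groebner_Basis.algebra
  then show False by simp
qed

lemma E5_L: "X \<in> E5 j \<longleftrightarrow> q.L 2 1 X = 0"
proof -
  have "q.L 2 1 X = X + X + ti j X" by (simp add: q.L_def numeral_2_eq_2)
  then show ?thesis by (simp add: E5_def eq_neg_iff_add_eq_0)
qed

lemma pr5_L: "pr5 j R = q.L (-2) 1 R"
proof -
  have "zs (-2) R = - (R + R)" using zs_uminus[of 2 R] by (simp add: numeral_2_eq_2)
  then show ?thesis by (simp add: pr5_def q.L_def add.commute)
qed

lemma E5_tor: "X \<in> E5 j \<Longrightarrow> X \<in> tor 5"
  using q.L_L[of 2 "-1" 2 1 X] by (simp add: E5_L tor_def q.L_def ti_0[OF j])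

lemma pr5_E5: "R \<in> tor 5 \<Longrightarrow> pr5 j R \<in> E5 j"
  using q.L_L[of 2 1 "-2" 1 R] q.L_mod[of R 5 "-5" 0 0 0] by (simp add: E5_L pr5_L)

lemma pr5_fix: "X \<in> E5 j \<Longrightarrow> pr5 j X = X"
proof -
  assume X: "X \<in> E5 j"
  have "pr5 j X = q.L (-4) 0 X + q.L 2 1 X" unfolding pr5_L q.L_add by simp
  also have "\<dots> = q.L (-4) 0 X" using X by (simp add: E5_L)
  also have "\<dots> = q.L 1 0 X" by (rule q.L_mod[OF E5_tor[OF X]]) auto
  finally show ?thesis by simp
qed

lemma pr5_add: "pr5 j (X + Y) = pr5 j X + pr5 j Y"
  by (simp add: pr5_def q.\<tau>_add)

lemma pr5_sc: assumes z: "autom TYPE(quar) z" shows "pr5 j (sc z X) = sc z (pr5 j X)"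
proof -
  have "ti j (sc z X) = sc z (ti j X)" using z autom_j[OF j] by (simp add: ti_def sc_sc mult.commute)
  then show ?thesis unfolding pr5_def sc_add[OF z] sc_uminus[OF z] by simp
qed

lemma pr5_alg: "alg R \<Longrightarrow> alg (pr5 j R)"
  unfolding pr5_def by (intro alg_add alg_uminus ti_alg[OF j]) auto

lemma mj: "(- j)^2 = -1" using j by simp

lemma ti_mj: "ti (- j) X = - ti j X"
proof -
  have "autom TYPE(quar) (- 1)" by (simp add: autom_quar)
  from sc_sc[OF this autom_j[OF j], of X] show ?thesis by (simp add: ti_def)
qed

lemma E5_sc: "autom TYPE(quar) z \<Longrightarrow> X \<in> E5 j \<Longrightarrow> sc z X \<in> E5 j"
proof -
  assume z: "autom TYPE(quar) z" and X: "X \<in> E5 j"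
  have "sc z X + sc z X = sc z (- ti j X)" using X by (simp add: E5_def flip: sc_add[OF z])
  also have "\<dots> = - ti j (sc z X)" using z autom_j[OF j] by (simp add: sc_uminus ti_def sc_sc mult.commute)
  finally show ?thesis by (simp add: E5_def)
qed

lemma pr5_opposite: "X \<in> E5 j \<Longrightarrow> pr5 (- j) X = 0"
  unfolding pr5_def ti_mj by (simp add: E5_def)

text \<open>All nonzero points of the kernel share the squared abscissa, so they are among the four
  automorphic images of X; because j acts as -2, these are multiples of X.\<close>

lemma E5_multiple:
  assumes X: "X \<noteq> 0" "X \<in> E5 j" and Y: "Y \<in> E5 j"
  shows "\<exists>k\<in>{-2,-1,0,1,2}. Y = zs k X"
proof (cases "Y = 0")
  case False
  have "5 * px X^2 = 5 * px Y^2" using X Y E5_iff False by simp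
  then have "px X^2 = px Y^2" by simp
  note s = quar_same_square[OF X(1) False this]
  have "\<i> = j \<or> \<i> = - j" using j power2_eq_iff[of \<i> j] by simp
  then have s': "Y = X \<or> Y = - X \<or> Y = ti j X \<or> Y = - ti j X" using s ti_mj by auto
  have 2: "zs 2 X = - ti j X" using X(2) by (simp add: E5_def numeral_2_eq_2)
  then have m2: "zs (-2) X = ti j X" using zs_uminus[of 2 X] by simp
  show ?thesis using s'
    by (elim disjE) (use 2 m2 in \<open>auto intro: bexI[of _ 1] bexI[of _ "-1"]\<close>)
qed (auto intro: bexI[of _ 0])

end

context
  fixes j r :: complex assumes j: "j^2 = -1" and r: "5 * r^4 = 1"
begin

lemma F5_coords:
  assumes X: "X \<noteq> 0" "X \<in> E5 j"
  shows "F5 r j X \<noteq> 0" "px (F5 r j X) = r^2 / px X" "py (F5 r j X) = r^3 * (2 + j) * py X / px X"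
    "F5 r j X \<in> E5 (- j)"
proof -
  define x y where "x = px X" and "y = py X"
  have y2: "y^2 = x^3 + x" using quar_eq[OF X(1)] by (simp add: x_def y_def)
  have t: "5 * x^2 = -1 - 2*j" using X E5_iff[OF j] by (simp add: x_def)
  have x0: "x \<noteq> 0" using E5_px[OF j X] by (simp add: x_def)
  have "25 * (x * (r^3 * (2 + j) * y)^2 - ((r^2)^3 + r^2 * x^2)) = 0" using r t y2 j by Groebner_Basis.algebra
  then have "x * (r^3 * (2 + j) * y)^2 - ((r^2)^3 + r^2 * x^2) = 0" by (simp only: mult_eq_0_iff) simp
  then have "(r^3 * (2 + j) * y / x)^2 = (r^2 / x)^3 + r^2 / x"
    using x0 by (simp add: field_simps power2_eq_square power3_eq_cube)
  then have on: "(r^3 * (2 + j) * y / x)^2 = (r^2 / x)^3 + ca TYPE(quar) * (r^2 / x) + cb TYPE(quar)" by simp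
  have F: "F5 r j X = mk (r^2 / x) (r^3 * (2 + j) * y / x)" using X by (simp add: F5_def x_def y_def)
  note m = mk_simps[OF on, folded F]
  show n: "F5 r j X \<noteq> 0" and px: "px (F5 r j X) = r^2 / px X" and "py (F5 r j X) = r^3 * (2 + j) * py X / px X"
    using m by (simp_all add: x_def y_def)
  have "5 * (5 * (r^2)^2 - (-1 + 2*j) * x^2) = 0" using r t j by Groebner_Basis.algebra
  then have "5 * (r^2)^2 = (-1 + 2*j) * x^2" by (simp only: mult_eq_0_iff) simp
  then have "5 * px (F5 r j X)^2 = -1 - 2 * (- j)" unfolding px x_def[symmetric] using x0 by (simp add: power_divide)
  then show "F5 r j X \<in> E5 (- j)" using E5_iff[OF mj[OF j] n] by blast
qed

lemma F5_E5: "X \<in> E5 j \<Longrightarrow> F5 r j X \<in> E5 (- j)"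
  using F5_coords(4) E5_0[OF mj[OF j]] by (cases "X = 0") auto

lemma F5_sc:
  assumes z: "autom TYPE(quar) z" and X: "X \<in> E5 j" shows "F5 r j (sc z X) = sc (inverse z) (F5 r j X)"
proof (cases "X = 0")
  case False
  have z4: "z^4 = 1" "z \<noteq> 0" using z by (auto simp: autom_quar)
  note s = sc_coords[OF z False]
  note m = F5_coords[OF False X]
  note s' = sc_coords[OF autom_inverse[OF z] m(1)]
  note m' = F5_coords[OF s(1) E5_sc[OF j z X]]
  have x: "px X \<noteq> 0" using E5_px[OF j False X] .
  have zz: "z^3 * z^3 = z^2" using z4(1) by Groebner_Basis.algebra
  show ?thesis using m'(1) s'(1)
  proof (rule ept_eqI)
    show "px (F5 r j (sc z X)) = px (sc (inverse z) (F5 r j X))"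
      unfolding m' s' m s using z4(2) x by (simp add: field_simps)
    show "py (F5 r j (sc z X)) = py (sc (inverse z) (F5 r j X))"
      unfolding m' s' m s using z4(2) x zz by (simp add: field_simps)
  qed
qed (use z autom_inverse[OF z] in simp)

text \<open>Doubling is the automorphism \<open>j\<close> on one kernel and its inverse
  \<open>- j\<close> on the other, so \<open>F5_sc\<close> already says that F commutes with it; -1
  and 2 generate the units modulo 5.\<close>

lemma F5_zs:
  assumes X: "X \<in> E5 j" and k: "k \<in> {-2,-1,0,1,2}" shows "F5 r j (zs k X) = zs k (F5 r j X)"
proof -
  have a: "autom TYPE(quar) j" "autom TYPE(quar) (-1)" using autom_j[OF mj[OF j]] by (simp_all add: autom_quar)
  have m: "F5 r j (- Y) = - F5 r j Y" if "Y \<in> E5 j" for Y using F5_sc[OF a(2) that] by simp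
  have two: "zs 2 X = sc j X" using X ti_mj[OF j, of X] by (simp add: E5_def numeral_2_eq_2 ti_def)
  have two': "zs 2 (F5 r j X) = sc (- j) (F5 r j X)"
    using F5_E5[OF X] ti_mj[OF j, of "F5 r j X"] by (simp add: E5_def numeral_2_eq_2 ti_def)
  have "inverse j = - j" using j by (intro inverse_unique) (simp add: power2_eq_square)
  then have f2: "F5 r j (zs 2 X) = zs 2 (F5 r j X)" unfolding two two' using F5_sc[OF a(1) X] by simp
  have "zs 2 X \<in> E5 j" unfolding two by (rule E5_sc[OF j a(1) X])
  from m[OF this] have "F5 r j (zs (-2) X) = zs (-2) (F5 r j X)" 
    using f2 zs_uminus[of 2 X] zs_uminus[of 2 "F5 r j X"] by simp
  then show ?thesis using k f2 m[OF X] by auto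
qed

lemma F5_add:
  assumes "X \<in> E5 j" "Y \<in> E5 j" shows "F5 r j (X + Y) = F5 r j X + F5 r j Y"
proof (cases "X = 0")
  case False
  obtain k where k: "k \<in> {-2,-1,0,1,2}" "Y = zs k X" using E5_multiple[OF j False assms] by blast
  have XY: "X + Y = zs (1 + k) X" unfolding k(2) zs_add by simp
  have T: "X \<in> tor 5" "F5 r j X \<in> tor 5" using E5_tor[OF j assms(1)] E5_tor[OF mj[OF j] F5_E5[OF assms(1)]] by auto
  have z3: "zs 3 X = zs (-2) X" "zs 3 (F5 r j X) = zs (-2) (F5 r j X)"
    by (rule zs_mod[where p=5], use T in simp, simp)+
  have "F5 r j (zs (1 + k) X) = zs (1 + k) (F5 r j X)"
  \<comment> \<open>Only for k = 2 does 1 + k leave the chosen representatives; 3 is then replaced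
    by -2.\<close>
  proof (cases "k = 2")
    case True
    have "F5 r j (zs 3 X) = zs 3 (F5 r j X)" unfolding z3 by (rule F5_zs[OF assms(1)]) simp
    then show ?thesis using True by simp
  next
    case f: False
    have "1 + k \<in> {-2,-1,0,1,2}" using k(1) f by auto
    then show ?thesis by (rule F5_zs[OF assms(1)])
  qed
  then show ?thesis unfolding XY using F5_zs[OF assms(1) k(1)] by (simp add: k(2) zs_add)
qed simp

end

lemma F5_F5:
  assumes j: "j^2 = -1" and r: "5 * r^4 = 1" and X: "X \<in> E5 j" shows "F5 r (- j) (F5 r j X) = X"
proof (cases "X = 0")
  case False
  note m = F5_coords[OF j r False X]
  note m' = F5_coords[OF mj[OF j] r m(1,4)]
  have x: "px X \<noteq> 0" using E5_px[OF j False X] .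
  have r0: "r \<noteq> 0" using r by auto
  have e: "r^3 * (2 + - j) * (r^3 * (2 + j)) = r^2" using r j by Groebner_Basis.algebra
  show ?thesis
  proof (rule ept_eqI)
    show "px (F5 r (- j) (F5 r j X)) = px X" unfolding m' m using x r0 by (simp add: field_simps)
    have "py (F5 r (- j) (F5 r j X)) = (r^3 * (2 + - j) * (r^3 * (2 + j))) * py X / r^2"
      unfolding m' m using x r0 by (simp add: field_simps)
    then show "py (F5 r (- j) (F5 r j X)) = py X" unfolding e using r0 by simp
  qed (use m' False in auto)
qed simp

lemma F5_alg:
  assumes j: "j^2 = -1" "j \<in> Qbar" and r: "5 * r^4 = 1" "r \<in> Qbar" and X: "X \<in> E5 j" "alg X"
  shows "alg (F5 r j X)"
  using F5_coords[OF j(1) r(1) _ X(1)] X(2) j(2) r(2)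
  by (cases "X = 0") (auto simp: alg_iff intro!: Qbar_intros)

lemma F5_scale:
  assumes j: "j^2 = -1" and r: "5 * r^4 = 1" and z: "autom TYPE(quar) z" and X: "X \<in> E5 j"
  shows "F5 (z * r) j X = sc z (F5 r j X)"
proof (cases "X = 0")
  case False
  have zr: "5 * (z * r)^4 = 1" using z r by (simp add: power_mult_distrib autom_quar)
  note m = F5_coords[OF j r False X] and m' = F5_coords[OF j zr False X]
  note s = sc_coords[OF z m(1)]
  show ?thesis using m'(1) s(1) by (rule ept_eqI) (simp_all add: m' s m power_mult_distrib)
qed (simp add: z)

lemma F5_gal:
  assumes \<sigma>: "\<sigma> \<in> GalQ" and j: "j^2 = -1" "j \<in> Qbar" and r: "5 * r^4 = 1" "r \<in> Qbar" and X: "X \<in> E5 j" "alg X"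
  shows "gal \<sigma> (F5 r j X) = F5 (\<sigma> r) (\<sigma> j) (gal \<sigma> X)"
proof (cases "X = 0")
  case False
  have sr: "5 * (\<sigma> r)^4 = 1"
  proof -
    have "\<sigma> (5 * r^4) = 1" unfolding r(1) by (rule gal_1[OF \<sigma>])
    then show ?thesis using r(2) by (simp add: gal_simps[OF \<sigma>] Qbar_intros)
  qed
  have sj: "(\<sigma> j)^2 = -1" using gal_power[OF \<sigma> j(2), of 2] j(1) gal_uminus[OF \<sigma> Qbar_1] gal_1[OF \<sigma>] by simp
  have xq: "px X \<in> Qbar" "py X \<in> Qbar" using X False by (auto simp: alg_iff)
  note g = gal_coords[OF \<sigma> False X(2)]
  have "\<sigma> (5 * px X^2) = \<sigma> (-1 - 2*j)" using E5_iff[OF j(1) False] X by simp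
  then have "5 * px (gal \<sigma> X)^2 = -1 - 2 * \<sigma> j" using xq j(2) by (simp add: g gal_simps[OF \<sigma>] Qbar_intros)
  then have gE: "gal \<sigma> X \<in> E5 (\<sigma> j)" using E5_iff[OF sj g(1)] by blast
  note m = F5_coords[OF j(1) r(1) False X(1)] and m' = F5_coords[OF sj sr g(1) gE]
  note gm = gal_coords[OF \<sigma> m(1) F5_alg[OF j r X]]
  show ?thesis using gm(1) m'(1)
    by (rule ept_eqI) (simp_all add: gm m m' g gal_simps[OF \<sigma>] Qbar_intros xq r j)
qed (simp add: \<sigma>)

lemma pr5_gal:
  assumes \<sigma>: "\<sigma> \<in> GalQ" and j: "j^2 = -1" "j \<in> Qbar" and R: "alg R"
  shows "gal \<sigma> (pr5 j R) = pr5 (\<sigma> j) (gal \<sigma> R)"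
proof -
  have "gal \<sigma> (ti j R) = ti (\<sigma> j) (gal \<sigma> R)"
    unfolding ti_def using gal_sc[OF \<sigma> autom_j[OF j(1)] R] gal_uminus[OF \<sigma> j(2)] by simp
  then show ?thesis
    unfolding pr5_def using R by (simp only: gal_ept_add[OF \<sigma>] gal_ept_uminus[OF \<sigma>] alg_add alg_uminus ti_alg[OF j(1)])
qed

lemmas i2 = power2_i mj[OF power2_i]

lemma pr5_sum: assumes "R \<in> tor 5" shows "pr5 \<i> R + pr5 (- \<i>) R = R"
proof -
  have "pr5 \<i> R + pr5 (- \<i>) R = zs (-4) R"
    unfolding pr5_def ti_minus_i using zs_uminus[of 4 R] by (simp add: eval_nat_numeral algebra_simps)
  also have "\<dots> = zs 1 R" by (rule zs_mod[OF assms]) simp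
  finally show ?thesis by simp
qed

lemma M5_on:
  assumes "X \<in> E5 \<i>" shows "M5 r X = F5 r \<i> X"
  using pr5_fix[OF power2_i assms] pr5_opposite[OF power2_i assms] by (simp add: M5_def)

lemma M5_on':
  assumes "X \<in> E5 (- \<i>)" shows "M5 r X = F5 r (- \<i>) X"
  using pr5_fix[OF i2(2) assms] pr5_opposite[OF i2(2) assms] by (simp add: M5_def)

context
  fixes r :: complex assumes r: "5 * r^4 = 1"
begin

lemma M5_add: "X \<in> tor 5 \<Longrightarrow> Y \<in> tor 5 \<Longrightarrow> M5 r (X + Y) = M5 r X + M5 r Y"
  unfolding M5_def by (simp add: pr5_add i2 F5_add[OF _ r] pr5_E5 algebra_simps)

lemma M5_tor:
  assumes X: "X \<in> tor 5" shows "M5 r X \<in> tor 5"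
proof -
  have "F5 r \<i> (pr5 \<i> X) \<in> E5 (- \<i>)" by (intro F5_E5[OF power2_i r] pr5_E5[OF power2_i] X)
  moreover have "F5 r (- \<i>) (pr5 (- \<i>) X) \<in> E5 \<i>" using F5_E5[OF i2(2) r pr5_E5[OF i2(2) X]] by simp
  ultimately show ?thesis unfolding M5_def by (intro tor_plus E5_tor[OF i2(2)] E5_tor[OF power2_i])
qed

lemma M5_M5: assumes X: "X \<in> tor 5" shows "M5 r (M5 r X) = X"
proof -
  define A B where "A = F5 r \<i> (pr5 \<i> X)" and "B = F5 r (- \<i>) (pr5 (- \<i>) X)"
  have A: "A \<in> E5 (- \<i>)" unfolding A_def by (intro F5_E5[OF power2_i r] pr5_E5[OF power2_i] X)
  have B: "B \<in> E5 \<i>" unfolding B_def using F5_E5[OF i2(2) r pr5_E5[OF i2(2) X]] by simp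
  have "M5 r (A + B) = M5 r A + M5 r B" by (intro M5_add E5_tor[OF i2(2) A] E5_tor[OF power2_i B])
  also have "\<dots> = F5 r (- \<i>) A + F5 r \<i> B" by (simp add: M5_on[OF B] M5_on'[OF A])
  also have "\<dots> = pr5 \<i> X + pr5 (- \<i>) X"
    unfolding A_def B_def using F5_F5[OF power2_i r pr5_E5[OF power2_i X]] F5_F5[OF i2(2) r pr5_E5[OF i2(2) X]] by simp
  finally show ?thesis unfolding pr5_sum[OF X] by (simp add: M5_def A_def B_def)
qed

lemma M5_sc: "autom TYPE(quar) z \<Longrightarrow> X \<in> tor 5 \<Longrightarrow> M5 r (sc z X) = sc (inverse z) (M5 r X)"
  unfolding M5_def by (simp add: pr5_sc i2 F5_sc[OF _ r] pr5_E5 sc_add[OF autom_inverse])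

lemma M5_ti: assumes "X \<in> tor 5" shows "M5 r (ti \<i> X) = - ti \<i> (M5 r X)"
  using M5_sc[OF autom_j[OF power2_i] assms] by (simp add: ti_def ti_minus_i[unfolded ti_def, symmetric])

end

lemma ex_E5: assumes "j^2 = -1" shows "\<exists>X. X \<noteq> 0 \<and> X \<in> E5 j"
proof -
  obtain X :: "quar ept" where X: "X \<noteq> 0" "px X = csqrt ((-1 - 2*j) / 5)" using ex_point by blast
  then show ?thesis using E5_iff[OF assms X(1)] by auto
qed

text \<open>The sum of nonzero vectors from the two eigenspaces generates the 5-torsion over Z[i],
  because the two projections recover both summands from it.\<close>

lemma pairing5_quar: "\<exists>X\<^sub>0. cm_pairing (ti \<i>) 0 5 (wp 5) X\<^sub>0"
proof -
  obtain P where P: "P \<noteq> 0" "P \<in> E5 \<i>" using ex_E5[OF power2_i] by blast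
  obtain Q where Q: "Q \<noteq> 0" "Q \<in> E5 (- \<i>)" using ex_E5[OF i2(2)] by blast
  define X where "X = P + Q"
  have XT: "X \<in> tor 5" unfolding X_def by (intro tor_plus E5_tor[OF power2_i P(2)] E5_tor[OF i2(2) Q(2)])
  have mm: "zs (-2) X = - (X + X)" using zs_uminus[of 2 X] by (simp add: numeral_2_eq_2)
  have pP: "P = qi.L (-2) 1 X"
    using pr5_add[OF power2_i, of P Q] pr5_fix[OF power2_i P(2)] pr5_opposite[OF i2(2) Q(2)] pr5_L[OF power2_i, of X]
    by (simp add: X_def)
  have pQ: "Q = qi.L (-2) (-1) X"
    using pr5_add[OF i2(2), of P Q] pr5_fix[OF i2(2) Q(2)] pr5_opposite[OF power2_i P(2)] mm
    by (simp add: X_def[symmetric] pr5_def ti_minus_i qi.L_def zs_uminus)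
  have g: "\<exists>m n. R = qi.L m n X" if R: "R \<in> tor 5" for R
  proof -
    obtain k where k: "pr5 \<i> R = zs k P" using E5_multiple[OF power2_i P pr5_E5[OF power2_i R]] by blast
    obtain l where l: "pr5 (- \<i>) R = zs l Q" using E5_multiple[OF i2(2) Q pr5_E5[OF i2(2) R]] by blast
    have "R = zs k P + zs l Q" using pr5_sum[OF R] k l by simp
    then show ?thesis by (subst (asm) pP, subst (asm) pQ) (auto simp: qi.L_zs qi.L_add)
  qed
  have f: "finite (tor 5 :: quar ept set)" by (rule qi.finite_tor[OF XT _ g]) simp_all
  have o: "off_line_additive 5 (wp 5 :: quar ept \<Rightarrow> _)" by (rule wp_off_line_additive) (simp_all add: f)
  have "cm_pairing (ti \<i>) 0 5 (wp 5) X"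
    by (rule qi.cm_pairing_wp[OF o off_line_additive.bilinear[OF o] XT g]) simp_all
  then show ?thesis by blast
qed

text \<open>The square of M is 1, so the pairing is raised to the power -1; its values are fifth
  roots of unity, so this is the natural exponent 4.\<close>

lemma quartic_5_congruence:
  assumes a: "a \<noteq> 0" shows "weil_congruent 5 (quartic a) (quartic (5 / a)) 4"
proof -
  obtain u where u: "u^4 = (of_rat a :: complex)" using ex_fourth_root by blast
  obtain u' where u': "u'^4 = (of_rat (5 / a) :: complex)" using ex_fourth_root by blast
  have a': "5 / a \<noteq> 0" using a by simp
  define r where "r = 1 / (u * u')"
  have r: "5 * r^4 = 1" unfolding r_def power_divide power_mult_distrib u u' using a
    by (simp add: of_rat_divide)
  have rQ: "r \<in> Qbar" unfolding r_def
    by (intro Qbar_intros twist_quartic(2)[OF u a] twist_quartic(2)[OF u' a'])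
  have iQ: "- \<i> \<in> Qbar" by (intro Qbar_uminus i_Qbar)
  obtain X\<^sub>0 where X0: "cm_pairing (ti \<i>) 0 5 (wp 5) X\<^sub>0" using pairing5_quar by blast
  interpret P: cm_pairing "ti \<i>" 0 5 "wp 5" X\<^sub>0 by (rule X0)
  show ?thesis
  proof (rule semilinear_congruence[OF twist_quartic(1)[OF u a] twist_quartic(1)[OF u' a']
        twist_quartic(2)[OF u a] twist_quartic(2)[OF u' a'] _ r_def, where M=M5])
    show "prime (5::nat)" "\<not> (5::nat) dvd 4" by simp_all
    fix X :: "quar ept" assume X: "X \<in> tor 5"
    note e = pr5_E5[OF power2_i X] pr5_E5[OF i2(2) X]
    show "M5 r X \<in> tor 5" by (rule M5_tor[OF r X])
    show "alg (M5 r X)" if "alg X" unfolding M5_def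
      by (intro alg_add F5_alg[OF power2_i i_Qbar r rQ] F5_alg[OF i2(2) iQ r rQ] e pr5_alg i2 that)
    show "M5 r (M5 r X) = X \<or> M5 r (M5 r X) = - X" using M5_M5[OF r X] by simp
    show "M5 r (sc z X) = sc (inverse z) (M5 r X)" if "autom TYPE(quar) z" for z by (rule M5_sc[OF r that X])
    show "M5 (z * r) X = sc z (M5 r X)" if z: "autom TYPE(quar) z" for z
      unfolding M5_def using F5_scale[OF power2_i r z e(1)] F5_scale[OF i2(2) r z e(2)] by (simp add: sc_add[OF z])
    show "gal \<sigma> (M5 r X) = M5 (\<sigma> r) (gal \<sigma> X)" if \<sigma>: "\<sigma> \<in> GalQ" and al: "alg X" for \<sigma>
    proof -
      note p = pr5_alg[OF power2_i al] pr5_alg[OF i2(2) al]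
      have "gal \<sigma> (M5 r X) = gal \<sigma> (F5 r \<i> (pr5 \<i> X)) + gal \<sigma> (F5 r (- \<i>) (pr5 (- \<i>) X))"
        unfolding M5_def by (intro gal_ept_add[OF \<sigma>] F5_alg[OF power2_i i_Qbar r rQ] F5_alg[OF i2(2) iQ r rQ] e p)
      also have "\<dots> = F5 (\<sigma> r) (\<sigma> \<i>) (pr5 (\<sigma> \<i>) (gal \<sigma> X)) + F5 (\<sigma> r) (\<sigma> (- \<i>)) (pr5 (\<sigma> (- \<i>)) (gal \<sigma> X))"
        unfolding F5_gal[OF \<sigma> power2_i i_Qbar r rQ e(1) p(1)] F5_gal[OF \<sigma> i2(2) iQ r rQ e(2) p(2)]
          pr5_gal[OF \<sigma> power2_i i_Qbar al] pr5_gal[OF \<sigma> i2(2) iQ al] ..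
      also have "\<dots> = M5 (\<sigma> r) (gal \<sigma> X)"
        using gal_i[OF \<sigma>] gal_uminus[OF \<sigma> i_Qbar] by (auto simp: M5_def add.commute)
      finally show ?thesis .
    qed
    fix Y :: "quar ept" assume Y: "Y \<in> tor 5"
    show "M5 r (X + Y) = M5 r X + M5 r Y" by (rule M5_add[OF r X Y])
    have "wp 5 (M5 r X) (M5 r Y) = wp 5 X Y powi (- 1)"
      by (rule P.B_semilinear[OF M5_add[OF r] M5_tor[OF r] _ _ X Y])
        (simp_all add: M5_ti[OF r] M5_M5[OF r] P.X0)
    also have "\<dots> = wp 5 X Y ^ 4"
    proof -
      have "wp 5 X Y * wp 5 X Y ^ 4 = 1" using P.B_root[OF X Y] by (simp add: eval_nat_numeral)
      then show ?thesis by (simp add: power_int_minus inverse_unique)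
    qed
    finally show "wp 5 (M5 r X) (M5 r Y) = wp 5 X Y ^ 4" .
  qed
qed

section \<open>Curves with complex multiplication by a cube root of unity\<close>

datatype sext = Sext

instantiation sext :: curve
begin
definition "crv (T :: sext itself) = (0, 1)"
instance by standard (simp add: crv_sext_def)
end

lemma sext_coeffs [simp]: "ca TYPE(sext) = 0" "cb TYPE(sext) = 1"
  by (simp_all add: ca_def cb_def crv_sext_def)

lemma autom_sext: "autom TYPE(sext) u \<longleftrightarrow> u^6 = 1"
  by (auto simp: autom_iff)

lemma sext_eq: "X \<noteq> (0::sext ept) \<Longrightarrow> (py X)^2 = (px X)^3 + 1"
  using curve_eq[of X] by simp

text \<open>Multiplication by w on y^2 = x^3 + 1, sending (x, y) to (w x, y), for either primitive
  cube root of unity w. The scalar is \<open>w^2\<close> because its square has to be w and its cube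
  1.\<close>

definition tw :: "complex \<Rightarrow> sext ept \<Rightarrow> sext ept" where "tw w = sc (w^2)"

context
  fixes w :: complex assumes w: "w^2 + w + 1 = 0"
begin

lemma w3: "w^3 = 1" using w by Groebner_Basis.algebra

lemma w_neq: "w \<noteq> 0" "w \<noteq> 1" using w by auto

lemma autom_w: "autom TYPE(sext) (w^2)"
proof -
  have "(w^2)^6 = (w^3)^4" by (simp flip: power_mult)
  then show ?thesis by (simp add: autom_sext w3)
qed

lemma tw_coords:
  assumes "X \<noteq> 0" shows "tw w X \<noteq> 0" "px (tw w X) = w * px X" "py (tw w X) = py X"
proof -
  have "(w^2)^2 = w" "(w^2)^3 = 1" using w by Groebner_Basis.algebra+
  then show "tw w X \<noteq> 0" "px (tw w X) = w * px X" "py (tw w X) = py X"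
    using sc_coords[OF autom_w assms] by (simp_all add: tw_def)
qed

lemma tw_tw: "tw w (tw w X) = tw (w^2) X"
proof -
  have "w^2 * w^2 = (w^2)^2" by (simp add: power2_eq_square)
  then show ?thesis using sc_sc[OF autom_w autom_w, of X] by (simp add: tw_def)
qed

text \<open>The orbit of X under w lies on a horizontal line, so its three points add up to
  0.\<close>

lemma tw_sum: "X + tw w X = - tw w (tw w X)"
proof (cases "X = 0")
  case True
  then show ?thesis using autom_w by (simp add: tw_def)
next
  case False
  note c = tw_coords[OF False]
  note c2 = tw_coords[OF c(1)]
  have n: "X + tw w X \<noteq> 0"
  proof
    assume "X + tw w X = 0"
    then have e: "tw w X = - X" by (simp add: add_eq_0_iff)
    then have "w * px X = px X" "py X = - py X" using c(2,3) py_uminus[OF False] by auto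
    then have "px X = 0" "py X = 0" using w_neq by auto
    then show False using sext_eq[OF False] by simp
  qed
  have s: "0 = slp X (tw w X)" using c w_neq by (simp add: slp_def)
  note l = line[OF False c(1) n s refl]
  have w2: "w * (w * px X) = - px X - w * px X" using w by Groebner_Basis.algebra
  show ?thesis
    by (rule ept_eqI) (use n c c2 l(3,4) w2 py_uminus[OF c2(1)] in auto)
qed

lemma tw_cm: "cm (tw w) (-1)"
proof
  show "tw w (X + Y) = tw w X + tw w Y" for X Y by (simp add: tw_def sc_add[OF autom_w])
  show "tw w (tw w X) = - X + zs (- 1) (tw w X)" for X
    using tw_sum[of X] by (metis minus_add_distrib minus_minus zs_m1)
qed

lemma tw_alg: "alg X \<Longrightarrow> alg (tw w X)"
  by (simp add: tw_def alg_sc[OF autom_w])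

lemma delta_sq: "(1 + 2*w)^2 = -3" using w by Groebner_Basis.algebra

lemma w_conj: "(w^2)^2 + w^2 + 1 = 0" using w by Groebner_Basis.algebra

end

definition om :: complex where "om = (-1 + csqrt (-3)) / 2"

lemma om: "om^2 + om + 1 = 0"
proof -
  define d where "d = csqrt (-3)"
  have "d^2 = -3" by (simp only: d_def power2_csqrt)
  then show ?thesis unfolding om_def d_def[symmetric] by (simp add: field_simps power2_eq_square)
qed

interpretation so: cm "tw om" "-1" by (rule tw_cm[OF om])

text \<open>The endomorphism sqrt(-3) = 1 + 2w; \<open>dl\<close> is the corresponding complex
  number.\<close>

definition th :: "sext ept \<Rightarrow> sext ept" where "th X = so.L 1 2 X"

definition dl :: complex where "dl = 1 + 2 * om"

lemma dl: "dl^2 = -3" "dl \<noteq> 0"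
  using delta_sq[OF om] by (auto simp: dl_def)

lemma th_coords:
  assumes X: "X \<noteq> 0" "px X \<noteq> 0"
  shows "th X \<noteq> 0" "px (th X) = - (px X^3 + 4) / (3 * px X^2)" "py (th X) = py X * (8 - px X^3) / (3 * px X^3 * dl)"
proof -
  define x y where "x = px X" and "y = py X"
  have x0: "x \<noteq> 0" using X by (simp add: x_def)
  \<comment> \<open>In the form sqrt(-3) = w - w^2 the endomorphism needs a single chord, between
    two points with opposite ordinates.\<close>
  define A B where "A = tw om X" and "B = - tw om (tw om X)"
  note a = tw_coords[OF om X(1), folded A_def x_def y_def]
  note b = tw_coords[OF om a(1), unfolded A_def]
  have B: "B \<noteq> 0" "px B = om^2 * x" "py B = - y"
    using b a py_uminus[OF b(1)] by (auto simp: B_def A_def power2_eq_square)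
  have thAB: "th X = A + B"
    unfolding th_def A_def B_def so.\<tau>_sq so.L_def by (simp add: numeral_2_eq_2 algebra_simps)
  have ne: "px A \<noteq> px B"
  proof
    assume "px A = px B"
    then have "om = om^2" using a B x0 by simp
    then have "dl^2 = 1" using om unfolding dl_def by Groebner_Basis.algebra
    then show False using dl by simp
  qed
  have n: "A + B \<noteq> 0"
  proof
    assume "A + B = 0"
    then have "B = - A" by (simp add: add_eq_0_iff)
    then show False using ne by simp
  qed
  then show "th X \<noteq> 0" by (simp add: thAB)
  define s where "s = slp A B"
  note l = line[OF a(1) B(1) n s_def refl]
  have d: "dl * (om^2 * x - om * x) = 3 * x" using om unfolding dl_def by Groebner_Basis.algebra
  have d0: "om^2 * x - om * x \<noteq> 0" using ne a B by auto
  have "s = (- y - y) / (om^2 * x - om * x)" using ne unfolding s_def slp_def a B by simp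
  then have "s * (om^2 * x - om * x) = - 2 * y" using d0 by simp
  then have "s * (dl * (om^2 * x - om * x)) = - 2 * y * dl" by Groebner_Basis.algebra
  then have s: "3 * x * s = - 2 * y * dl" unfolding d by (simp add: mult_ac)
  have y2: "y^2 = x^3 + 1" using sext_eq[OF X(1)] by (simp add: x_def y_def)
  have px: "px (A + B) = s^2 + x" using l(3) a(2) B(2) om by Groebner_Basis.algebra
  have "3 * (3 * x^2 * (s^2 + x) + (x^3 + 4)) = 0" using s dl(1) y2 by Groebner_Basis.algebra
  then have "3 * x^2 * (s^2 + x) + (x^3 + 4) = 0" by (simp only: mult_eq_0_iff) simp
  then have "3 * x^2 * (s^2 + x) = - (x^3 + 4)" by (simp only: eq_neg_iff_add_eq_0)
  then have px': "px (A + B) = - (x^3 + 4) / (3 * x^2)" using x0 px by (simp add: eq_divide_eq mult.commute)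
  then show "px (th X) = - (px X^3 + 4) / (3 * px X^2)" by (simp add: thAB x_def)
  have "py (A + B) = s * (om * x - px (A + B)) - y" using l(1,4) a by (simp add: algebra_simps)
  then have py: "py (A + B) = s * (om * x - (s^2 + x)) - y" unfolding px .
  have "dl * 3 * (3 * x^3 * dl * py (A + B) - y * (8 - x^3)) = 0"
    using s dl(1) y2 om unfolding py dl_def by Groebner_Basis.algebra
  then have "3 * x^3 * dl * py (A + B) = y * (8 - x^3)" using dl(2) by (simp only: mult_eq_0_iff) simp
  then have "py (A + B) = y * (8 - x^3) / (3 * x^3 * dl)" using x0 dl by (simp add: eq_divide_eq mult_ac)
  then show "py (th X) = py X * (8 - px X^3) / (3 * px X^3 * dl)" by (simp add: thAB x_def y_def)
qed

lemma th_eq_0_iff: "th X = 0 \<longleftrightarrow> X = 0 \<or> px X = 0"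
proof (cases "X = 0 \<or> px X \<noteq> 0")
  case True
  then show ?thesis using th_coords(1)[of X] by (auto simp: th_def so.L_def so.\<tau>_zs[of 0 0, simplified])
next
  case False
  note c = tw_coords[OF om, of X]
  have "tw om X = X" using False c by (intro ept_eqI) auto
  moreover have "so.L 1 2 X = tw om X + (X + tw om X)" by (simp add: so.L_def numeral_2_eq_2 algebra_simps)
  ultimately show ?thesis using False tw_sum[OF om, of X] by (simp add: th_def)
qed

lemma th_add: "th (X + Y) = th X + th Y"
  by (simp add: th_def so.L_def so.\<tau>_add zs_plus)

lemma th_alg: "alg X \<Longrightarrow> alg (th X)"
  unfolding th_def so.L_def by (intro alg_add alg_zs tw_alg[OF om]) auto

lemma om_Qbar: "om \<in> Qbar"
proof -
  have "om ^ 3 = 1" using w3[OF om] .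
  then show ?thesis using Qbar_root[of om 3] Qbar_1 by simp
qed

lemma om_roots: "z^2 + z + 1 = 0 \<Longrightarrow> z = om \<or> z = om^2"
proof -
  assume "z^2 + z + 1 = 0"
  then have "(z - om) * (z - om^2) = 0" using om by Groebner_Basis.algebra
  then show ?thesis by auto
qed

lemma gal_om: "\<sigma> \<in> GalQ \<Longrightarrow> \<sigma> om = om \<or> \<sigma> om = om^2"
proof -
  assume \<sigma>: "\<sigma> \<in> GalQ"
  have "\<sigma> (om^2 + om + 1) = 0" unfolding om using gal_0[OF \<sigma>] .
  then have "(\<sigma> om)^2 + \<sigma> om + 1 = 0" by (simp add: gal_simps[OF \<sigma>] om_Qbar Qbar_intros)
  then show ?thesis by (rule om_roots)
qed

lemma twist_sextic:
  assumes "u^6 = of_rat b" "b \<noteq> 0" shows "twist u (crv TYPE(sext)) (sextic b)" "u \<in> Qbar"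
proof -
  have "u \<noteq> 0" using assms by auto
  then show "twist u (crv TYPE(sext)) (sextic b)" using assms by (simp add: twist_def crv_sext_def sextic_def)
  show "u \<in> Qbar" by (rule Qbar_root[of u 6]) (simp_all add: assms Qbar_rat)
qed

lemma ex_cube_root: "\<exists>v::complex. v^3 = z"
proof (cases "z = 0")
  case False
  define v where "v = rcis (root 3 (cmod z)) (Arg z / 3)"
  have "v^3 = rcis (root 3 (cmod z) ^ 3) (3 * (Arg z / 3))" unfolding v_def DeMoivre2 by simp
  also have "\<dots> = z" by (simp add: real_root_pow_pos2 rcis_cmod_Arg)
  finally show ?thesis by blast
qed (auto intro: exI[of _ 0])

lemma ex_sixth_root: "\<exists>u::complex. u^6 = z"
proof -
  obtain v where "v^3 = z" using ex_cube_root by blast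
  then have "(csqrt v)^6 = z" using power_mult[of "csqrt v" 2 3] by simp
  then show ?thesis by blast
qed

lemma dl_powers: "dl^3 = -3 * dl" "dl^6 = -27"
  using dl(1) by Groebner_Basis.algebra+

text \<open>The kernel of sqrt(-3) is O and the two points with abscissa 0, and (sqrt(-3))^6 = -27
  gives the twist. In twisted coordinates the map sends x to (x^3 + 4b)/x^2 and y to y (x^3 -
  8b)/x^3.\<close>

lemma isogenous_sextic:
  assumes "b \<noteq> 0" shows "isogenous 3 (sextic b) (sextic (-27 * b))"
proof -
  obtain u where u: "u^6 = (of_rat b :: complex)" using ex_sixth_root by blast
  define u' where "u' = dl * u"
  have u': "u'^6 = of_rat (-27 * b)" by (simp add: u'_def power_mult_distrib u dl_powers of_rat_mult of_rat_minus)
  have u0: "u \<noteq> 0" using u assms by auto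
  have b': "-27 * b \<noteq> 0" using assms by simp
  show ?thesis
  proof (rule isogenous_from_map[OF twist_sextic(1)[OF u assms] twist_sextic(1)[OF u' b'] twist_sextic(2)[OF u assms] twist_sextic(2)[OF u' b'],
        where N=th and ?a1.0="[:4 * b, 0, 0, 1:]" and ?b1.0="[:0, 0, 1:]" and ?c1.0=0
          and ?a2.0=0 and ?b2.0="[:0, 0, 0, 1:]" and ?c2.0="[:- 8 * b, 0, 0, 1:]"])
    show "th (X + Y) = th X + th Y" for X Y by (rule th_add)
    show "alg X \<Longrightarrow> alg (th X)" for X by (rule th_alg)
    define O1 O2 :: "sext ept" where "O1 = mk 0 1" and "O2 = mk 0 (-1)"
    have O1: "O1 \<noteq> 0" "px O1 = 0" "py O1 = 1" using mk_simps[of 1 0, where 'c=sext] by (auto simp: O1_def)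
    have O2: "O2 \<noteq> 0" "px O2 = 0" "py O2 = -1" using mk_simps[of "-1" 0, where 'c=sext] by (auto simp: O2_def)
    have "X = O1 \<or> X = O2" if "X \<noteq> 0" "px X = 0" for X
    proof -
      have "(py X)^2 = 1" using sext_eq[OF that(1)] that(2) by simp
      then have "py X = 1 \<or> py X = -1" by (simp only: power2_eq_1_iff)
      then show ?thesis using that O1 O2 ept_eqI by metis
    qed
    moreover have "alg O1" "alg O2" using O1 O2 by (auto simp: alg_iff Qbar_0 Qbar_1 Qbar_uminus)
    ultimately have "{X. alg X \<and> th X = 0} = {0, O1, O2}" using O1 O2 by (auto simp: th_eq_0_iff)
    moreover have "O1 \<noteq> O2" using O1 O2 by auto
    ultimately show "card {X. alg X \<and> th X = 0} = 3" using O1(1) O2(1) by auto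
    fix X :: "sext ept" assume X: "X \<noteq> 0" "th X \<noteq> 0"
    define x y where "x = px X" and "y = py X"
    have x0: "px X \<noteq> 0" using X th_eq_0_iff by blast
    note c = th_coords[OF X(1) x0, folded x_def y_def]
    have x0: "x \<noteq> 0" using x0 by (simp add: x_def)
    have 1: "u'^2 * px (th X) = (4 * u^6 + (u^2*x)^3) / (u^2*x)^2"
    proof -
      have "u'^2 * px (th X) = u^2 * ((x^3 + 4) / x^2)"
        unfolding c u'_def power_mult_distrib dl using x0 by (simp add: field_simps)
      also have "\<dots> = (4 * u^6 + (u^2*x)^3) / (u^2*x)^2"
        using u0 x0 by (simp add: field_simps power2_eq_square power3_eq_cube eval_nat_numeral)
      finally show ?thesis .
    qed
    have 2: "u'^3 * py (th X) = u^3*y * ((u^2*x)^3 - 8 * u^6) / (u^2*x)^3"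
    proof -
      have "u'^3 * py (th X) = u^3 * y * ((x^3 - 8) / x^3)"
        unfolding c u'_def power_mult_distrib dl_powers using x0 dl(2) by (simp add: field_simps)
      also have "\<dots> = u^3*y * ((u^2*x)^3 - 8 * u^6) / (u^2*x)^3"
        using u0 x0 by (simp add: field_simps power2_eq_square power3_eq_cube eval_nat_numeral)
      finally show ?thesis .
    qed
    have ev: "poly (map_poly of_rat [:0, 0, 0, 1:]) z = z^3" "poly (map_poly of_rat [:0, 0, 1:]) z = z^2"
      "poly (map_poly of_rat [:4 * b, 0, 0, 1:]) z = 4 * u^6 + z^3" "poly (map_poly of_rat [:- 8 * b, 0, 0, 1:]) z = z^3 - 8 * u^6"
      for z :: complex by (simp_all add: map_poly_pCons u of_rat_minus of_rat_mult power2_eq_square power3_eq_cube)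
    show "poly (map_poly of_rat [:0, 0, 1:]) (u^2 * px X) \<noteq> 0 \<and> poly (map_poly of_rat [:0, 0, 0, 1:]) (u^2 * px X) \<noteq> 0 \<and>
      u'^2 * px (th X) = (poly (map_poly of_rat [:4 * b, 0, 0, 1:]) (u^2 * px X)
        + u^3 * py X * poly (map_poly of_rat 0) (u^2 * px X)) / poly (map_poly of_rat [:0, 0, 1:]) (u^2 * px X) \<and>
      u'^3 * py (th X) = (poly (map_poly of_rat 0) (u^2 * px X)
        + u^3 * py X * poly (map_poly of_rat [:- 8 * b, 0, 0, 1:]) (u^2 * px X)) / poly (map_poly of_rat [:0, 0, 0, 1:]) (u^2 * px X)"
      unfolding ev 1 2 using u0 x0 by (simp add: x_def y_def)
  qed
qed

lemma sc_tw: "autom TYPE(sext) z \<Longrightarrow> w^2 + w + 1 = 0 \<Longrightarrow> tw w (sc z X) = sc z (tw w X)"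
  using autom_w by (simp add: tw_def sc_sc mult.commute)

lemma gal_tw:
  assumes \<sigma>: "\<sigma> \<in> GalQ" and w: "w^2 + w + 1 = 0" and X: "alg X"
  shows "gal \<sigma> (tw w X) = tw (\<sigma> w) (gal \<sigma> X)"
proof -
  have "w \<in> Qbar" using om_roots[OF w] om_Qbar Qbar_power by auto
  then show ?thesis unfolding tw_def using gal_sc[OF \<sigma> autom_w[OF w] X] gal_power[OF \<sigma>] by simp
qed

text \<open>The exponent is the norm of sqrt(-3), whose negative serves as inverse up to 3.\<close>

lemma three_isogeny_congruence:
  assumes b: "b \<noteq> 0" and p: "prime p" "p \<noteq> 3" and P: "cm_pairing (tw om) (-1) p (wp p) X\<^sub>0"
  shows "weil_congruent p (sextic b) (sextic (-27 * b)) 3"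
proof -
  interpret P: cm_pairing "tw om" "-1" p "wp p" X\<^sub>0 by fact
  obtain u where u: "u^6 = (of_rat b :: complex)" using ex_sixth_root by blast
  define u' where "u' = dl * u"
  have u': "u'^6 = of_rat (-27 * b)" by (simp add: u'_def power_mult_distrib u dl_powers of_rat_mult of_rat_minus)
  have u0: "u \<noteq> 0" using u b by auto
  have b': "-27 * b \<noteq> 0" using b by simp
  have mth: "- th X = so.L (-1) (-2) X" for X by (simp add: th_def so.L_uminus)
  show ?thesis
  proof (rule linear_congruence[OF twist_sextic(1)[OF u b] twist_sextic(1)[OF u' b'] twist_sextic(2)[OF u b] twist_sextic(2)[OF u' b'] p(1),
        where N=th and N'="\<lambda>X. - th X"])
    show "th (X + Y) = th X + th Y" for X Y by (rule th_add)
    show "alg X \<Longrightarrow> alg (th X)" for X by (rule th_alg)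
    show "alg X \<Longrightarrow> alg (- th X)" for X by (intro alg_uminus th_alg)
    show "th (- th X) = nm 3 X" for X unfolding mth unfolding th_def so.L_L by (simp add: so.L_def)
    show "- th (th X) = nm 3 X" for X unfolding mth unfolding th_def so.L_L by (simp add: so.L_def)
    show "- th 0 = 0" by (simp add: th_eq_0_iff)
    show "X \<in> tor p \<Longrightarrow> - th X \<in> tor p" for X unfolding mth by (rule so.L_tor)
    show "th (sc z X) = sc z (th X)" if "autom TYPE(sext) z" for z X
      using that by (simp add: th_def so.L_def sc_add sc_nm sc_tw om)
    show "\<not> p dvd 3" using p primes_dvd_imp_eq[of p 3] by auto
    show "wp p (th X) (th Y) = wp p X Y ^ 3" if "X \<in> tor p" "Y \<in> tor p" for X Y
      unfolding th_def using P.B_linear[OF that, of 1 2] by simp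
    fix \<sigma> and X :: "sext ept" assume \<sigma>: "\<sigma> \<in> GalQ" and X: "alg X"
    have uu: "u' / u = dl" using u0 by (simp add: u'_def)
    have g: "gal \<sigma> (th X) = gal \<sigma> X + zs 2 (tw (\<sigma> om) (gal \<sigma> X))"
      unfolding th_def so.L_def using X
      by (simp only: gal_ept_add[OF \<sigma>] gal_ept_zs[OF \<sigma>] alg_zs tw_alg[OF om] gal_tw[OF \<sigma> om] zs_1)
    have s: "\<sigma> dl = 1 + 2 * \<sigma> om" unfolding dl_def using om_Qbar by (simp add: gal_simps[OF \<sigma>] Qbar_intros)
    show "sc (\<sigma> (u' / u) / (u' / u)) (gal \<sigma> (th X)) = th (gal \<sigma> X)"
    proof (cases "\<sigma> om = om")
      case True
      then show ?thesis unfolding g uu s using dl(2) by (simp add: th_def so.L_def flip: dl_def)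
    next
      \<comment> \<open>Conjugation sends sqrt(-3) to its negative both as a scalar and as an
        endomorphism, and the two signs cancel.\<close>
      case False
      then have m: "\<sigma> om = om^2" using gal_om[OF \<sigma>] by blast
      have "1 + 2 * om^2 = - dl" using om unfolding dl_def by Groebner_Basis.algebra
      then have r: "\<sigma> dl / dl = -1" unfolding s m using dl(2) by simp
      define Y where "Y = gal \<sigma> X"
      have "tw (om^2) Y = so.L (-1) (-1) Y" using tw_tw[OF om, of Y] tw_sum[OF om, of Y]
        by (simp add: so.L_def) (metis minus_add_distrib minus_minus uminus_add_conv_diff add_uminus_conv_diff)
      then have "Y + zs 2 (tw (om^2) Y) = so.L 1 0 Y + so.L (-2) (-2) Y" by (simp only: so.L_zs) simp
      also have "\<dots> = - th Y" unfolding so.L_add mth by simp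
      finally show ?thesis unfolding g uu r m Y_def[symmetric] by simp
    qed
  qed
qed

section \<open>The 7-torsion of sextic twists\<close>

text \<open>The kernel of 2 - w, of norm 7, where w acts as 2. The 7-torsion is the sum of the
  kernels for the two primitive cube roots of unity.\<close>

definition E7 :: "complex \<Rightarrow> sext ept set" where "E7 w = {X. X + X = tw w X}"

text \<open>Maps the kernel for w to the kernel for \<open>w^2\<close> when 28 r^6 = -1. The element
  3 + 2w has norm 7, so applying the map and then its conjugate multiplies the ordinate by 28 r^6 =
  -1.\<close>

definition F7 :: "complex \<Rightarrow> complex \<Rightarrow> sext ept \<Rightarrow> sext ept" where
  "F7 r w X = (if X = 0 then 0 else mk (- 4 * r^2 / px X) (2 * r^3 * (3 + 2*w) * py X))"

text \<open>Multiplication by 2 + 3w: modulo 7 it is 8 = 1 where w acts as 2, and 14 = 0 where w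
  acts as 4, as it does on the kernel for \<open>w^2\<close>.\<close>

definition pr7 :: "complex \<Rightarrow> sext ept \<Rightarrow> sext ept" where "pr7 w R = zs 2 R + zs 3 (tw w R)"

definition M7 :: "complex \<Rightarrow> sext ept \<Rightarrow> sext ept" where
  "M7 r R = F7 r om (pr7 om R) + F7 r (om^2) (pr7 (om^2) R)"

lemma F7_0 [simp]: "F7 r w 0 = 0" by (simp add: F7_def)

context
  fixes w :: complex assumes w: "w^2 + w + 1 = 0"
begin

interpretation q: cm "tw w" "-1" by (rule tw_cm[OF w])

lemma tw_0: "tw w 0 = 0" by (simp add: tw_def autom_w[OF w])

lemma tw_conj: "tw (w^2) X = q.L (-1) (-1) X"
  using tw_tw[OF w, of X] tw_sum[OF w, of X]
  by (simp add: q.L_def) (metis minus_add_distrib minus_minus uminus_add_conv_diff add_uminus_conv_diff)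

lemma w4: "(w^2)^2 = w" "w^4 = w" using w by Groebner_Basis.algebra+

lemma E7_0 [simp]: "0 \<in> E7 w" by (simp add: E7_def tw_0)

lemma E7_iff:
  assumes X: "X \<noteq> 0" shows "X \<in> E7 w \<longleftrightarrow> (1 + 3*w) * px X^3 = -4"
proof -
  define x y where "x = px X" and "y = py X"
  have y2: "y^2 = x^3 + 1" using sext_eq[OF X] by (simp add: x_def y_def)
  note c = tw_coords[OF w X, folded x_def y_def]
  show ?thesis
  proof
    assume "X \<in> E7 w"
    then have e: "X + X = tw w X" by (simp add: E7_def)
    have y0: "y \<noteq> 0" using py_eq_0_iff_double[OF X] e c(1) by (auto simp: y_def)
    define s where "s = (3 * px X^2 + ca TYPE(sext)) / (2 * py X)"
    note d = double_coords[OF X y0[unfolded y_def] s_def, folded x_def y_def]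
    have s: "2 * y * s = 3 * x^2" using y0 by (simp add: s_def x_def y_def)
    have "y = s * (x - w * x) - y" using d(3) unfolding e c .
    then have "(1 + 3*w) * x^3 = -4" using s y2 by Groebner_Basis.algebra
    then show "(1 + 3*w) * px X^3 = -4" by (simp add: x_def)
  next
    assume "(1 + 3*w) * px X^3 = -4"
    then have t: "(1 + 3*w) * x^3 = -4" by (simp add: x_def)
    have y0: "y \<noteq> 0"
    proof
      assume "y = 0"
      then have "x^3 = -1" using y2 by (simp add: eq_neg_iff_add_eq_0)
      then have "3 * (w - 1) = 0" using t by Groebner_Basis.algebra
      then show False using w_neq[OF w] by simp
    qed
    define s where "s = (3 * px X^2 + ca TYPE(sext)) / (2 * py X)"
    note d = double_coords[OF X y0[unfolded y_def] s_def, folded x_def y_def]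
    have s: "2 * y * s = 3 * x^2" using y0 by (simp add: s_def x_def y_def)
    have "(4 * y^2) * s^2 = (4 * y^2) * ((2 + w) * x)" using s y2 t w by Groebner_Basis.algebra
    then have "s^2 = (2 + w) * x" using y0 by simp
    then have 1: "px (X + X) = w * x" using d(2) by (simp add: algebra_simps)
    have "(2 * y) * (s * (x - w * x) - y) = (2 * y) * y" using s y2 t by Groebner_Basis.algebra
    then have "s * (x - w * x) - y = y" using y0 by simp
    moreover have "py (X + X) = s * (x - w * x) - y" using d(3) unfolding 1 .
    ultimately have "X + X = tw w X" using 1 c d(1) by (intro ept_eqI) auto
    then show "X \<in> E7 w" by (simp add: E7_def)
  qed
qed

lemma E7_px: "X \<noteq> 0 \<Longrightarrow> X \<in> E7 w \<Longrightarrow> px X \<noteq> 0"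
  using E7_iff[of X] by auto

lemma E7_L: "X \<in> E7 w \<longleftrightarrow> q.L 2 (-1) X = 0"
proof -
  have "q.L 2 (-1) X = X + X - tw w X" by (simp add: q.L_def numeral_2_eq_2)
  then show ?thesis by (simp add: E7_def)
qed

lemma pr7_L: "pr7 w R = q.L 2 3 R"
  by (simp add: pr7_def q.L_def)

lemma pr7_conj_L: "pr7 (w^2) R = q.L (-1) (-3) R"
proof -
  have "pr7 (w^2) R = q.L 2 0 R + q.L (-3) (-3) R"
    unfolding pr7_def tw_conj q.L_zs by (simp add: q.L_def)
  then show ?thesis by (simp add: q.L_add)
qed

lemma pr7_sum: "pr7 w R + pr7 (w^2) R = R"
  by (simp add: pr7_L pr7_conj_L q.L_add)

lemma E7_tor: "X \<in> E7 w \<Longrightarrow> X \<in> tor 7"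
  using q.L_L[of 3 1 2 "-1" X] by (simp add: E7_L tor_def q.L_def tw_0)

lemma pr7_E7: "R \<in> tor 7 \<Longrightarrow> pr7 w R \<in> E7 w"
  using q.L_L[of 2 "-1" 2 3 R] q.L_mod[of R 7 7 0 7 0] by (simp add: E7_L pr7_L)

lemma pr7_fix: assumes X: "X \<in> E7 w" shows "pr7 w X = X" "pr7 (w^2) X = 0"
proof -
  have 0: "q.L (-6) 3 X = 0" "q.L 6 (-3) X = 0"
    using X q.L_zs[of "-3" 2 "-1" X] q.L_zs[of 3 2 "-1" X] by (simp_all add: E7_L)
  have "pr7 w X = q.L 8 0 X + q.L (-6) 3 X" unfolding pr7_L q.L_add by simp
  also have "\<dots> = q.L 8 0 X" by (simp add: 0)
  also have "\<dots> = q.L 1 0 X" by (rule q.L_mod[OF E7_tor[OF X]]) auto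
  finally show "pr7 w X = X" by simp
  then show "pr7 (w^2) X = 0" using pr7_sum[of X] by simp
qed

lemma pr7_add: "pr7 w (X + Y) = pr7 w X + pr7 w Y"
  by (simp add: pr7_def q.\<tau>_add zs_plus del: zs_numeral)

lemma pr7_sc: assumes z: "autom TYPE(sext) z" shows "pr7 w (sc z X) = sc z (pr7 w X)"
  unfolding pr7_def sc_add[OF z] sc_zs[OF z] sc_tw[OF z w] ..

lemma pr7_alg: "alg R \<Longrightarrow> alg (pr7 w R)"
  unfolding pr7_def by (intro alg_add alg_zs tw_alg[OF w])

lemma E7_sc: "autom TYPE(sext) z \<Longrightarrow> X \<in> E7 w \<Longrightarrow> sc z X \<in> E7 w"
  by (simp add: E7_def sc_tw[OF _ w] flip: sc_add)

text \<open>Membership fixes the cube of the abscissa, which leaves X, wX and w^2 X up to sign; as w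
  acts as 2, these are the multiples by 1, 2 and 4 up to sign.\<close>

lemma E7_multiple:
  assumes X: "X \<noteq> 0" "X \<in> E7 w" and Y: "Y \<in> E7 w"
  shows "\<exists>k. Y = zs k X"
proof (cases "Y = 0")
  case False
  have 2: "tw w X = zs 2 X" using X(2) by (simp add: E7_def numeral_2_eq_2)
  have 4: "tw w (tw w X) = zs 4 X" using q.\<tau>_zs[of 2 X] zs_mult[of 2 2 X] unfolding 2[symmetric] by (simp add: 2)
  have n: "1 + 3*w \<noteq> 0" using X E7_iff by auto
  have "(1 + 3*w) * px X^3 = (1 + 3*w) * px Y^3" using X Y E7_iff False by simp
  then have e: "px X^3 = px Y^3" using mult_left_cancel[OF n] by blast
  then have "(px Y - px X) * ((px Y - w * px X) * (px Y - w * (w * px X))) = 0" using w by Groebner_Basis.algebra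
  then have px: "px Y = px X \<or> px Y = w * px X \<or> px Y = w * (w * px X)" by auto
  have "py Y^2 = py X^2" using sext_eq[OF X(1)] sext_eq[OF False] e by simp
  then have py: "py Y = py X \<or> py Y = - py X" by (simp only: power2_eq_iff)
  note c = tw_coords[OF w X(1)]
  note c' = tw_coords[OF w c(1)]
  have k: "Z = Y \<or> Z = - Y" if "Z \<noteq> 0" "px Z = px Y" "py Z = py X" for Z
    using that py ept_eqI[OF that(1) False] ept_eqI[OF that(1), of "- Y"] False py_uminus[OF False] by auto
  have "\<exists>k. zs k X = Y \<or> zs k X = - Y" using px
  proof (elim disjE)
    assume "px Y = px X"
    then show ?thesis using k[of X] X(1) by (intro exI[of _ 1]) auto
  next
    assume "px Y = w * px X"
    then show ?thesis using k[of "tw w X"] c unfolding 2 by (intro exI[of _ 2]) auto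
  next
    assume "px Y = w * (w * px X)"
    then show ?thesis using k[of "tw w (tw w X)"] c c' unfolding 4 by (intro exI[of _ 4]) auto
  qed
  then obtain k where "Y = zs k X \<or> Y = zs (- k) X" unfolding zs_uminus by (metis minus_minus)
  then show ?thesis by blast
qed (auto intro: exI[of _ 0])

end

context
  fixes w r :: complex assumes w: "w^2 + w + 1 = 0" and r: "28 * r^6 = -1"
begin

lemma F7_coords:
  assumes X: "X \<noteq> 0" "X \<in> E7 w"
  shows "F7 r w X \<noteq> 0" "px (F7 r w X) = - 4 * r^2 / px X" "py (F7 r w X) = 2 * r^3 * (3 + 2*w) * py X"
    "F7 r w X \<in> E7 (w^2)"
proof -
  define x y where "x = px X" and "y = py X"
  have y2: "y^2 = x^3 + 1" using sext_eq[OF X(1)] by (simp add: x_def y_def)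
  have t: "(1 + 3*w) * x^3 = -4" using X E7_iff[OF w] by (simp add: x_def)
  have x0: "x \<noteq> 0" using E7_px[OF w X] by (simp add: x_def)
  have "7 * (x^3 * (2 * r^3 * (3 + 2*w) * y)^2 - (- 64 * r^6 + x^3)) = 0" using r t y2 w by Groebner_Basis.algebra
  then have "x^3 * (2 * r^3 * (3 + 2*w) * y)^2 - (- 64 * r^6 + x^3) = 0" by (simp only: mult_eq_0_iff) simp
  then have "x^3 * (2 * r^3 * (3 + 2*w) * y)^2 = x^3 * ((- 4 * r^2 / x)^3 + 1)"
    using x0 by (simp add: power_divide power_mult_distrib distrib_left right_diff_distrib flip: power_mult)
  then have on: "(2 * r^3 * (3 + 2*w) * y)^2 = (- 4 * r^2 / x)^3 + ca TYPE(sext) * (- 4 * r^2 / x) + cb TYPE(sext)"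
    using x0 by simp
  have F: "F7 r w X = mk (- 4 * r^2 / x) (2 * r^3 * (3 + 2*w) * y)" using X by (simp add: F7_def x_def y_def)
  note m = mk_simps[OF on, folded F]
  show n: "F7 r w X \<noteq> 0" and px: "px (F7 r w X) = - 4 * r^2 / px X"
    and "py (F7 r w X) = 2 * r^3 * (3 + 2*w) * py X"
    using m by (simp_all add: x_def y_def)
  have "7 * ((1 + 3*w^2) * (- 64 * r^6) + 4 * x^3) = 0" using r t w by Groebner_Basis.algebra
  then have "(1 + 3*w^2) * (- 64 * r^6) + 4 * x^3 = 0" by (simp only: mult_eq_0_iff) simp
  then have "(1 + 3*w^2) * (- 64 * r^6) = -4 * x^3" by (simp add: add_eq_0_iff)
  moreover have "x^3 * (- 4 * r^2 / x)^3 = - 64 * r^6"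
    using x0 by (simp add: power_divide power_mult_distrib flip: power_mult)
  ultimately have "x^3 * ((1 + 3*w^2) * (- 4 * r^2 / x)^3) = x^3 * (-4)" by Groebner_Basis.algebra
  then have "(1 + 3*w^2) * px (F7 r w X)^3 = -4" unfolding px x_def[symmetric] using x0 by simp
  then show "F7 r w X \<in> E7 (w^2)" using E7_iff[OF w_conj[OF w] n] by blast
qed

lemma F7_E7: "X \<in> E7 w \<Longrightarrow> F7 r w X \<in> E7 (w^2)"
  using F7_coords(4) E7_0[OF w_conj[OF w]] by (cases "X = 0") auto

lemma F7_sc:
  assumes z: "autom TYPE(sext) z" and X: "X \<in> E7 w" shows "F7 r w (sc z X) = sc (inverse z) (F7 r w X)"
proof (cases "X = 0")
  case False
  have z0: "z^6 = 1" "z \<noteq> 0" using z by (auto simp: autom_sext)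
  note s = sc_coords[OF z False]
  note m = F7_coords[OF False X]
  note s' = sc_coords[OF autom_inverse[OF z] m(1)]
  note m' = F7_coords[OF s(1) E7_sc[OF w z X]]
  have x: "px X \<noteq> 0" using E7_px[OF w False X] .
  have "z^3 * z^3 = 1" using z0(1) by Groebner_Basis.algebra
  then have zz: "inverse (z^3) = z^3" by (rule inverse_unique)
  show ?thesis using m'(1) s'(1)
  proof (rule ept_eqI)
    show "px (F7 r w (sc z X)) = px (sc (inverse z) (F7 r w X))"
      unfolding m' s' m s using z0(2) x by (simp add: field_simps)
    show "py (F7 r w (sc z X)) = py (sc (inverse z) (F7 r w X))"
      unfolding m' s' m s power_inverse zz by (simp add: mult_ac)
  qed
qed (use z autom_inverse[OF z] in simp)

text \<open>Doubling is the automorphism \<open>w^2\<close> on the kernel for w and its inverse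
  \<open>w\<close> on the kernel for \<open>w^2\<close>. As 2 and -1 generate the units modulo 7,
  semilinearity under automorphisms yields all multiples.\<close>

lemma F7_zs:
  assumes X: "X \<in> E7 w" shows "F7 r w (zs k X) = zs k (F7 r w X)"
proof -
  have a: "autom TYPE(sext) (w^2)" "autom TYPE(sext) (-1)" using autom_w[OF w] by (simp_all add: autom_sext)
  have m: "F7 r w (- Y) = - F7 r w Y" if "Y \<in> E7 w" for Y using F7_sc[OF a(2) that] by simp
  have two: "zs 2 Y = sc (w^2) Y" if "Y \<in> E7 w" for Y using that by (simp add: E7_def numeral_2_eq_2 tw_def)
  have two': "zs 2 Y = sc w Y" if "Y \<in> E7 (w^2)" for Y
    
  proof -
    have "zs 2 Y = tw (w^2) Y" using that zs_add[of 1 1 Y] by (simp add: E7_def)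
    then show ?thesis unfolding tw_def w4(1)[OF w] .
  qed
  have "w^2 * w = 1" using w3[OF w] by (simp add: power2_eq_square power3_eq_cube)
  then have iw: "inverse (w^2) = w" by (rule inverse_unique)
  have f2: "F7 r w (zs 2 Y) = zs 2 (F7 r w Y)" "zs 2 Y \<in> E7 w" if Y: "Y \<in> E7 w" for Y
    unfolding two[OF Y] two'[OF F7_E7[OF Y]] using F7_sc[OF a(1) Y] iw E7_sc[OF w a(1) Y] by simp_all
  have z4: "zs 4 Y = zs 2 (zs 2 Y)" for Y :: "sext ept" using zs_mult[of 2 2 Y] by simp
  have f4: "F7 r w (zs 4 X) = zs 4 (F7 r w X)" "zs 4 X \<in> E7 w" unfolding z4 using f2[OF f2(2)[OF X]] f2[OF X] by simp_all
  have neg: "F7 r w (zs (- l) X) = zs (- l) (F7 r w X)" if "F7 r w (zs l X) = zs l (F7 r w X)" "zs l X \<in> E7 w" for l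
    unfolding zs_uminus using m[OF that(2)] that(1) by simp
  have red: "F7 r w (zs k X) = zs k (F7 r w X)" if "F7 r w (zs l X) = zs l (F7 r w X)" "7 dvd k - l" for l
  proof -
    have "zs k X = zs l X" "zs k (F7 r w X) = zs l (F7 r w X)"
      using that(2) by (auto intro!: zs_mod[where p=7] E7_tor[OF w X] E7_tor[OF w_conj[OF w] F7_E7[OF X]])
    then show ?thesis using that(1) by simp
  qed
  have "7 dvd k - 0 \<or> 7 dvd k - 1 \<or> 7 dvd k - 2 \<or> 7 dvd k - (-4) \<or> 7 dvd k - 4 \<or> 7 dvd k - (-2) \<or> 7 dvd k - (-1)"
    by presburger
  then show ?thesis
    by (elim disjE) (erule red[rotated], use f2[OF X] f4 neg[of 1] neg[of 2] neg[of 4] X in simp)+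
qed

lemma F7_add:
  assumes "X \<in> E7 w" "Y \<in> E7 w" shows "F7 r w (X + Y) = F7 r w X + F7 r w Y"
proof (cases "X = 0")
  case False
  obtain k where k: "Y = zs k X" using E7_multiple[OF w False assms] by blast
  have XY: "X + Y = zs (1 + k) X" unfolding k zs_add by simp
  show ?thesis unfolding XY F7_zs[OF assms(1)] unfolding k F7_zs[OF assms(1)] zs_add by simp
qed simp

end

lemma F7_F7:
  assumes w: "w^2 + w + 1 = 0" and r: "28 * r^6 = -1" and X: "X \<in> E7 w" shows "F7 r (w^2) (F7 r w X) = - X"
proof (cases "X = 0")
  case False
  note m = F7_coords[OF w r False X]
  note m' = F7_coords[OF w_conj[OF w] r m(1,4)]
  have x: "px X \<noteq> 0" using E7_px[OF w False X] .
  have r0: "r \<noteq> 0" using r by auto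
  have e: "2 * r^3 * (3 + 2*w^2) * (2 * r^3 * (3 + 2*w) * y) = - y" for y using r w by Groebner_Basis.algebra
  show ?thesis
  proof (rule ept_eqI)
    show "px (F7 r (w^2) (F7 r w X)) = px (- X)" unfolding m' m using x r0 by (simp add: field_simps)
    show "py (F7 r (w^2) (F7 r w X)) = py (- X)" unfolding m' m e using py_uminus[OF False] by simp
  qed (use m' False in auto)
qed simp

lemma F7_alg:
  assumes w: "w^2 + w + 1 = 0" "w \<in> Qbar" and r: "28 * r^6 = -1" "r \<in> Qbar" and X: "X \<in> E7 w" "alg X"
  shows "alg (F7 r w X)"
  using F7_coords[OF w(1) r(1) _ X(1)] X(2) w(2) r(2)
  by (cases "X = 0") (auto simp: alg_iff intro!: Qbar_intros)

lemma F7_scale: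
  assumes w: "w^2 + w + 1 = 0" and r: "28 * r^6 = -1" and z: "autom TYPE(sext) z" and X: "X \<in> E7 w"
  shows "F7 (z * r) w X = sc z (F7 r w X)"
proof (cases "X = 0")
  case False
  have zr: "28 * (z * r)^6 = -1" using z r by (simp add: power_mult_distrib autom_sext)
  note m = F7_coords[OF w r False X] and m' = F7_coords[OF w zr False X]
  note s = sc_coords[OF z m(1)]
  show ?thesis using m'(1) s(1) by (rule ept_eqI) (simp_all add: m' s m power_mult_distrib)
qed (simp add: z)

lemma F7_gal:
  assumes \<sigma>: "\<sigma> \<in> GalQ" and w: "w^2 + w + 1 = 0" "w \<in> Qbar" and r: "28 * r^6 = -1" "r \<in> Qbar"
    and X: "X \<in> E7 w" "alg X"
  shows "gal \<sigma> (F7 r w X) = F7 (\<sigma> r) (\<sigma> w) (gal \<sigma> X)"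
proof (cases "X = 0")
  case False
  have sr: "28 * (\<sigma> r)^6 = -1"
  proof -
    have "\<sigma> (28 * r^6) = \<sigma> (-1)" by (simp only: r(1))
    then show ?thesis using r(2) by (simp add: gal_simps[OF \<sigma>] Qbar_intros)
  qed
  have sw: "(\<sigma> w)^2 + \<sigma> w + 1 = 0"
  proof -
    have "\<sigma> (w^2 + w + 1) = 0" unfolding w(1) using gal_0[OF \<sigma>] .
    then show ?thesis using w(2) by (simp add: gal_simps[OF \<sigma>] Qbar_intros)
  qed
  have xq: "px X \<in> Qbar" "py X \<in> Qbar" using X False by (auto simp: alg_iff)
  note g = gal_coords[OF \<sigma> False X(2)]
  have "\<sigma> ((1 + 3*w) * px X^3) = \<sigma> (-4)" using E7_iff[OF w(1) False] X by simp
  then have "(1 + 3 * \<sigma> w) * px (gal \<sigma> X)^3 = -4" using xq w(2) by (simp add: g gal_simps[OF \<sigma>] Qbar_intros)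
  then have gE: "gal \<sigma> X \<in> E7 (\<sigma> w)" using E7_iff[OF sw g(1)] by blast
  note m = F7_coords[OF w(1) r(1) False X(1)] and m' = F7_coords[OF sw sr g(1) gE]
  note gm = gal_coords[OF \<sigma> m(1) F7_alg[OF w r X]]
  show ?thesis using gm(1) m'(1)
    by (rule ept_eqI) (simp_all add: gm m m' g gal_simps[OF \<sigma>] Qbar_intros xq r w)
qed (simp add: \<sigma>)

lemma pr7_gal:
  assumes \<sigma>: "\<sigma> \<in> GalQ" and w: "w^2 + w + 1 = 0" and R: "alg R"
  shows "gal \<sigma> (pr7 w R) = pr7 (\<sigma> w) (gal \<sigma> R)"
  unfolding pr7_def using R
  by (simp only: gal_ept_add[OF \<sigma>] gal_ept_zs[OF \<sigma>] alg_zs tw_alg[OF w] gal_tw[OF \<sigma> w])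

lemmas om2 = om w_conj[OF om]
lemmas om4 = w4[OF om]

lemma M7_on:
  assumes "X \<in> E7 om" shows "M7 r X = F7 r om X"
  using pr7_fix[OF om assms] by (simp add: M7_def)

lemma M7_on':
  assumes "X \<in> E7 (om^2)" shows "M7 r X = F7 r (om^2) X"
  using pr7_fix[OF om2(2) assms] by (simp add: M7_def om4)

context
  fixes r :: complex assumes r: "28 * r^6 = -1"
begin

lemma M7_add: "X \<in> tor 7 \<Longrightarrow> Y \<in> tor 7 \<Longrightarrow> M7 r (X + Y) = M7 r X + M7 r Y"
  unfolding M7_def by (simp add: pr7_add[OF om] pr7_add[OF om2(2)] F7_add[OF om r] F7_add[OF om2(2) r] pr7_E7[OF om] pr7_E7[OF om2(2)] add_ac)

lemma M7_parts:
  assumes X: "X \<in> tor 7"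
  shows "F7 r om (pr7 om X) \<in> E7 (om^2)" "F7 r (om^2) (pr7 (om^2) X) \<in> E7 om"
  using F7_E7[OF om r pr7_E7[OF om X]] F7_E7[OF om2(2) r pr7_E7[OF om2(2) X]] by (simp_all add: om4)

lemma M7_tor: "X \<in> tor 7 \<Longrightarrow> M7 r X \<in> tor 7"
  unfolding M7_def by (intro tor_plus E7_tor[OF om2(2) M7_parts(1)] E7_tor[OF om M7_parts(2)])

lemma M7_M7: assumes X: "X \<in> tor 7" shows "M7 r (M7 r X) = - X"
proof -
  define A B where "A = F7 r om (pr7 om X)" and "B = F7 r (om^2) (pr7 (om^2) X)"
  note AB = M7_parts[OF X, folded A_def B_def]
  have "M7 r (A + B) = M7 r A + M7 r B" by (intro M7_add E7_tor[OF om2(2) AB(1)] E7_tor[OF om AB(2)])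
  also have "\<dots> = F7 r (om^2) A + F7 r om B" by (simp add: M7_on[OF AB(2)] M7_on'[OF AB(1)])
  also have "\<dots> = - (pr7 om X + pr7 (om^2) X)"
    unfolding A_def B_def using F7_F7[OF om r pr7_E7[OF om X]] F7_F7[OF om2(2) r pr7_E7[OF om2(2) X]] by (simp add: om4)
  finally show ?thesis unfolding pr7_sum[OF om] by (simp add: M7_def A_def B_def)
qed

lemma M7_sc: "autom TYPE(sext) z \<Longrightarrow> X \<in> tor 7 \<Longrightarrow> M7 r (sc z X) = sc (inverse z) (M7 r X)"
  unfolding M7_def by (simp add: pr7_sc[OF om] pr7_sc[OF om2(2)] F7_sc[OF om r] F7_sc[OF om2(2) r] pr7_E7[OF om] pr7_E7[OF om2(2)] sc_add[OF autom_inverse])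

end

lemma sc_inverse_om: "sc (inverse (om^2)) Y = zs (-1) Y - tw om Y"
proof -
  have "om^2 * om = 1" using w3[OF om] by (simp add: power2_eq_square power3_eq_cube)
  then have "inverse (om^2) = (om^2)^2" using inverse_unique om4(1) by metis
  then have "sc (inverse (om^2)) Y = tw (om^2) Y" by (simp only: tw_def)
  also have "\<dots> = zs (-1) Y - tw om Y" unfolding tw_conj[OF om] so.L_def by (simp add: zs_uminus)
  finally show ?thesis .
qed

lemma ex_E7: assumes "w^2 + w + 1 = 0" shows "\<exists>X. X \<noteq> 0 \<and> X \<in> E7 w"
proof -
  have n: "1 + 3*w \<noteq> 0"
  proof
    assume "1 + 3*w = 0"
    then have "7 = (0::complex)" using assms by Groebner_Basis.algebra
    then show False by simp
  qed
  obtain v where v: "v^3 = -4 / (1 + 3*w)" using ex_cube_root by blast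
  obtain X :: "sext ept" where X: "X \<noteq> 0" "px X = v" using ex_point by blast
  have "(1 + 3*w) * px X^3 = -4" unfolding X(2) v times_divide_eq_right by (rule nonzero_mult_div_cancel_left[OF n])
  then show ?thesis using E7_iff[OF assms X(1)] X(1) by blast
qed

text \<open>A nonzero vector is taken from each eigenspace; the two projections recover both from
  their sum, which is therefore a generator.\<close>

lemma pairing7: "\<exists>X\<^sub>0. cm_pairing (tw om) (-1) 7 (wp 7) X\<^sub>0"
proof -
  obtain P where P: "P \<noteq> 0" "P \<in> E7 om" using ex_E7[OF om] by blast
  obtain Q where Q: "Q \<noteq> 0" "Q \<in> E7 (om^2)" using ex_E7[OF om2(2)] by blast
  define X where "X = P + Q"
  have XT: "X \<in> tor 7" unfolding X_def by (intro tor_plus E7_tor[OF om P(2)] E7_tor[OF om2(2) Q(2)])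
  have pP: "P = so.L 2 3 X"
    using pr7_add[OF om, of P Q] pr7_fix[OF om P(2)] pr7_fix[OF om2(2) Q(2)] pr7_L[OF om, of X]
    by (simp add: X_def om4)
  have pQ: "Q = so.L (-1) (-3) X"
    using pr7_add[OF om2(2), of P Q] pr7_fix[OF om P(2)] pr7_fix[OF om2(2) Q(2)] pr7_conj_L[OF om, of X]
    by (simp add: X_def)
  have g: "\<exists>m n. R = so.L m n X" if R: "R \<in> tor 7" for R
  proof -
    obtain k where k: "pr7 om R = zs k P" using E7_multiple[OF om P pr7_E7[OF om R]] by blast
    obtain l where l: "pr7 (om^2) R = zs l Q" using E7_multiple[OF om2(2) Q pr7_E7[OF om2(2) R]] by blast
    have "R = zs k P + zs l Q" using pr7_sum[OF om, of R] k l by simp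
    then show ?thesis by (subst (asm) pP, subst (asm) pQ) (auto simp: so.L_zs so.L_add)
  qed
  have f: "finite (tor 7 :: sext ept set)" by (rule so.finite_tor[OF XT _ g]) simp_all
  have o: "off_line_additive 7 (wp 7 :: sext ept \<Rightarrow> _)" by (rule wp_off_line_additive) (simp_all add: f)
  have "cm_pairing (tw om) (-1) 7 (wp 7) X"
    by (rule so.cm_pairing_wp[OF o off_line_additive.bilinear[OF o] XT g]) simp_all
  then show ?thesis by blast
qed

text \<open>Here \<open>u * u'\<close> has sixth power -28, hence 28 r^6 = -1. The square of M is
  -1, so the exponent is 1.\<close>

lemma sextic_7_congruence:
  assumes b: "b \<noteq> 0" shows "weil_congruent 7 (sextic b) (sextic (-28 / b)) 1"
proof -
  obtain u where u: "u^6 = (of_rat b :: complex)" using ex_sixth_root by blast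
  obtain u' where u': "u'^6 = (of_rat (-28 / b) :: complex)" using ex_sixth_root by blast
  have b': "-28 / b \<noteq> 0" using b by simp
  define r where "r = 1 / (u * u')"
  have r: "28 * r^6 = -1" unfolding r_def power_divide power_mult_distrib u u' using b
    by (simp add: of_rat_divide of_rat_minus)
  have rQ: "r \<in> Qbar" unfolding r_def
    by (intro Qbar_intros twist_sextic(2)[OF u b] twist_sextic(2)[OF u' b'])
  have o2: "om^2 \<in> Qbar" by (intro Qbar_power om_Qbar)
  obtain X\<^sub>0 where X0: "cm_pairing (tw om) (-1) 7 (wp 7) X\<^sub>0" using pairing7 by blast
  interpret P: cm_pairing "tw om" "-1" 7 "wp 7" X\<^sub>0 by (rule X0)
  show ?thesis
  proof (rule semilinear_congruence[OF twist_sextic(1)[OF u b] twist_sextic(1)[OF u' b']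
        twist_sextic(2)[OF u b] twist_sextic(2)[OF u' b'] _ r_def, where M=M7])
    show "prime (7::nat)" "\<not> (7::nat) dvd 1" by simp_all
    fix X :: "sext ept" assume X: "X \<in> tor 7"
    note e = pr7_E7[OF om X] pr7_E7[OF om2(2) X]
    show "M7 r X \<in> tor 7" by (rule M7_tor[OF r X])
    show "alg (M7 r X)" if "alg X" unfolding M7_def
      by (intro alg_add F7_alg[OF om om_Qbar r rQ] F7_alg[OF om2(2) o2 r rQ] e pr7_alg om2 that)
    show "M7 r (M7 r X) = X \<or> M7 r (M7 r X) = - X" using M7_M7[OF r X] by simp
    show "M7 r (sc z X) = sc (inverse z) (M7 r X)" if "autom TYPE(sext) z" for z by (rule M7_sc[OF r that X])
    show "M7 (z * r) X = sc z (M7 r X)" if z: "autom TYPE(sext) z" for z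
      unfolding M7_def using F7_scale[OF om r z e(1)] F7_scale[OF om2(2) r z e(2)] by (simp add: sc_add[OF z])
    show "gal \<sigma> (M7 r X) = M7 (\<sigma> r) (gal \<sigma> X)" if \<sigma>: "\<sigma> \<in> GalQ" and al: "alg X" for \<sigma>
    proof -
      note p = pr7_alg[OF om al] pr7_alg[OF om2(2) al]
      have "gal \<sigma> (M7 r X) = gal \<sigma> (F7 r om (pr7 om X)) + gal \<sigma> (F7 r (om^2) (pr7 (om^2) X))"
        unfolding M7_def by (intro gal_ept_add[OF \<sigma>] F7_alg[OF om om_Qbar r rQ] F7_alg[OF om2(2) o2 r rQ] e p)
      also have "\<dots> = F7 (\<sigma> r) (\<sigma> om) (pr7 (\<sigma> om) (gal \<sigma> X)) + F7 (\<sigma> r) (\<sigma> (om^2)) (pr7 (\<sigma> (om^2)) (gal \<sigma> X))"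
        unfolding F7_gal[OF \<sigma> om om_Qbar r rQ e(1) p(1)] F7_gal[OF \<sigma> om2(2) o2 r rQ e(2) p(2)]
          pr7_gal[OF \<sigma> om al] pr7_gal[OF \<sigma> om2(2) al] ..
      also have "\<dots> = M7 (\<sigma> r) (gal \<sigma> X)"
        using gal_om[OF \<sigma>] by (auto simp: M7_def add.commute gal_power[OF \<sigma> om_Qbar] om4)
      finally show ?thesis .
    qed
    fix Y :: "sext ept" assume Y: "Y \<in> tor 7"
    show "M7 r (X + Y) = M7 r X + M7 r Y" by (rule M7_add[OF r X Y])
    have "M7 r (tw om Z) = zs (-1) (M7 r Z) - tw om (M7 r Z)" if "Z \<in> tor 7" for Z
      using M7_sc[OF r autom_w[OF om] that] unfolding sc_inverse_om by (simp only: tw_def)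
    then have "wp 7 (M7 r X) (M7 r Y) = wp 7 X Y powi (- (- 1))"
      by (intro P.B_semilinear[OF M7_add[OF r] M7_tor[OF r] _ _ X Y])
        (simp_all only: M7_M7[OF r] P.X0 zs_m1)
    then show "wp 7 (M7 r X) (M7 r Y) = wp 7 X Y ^ 1" by simp
  qed
qed

section \<open>The 5-torsion of sextic twists\<close>

text \<open>On 5-torsion points, t = x^3 satisfies 5t^4 + 380t^3 - 240t^2 - 1600t - 256 = 0, and
  h = (t - 8) / (4 - 5t) is a better parameter: v = h^2 + h satisfies 5v^2 - 5v - 1 = 0, and
  the three values of x belonging to h are the solutions of 5(hx)^3 = 4.\<close>

definition T5 :: "sext ept \<Rightarrow> complex \<Rightarrow> bool" where
  "T5 X h \<longleftrightarrow> X \<noteq> 0 \<and> 5 * (h^2 + h)^2 - 5 * (h^2 + h) - 1 = 0 \<and> 5 * (h * px X)^3 = 4"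

definition hh :: "sext ept \<Rightarrow> complex" where
  "hh X = (px X^3 - 8) / (4 - 5 * px X^3)"

lemma th_0: "th 0 = 0" by (simp add: th_eq_0_iff)

lemma th_th: "th (th X) = zs (-3) X"
  unfolding th_def so.L_L by (simp add: so.L_def)

lemma double_sext:
  fixes X :: "sext ept"
  assumes X: "X \<noteq> 0" "py X \<noteq> 0"
  shows "X + X \<noteq> 0" "4 * (px X^3 + 1) * px (X + X) = px X * (px X^3 - 8)"
proof -
  define s where "s = (3 * px X^2 + ca TYPE(sext)) / (2 * py X)"
  note d = double_coords[OF X s_def]
  show "X + X \<noteq> 0" by (rule d)
  have s: "2 * py X * s = 3 * px X^2" using X by (simp add: s_def)
  show "4 * (px X^3 + 1) * px (X + X) = px X * (px X^3 - 8)"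
    unfolding d(2) using s sext_eq[OF X(1)] by Groebner_Basis.algebra
qed

lemma T5D:
  assumes "T5 X h"
  shows "X \<noteq> 0" "5 * (h^2 + h)^2 - 5 * (h^2 + h) - 1 = 0" "5 * (h * px X)^3 = 4" "5*h^4 + 10*h^3 - 5*h - 1 = 0"
proof -
  show "X \<noteq> 0" and v: "5 * (h^2 + h)^2 - 5 * (h^2 + h) - 1 = 0" and "5 * (h * px X)^3 = 4"
    using assms by (auto simp only: T5_def)
  show "5*h^4 + 10*h^3 - 5*h - 1 = 0" using v by Groebner_Basis.algebra
qed

lemma T5_facts:
  assumes "T5 X h"
  shows "X \<noteq> 0" "h \<noteq> 0" "px X \<noteq> 0" "1 + h \<noteq> 0" "1 + 5 * h^3 \<noteq> 0" "py X \<noteq> 0"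
    "h * (4 - 5 * px X^3) = px X^3 - 8" "4 - 5 * px X^3 \<noteq> 0"
proof -
  note a = T5D[OF assms] and q = T5D(4)[OF assms]
  show X: "X \<noteq> 0" and h: "h \<noteq> 0" and x: "px X \<noteq> 0" using a by auto
  show "1 + h \<noteq> 0"
  proof
    assume "1 + h = 0"
    then have "1 = (0::complex)" using q by Groebner_Basis.algebra
    then show False by simp
  qed
  show "1 + 5 * h^3 \<noteq> 0"
  proof
    assume e: "1 + 5 * h^3 = 0"
    then have "6 * h = -3" using q by Groebner_Basis.algebra
    then have "2 * h = -1" by simp
    then have "3 = (0::complex)" using e by Groebner_Basis.algebra
    then show False by simp
  qed
  have t: "5 * h^3 * px X^3 = 4" using a(3) unfolding power_mult_distrib by (simp only: mult.assoc)
  show "py X \<noteq> 0"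
  proof
    assume "py X = 0"
    then have x1: "px X^3 = -1" using sext_eq[OF X] by (simp add: eq_neg_iff_add_eq_0)
    have "- (5 * h^3) = 4" using t unfolding x1 by simp
    then have e: "5 * h^3 = -4" by (metis minus_minus)
    then have "9 * h = -9" using q by Groebner_Basis.algebra
    then have "h = -1" by simp
    then show False using e by simp
  qed
  have "(5 * h^3) * (h * (4 - 5 * px X^3)) = (5 * h^3) * (px X^3 - 8)" using q t by Groebner_Basis.algebra
  moreover have "5 * h^3 \<noteq> 0" using h by simp
  ultimately show r: "h * (4 - 5 * px X^3) = px X^3 - 8" using mult_left_cancel by blast
  show "4 - 5 * px X^3 \<noteq> 0"
  proof
    assume e: "4 - 5 * px X^3 = 0"
    then have "px X^3 = 8" using r by simp
    then show False using e by simp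
  qed
qed

lemma T5_hh: assumes "T5 X h" shows "hh X = h"
  unfolding hh_def T5_facts(7)[OF assms, symmetric] by (rule nonzero_mult_div_cancel_right[OF T5_facts(8)[OF assms]])

text \<open>On 5-torsion the square of sqrt(-3), which is -3, acts as 2. Equating the abscissa from
  \<open>th_coords\<close> applied twice with the duplication formula gives the quartic in
  \<open>t = x^3\<close>.\<close>

lemma tor5_sext:
  assumes X: "X \<noteq> 0" "X \<in> tor 5" shows "T5 X (hh X)"
proof -
  have n3: "zs (-3) X \<noteq> 0"
  proof
    assume "zs (-3) X = 0"
    then have "zs 2 (zs (-3) X) = 0" by simp
    then have "zs (-6) X = 0" using zs_mult[of 2 "-3" X] by simp
    moreover have "zs (-6) X = zs (-1) X" using X(2) by (intro zs_mod[where p=5]) auto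
    ultimately show False using X by simp
  qed
  have e: "th (th X) = X + X"
  proof -
    have "zs (-3) X = zs 2 X" using X(2) by (intro zs_mod[where p=5]) auto
    then show ?thesis unfolding th_th by (simp add: numeral_2_eq_2)
  qed
  have n1: "th X \<noteq> 0" and n2: "th (th X) \<noteq> 0" using n3 th_0 unfolding th_th[symmetric] by auto
  have x0: "px X \<noteq> 0" and x10: "px (th X) \<noteq> 0" using n1 n2 th_eq_0_iff by auto
  define x x1 x2 where "x = px X" and "x1 = px (th X)" and "x2 = px (th (th X))"
  note x0 = x0[folded x_def] and x10 = x10[folded x1_def]
  have "py X \<noteq> 0" using py_eq_0_iff_double[OF X(1)] n2 e by auto
  note d = double_sext[OF X(1) this, folded e, folded x_def x2_def]
  have c1: "3 * x^2 * x1 = - (x^3 + 4)"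
    using th_coords(2)[OF X(1) x0[unfolded x_def]] x0 unfolding x_def[symmetric] x1_def[symmetric] by (simp add: field_simps)
  have c2: "3 * x1^2 * x2 = - (x1^3 + 4)"
    using th_coords(2)[OF n1 x10[unfolded x1_def]] x10 unfolding x2_def[symmetric] x1_def[symmetric] by (simp add: field_simps)
  define t where "t = x^3"
  have a: "9 * x^4 * x1^2 = (t + 4)^2" "27 * x^6 * x1^3 = - ((t + 4)^3)"
    using c1 unfolding t_def by Groebner_Basis.algebra+
  have "3 * (27 * x^6 * x1^2 * x2) = - (27 * x^6 * x1^3) - 108 * t^2" using c2 unfolding t_def by Groebner_Basis.algebra
  then have b: "9 * x^2 * (t + 4)^2 * x2 = (t + 4)^3 - 108 * t^2" using a by Groebner_Basis.algebra
  have d': "4 * (t + 1) * x2 = x * (t - 8)" using d(2) by (simp add: t_def)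
  have "9 * x^3 * (t + 4)^2 * (t - 8) = 4 * (t + 1) * ((t + 4)^3 - 108 * t^2)" using b d' by Groebner_Basis.algebra
  then have q: "5*t^4 + 380*t^3 - 240*t^2 - 1600*t - 256 = 0" unfolding t_def[symmetric] by Groebner_Basis.algebra
  have n: "4 - 5*t \<noteq> 0"
  proof
    assume "4 - 5*t = 0"
    then have t: "t = 4/5" by (simp add: eq_divide_eq mult.commute)
    show False using q unfolding t by (simp add: eval_nat_numeral)
  qed
  define h where "h = hh X"
  have h: "h * (4 - 5*t) = t - 8" using n unfolding h_def hh_def x_def[symmetric] t_def[symmetric] by simp
  have "(4 - 5*t)^4 * (5 * (h^2 + h)^2 - 5 * (h^2 + h) - 1) =
      5 * (t - 8)^4 + 10 * (t - 8)^3 * (4 - 5*t) - 5 * (t - 8) * (4 - 5*t)^3 - (4 - 5*t)^4"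
    unfolding h[symmetric] by Groebner_Basis.algebra
  also have "\<dots> = 0" using q by Groebner_Basis.algebra
  finally have v: "5 * (h^2 + h)^2 - 5 * (h^2 + h) - 1 = 0" using n by (simp only: mult_eq_0_iff power_eq_0_iff) simp
  have "(4 - 5*t)^3 * (5 * h^3 * t - 4) = 5 * (t - 8)^3 * t - 4 * (4 - 5*t)^3"
    unfolding h[symmetric] by Groebner_Basis.algebra
  also have "\<dots> = 0" using q by Groebner_Basis.algebra
  finally have "5 * h^3 * t - 4 = 0" using n by (simp only: mult_eq_0_iff power_eq_0_iff) simp
  then have "5 * (h * x)^3 = 4" by (simp add: t_def power_mult_distrib mult.assoc)
  then show ?thesis using X(1) v unfolding T5_def h_def x_def by blast
qed

text \<open>Besides the new parameter, sqrt(-3) preserves h x and sends v = h^2 + h to 1 - v, the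
  other root of 5v^2 - 5v - 1; the semilinear map is built from these two quantities.\<close>

lemma T5_th:
  assumes a: "T5 X h" and h': "h' = - 3 * h / (1 + 5 * h^3)"
  shows "T5 (th X) h'" "h' * px (th X) = h * px X" "h'^2 + h' = 1 - (h^2 + h)" "h' * (1 + 5 * h^3) = - 3 * h"
proof -
  note f = T5_facts[OF a]
  note a' = T5D[OF a] and q = T5D(4)[OF a]
  define D where "D = 1 + 5 * h^3"
  have D: "D \<noteq> 0" using f by (simp add: D_def)
  show r: "h' * (1 + 5 * h^3) = - 3 * h" using h' f by simp
  have "D^2 * (h'^2 + h') = (h' * D)^2 + (h' * D) * D" by Groebner_Basis.algebra
  also have "\<dots> = (- 3 * h)^2 + (- 3 * h) * D" unfolding D_def r ..
  also have "\<dots> = D^2 * (1 - (h^2 + h))" unfolding D_def using q by Groebner_Basis.algebra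
  finally show v: "h'^2 + h' = 1 - (h^2 + h)" using D by simp
  have t: "5 * h^3 * px X^3 = 4" using a'(3) unfolding power_mult_distrib by (simp only: mult.assoc)
  have "3 * px X^2 * px (th X) = - (px X^3 + 4)" using th_coords(2)[OF f(1,3)] f(3) by (simp add: field_simps)
  then have "px X^2 * (3 * px (th X)) = px X^2 * (- (px X * D))" using t unfolding D_def by Groebner_Basis.algebra
  moreover have "px X^2 \<noteq> 0" using f(3) by simp
  ultimately have "3 * px (th X) = - (px X * D)" using mult_left_cancel by blast
  then have "(3 * D) * (h' * px (th X)) = (3 * D) * (h * px X)" using r unfolding D_def by Groebner_Basis.algebra
  then show k: "h' * px (th X) = h * px X" using D by simp
  have "5 * (h'^2 + h')^2 - 5 * (h'^2 + h') - 1 = 0" unfolding v using a'(2) by Groebner_Basis.algebra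
  then show "T5 (th X) h'" unfolding T5_def k using a' th_coords(1)[OF f(1,3)] by blast
qed

text \<open>Applying sqrt(-3) twice exchanges the two roots of h^2 + h = v. Together with
  \<open>T5_th\<close> this makes the four values of h a single orbit.\<close>

lemma T5_th_th:
  assumes a: "T5 X h" shows "T5 (th (th X)) (- 1 - h)" "(- 1 - h) * px (th (th X)) = h * px X"
proof -
  define h' where "h' = - 3 * h / (1 + 5 * h^3)"
  define h'' where "h'' = - 3 * h' / (1 + 5 * h'^3)"
  note b = T5_th[OF a h'_def]
  note c = T5_th[OF b(1) h''_def]
  define D where "D = 1 + 5 * h^3"
  have D: "D \<noteq> 0" "1 + 5 * h'^3 \<noteq> 0" using T5_facts[OF a] T5_facts[OF b(1)] by (simp_all add: D_def)
  note q = T5D(4)[OF a]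
  have r: "h' * D = - 3 * h" using b(4) by (simp add: D_def)
  have e1: "D^3 * (1 + 5 * h'^3) = D^3 - 135 * h^3" using r by Groebner_Basis.algebra
  have e2: "D^3 * h' = - 3 * h * D^2" using r by Groebner_Basis.algebra
  have p: "9 * h * D^2 + (1 + h) * (D^3 - 135 * h^3) = 0" using q unfolding D_def by Groebner_Basis.algebra
  have "D^3 * (h'' * (1 + 5 * h'^3)) = - 3 * (D^3 * h')" using c(4) by Groebner_Basis.algebra
  then have "h'' * (D^3 - 135 * h^3) = 9 * h * D^2" using e1 e2 by Groebner_Basis.algebra
  then have "(D^3 - 135 * h^3) * (h'' + 1 + h) = 0" using p by Groebner_Basis.algebra
  moreover have "D^3 - 135 * h^3 \<noteq> 0" unfolding e1[symmetric] using D by simp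
  ultimately have "h'' + 1 + h = 0" by simp
  then have "h'' = - 1 - h" by Groebner_Basis.algebra
  then show "T5 (th (th X)) (- 1 - h)" "(- 1 - h) * px (th (th X)) = h * px X" using c(1,2) b(2) by simp_all
qed

text \<open>The points -3X and 2X have the same abscissa, so either 5X = 0 or -3X = -2X, and the
  latter means X = 0.\<close>

lemma T5_tor: assumes a: "T5 X h" shows "X \<in> tor 5"
proof -
  note f = T5_facts[OF a]
  note b = T5_th_th[OF a]
  note d = double_sext[OF f(1,6)]
  define t where "t = px X^3"
  have "t + 1 \<noteq> 0" using sext_eq[OF f(1)] f(6) by (auto simp: t_def)
  then have t1: "4 * (t + 1) \<noteq> 0" by (simp only: mult_eq_0_iff) simp
  have "(1 + h) * (4 * (t + 1)) * px (th (th X)) = (1 + h) * (4 * (t + 1)) * px (X + X)"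
    using b(2) d(2) f(7) unfolding t_def[symmetric] by Groebner_Basis.algebra
  moreover have "(1 + h) * (4 * (t + 1)) \<noteq> 0" using f(4) t1 by (simp only: mult_eq_0_iff) simp
  ultimately have "px (th (th X)) = px (X + X)" using mult_left_cancel by blast
  then have "th (th X) = X + X \<or> th (th X) = - (X + X)"
    using px_eq_iff[OF T5_facts(1)[OF b(1)] d(1)] by blast
  then consider "zs (-3) X = zs 2 X" | "zs (-3) X = zs (-2) X"
    unfolding th_th using zs_add[of 1 1 X] zs_uminus[of 2 X] by auto
  then show ?thesis
  proof cases
    case 1
    then have "zs (2 - (-3)) X = 0" unfolding zs_diff by simp
    then show ?thesis by (simp add: tor_def)
  next
    case 2
    then have "zs (-2 - (-3)) X = 0" unfolding zs_diff by simp
    then show ?thesis using f(1) by simp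
  qed
qed

lemma sext_same_cube:
  assumes "X \<noteq> 0" "Y \<noteq> 0" "px X^3 = px Y^3" shows "\<exists>m n. Y = so.L m n X"
proof -
  have "(px Y - px X) * ((px Y - om * px X) * (px Y - om * (om * px X))) = 0" using assms(3) om by Groebner_Basis.algebra
  then have "px Y = px X \<or> px Y = om * px X \<or> px Y = om * (om * px X)" by auto
  then have "Y = X \<or> Y = - X \<or> Y = tw om X \<or> Y = - tw om X \<or> Y = tw om (tw om X) \<or> Y = - tw om (tw om X)"
    using px_eq_iff[OF assms(2,1)] px_eq_iff[OF assms(2) tw_coords(1)[OF om assms(1)]]
      px_eq_iff[OF assms(2) tw_coords(1)[OF om tw_coords(1)[OF om assms(1)]]]
    by (simp add: tw_coords[OF om] assms)
  moreover have "X = so.L 1 0 X" "tw om X = so.L 0 1 X" by (simp_all add: so.L_0_1)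
  ultimately show ?thesis by (metis so.L_\<tau> so.L_uminus)
qed

text \<open>The powers of sqrt(-3) move X through all four values of h, and for given h the cube of
  the abscissa is determined, which leaves one orbit of the six automorphisms.\<close>

lemma tor5_generated:
  assumes X: "X \<noteq> 0" "X \<in> tor 5" and Y: "Y \<in> tor 5" shows "\<exists>m n. Y = so.L m n X"
proof (cases "Y = 0")
  case True
  then show ?thesis by (metis so.L_0_0)
next
  case False
  define h u where "h = hh X" and "u = hh Y"
  have a: "T5 X h" using tor5_sext[OF X] by (simp add: h_def)
  have b: "T5 Y u" using tor5_sext[OF False Y] by (simp add: u_def)
  have same: "\<exists>m n. Y = so.L m n Z" if "T5 Z u" for Z
  proof (rule sext_same_cube)
    show "Z \<noteq> 0" "Y \<noteq> 0" using that b by (auto simp: T5_def)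
    have "(5 * u^3) * px Z^3 = (5 * u^3) * px Y^3" 
      using T5D(3)[OF that] T5D(3)[OF b] unfolding power_mult_distrib by (simp only: mult.assoc)
    moreover have "5 * u^3 \<noteq> 0" using T5_facts(2)[OF b] by simp
    ultimately show "px Z^3 = px Y^3" using mult_left_cancel by blast
  qed
  have opp: "\<exists>m n. Y = so.L m n Z" if Z: "T5 Z k" and e: "u^2 + u = k^2 + k" for Z k
  proof -
    have "(u - k) * (u - (- 1 - k)) = 0" using e by Groebner_Basis.algebra
    then consider "u = k" | "u = - 1 - k" by auto
    then show ?thesis
    proof cases
      case 2
      obtain m n where "Y = so.L m n (th (th Z))" using same T5_th_th(1)[OF Z] 2 by blast
      then show ?thesis unfolding th_def so.L_L by blast
    qed (use same Z in blast)
  qed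
  have "5 * ((u^2 + u - (h^2 + h)) * (u^2 + u - (1 - (h^2 + h)))) = 0"
    using T5D(2)[OF a] T5D(2)[OF b] by Groebner_Basis.algebra
  then have "(u^2 + u - (h^2 + h)) * (u^2 + u - (1 - (h^2 + h))) = 0" by (simp only: mult_eq_0_iff) simp
  then consider "u^2 + u = h^2 + h" | "u^2 + u = 1 - (h^2 + h)" by auto
  then show ?thesis
  proof cases
    case 2
    note c = T5_th[OF a refl]
    obtain m n where "Y = so.L m n (th X)" using opp[OF c(1)] 2 c(3) by auto
    then show ?thesis unfolding th_def so.L_L by blast
  qed (use opp a in blast)
qed

text \<open>The equations behind \<open>T5\<close> are solved one after another: v by a square root
  of 45, h from v by another square root, and the abscissa from h by a cube root.\<close>

lemma ex_tor5: "\<exists>X::sext ept. X \<noteq> 0 \<and> X \<in> tor 5"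
proof -
  define d where "d = csqrt 45"
  have d: "d^2 = 45" unfolding d_def by (rule power2_csqrt)
  define v where "v = (5 + d) / 10"
  have "10 * v = 5 + d" by (simp add: v_def)
  then have "20 * (5 * v^2 - 5 * v - 1) = 0" using d by Groebner_Basis.algebra
  then have v: "5 * v^2 - 5 * v - 1 = 0" by (simp only: mult_eq_0_iff) simp
  define e where "e = csqrt (1 + 4 * v)"
  have e: "e^2 = 1 + 4 * v" unfolding e_def by (rule power2_csqrt)
  define h where "h = (e - 1) / 2"
  have "2 * h = e - 1" by (simp add: h_def)
  then have "4 * (h^2 + h - v) = 0" using e by Groebner_Basis.algebra
  then have "h^2 + h - v = 0" by (simp only: mult_eq_0_iff) simp
  then have h: "h^2 + h = v" by simp
  have h0: "h \<noteq> 0" using h v by auto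
  obtain k :: complex where k: "k^3 = 4 / 5" using ex_cube_root by blast
  obtain X :: "sext ept" where X: "X \<noteq> 0" "px X = k / h" using ex_point by blast
  have "5 * k^3 = 4" unfolding k by simp
  moreover have "h * px X = k" using X(2) h0 by simp
  ultimately have "T5 X h" unfolding T5_def h using X(1) v by simp
  then show ?thesis using X(1) T5_tor by blast
qed

lemma pairing5_sext:
  assumes X: "X \<noteq> 0" "X \<in> tor 5" shows "cm_pairing (tw om) (-1) 5 (wp 5) X"
proof -
  have g: "\<exists>m n. P = so.L m n X" if "P \<in> tor 5" for P by (rule tor5_generated[OF X that])
  have f: "finite (tor 5 :: sext ept set)" by (rule so.finite_tor[OF X(2) _ g]) simp_all
  have o: "off_line_additive 5 (wp 5 :: sext ept \<Rightarrow> _)" by (rule wp_off_line_additive) (simp_all add: f)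
  show ?thesis
    by (rule so.cm_pairing_wp[OF o off_line_additive.bilinear[OF o] X(2) g]) simp_all
qed

text \<open>As 5 is inert, the semilinear involution moves each point by a sixth root of unity.\<close>

definition gg :: "sext ept \<Rightarrow> complex" where
  "gg X = 2 * (1 - 2 * ((hh X)^2 + hh X)) / (3 * (hh X * px X))"

definition MS :: "complex \<Rightarrow> sext ept \<Rightarrow> sext ept" where
  "MS r X = (if X = 0 then 0 else sc (r * gg X) X)"

lemma MS_0 [simp]: "MS r 0 = 0" by (simp add: MS_def)

context
  fixes r :: complex assumes r: "4 * r^6 = 5"
begin

lemma gg_autom: assumes X: "X \<noteq> 0" "X \<in> tor 5" shows "autom TYPE(sext) (r * gg X)"
proof -
  define h where "h = hh X"
  have a: "T5 X h" using tor5_sext[OF X] by (simp add: h_def)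
  define k v where "k = h * px X" and "v = h^2 + h"
  have v: "5 * v^2 - 5 * v - 1 = 0" and k: "5 * k^3 = 4" using a by (simp_all add: T5_def v_def k_def)
  have k0: "k \<noteq> 0" using k by auto
  have "3 * k * gg X = 2 * (1 - 2 * v)" unfolding gg_def h_def[symmetric] k_def[symmetric] v_def[symmetric] using k0 by simp
  \<comment> \<open>The equation for v gives \<open>(1 - 2*v)^2 = 9/5\<close>. With
    \<open>5*k^3 = 4\<close> the sixth power of \<open>gg X\<close> becomes 4/5, the inverse of
    r^6.\<close>
  then have "45 * (5 * (k * gg X)^2 - 4) = 0" using v by Groebner_Basis.algebra
  then have g: "5 * (k * gg X)^2 = 4" by (simp only: mult_eq_0_iff) simp
  have "(5 * (k * gg X)^2)^3 = 64" unfolding g by simp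
  moreover have "5 * (5 * k^3)^2 * gg X^6 = (5 * (k * gg X)^2)^3"
    by (simp add: power_mult_distrib flip: power_mult)
  ultimately have "5 * (5 * k^3)^2 * gg X^6 = 64" by (simp only:)
  then have g6: "5 * gg X^6 = 4" unfolding k by simp
  have "20 * (r * gg X)^6 = (4 * r^6) * (5 * gg X^6)" by (simp add: power_mult_distrib)
  then have "(r * gg X)^6 = 1" unfolding r g6 by simp
  then show ?thesis by (simp add: autom_sext)
qed

lemma MS_tor: "X \<in> tor 5 \<Longrightarrow> MS r X \<in> tor 5"
  by (simp add: MS_def sc_tor gg_autom)

text \<open>Since \<open>gg\<close> has weight -2 under an automorphism z, applying z first and then
  the scalar \<open>r * gg\<close> amounts to the inverse of z: semilinearity comes from the
  weight.\<close>

lemma gg_sc: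
  assumes z: "autom TYPE(sext) z" and X: "X \<noteq> 0" shows "gg (sc z X) = inverse z^2 * gg X"
proof -
  have z6: "z^6 = 1" "z \<noteq> 0" using z by (auto simp: autom_sext)
  have "(z^2 * px X)^3 = px X^3" using z6(1) by (simp add: power_mult_distrib flip: power_mult)
  then have "hh (sc z X) = hh X" by (simp add: hh_def sc_coords[OF z X])
  then show ?thesis using z6 by (simp add: gg_def sc_coords[OF z X] field_simps)
qed

lemma MS_sc:
  assumes z: "autom TYPE(sext) z" and X: "X \<in> tor 5" shows "MS r (sc z X) = sc (inverse z) (MS r X)"
proof (cases "X = 0")
  case False
  have z0: "z \<noteq> 0" using z by (simp add: autom_iff)
  note s = sc_coords(1)[OF z False]
  note a = gg_autom[OF False X] and b = gg_autom[OF s sc_tor[OF z X]]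
  have e: "r * gg (sc z X) * z = inverse z * (r * gg X)"
    unfolding gg_sc[OF z False] using z0 by (simp add: power2_eq_square field_simps)
  have "MS r (sc z X) = sc (r * gg (sc z X)) (sc z X)" using s by (simp add: MS_def)
  also have "\<dots> = sc (inverse z) (sc (r * gg X) X)" unfolding sc_sc[OF b z] sc_sc[OF autom_inverse[OF z] a] e ..
  finally show ?thesis using False by (simp add: MS_def)
qed (use z autom_inverse[OF z] in simp)

lemma MS_MS: assumes X: "X \<in> tor 5" shows "MS r (MS r X) = X"
proof (cases "X = 0")
  case False
  note a = gg_autom[OF False X]
  have "MS r (MS r X) = sc (inverse (r * gg X)) (sc (r * gg X) X)"
    using MS_sc[OF a X] False by (simp add: MS_def)
  also have "\<dots> = X" using sc_inverse[OF autom_inverse[OF a], of X] by simp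
  finally show ?thesis .
qed simp

text \<open>Under sqrt(-3) the factor 1 - 2v changes sign while h x is fixed, so \<open>gg\<close>
  changes sign. As conjugation sends sqrt(-3) to its negative, this is semilinearity again.\<close>

lemma MS_th: assumes X: "X \<in> tor 5" shows "MS r (th X) = - th (MS r X)"
proof (cases "X = 0")
  case True
  then show ?thesis by (simp add: th_0)
next
  case False
  define h where "h = hh X"
  have t: "T5 X h" using tor5_sext[OF False X] by (simp add: h_def)
  define h' where "h' = - 3 * h / (1 + 5 * h^3)"
  note c = T5_th[OF t h'_def]
  have n: "th X \<noteq> 0" using T5_facts(1)[OF c(1)] .
  have "hh (th X) = h'" using T5_hh[OF c(1)] .
  moreover have "2 * (1 - 2 * (h'^2 + h')) = - (2 * (1 - 2 * (h^2 + h)))" unfolding c(3) by simp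
  ultimately have g: "gg (th X) = - gg X" by (simp only: gg_def h_def[symmetric] c(2) minus_divide_left)
  note a = gg_autom[OF False X]
  have "MS r (th X) = sc (-1 * (r * gg X)) (th X)" using n by (simp add: MS_def g)
  also have "\<dots> = sc (-1) (sc (r * gg X) (th X))" using a by (intro sc_sc[symmetric]) (simp_all add: autom_sext)
  also have "sc (r * gg X) (th X) = th (sc (r * gg X) X)"
    using a by (simp add: th_def so.L_def sc_add sc_nm sc_tw om)
  finally show ?thesis using False by (simp add: MS_def)
qed

lemma MS_tw: "X \<in> tor 5 \<Longrightarrow> MS r (tw om X) = zs (-1) (MS r X) - tw om (MS r X)"
  using MS_sc[OF autom_w[OF om]] unfolding sc_inverse_om by (simp only: tw_def)

text \<open>The units modulo 5 form a cyclic group of order 24 generated by the cube root of unity and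
  the square root of -3, so the two rules above reach every residue class.\<close>

lemma MS_L:
  assumes X: "X \<noteq> 0" "X \<in> tor 5" shows "MS r (so.L m n X) = so.L (m - n) (- n) (MS r X)"
proof -
  note T = X(2) MS_tor[OF X(2)]
  let ?C = "\<lambda>m n. MS r (so.L m n X) = so.L (m - n) (- n) (MS r X)"
  have OM: "?C (- n) (m - n)" if "?C m n" for m n
  proof -
    have 1: "tw om (so.L m n X) = so.L (- n) (m - n) X" by (simp add: so.L_\<tau>)
    have 2: "zs (-1) Y - tw om Y = so.L (-1) (-1) Y" for Y by (simp add: so.L_def zs_uminus)
    show ?thesis using MS_tw[OF so.L_tor[OF T(1), of m n]] unfolding 1 2 that so.L_L by simp
  qed
  have TH: "?C (m - 2 * n) (2 * m - n)" if "?C m n" for m n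
  proof -
    have 1: "th (so.L m n Y) = so.L (m - 2 * n) (2 * m - n) Y" for m n Y
      unfolding th_def so.L_L by (simp add: algebra_simps)
    show ?thesis using MS_th[OF so.L_tor[OF T(1), of m n]] unfolding 1 that so.L_uminus by (simp add: algebra_simps)
  qed
  have mod: "?C m n" if "?C m' n'" "5 dvd m - m'" "5 dvd n - n'" for m n m' n'
  proof -
    have "5 dvd (m - n) - (m' - n')" "5 dvd - n - - n'" using that(2,3) by presburger+
    then show ?thesis using that so.L_mod[OF T(1), of m m' n n'] so.L_mod[OF T(2), of "m - n" "m' - n'" "- n" "- n'"] by simp
  qed
  \<comment> \<open>The digits in each name are the residue class (m, n). Each of the following
    lines multiplies an earlier class by the cube root of unity or by sqrt(-3) and reduces modulo
    5.\<close>
  have c10: "?C 1 0" by simp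
  have c12: "?C 1 2" by (rule mod[OF TH[OF c10]]) simp_all
  have c01: "?C 0 1" by (rule mod[OF OM[OF c10]]) simp_all
  have c20: "?C 2 0" by (rule mod[OF TH[OF c12]]) simp_all
  have c34: "?C 3 4" by (rule mod[OF OM[OF c12]]) simp_all
  have c44: "?C 4 4" by (rule mod[OF OM[OF c01]]) simp_all
  have c24: "?C 2 4" by (rule mod[OF TH[OF c20]]) simp_all
  have c02: "?C 0 2" by (rule mod[OF OM[OF c20]]) simp_all
  have c14: "?C 1 4" by (rule mod[OF OM[OF c34]]) simp_all
  have c40: "?C 4 0" by (rule mod[OF TH[OF c24]]) simp_all
  have c13: "?C 1 3" by (rule mod[OF OM[OF c24]]) simp_all
  have c33: "?C 3 3" by (rule mod[OF OM[OF c02]]) simp_all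
  have c43: "?C 4 3" by (rule mod[OF TH[OF c40]]) simp_all
  have c04: "?C 0 4" by (rule mod[OF OM[OF c40]]) simp_all
  have c23: "?C 2 3" by (rule mod[OF OM[OF c13]]) simp_all
  have c30: "?C 3 0" by (rule mod[OF TH[OF c43]]) simp_all
  have c21: "?C 2 1" by (rule mod[OF OM[OF c43]]) simp_all
  have c11: "?C 1 1" by (rule mod[OF OM[OF c04]]) simp_all
  have c31: "?C 3 1" by (rule mod[OF TH[OF c30]]) simp_all
  have c03: "?C 0 3" by (rule mod[OF OM[OF c30]]) simp_all
  have c41: "?C 4 1" by (rule mod[OF OM[OF c21]]) simp_all
  have c42: "?C 4 2" by (rule mod[OF OM[OF c31]]) simp_all
  have c22: "?C 2 2" by (rule mod[OF OM[OF c03]]) simp_all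
  have c32: "?C 3 2" by (rule mod[OF OM[OF c42]]) simp_all
  have c00: "?C 0 0" by simp
  have base: "?C m' n'" if "m' \<in> {0,1,2,3,4}" "n' \<in> {0,1,2,3,4}" for m' n'
    using that by (elim insertE emptyE; hypsubst) (rule c00 c01 c02 c03 c04 c10 c11 c12 c13 c14 c20 c21 c22 c23 c24 c30 c31 c32 c33 c34 c40 c41 c42 c43 c44)+
  have r5: "\<exists>k'\<in>{0,1,2,3,4}. 5 dvd k - k'" for k :: int
  proof -
    have "5 dvd k - 0 \<or> 5 dvd k - 1 \<or> 5 dvd k - 2 \<or> 5 dvd k - 3 \<or> 5 dvd k - 4" by presburger
    then show ?thesis by blast
  qed
  obtain m' where m': "m' \<in> {0,1,2,3,4}" "5 dvd m - m'" using r5 by blast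
  obtain n' where n': "n' \<in> {0,1,2,3,4}" "5 dvd n - n'" using r5 by blast
  show ?thesis by (rule mod[OF base[OF m'(1) n'(1)] m'(2) n'(2)])
qed

lemma MS_add:
  assumes "X \<in> tor 5" "Y \<in> tor 5" shows "MS r (X + Y) = MS r X + MS r Y"
proof (cases "X = 0")
  case False
  obtain m n where Y: "Y = so.L m n X" using tor5_generated[OF False assms] by blast
  have XY: "X + Y = so.L (1 + m) n X" unfolding Y using so.L_add[of 1 0 X m n] by simp
  show ?thesis unfolding XY unfolding Y MS_L[OF False assms(1)]
    using so.L_add[of 1 0 "MS r X" "m - n" "-n"] by (simp add: algebra_simps)
qed simp

end

text \<open>The sixth power of \<open>u * u'\<close> is 4/5, hence 4 r^6 = 5. The square of M is 1,
  and the exponent -1 becomes 4 on fifth roots of unity.\<close>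

lemma sextic_5_congruence:
  assumes b: "b \<noteq> 0" shows "weil_congruent 5 (sextic b) (sextic (4 / (5 * b))) 4"
proof -
  obtain u where u: "u^6 = (of_rat b :: complex)" using ex_sixth_root by blast
  obtain u' where u': "u'^6 = (of_rat (4 / (5 * b)) :: complex)" using ex_sixth_root by blast
  have b': "4 / (5 * b) \<noteq> 0" using b by simp
  define r where "r = 1 / (u * u')"
  have r: "4 * r^6 = 5" unfolding r_def power_divide power_mult_distrib u u' using b
    by (simp add: of_rat_divide of_rat_mult)
  have rQ: "r \<in> Qbar" unfolding r_def
    by (intro Qbar_intros twist_sextic(2)[OF u b] twist_sextic(2)[OF u' b'])
  obtain X\<^sub>0 :: "sext ept" where X0: "X\<^sub>0 \<noteq> 0" "X\<^sub>0 \<in> tor 5" using ex_tor5 by blast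
  interpret P: cm_pairing "tw om" "-1" 5 "wp 5" X\<^sub>0 by (rule pairing5_sext[OF X0])
  show ?thesis
  proof (rule semilinear_congruence[OF twist_sextic(1)[OF u b] twist_sextic(1)[OF u' b']
        twist_sextic(2)[OF u b] twist_sextic(2)[OF u' b'] _ r_def, where M=MS])
    show "prime (5::nat)" "\<not> (5::nat) dvd 4" by simp_all
    fix X :: "sext ept" assume X: "X \<in> tor 5"
    show "MS r X \<in> tor 5" by (rule MS_tor[OF r X])
    show "alg (MS r X)" if "alg X" using that X by (simp add: MS_def alg_sc gg_autom[OF r])
    show "MS r (MS r X) = X \<or> MS r (MS r X) = - X" using MS_MS[OF r X] by simp
    show "MS r (sc z X) = sc (inverse z) (MS r X)" if "autom TYPE(sext) z" for z by (rule MS_sc[OF r that X])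
    show "MS (z * r) X = sc z (MS r X)" if z: "autom TYPE(sext) z" for z
    proof (cases "X = 0")
      case False
      then show ?thesis using sc_sc[OF z gg_autom[OF r False X]] by (simp add: MS_def mult.assoc)
    qed (simp add: z)
    show "gal \<sigma> (MS r X) = MS (\<sigma> r) (gal \<sigma> X)" if \<sigma>: "\<sigma> \<in> GalQ" and al: "alg X" for \<sigma>
    proof (cases "X = 0")
      case False
      note g = gal_coords[OF \<sigma> False al]
      have xq: "px X \<in> Qbar" using al False by (auto simp: alg_iff)
      have hq: "hh X \<in> Qbar" unfolding hh_def using xq by (intro Qbar_intros)
      have gq: "gg X \<in> Qbar" unfolding gg_def using xq hq by (intro Qbar_intros)
      have "\<sigma> (hh X) = hh (gal \<sigma> X)" unfolding hh_def using xq by (simp add: g gal_simps[OF \<sigma>] Qbar_intros)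
      then have "\<sigma> (gg X) = gg (gal \<sigma> X)" unfolding gg_def using xq hq by (simp add: g gal_simps[OF \<sigma>] Qbar_intros)
      then have "\<sigma> (r * gg X) = \<sigma> r * gg (gal \<sigma> X)" using rQ gq by (simp add: gal_simps[OF \<sigma>])
      then show ?thesis using gal_sc[OF \<sigma> gg_autom[OF r False X] al] False g(1) by (simp add: MS_def)
    qed (simp add: \<sigma>)
    fix Y :: "sext ept" assume Y: "Y \<in> tor 5"
    show "MS r (X + Y) = MS r X + MS r Y" by (rule MS_add[OF r X Y])
    have "wp 5 (MS r X) (MS r Y) = wp 5 X Y powi (- 1)"
      by (rule P.B_semilinear[OF MS_add[OF r] MS_tor[OF r] MS_tw[OF r] _ X Y])
        (simp_all add: MS_MS[OF r] X0)
    also have "\<dots> = wp 5 X Y ^ 4"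
    proof -
      have "wp 5 X Y * wp 5 X Y ^ 4 = 1" using P.B_root[OF X Y] by (simp add: eval_nat_numeral)
      then show ?thesis by (simp add: power_int_minus inverse_unique)
    qed
    finally show "wp 5 (MS r X) (MS r Y) = wp 5 X Y ^ 4" .
  qed
qed

section \<open>Symplectic types\<close>

lemma sympl_congI: "weil_congruent p E E' d \<Longrightarrow> QuadRes (int p) (int d) \<Longrightarrow> sympl_cong p E E'"
  by (auto simp: weil_congruent_def sympl_cong_def)

lemma antisympl_congI: "weil_congruent p E E' d \<Longrightarrow> \<not> QuadRes (int p) (int d) \<Longrightarrow> antisympl_cong p E E'"
  by (auto simp: weil_congruent_def antisympl_cong_def)

lemma QuadRes_residue:
  assumes "QuadRes m a" "m > 0" shows "\<exists>y\<in>set [0..m - 1]. (y^2 - a) mod m = 0"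
proof -
  obtain y where "[y^2 = a] (mod m)" using assms by (auto simp: QuadRes_def)
  then have "m dvd (y mod m)^2 - a" by (simp add: cong_iff_dvd_diff[symmetric] cong_def power_mod)
  then show ?thesis using assms by (intro bexI[of _ "y mod m"]) (auto simp: dvd_eq_mod_eq_0)
qed

text \<open>These are the exponents that occur: the norms 2 and 3 of the isogenies, and 8 and 12 for
  their composites with a symplectic congruence of exponent 4. Modulo 3 and 7 the symplectic
  exponent is 1.\<close>

lemma nonresidues:
  "\<not> QuadRes 3 2" "\<not> QuadRes 5 2" "\<not> QuadRes 5 8" "\<not> QuadRes 5 3" "\<not> QuadRes 5 12" "\<not> QuadRes 7 3"
  using QuadRes_residue[of 3 2] QuadRes_residue[of 5 2] QuadRes_residue[of 5 8]
    QuadRes_residue[of 5 3] QuadRes_residue[of 5 12] QuadRes_residue[of 7 3]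
  by (auto simp: upto_rec1)

lemma residues_1_4: "QuadRes m 1" "QuadRes m 4"
  unfolding QuadRes_def by (rule exI[of _ 1], simp) (rule exI[of _ 2], simp)

theorem theorem1p2:
  shows "(\<forall>a::rat. a \<noteq> 0 \<longrightarrow>
            sympl_cong 3 (quartic a) (quartic (-1 / (3 * a))) \<and>
            antisympl_cong 3 (quartic a) (quartic (-4 * a)) \<and>
            antisympl_cong 3 (quartic a) (quartic (4 / (3 * a))) \<and>
            isogenous 2 (quartic a) (quartic (-4 * a)) \<and>
            isogenous 2 (quartic (-1 / (3 * a))) (quartic (4 / (3 * a))) \<and>
            sympl_cong 5 (quartic a) (quartic (5 / a)) \<and>
            antisympl_cong 5 (quartic a) (quartic (-4 * a)) \<and>
            antisympl_cong 5 (quartic a) (quartic (-20 / a)) \<and>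
            isogenous 2 (quartic a) (quartic (-4 * a)) \<and>
            isogenous 2 (quartic (5 / a)) (quartic (-20 / a))) \<and>
         (\<forall>b::rat. b \<noteq> 0 \<longrightarrow>
            sympl_cong 5 (sextic b) (sextic (4 / (5 * b))) \<and>
            antisympl_cong 5 (sextic b) (sextic (-27 * b)) \<and>
            antisympl_cong 5 (sextic b) (sextic (-108 / (5 * b))) \<and>
            isogenous 3 (sextic b) (sextic (-27 * b)) \<and>
            isogenous 3 (sextic (4 / (5 * b))) (sextic (-108 / (5 * b))) \<and>
            sympl_cong 7 (sextic b) (sextic (-28 / b)) \<and>
            antisympl_cong 7 (sextic b) (sextic (-27 * b)) \<and>
            antisympl_cong 7 (sextic b) (sextic (756 / b)) \<and>
            isogenous 3 (sextic b) (sextic (-27 * b)) \<and>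
            isogenous 3 (sextic (-28 / b)) (sextic (756 / b)))"
proof (intro conjI allI impI)
  fix a :: rat assume a: "a \<noteq> 0"
  have a': "-1 / (3 * a) \<noteq> 0" "5 / a \<noteq> 0" using a by simp_all
  \<comment> \<open>The third curve is the isogenous twist of the second, so its congruence is the
    symplectic one followed by one of exponent 2.\<close>
  have e: "4 / (3 * a) = -4 * (-1 / (3 * a))" "-20 / a = -4 * (5 / a)" by simp_all
  obtain X\<^sub>3 :: "quar ept" where X3: "X\<^sub>3 \<noteq> 0" "X\<^sub>3 \<in> tor 3" using ex_tor3_quar by blast
  obtain X\<^sub>5 where X5: "cm_pairing (ti \<i>) 0 5 (wp 5) X\<^sub>5" using pairing5_quar by blast
  have p: "prime (3::nat)" "odd (3::nat)" "prime (5::nat)" "odd (5::nat)" by simp_all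
  note i3 = two_isogeny_congruence[OF _ p(1,2) pairing3_quar[OF X3]]
  note i5 = two_isogeny_congruence[OF _ p(3,4) X5]
  show "sympl_cong 3 (quartic a) (quartic (-1 / (3 * a)))"
    by (rule sympl_congI[OF quartic_3_congruence[OF a]]) (simp add: residues_1_4)
  show "antisympl_cong 3 (quartic a) (quartic (-4 * a))"
    by (rule antisympl_congI[OF i3[OF a]]) (simp add: nonresidues)
  show "antisympl_cong 3 (quartic a) (quartic (4 / (3 * a)))" unfolding e
    by (rule antisympl_congI[OF weil_congruent_trans[OF quartic_3_congruence[OF a] i3[OF a'(1)] p(1)]])
      (simp add: nonresidues)
  show "sympl_cong 5 (quartic a) (quartic (5 / a))"
    by (rule sympl_congI[OF quartic_5_congruence[OF a]]) (simp add: residues_1_4)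
  show "antisympl_cong 5 (quartic a) (quartic (-4 * a))"
    by (rule antisympl_congI[OF i5[OF a]]) (simp add: nonresidues)
  show "antisympl_cong 5 (quartic a) (quartic (-20 / a))" unfolding e
    by (rule antisympl_congI[OF weil_congruent_trans[OF quartic_5_congruence[OF a] i5[OF a'(2)] p(3)]])
      (simp add: nonresidues)
  show "isogenous 2 (quartic a) (quartic (-4 * a))" "isogenous 2 (quartic a) (quartic (-4 * a))"
    by (rule isogenous_quartic[OF a])+
  show "isogenous 2 (quartic (-1 / (3 * a))) (quartic (4 / (3 * a)))"
    "isogenous 2 (quartic (5 / a)) (quartic (-20 / a))"
    unfolding e by (rule isogenous_quartic[OF a'(1)] isogenous_quartic[OF a'(2)])+
next
  fix b :: rat assume b: "b \<noteq> 0"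
  have b': "4 / (5 * b) \<noteq> 0" "-28 / b \<noteq> 0" using b by simp_all
  have e: "-108 / (5 * b) = -27 * (4 / (5 * b))" "756 / b = -27 * (-28 / b)" by simp_all
  obtain X\<^sub>5 :: "sext ept" where X5: "X\<^sub>5 \<noteq> 0" "X\<^sub>5 \<in> tor 5" using ex_tor5 by blast
  obtain X\<^sub>7 where X7: "cm_pairing (tw om) (-1) 7 (wp 7) X\<^sub>7" using pairing7 by blast
  have p: "prime (5::nat)" "(5::nat) \<noteq> 3" "prime (7::nat)" "(7::nat) \<noteq> 3" by simp_all
  note i5 = three_isogeny_congruence[OF _ p(1,2) pairing5_sext[OF X5]]
  note i7 = three_isogeny_congruence[OF _ p(3,4) X7]
  show "sympl_cong 5 (sextic b) (sextic (4 / (5 * b)))"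
    by (rule sympl_congI[OF sextic_5_congruence[OF b]]) (simp add: residues_1_4)
  show "antisympl_cong 5 (sextic b) (sextic (-27 * b))"
    by (rule antisympl_congI[OF i5[OF b]]) (simp add: nonresidues)
  show "antisympl_cong 5 (sextic b) (sextic (-108 / (5 * b)))" unfolding e
    by (rule antisympl_congI[OF weil_congruent_trans[OF sextic_5_congruence[OF b] i5[OF b'(1)] p(1)]])
      (simp add: nonresidues)
  show "sympl_cong 7 (sextic b) (sextic (-28 / b))"
    by (rule sympl_congI[OF sextic_7_congruence[OF b]]) (simp add: residues_1_4)
  show "antisympl_cong 7 (sextic b) (sextic (-27 * b))"
    by (rule antisympl_congI[OF i7[OF b]]) (simp add: nonresidues)
  show "antisympl_cong 7 (sextic b) (sextic (756 / b))" unfolding e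
    by (rule antisympl_congI[OF weil_congruent_trans[OF sextic_7_congruence[OF b] i7[OF b'(2)] p(3)]])
      (simp add: nonresidues)
  show "isogenous 3 (sextic b) (sextic (-27 * b))" "isogenous 3 (sextic b) (sextic (-27 * b))"
    by (rule isogenous_sextic[OF b])+
  show "isogenous 3 (sextic (4 / (5 * b))) (sextic (-108 / (5 * b)))"
    "isogenous 3 (sextic (-28 / b)) (sextic (756 / b))"
    unfolding e by (rule isogenous_sextic[OF b'(1)] isogenous_sextic[OF b'(2)])+
qed

end
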